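(* Let $\mathfrak g,\tilde{\mathfrak g}$ be simple finite dimensional Lie algebras over $\mathbb F\in\{\mathbb R,\mathbb C\}$ and $\sigma\in\mathrm{Aut}\,\mathfrak g$, $\tilde\sigma\in\mathrm{Aut}\,\tilde{\mathfrak g}$ of finite order. (i) Every isomorphism $\varphi:L_{\mathrm{alg}}(\mathfrak g,\sigma)\to L_{\mathrm{alg}}(\tilde{\mathfrak g},\tilde\sigma)$ is induced by some isomorphism $\hat\varphi:\hat L_{\mathrm{alg}}(\mathfrak g,\sigma)\to\hat L_{\mathrm{alg}}(\tilde{\mathfrak g},\tilde\sigma)$. (ii) The natural map $\mathrm{Aut}\,\hat L'_{\mathrm{alg}}(\mathfrak g,\sigma)\to\mathrm{Aut}\,L_{\mathrm{alg}}(\mathfrak g,\sigma)$ is a group isomorphism. (iii) The kernel of the restriction map $\mathrm{Aut}\,\hat L_{\mathrm{alg}}(\mathfrak g,\sigma)\to\mathrm{Aut}\,\hat L'_{\mathrm{alg}}(\mathfrak g,\sigma)$ is $\{\hat\varphi:\exists\nu\in\mathbb F,\ \hat\varphi c=c,\ \hat\varphi d=d+\nu c,\ \hat\varphi u=u\ \forall u\in L_{\mathrm{alg}}(\mathfrak g,\sigma)\}$, which is isomorphic to $(\mathbb F,+)$. (iv) $\mathrm{Aut}\,\hat L_{\mathrm{alg}}(\mathfrak g,\sigma)\cong\mathrm{Aut}_{(,)}\hat L_{\mathrm{alg}}(\mathfrak g,\sigma)\times\mathbb F$, where $\mathrm{Aut}_{(,)}$ denotes the subgroup of automorphisms preserving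 the natural bilinear form.
   Context: For $\sigma^l=\mathrm{id}$, $L_{\mathrm{alg}}(\mathfrak g,\sigma)=\{u:\mathbb R\to\mathfrak g\mid u(t+2\pi)=\sigma u(t),\ u(t)=\sum_{|n|\le N}u_ne^{int/l},\ u_n\in\mathfrak g_{\mathbb C}\}$ ($\mathfrak g_{\mathbb C}$ the complexification if $\mathbb F=\mathbb R$, $\mathfrak g$ if $\mathbb F=\mathbb C$) with pointwise bracket $[u,v]_0$. With $(u,v)=\frac1{2\pi}\int_0^{2\pi}(u(t),v(t))_0dt$, $(\cdot,\cdot)_0$ the Killing form, $\hat L_{\mathrm{alg}}(\mathfrak g,\sigma)=L_{\mathrm{alg}}(\mathfrak g,\sigma)\oplus\mathbb Fc\oplus\mathbb Fd$ with $c$ central, $[d,u]=-[u,d]=u'$, $[u,v]=[u,v]_0+(u',v)c$; its natural bilinear form extends $(\cdot,\cdot)$ by $c,d\perp L_{\mathrm{alg}}$, $(c,c)=(d,d)=0$, $(c,d)=1$. $\hat L'_{\mathrm{alg}}(\mathfrak g,\sigma)=L_{\mathrm{alg}}(\mathfrak g,\sigma)\oplus\mathbb Fc$ is the derived algebra, with center $\mathbb Fc$. An isomorphism $\hat\varphi$ of the affine algebras restricts to one of the derived algebras, which induces one $\varphi$ of the loop algebras by passing to the quotient by $\mathbb Fc$; $\hat\varphi$ is said to induce $\varphi$. *)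

theory Defs
  imports "HOL-Analysis.Analysis" "HOL-Algebra.Group" "HOL-Algebra.Coset" "HOL-Library.FuncSet"
begin

text \<open>The Lie algebra g is the whole type 'a, which is a real normed vector space
  (the norm is only used to differentiate loops); its F-vector space structure is
  given by a scalar multiplication sc :: 'k => 'a => 'a compatible with the real one.
  For F = R we take sc = scaleR, for F = C an arbitrary complex structure sc.\<close>

definition F_vector_space :: "('k::real_normed_field \<Rightarrow> 'a::real_normed_vector \<Rightarrow> 'a) \<Rightarrow> bool" where
  "F_vector_space sc \<longleftrightarrow> vector_space sc \<and> (\<forall>r x. sc (of_real r) x = scaleR r x)"

definition fin_dim :: "('k::field \<Rightarrow> 'a::ab_group_add \<Rightarrow> 'a) \<Rightarrow> bool" where
  "fin_dim sc \<longleftrightarrow> (\<exists>B. finite B \<and> module.span sc B = UNIV)"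

definition lie_algebra :: "('k::field \<Rightarrow> 'a::ab_group_add \<Rightarrow> 'a) \<Rightarrow> ('a \<Rightarrow> 'a \<Rightarrow> 'a) \<Rightarrow> bool" where
  "lie_algebra sc br \<longleftrightarrow> vector_space sc
     \<and> (\<forall>x y z. br (x + y) z = br x z + br y z) \<and> (\<forall>k x y. br (sc k x) y = sc k (br x y))
     \<and> (\<forall>x y z. br x (y + z) = br x y + br x z) \<and> (\<forall>k x y. br x (sc k y) = sc k (br x y))
     \<and> (\<forall>x. br x x = 0)
     \<and> (\<forall>x y z. br x (br y z) + br y (br z x) + br z (br x y) = 0)"

definition simple_lie :: "('k::field \<Rightarrow> 'a::ab_group_add \<Rightarrow> 'a) \<Rightarrow> ('a \<Rightarrow> 'a \<Rightarrow> 'a) \<Rightarrow> bool" where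
  "simple_lie sc br \<longleftrightarrow> lie_algebra sc br \<and> (\<exists>x y. br x y \<noteq> 0)
     \<and> (\<forall>I. module.subspace sc I \<and> (\<forall>x\<in>I. \<forall>y. br y x \<in> I) \<longrightarrow> I = {0} \<or> I = UNIV)"

definition lie_aut :: "('k::field \<Rightarrow> 'a::ab_group_add \<Rightarrow> 'a) \<Rightarrow> ('a \<Rightarrow> 'a \<Rightarrow> 'a) \<Rightarrow> ('a \<Rightarrow> 'a) \<Rightarrow> bool" where
  "lie_aut sc br \<sigma> \<longleftrightarrow> bij \<sigma> \<and> Vector_Spaces.linear sc sc \<sigma> \<and> (\<forall>x y. \<sigma> (br x y) = br (\<sigma> x) (\<sigma> y))"

definition finite_order :: "('a \<Rightarrow> 'a) \<Rightarrow> bool" where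
  "finite_order \<sigma> \<longleftrightarrow> (\<exists>l::nat. 0 < l \<and> \<sigma> ^^ l = id)"

definition setting :: "('k::real_normed_field \<Rightarrow> 'a::real_normed_vector \<Rightarrow> 'a) \<Rightarrow> ('a \<Rightarrow> 'a \<Rightarrow> 'a) \<Rightarrow> ('a \<Rightarrow> 'a) \<Rightarrow> bool" where
  "setting sc br \<sigma> \<longleftrightarrow> F_vector_space sc \<and> fin_dim sc \<and> simple_lie sc br \<and> lie_aut sc br \<sigma> \<and> finite_order \<sigma>"

definition some_basis :: "('k::field \<Rightarrow> 'a::ab_group_add \<Rightarrow> 'a) \<Rightarrow> 'a set" where
  "some_basis sc = (SOME B. finite B \<and> \<not> module.dependent sc B \<and> module.span sc B = UNIV)"

definition trace_F :: "('k::field \<Rightarrow> 'a::ab_group_add \<Rightarrow> 'a) \<Rightarrow> ('a \<Rightarrow> 'a) \<Rightarrow> 'k" where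
  "trace_F sc f = (\<Sum>b\<in>some_basis sc. module.representation sc (some_basis sc) (f b) b)"

definition killing :: "('k::field \<Rightarrow> 'a::ab_group_add \<Rightarrow> 'a) \<Rightarrow> ('a \<Rightarrow> 'a \<Rightarrow> 'a) \<Rightarrow> 'a \<Rightarrow> 'a \<Rightarrow> 'k" where
  "killing sc br x y = trace_F sc (\<lambda>z. br x (br y z))"

definition order_of :: "('a \<Rightarrow> 'a) \<Rightarrow> nat" where
  "order_of \<sigma> = (LEAST l::nat. 0 < l \<and> \<sigma> ^^ l = id)"

text \<open>L_alg(g, sigma): twisted trigonometric polynomial loops with frequencies in (1/l)Z,
  written in real (cos/sin) form, which is equivalent to the complex exponential form
  sum_{|n| <= N} u_n e^{int/l} with coefficients in the complexification.\<close>
definition loop_set :: "('a::real_vector \<Rightarrow> 'a) \<Rightarrow> (real \<Rightarrow> 'a) set" where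
  "loop_set \<sigma> = {u. (\<forall>t. u (t + 2 * pi) = \<sigma> (u t)) \<and>
     (\<exists>N::nat. \<exists>a b :: nat \<Rightarrow> 'a. \<forall>t. u t =
        (\<Sum>n\<le>N. cos (real n * t / real (order_of \<sigma>)) *\<^sub>R a n
               + sin (real n * t / real (order_of \<sigma>)) *\<^sub>R b n))}"

definition deriv_loop :: "(real \<Rightarrow> 'a::real_normed_vector) \<Rightarrow> real \<Rightarrow> 'a" where
  "deriv_loop u = (\<lambda>t. vector_derivative u (at t))"

definition loop_pair :: "('k::real_normed_field \<Rightarrow> 'a::real_normed_vector \<Rightarrow> 'a) \<Rightarrow> ('a \<Rightarrow> 'a \<Rightarrow> 'a)
     \<Rightarrow> (real \<Rightarrow> 'a) \<Rightarrow> (real \<Rightarrow> 'a) \<Rightarrow> 'k" where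
  "loop_pair sc br u v = of_real (1 / (2 * pi)) * integral {0..2 * pi} (\<lambda>t. killing sc br (u t) (v t))"

record ('k, 'v) liealg =
  carr :: "'v set"
  ladd :: "'v \<Rightarrow> 'v \<Rightarrow> 'v"
  lsmul :: "'k \<Rightarrow> 'v \<Rightarrow> 'v"
  lbr :: "'v \<Rightarrow> 'v \<Rightarrow> 'v"

definition lie_iso :: "('k, 'v) liealg \<Rightarrow> ('k, 'w) liealg \<Rightarrow> ('v \<Rightarrow> 'w) \<Rightarrow> bool" where
  "lie_iso A B \<phi> \<longleftrightarrow> bij_betw \<phi> (carr A) (carr B)
     \<and> (\<forall>x\<in>carr A. \<forall>y\<in>carr A. \<phi> (ladd A x y) = ladd B (\<phi> x) (\<phi> y))
     \<and> (\<forall>k. \<forall>x\<in>carr A. \<phi> (lsmul A k x) = lsmul B k (\<phi> x))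
     \<and> (\<forall>x\<in>carr A. \<forall>y\<in>carr A. \<phi> (lbr A x y) = lbr B (\<phi> x) (\<phi> y))"

definition AutG :: "('k, 'v) liealg \<Rightarrow> ('v \<Rightarrow> 'v) monoid" where
  "AutG A = \<lparr>carrier = {\<phi> \<in> extensional (carr A). lie_iso A A \<phi>},
             mult = (\<lambda>f g. compose (carr A) f g),
             one = restrict id (carr A)\<rparr>"

definition AutFormG :: "('k, 'v) liealg \<Rightarrow> ('v \<Rightarrow> 'v \<Rightarrow> 'k) \<Rightarrow> ('v \<Rightarrow> 'v) monoid" where
  "AutFormG A B = (AutG A)\<lparr>carrier := {\<phi> \<in> carrier (AutG A).
       \<forall>x\<in>carr A. \<forall>y\<in>carr A. B (\<phi> x) (\<phi> y) = B x y}\<rparr>"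

definition addG :: "'k::ab_group_add monoid" where
  "addG = \<lparr>carrier = UNIV, mult = (+), one = 0\<rparr>"

definition Lalg :: "('k::real_normed_field \<Rightarrow> 'a::real_normed_vector \<Rightarrow> 'a) \<Rightarrow> ('a \<Rightarrow> 'a \<Rightarrow> 'a) \<Rightarrow> ('a \<Rightarrow> 'a)
    \<Rightarrow> ('k, real \<Rightarrow> 'a) liealg" where
  "Lalg sc br \<sigma> = \<lparr>carr = loop_set \<sigma>,
     ladd = (\<lambda>u v t. u t + v t), lsmul = (\<lambda>k u t. sc k (u t)),
     lbr = (\<lambda>u v t. br (u t) (v t))\<rparr>"

text \<open>Elements of the affine algebra: (u, a, b) stands for u + a c + b d.
  [u + a c + b d, v + a' c + b' d] = [u,v]_0 + b v' - b' u' + (u',v) c.\<close>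
definition Lhat :: "('k::real_normed_field \<Rightarrow> 'a::real_normed_vector \<Rightarrow> 'a) \<Rightarrow> ('a \<Rightarrow> 'a \<Rightarrow> 'a) \<Rightarrow> ('a \<Rightarrow> 'a)
    \<Rightarrow> ('k, (real \<Rightarrow> 'a) \<times> 'k \<times> 'k) liealg" where
  "Lhat sc br \<sigma> = \<lparr>carr = loop_set \<sigma> \<times> UNIV \<times> UNIV,
     ladd = (\<lambda>(u, a, b) (v, a', b'). (\<lambda>t. u t + v t, a + a', b + b')),
     lsmul = (\<lambda>k (u, a, b). (\<lambda>t. sc k (u t), k * a, k * b)),
     lbr = (\<lambda>(u, a, b) (v, a', b').
        (\<lambda>t. br (u t) (v t) + sc b (deriv_loop v t) - sc b' (deriv_loop u t),
         loop_pair sc br (deriv_loop u) v, 0))\<rparr>"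

text \<open>The derived algebra L_alg + F c.\<close>
definition Lhat' :: "('k::real_normed_field \<Rightarrow> 'a::real_normed_vector \<Rightarrow> 'a) \<Rightarrow> ('a \<Rightarrow> 'a \<Rightarrow> 'a) \<Rightarrow> ('a \<Rightarrow> 'a)
    \<Rightarrow> ('k, (real \<Rightarrow> 'a) \<times> 'k \<times> 'k) liealg" where
  "Lhat' sc br \<sigma> = (Lhat sc br \<sigma>)\<lparr>carr := loop_set \<sigma> \<times> UNIV \<times> {0}\<rparr>"

definition cc :: "(real \<Rightarrow> 'a::zero) \<times> 'k::{zero,one} \<times> 'k" where "cc = ((\<lambda>t. 0), 1, 0)"
definition dd :: "(real \<Rightarrow> 'a::zero) \<times> 'k::{zero,one} \<times> 'k" where "dd = ((\<lambda>t. 0), 0, 1)"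
definition emb :: "(real \<Rightarrow> 'a) \<Rightarrow> (real \<Rightarrow> 'a) \<times> 'k::zero \<times> 'k" where "emb u = (u, 0, 0)"

definition hat_form :: "('k::real_normed_field \<Rightarrow> 'a::real_normed_vector \<Rightarrow> 'a) \<Rightarrow> ('a \<Rightarrow> 'a \<Rightarrow> 'a)
    \<Rightarrow> (real \<Rightarrow> 'a) \<times> 'k \<times> 'k \<Rightarrow> (real \<Rightarrow> 'a) \<times> 'k \<times> 'k \<Rightarrow> 'k" where
  "hat_form sc br = (\<lambda>(u, a, b) (v, a', b'). loop_pair sc br u v + a * b' + b * a')"

text \<open>phi-hat induces phi: phi(u) is the L_alg-component of phi-hat(u), i.e. phi-hat
  on the derived algebra modulo F c.\<close>
definition induces :: "((real \<Rightarrow> 'a) \<times> 'k::zero \<times> 'k \<Rightarrow> (real \<Rightarrow> 'b) \<times> 'k \<times> 'k) \<Rightarrow> (real \<Rightarrow> 'a) set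
    \<Rightarrow> ((real \<Rightarrow> 'a) \<Rightarrow> (real \<Rightarrow> 'b)) \<Rightarrow> bool" where
  "induces \<Phi> L \<phi> \<longleftrightarrow> (\<forall>u\<in>L. fst (\<Phi> (u, 0, 0)) = \<phi> u)"

text \<open>Natural map Aut Lhat' -> Aut L_alg (passing to the quotient by F c).\<close>
definition quot_map :: "(real \<Rightarrow> 'a) set \<Rightarrow> ((real \<Rightarrow> 'a) \<times> 'k::zero \<times> 'k \<Rightarrow> (real \<Rightarrow> 'a) \<times> 'k \<times> 'k)
    \<Rightarrow> ((real \<Rightarrow> 'a) \<Rightarrow> (real \<Rightarrow> 'a))" where
  "quot_map L \<Phi> = restrict (\<lambda>u. fst (\<Phi> (u, 0, 0))) L"

definition claim_i :: "('k::real_normed_field \<Rightarrow> 'a::real_normed_vector \<Rightarrow> 'a) \<Rightarrow> ('a \<Rightarrow> 'a \<Rightarrow> 'a) \<Rightarrow> ('a \<Rightarrow> 'a)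
    \<Rightarrow> ('k \<Rightarrow> 'b::real_normed_vector \<Rightarrow> 'b) \<Rightarrow> ('b \<Rightarrow> 'b \<Rightarrow> 'b) \<Rightarrow> ('b \<Rightarrow> 'b) \<Rightarrow> bool" where
  "claim_i sc br \<sigma> sc' br' \<sigma>' \<longleftrightarrow>
     (\<forall>\<phi>. lie_iso (Lalg sc br \<sigma>) (Lalg sc' br' \<sigma>') \<phi> \<longrightarrow>
        (\<exists>\<Phi>. lie_iso (Lhat sc br \<sigma>) (Lhat sc' br' \<sigma>') \<Phi> \<and> induces \<Phi> (loop_set \<sigma>) \<phi>))"

definition claim_ii :: "('k::real_normed_field \<Rightarrow> 'a::real_normed_vector \<Rightarrow> 'a) \<Rightarrow> ('a \<Rightarrow> 'a \<Rightarrow> 'a) \<Rightarrow> ('a \<Rightarrow> 'a) \<Rightarrow> bool" where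
  "claim_ii sc br \<sigma> \<longleftrightarrow>
     quot_map (loop_set \<sigma>) \<in> iso (AutG (Lhat' sc br \<sigma>)) (AutG (Lalg sc br \<sigma>))"

definition claim_iii :: "('k::real_normed_field \<Rightarrow> 'a::real_normed_vector \<Rightarrow> 'a) \<Rightarrow> ('a \<Rightarrow> 'a \<Rightarrow> 'a) \<Rightarrow> ('a \<Rightarrow> 'a) \<Rightarrow> bool" where
  "claim_iii sc br \<sigma> \<longleftrightarrow>
     (let res = (\<lambda>\<Phi>. restrict \<Phi> (carr (Lhat' sc br \<sigma>)));
          K = {\<Phi> \<in> carrier (AutG (Lhat sc br \<sigma>)). \<exists>\<nu>::'k.
                 \<Phi> cc = cc \<and> \<Phi> dd = (\<lambda>t. 0, \<nu>, 1) \<and> (\<forall>u\<in>loop_set \<sigma>. \<Phi> (emb u) = emb u)}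
      in res \<in> hom (AutG (Lhat sc br \<sigma>)) (AutG (Lhat' sc br \<sigma>))
         \<and> kernel (AutG (Lhat sc br \<sigma>)) (AutG (Lhat' sc br \<sigma>)) res = K
         \<and> (AutG (Lhat sc br \<sigma>))\<lparr>carrier := K\<rparr> \<cong> (addG :: 'k monoid))"

definition claim_iv :: "('k::real_normed_field \<Rightarrow> 'a::real_normed_vector \<Rightarrow> 'a) \<Rightarrow> ('a \<Rightarrow> 'a \<Rightarrow> 'a) \<Rightarrow> ('a \<Rightarrow> 'a) \<Rightarrow> bool" where
  "claim_iv sc br \<sigma> \<longleftrightarrow>
     AutG (Lhat sc br \<sigma>) \<cong> AutFormG (Lhat sc br \<sigma>) (hat_form sc br) \<times>\<times> (addG :: 'k monoid)"

end

theory Submission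
  imports Defs "HOL-Computational_Algebra.Fundamental_Theorem_Algebra"
begin

text \<open>
  Everything reduces to one fact about an isomorphism \<open>\<phi>\<close> of twisted loop algebras: it is isometric for
  the averaged Killing form, and \<open>\<phi> u' = e (\<phi> u)' + [w, \<phi> u]\<close> with \<open>e = \<plusminus>1\<close> and a loop \<open>w\<close>.
  To obtain it, \<open>\<phi>\<close> is read off on the centroid of the loop algebra: multiplication by trigonometric
  polynomials goes to multiplication by trigonometric polynomials with values in the centroid of the
  target, units go to units, and this forces a substitution \<open>t \<mapsto> e t + \<alpha>\<close> of the parameter. In the
  presence of a complex structure \<open>\<alpha>\<close> need not be real, but composition with \<open>z \<mapsto> s z\<close>, \<open>z = e\<^bsup>it/l\<^esup>\<close>,
  makes it so. After this substitution \<open>\<phi>\<close> acts pointwise by isomorphisms of the fibres, hence isometrically, and it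
  commutes with differentiation up to a family of derivations, which are inner. A complex Lie algebra is simple
  already over the reals, and its real Killing form is twice the real part of the complex one, so
  that the real numbers suffice as base field.

  Granted this, \<open>u + a c + b d\<close> goes to
  \<open>\<phi> u + b w + (e a + \<nu> b - e (w, \<phi> u)) c + e b d\<close> under an isomorphism of the affine algebras, for every
  \<open>\<nu>\<close>. Conversely every automorphism has this form: the coefficients of \<open>c\<close> and \<open>d\<close> are pinned down
  because the loop algebra is perfect, the cocycle \<open>(u', v)\<close> is nonzero on some commuting pair, and
  \<open>u \<mapsto> u'\<close> is not inner. The form is preserved exactly when \<open>2 e \<nu> = - (w, w)\<close>, and the
  maps \<open>d \<mapsto> d + \<nu> c\<close> are central in the automorphism group.
\<close>

section \<open>Traces and Killing forms\<close>

text \<open>An isomorphism of loop algebras is an abstract linear map, and the obstacle is to see it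
  as a map of functions. Evaluation at a point maps the twisted loops onto the whole Lie algebra,
  and every loop vanishing at \<open>t0\<close> is a combination of loops with coefficients
  \<open>1 - cos (t - t0)\<close> and \<open>sin (t - t0)\<close>. Hence a linear map compatible
  with multiplication by \<open>cos\<close> and \<open>sin\<close> is a family of maps between
  fibres. Only multipliers of period \<open>2 * pi\<close> preserve the twist, so these functions of
  \<open>t\<close>, and not those of \<open>t / l\<close>, are the test multipliers. The case
  distinction comes from the centroid of a real simple algebra, which is the reals or a copy of the
  complex numbers. A complex structure that does not commute with the twist is conjugated by it, and
  this confines the multiplier that replaces \<open>cis t\<close> to modulus one. One that commutes
  leaves the modulus of a unit free, and the modulus is the imaginary part of \<alpha>. The cocycle
  is transported up to the coboundary of \<open>u \<mapsto> e (w, \<phi> u)\<close>; this is the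
  origin of the coefficient of \<open>c\<close> in the affine isomorphism.\<close>

definition btrace :: "('k::field \<Rightarrow> 'a::ab_group_add \<Rightarrow> 'a) \<Rightarrow> 'a set \<Rightarrow> ('a \<Rightarrow> 'a) \<Rightarrow> 'k" where
  "btrace s B f = (\<Sum>b\<in>B. module.representation s B (f b) b)"

lemma vector_space_mult: "vector_space ((*) :: 'k::field \<Rightarrow> 'k \<Rightarrow> 'k)"
  by unfold_locales (simp_all add: algebra_simps)

text \<open>Both sides are the same double sum of products of matrix entries of \<open>f\<close> and
  \<open>g\<close>. The sets \<open>B\<close> and \<open>C\<close> are bases of subspaces only, so
  \<open>btrace\<close> is the trace of a restriction; \<open>btrace_nilpotent\<close> passes in
  this way from a subspace to a smaller one.\<close>

lemma (in vector_space_pair) btrace_comm: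
  assumes B: "finite B" "vs1.independent B" and C: "finite C" "vs2.independent C"
    and f: "Vector_Spaces.linear s1 s2 f" and fB: "f ` B \<subseteq> vs2.span C"
    and g: "Vector_Spaces.linear s2 s1 g" and gC: "g ` C \<subseteq> vs1.span B"
  shows "btrace s1 B (\<lambda>x. g (f x)) = btrace s2 C (\<lambda>y. f (g y))"
proof -
  interpret f: Vector_Spaces.linear s1 s2 f by (rule f)
  interpret g: Vector_Spaces.linear s2 s1 g by (rule g)
  let ?R = "vs1.representation B" and ?S = "vs2.representation C"
  have 1: "?R (g (f b)) b = (\<Sum>c\<in>C. ?S (f b) c * ?R (g c) b)" if "b \<in> B" for b
  proof -
    have "f b = (\<Sum>c\<in>C. s2 (?S (f b) c) c)"
      using vs2.sum_representation_eq[of C "f b" C] C fB that by auto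
    then have "g (f b) = (\<Sum>c\<in>C. s1 (?S (f b) c) (g c))"
      by (metis (no_types, lifting) g.scale g.sum sum.cong)
    moreover have "?R (\<Sum>c\<in>C. s1 (?S (f b) c) (g c)) = (\<lambda>b'. \<Sum>c\<in>C. ?R (s1 (?S (f b) c) (g c)) b')"
      using gC by (intro vs1.representation_sum) (auto simp: B vs1.span_scale image_subset_iff)
    ultimately show ?thesis
      using gC by (auto simp: vs1.representation_scale B image_subset_iff intro!: sum.cong)
  qed
  have 2: "?S (f (g c)) c = (\<Sum>b\<in>B. ?R (g c) b * ?S (f b) c)" if "c \<in> C" for c
  proof -
    have "g c = (\<Sum>b\<in>B. s1 (?R (g c) b) b)"
      using vs1.sum_representation_eq[of B "g c" B] B gC that by auto
    then have "f (g c) = (\<Sum>b\<in>B. s2 (?R (g c) b) (f b))"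
      by (metis (no_types, lifting) f.scale f.sum sum.cong)
    moreover have "?S (\<Sum>b\<in>B. s2 (?R (g c) b) (f b)) = (\<lambda>c'. \<Sum>b\<in>B. ?S (s2 (?R (g c) b) (f b)) c')"
      using fB by (intro vs2.representation_sum) (auto simp: C vs2.span_scale image_subset_iff)
    ultimately show ?thesis
      using fB by (auto simp: vs2.representation_scale C image_subset_iff intro!: sum.cong)
  qed
  have "btrace s1 B (\<lambda>x. g (f x)) = (\<Sum>b\<in>B. \<Sum>c\<in>C. ?S (f b) c * ?R (g c) b)"
    by (simp add: btrace_def 1)
  also have "\<dots> = (\<Sum>c\<in>C. \<Sum>b\<in>B. ?R (g c) b * ?S (f b) c)"
    by (subst sum.swap) (simp add: mult.commute)
  also have "\<dots> = btrace s2 C (\<lambda>y. f (g y))"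
    by (simp add: btrace_def 2)
  finally show ?thesis .
qed

locale fd_space = vector_space sc for sc :: "'k::field \<Rightarrow> 'a::ab_group_add \<Rightarrow> 'a" +
  assumes fd: "fin_dim sc"
begin

lemma some_basis: "finite (some_basis sc)" "independent (some_basis sc)" "span (some_basis sc) = UNIV"
proof -
  obtain B where B: "finite B" "span B = UNIV"
    using fd by (auto simp: fin_dim_def)
  obtain C where C: "C \<subseteq> B" "independent C" "B \<subseteq> span C"
    using maximal_independent_subset by blast
  have "finite C \<and> independent C \<and> span C = UNIV"
    using B C by (metis finite_subset span_mono span_span top.extremum_uniqueI)
  then have "finite (some_basis sc) \<and> \<not> dependent (some_basis sc) \<and> span (some_basis sc) = UNIV"
    unfolding some_basis_def by (rule someI)
  then show "finite (some_basis sc)" "independent (some_basis sc)" "span (some_basis sc) = UNIV"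
    by auto
qed

sublocale fd: finite_dimensional_vector_space sc "some_basis sc"
  by unfold_locales (use some_basis in auto)

text \<open>The basis is changed by \<open>btrace_comm\<close> with the identity as one of the two
  maps, so the trace does not depend on the choice made in \<open>some_basis\<close>.\<close>

lemma trace_F_eq:
  assumes "finite B" "independent B" "span B = UNIV" "Vector_Spaces.linear sc sc f"
  shows "trace_F sc f = btrace sc B f"
proof -
  interpret vector_space_pair sc sc by unfold_locales
  have "btrace sc (some_basis sc) (\<lambda>x. id (f x)) = btrace sc B (\<lambda>x. f (id x))"
    using assms some_basis by (intro btrace_comm linear_id) auto
  then show ?thesis by (simp add: trace_F_def btrace_def)
qed

lemma trace_F_comm_self:
  assumes "Vector_Spaces.linear sc sc f" "Vector_Spaces.linear sc sc g"
  shows "trace_F sc (\<lambda>x. f (g x)) = trace_F sc (\<lambda>x. g (f x))"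
proof -
  interpret vector_space_pair sc sc by unfold_locales
  show ?thesis
    using btrace_comm[of "some_basis sc" "some_basis sc" g f] assms some_basis
    by (simp add: trace_F_def btrace_def)
qed

lemma trace_F_add: "trace_F sc (\<lambda>x. f x + g x) = trace_F sc f + trace_F sc g"
  by (simp add: trace_F_def representation_add some_basis sum.distrib)

lemma trace_F_diff: "trace_F sc (\<lambda>x. f x - g x) = trace_F sc f - trace_F sc g"
  by (simp add: trace_F_def representation_diff some_basis sum_subtractf)

lemma trace_F_scale: "trace_F sc (\<lambda>x. sc k (f x)) = k * trace_F sc f"
  by (simp add: trace_F_def representation_scale some_basis sum_distrib_left)

lemma trace_F_zero: "trace_F sc (\<lambda>x. 0) = 0"
  by (simp add: trace_F_def representation_zero)

end

lemma trace_F_conj: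
  assumes "fd_space s1" "fd_space s2" "Vector_Spaces.linear s1 s2 f" "Vector_Spaces.linear s2 s1 g"
  shows "trace_F s1 (\<lambda>x. g (f x)) = trace_F s2 (\<lambda>y. f (g y))"
proof -
  interpret a: fd_space s1 by fact
  interpret b: fd_space s2 by fact
  interpret vector_space_pair s1 s2 by unfold_locales
  show ?thesis
    using btrace_comm[of "some_basis s1" "some_basis s2" f g] assms a.some_basis b.some_basis
    by (simp add: trace_F_def btrace_def)
qed

section \<open>The Killing form: invariance, representation of functionals, derivations\<close>

locale fd_lie = fd_space sc for sc :: "'k::field \<Rightarrow> 'a::ab_group_add \<Rightarrow> 'a" +
  fixes br :: "'a \<Rightarrow> 'a \<Rightarrow> 'a"
  assumes lie: "lie_algebra sc br"
begin

lemma br_add_left: "br (x + y) z = br x z + br y z"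
  and br_add_right: "br x (y + z) = br x y + br x z"
  and br_scale_left: "br (sc k x) y = sc k (br x y)"
  and br_scale_right: "br x (sc k y) = sc k (br x y)"
  and br_self [simp]: "br x x = 0"
  and jacobi: "br x (br y z) + br y (br z x) + br z (br x y) = 0"
  using lie by (auto simp: lie_algebra_def)

lemma br_linear: "Vector_Spaces.linear sc sc (br x)"
  by (simp add: Vector_Spaces.linear_iff vector_space_axioms br_add_right br_scale_right)

lemma br_linear_left: "Vector_Spaces.linear sc sc (\<lambda>x. br x y)"
  by (simp add: Vector_Spaces.linear_iff vector_space_axioms br_add_left br_scale_left)

sublocale br: Vector_Spaces.linear sc sc "br x" for x by (rule br_linear)
sublocale brl: Vector_Spaces.linear sc sc "\<lambda>x. br x y" for y by (rule br_linear_left)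

lemma br_swap: "br x y = - br y x"
proof -
  have "br x y + br y x = 0"
    using br_self[of "x + y"] unfolding br_add_left br_add_right by (simp add: add.commute)
  then show ?thesis by (simp add: eq_neg_iff_add_eq_0)
qed

lemma br_br_left: "br (br x y) z = br x (br y z) - br y (br x z)"
proof -
  have "br z (br x y) = - br (br x y) z" "br y (br z x) = - br y (br x z)"
    using br_swap[of z "br x y"] br_swap[of z x] br.neg by auto
  then show ?thesis using jacobi[of x y z] by (simp add: algebra_simps)
qed

lemma br_br_right: "br x (br y z) = br (br x y) z + br y (br x z)"
  by (simp add: br_br_left)

abbreviation "kil \<equiv> killing sc br"

lemma linear_brbr: "Vector_Spaces.linear sc sc (\<lambda>z. br x (br y z))"
  by (simp add: Vector_Spaces.linear_iff vector_space_axioms br_add_right br_scale_right)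

lemma kil_add_left: "kil (x + y) z = kil x z + kil y z"
  by (simp add: killing_def br_add_left trace_F_add)

lemma kil_add_right: "kil x (y + z) = kil x y + kil x z"
  by (simp add: killing_def br_add_left br_add_right trace_F_add)

lemma kil_scale_left: "kil (sc k x) z = k * kil x z"
  by (simp add: killing_def br_scale_left trace_F_scale)

lemma kil_scale_right: "kil x (sc k z) = k * kil x z"
  by (simp add: killing_def br_scale_left br_scale_right trace_F_scale)

lemma kil_commute: "kil x y = kil y x"
  unfolding killing_def by (rule trace_F_comm_self[OF br_linear br_linear])

lemma kil_assoc: "kil (br x y) z = kil x (br y z)"
proof -
  have "trace_F sc (\<lambda>v. br y (br x (br z v))) = trace_F sc (\<lambda>v. br x (br z (br y v)))"
    using trace_F_comm_self[OF br_linear linear_brbr] by simp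
  then show ?thesis
    by (simp add: killing_def br_br_left br.diff trace_F_diff)
qed

lemma kil_centroid:
  assumes "Vector_Spaces.linear sc sc J" "\<And>x y. br (J x) y = J (br x y)"
  shows "kil (J x) y = kil x (J y)"
proof -
  have "br x (J y) = J (br x y)" for x y
    by (metis assms(2) br_swap Vector_Spaces.linear.axioms(3)[OF assms(1)] module_hom.neg)
  then show ?thesis by (simp add: killing_def assms(2))
qed

text \<open>\<open>M\<close> inverts the map from \<open>w\<close> to the coefficient vector of
  \<open>kil w\<close> in the chosen basis. A single linear \<open>M\<close> is asked for, instead
  of a representing vector for each \<open>f\<close>, so that the representing vector depends
  linearly, hence trigonometrically, on a family of functionals.\<close>

lemma kil_nondegenerate_functional:
  assumes nd: "\<And>x. (\<And>y. kil x y = 0) \<Longrightarrow> x = 0"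
  obtains M where "Vector_Spaces.linear sc sc M"
    "\<And>f x. Vector_Spaces.linear sc (*) f \<Longrightarrow> kil (M (\<Sum>b\<in>some_basis sc. sc (f b) b)) x = f x"
proof -
  let ?B = "some_basis sc"
  define N where "N w = (\<Sum>b\<in>?B. sc (kil w b) b)" for w
  have linN: "Vector_Spaces.linear sc sc N"
    by (simp add: Vector_Spaces.linear_iff vector_space_axioms N_def kil_add_left kil_scale_left scale_left_distrib
        sum.distrib scale_sum_right)
  interpret N: Vector_Spaces.linear sc sc N by (rule linN)
  interpret p: vector_space_pair sc sc by unfold_locales
  have kilin: "Vector_Spaces.linear sc (*) (kil w)" for w
    by (simp add: Vector_Spaces.linear_iff vector_space_axioms kil_add_right kil_scale_right vector_space_mult)
  have ext: "f = g" if "Vector_Spaces.linear sc (*) f" "Vector_Spaces.linear sc (*) g"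
    "\<And>b. b \<in> ?B \<Longrightarrow> f b = g b" for f g :: "'a \<Rightarrow> 'k"
  proof -
    interpret q: vector_space_pair sc "(*)" by (simp add: vector_space_pair.intro vector_space_axioms vector_space_mult)
    show ?thesis using q.linear_eq_on[OF that(1,2)] that(3) some_basis(3) by blast
  qed
  have coef: "(\<Sum>b\<in>?B. sc (p b) b) = (\<Sum>b\<in>?B. sc (q b) b) \<Longrightarrow> b \<in> ?B \<Longrightarrow> p b = q b" for p q :: "'a \<Rightarrow> 'k" and b
  proof -
    assume e: "(\<Sum>b\<in>?B. sc (p b) b) = (\<Sum>b\<in>?B. sc (q b) b)" and b: "b \<in> ?B"
    have "(\<Sum>b\<in>?B. sc (p b - q b) b) = 0"
      using e by (simp add: scale_left_diff_distrib sum_subtractf)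
    then show "p b = q b"
      using some_basis(1,2) b independentD[OF some_basis(2,1) subset_refl, of "\<lambda>b. p b - q b" b] by simp
  qed
  have "inj N"
  proof (subst N.inj_iff_eq_0, safe)
    fix w assume "N w = 0"
    then have "kil w b = 0" if "b \<in> ?B" for b
      using coef[of "kil w" "\<lambda>_. 0" b] that by (simp add: N_def)
    then have "kil w = (\<lambda>x. 0)"
      by (intro ext[OF kilin]) (auto simp: Vector_Spaces.linear_iff vector_space_axioms vector_space_mult)
    then show "w = 0" by (intro nd) simp
  qed
  then have "surj N" using fd.linear_inj_imp_surj linN by blast
  then obtain M where M: "Vector_Spaces.linear sc sc M" "N \<circ> M = id"
    using p.linear_surjective_right_inverse[OF linN] by blast
  have "kil (M (\<Sum>b\<in>?B. sc (f b) b)) x = f x" if "Vector_Spaces.linear sc (*) f" for f x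
  proof -
    have "N (M (\<Sum>b\<in>?B. sc (f b) b)) = (\<Sum>b\<in>?B. sc (f b) b)"
      using M(2) by (metis comp_apply id_apply)
    then have "b \<in> ?B \<Longrightarrow> kil (M (\<Sum>b\<in>?B. sc (f b) b)) b = f b" for b
      using coef by (auto simp: N_def)
    then have "kil (M (\<Sum>b\<in>?B. sc (f b) b)) = f"
      by (intro ext[OF kilin that])
    then show ?thesis by simp
  qed
  then show ?thesis using that M(1) by blast
qed

text \<open>A derivation \<open>E\<close> is recovered from the functional
  \<open>x \<mapsto> tr (E \<circ> ad x)\<close>; the formula for the inner element is linear in \<open>E\<close>, which is what
  makes it depend polynomially on a parameter.\<close>

lemma derivation_inner:
  assumes nd: "\<And>x. (\<And>y. kil x y = 0) \<Longrightarrow> x = 0"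
    and E: "Vector_Spaces.linear sc sc E" "\<And>x y. E (br x y) = br (E x) y + br x (E y)"
    and w: "\<And>x. kil w x = trace_F sc (\<lambda>z. E (br x z))"
  shows "E x = br w x"
proof -
  interpret E: Vector_Spaces.linear sc sc E by (rule E)
  define F where "F x = E x - br w x" for x
  have linF: "Vector_Spaces.linear sc sc F"
    by (simp add: Vector_Spaces.linear_iff vector_space_axioms F_def E.add E.scale br_add_right br_scale_right
        scale_right_diff_distrib)
  have derF: "F (br x y) = br (F x) y + br x (F y)" for x y
    by (simp add: F_def E(2) br_br_right[of w x y] algebra_simps brl.diff br.diff)
  have tr0: "trace_F sc (\<lambda>z. F (br x z)) = 0" for x
    by (simp add: F_def trace_F_diff flip: killing_def w)
  \<comment> \<open>For a derivation, ad \<open>(F x)\<close> is the commutator of \<open>F\<close>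
    and ad \<open>x\<close>. Cyclicity of the trace then turns \<open>kil (F x) y\<close> into the
    trace of \<open>F\<close> composed with ad \<open>(br x y)\<close>, and \<open>w\<close> is
    chosen so that all these traces vanish.\<close>
  have "kil (F x) y = 0" for y
  proof -
    have "kil (F x) y = trace_F sc (\<lambda>z. F (br x (br y z)) - br x (F (br y z)))"
      by (simp add: killing_def derF)
    also have "\<dots> = trace_F sc (\<lambda>z. F (br x (br y z))) - trace_F sc (\<lambda>z. br x (F (br y z)))"
      by (rule trace_F_diff)
    also have "trace_F sc (\<lambda>z. br x (F (br y z))) = trace_F sc (\<lambda>z. F (br y (br x z)))"
      by (rule trace_F_comm_self[OF br_linear Vector_Spaces.linear_compose[OF br_linear linF, unfolded comp_def]])
    also have "trace_F sc (\<lambda>z. F (br x (br y z))) - \<dots> = trace_F sc (\<lambda>z. F (br (br x y) z))"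
      by (simp add: br_br_left module_hom.diff[OF Vector_Spaces.linear.axioms(3)[OF linF]] flip: trace_F_diff)
    finally show ?thesis by (simp add: tr0)
  qed
  then have "F x = 0" using nd by blast
  then show ?thesis by (simp add: F_def)
qed

end

lemma killing_iso:
  assumes "fd_lie s1 b1" "fd_lie s2 b2" and f: "Vector_Spaces.linear s1 s2 f" "bij f"
    and hom: "\<And>x y. f (b1 x y) = b2 (f x) (f y)"
  shows "killing s2 b2 (f x) (f y) = killing s1 b1 x y"
proof -
  interpret a: fd_lie s1 b1 by fact
  interpret b: fd_lie s2 b2 by fact
  interpret p: vector_space_pair s1 s2 by unfold_locales
  interpret q: vector_space_pair s2 s1 by unfold_locales
  obtain g where g: "Vector_Spaces.linear s2 s1 g" "g \<circ> f = id"
    using p.linear_injective_left_inverse f bij_def by blast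
  have gf: "g (f x) = x" for x
    using fun_cong[OF g(2), of x] by simp
  have fg: "f (g y) = y" for y
    using bij_is_surj[OF f(2)] gf by (metis surjD)
  have "killing s1 b1 x y = trace_F s1 (\<lambda>z. g (f (b1 x (b1 y z))))"
    by (simp add: killing_def gf)
  also have "\<dots> = trace_F s2 (\<lambda>z. f (b1 x (b1 y (g z))))"
    by (rule trace_F_conj)
      (use a.fd_space_axioms b.fd_space_axioms Vector_Spaces.linear_compose[OF a.linear_brbr f(1), unfolded comp_def] g in auto)
  also have "\<dots> = killing s2 b2 (f x) (f y)"
    by (simp add: killing_def hom fg)
  finally show ?thesis by simp
qed

section \<open>Generalized eigenspaces\<close>

text \<open>The sum of the generalized eigenspaces of \<open>X\<close> for the eigenvalues in \<open>M\<close>, described by its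
  closure property so that rule induction replaces exponents of nilpotency.\<close>

inductive_set gen_eig :: "('k::field \<Rightarrow> 'a::ab_group_add \<Rightarrow> 'a) \<Rightarrow> ('a \<Rightarrow> 'a) \<Rightarrow> 'k set \<Rightarrow> 'a set"
  for sc X M where
  zero: "0 \<in> gen_eig sc X M"
| step: "m \<in> M \<Longrightarrow> X v - sc m v \<in> gen_eig sc X M \<Longrightarrow> v \<in> gen_eig sc X M"

locale fd_operator = fd_space sc for sc :: "'k::field \<Rightarrow> 'a::ab_group_add \<Rightarrow> 'a" +
  fixes X :: "'a \<Rightarrow> 'a"
  assumes linX: "Vector_Spaces.linear sc sc X"
begin

sublocale X: Vector_Spaces.linear sc sc X by (rule linX)

abbreviation "GE \<equiv> gen_eig sc X"

lemma shift_add: "X (v + w) - sc m (v + w) = (X v - sc m v) + (X w - sc m w)"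
  by (simp add: X.add scale_right_distrib)

lemma shift_scale: "X (sc k v) - sc m (sc k v) = sc k (X v - sc m v)"
  by (simp add: X.scale scale_right_diff_distrib scale_left_commute)

lemma shift_commute: "X (X v - sc j v) - sc m (X v - sc j v) = X (X v - sc m v) - sc j (X v - sc m v)"
  by (simp add: X.diff X.scale scale_right_diff_distrib scale_left_commute)

lemma gen_eig_shift: "v \<in> GE M \<Longrightarrow> X v - sc j v \<in> GE M"
proof (induction rule: gen_eig.induct)
  case zero
  show ?case by (simp add: X.zero gen_eig.zero)
next
  case (step m v)
  have "X (X v - sc j v) - sc m (X v - sc j v) \<in> GE M"
    by (subst shift_commute) (rule step.IH)
  with step.hyps(1) show ?case by (rule gen_eig.step)
qed

lemma gen_eig_add: "v \<in> GE M \<Longrightarrow> w \<in> GE M \<Longrightarrow> v + w \<in> GE M"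
proof (induction arbitrary: w rule: gen_eig.induct)
  case (step m v)
  have "X (v + w) - sc m (v + w) \<in> GE M"
    unfolding shift_add using step gen_eig_shift by blast
  then show ?case using step gen_eig.step by blast
qed simp

lemma gen_eig_scale: "v \<in> GE M \<Longrightarrow> sc k v \<in> GE M"
proof (induction rule: gen_eig.induct)
  case (step m v)
  have "X (sc k v) - sc m (sc k v) \<in> GE M"
    by (subst shift_scale) (rule step.IH)
  with step.hyps(1) show ?case by (rule gen_eig.step)
qed (simp add: gen_eig.zero)

lemma subspace_gen_eig: "subspace (GE M)"
  by (simp add: subspace_def gen_eig.zero gen_eig_add gen_eig_scale)

lemma gen_eig_image: "v \<in> GE M \<Longrightarrow> X v \<in> GE M"
  using gen_eig_shift[of v M 0] by simp

lemma gen_eig_mono: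
  assumes "v \<in> GE M" "M \<subseteq> N"
  shows "v \<in> GE N"
  using assms(1)
proof (induction rule: gen_eig.induct)
  case (step m v)
  then show ?case using assms(2) gen_eig.step[of m N X v sc] by blast
qed (rule gen_eig.zero)

lemma gen_eig_eigenvector: "v \<in> GE M \<Longrightarrow> X v = sc j v \<Longrightarrow> j \<notin> M \<Longrightarrow> v = 0"
proof (induction rule: gen_eig.induct)
  case (step m v)
  have e: "X v - sc m v = sc (j - m) v"
    using step.prems by (simp add: scale_left_diff_distrib)
  have "X (X v - sc m v) = sc j (X v - sc m v)"
    unfolding e by (simp add: X.scale step.prems scale_left_commute)
  then have "X v - sc m v = 0" using step.IH step.prems by blast
  then have "sc (j - m) v = 0" unfolding e .
  then show ?case using step by auto
qed simp

lemma gen_eig_disjoint: "v \<in> GE M \<Longrightarrow> v \<in> GE N \<Longrightarrow> M \<inter> N = {} \<Longrightarrow> v = 0"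
proof (induction rule: gen_eig.induct)
  case (step m v)
  have "X v - sc m v = 0" using step gen_eig_shift by blast
  then show ?case using step gen_eig_eigenvector[of v N m] by auto
qed simp

text \<open>If \<open>v'\<close> solves the equation for \<open>X u - sc m u\<close>, then
  \<open>X - l\<close> maps \<open>u - v'\<close> to \<open>(m - l) u\<close>. The induction
  descends along the nilpotent operator \<open>X - m\<close>.\<close>

lemma gen_eig_solve: "u \<in> GE {m} \<Longrightarrow> l \<noteq> m \<Longrightarrow> \<exists>v\<in>GE {m}. X v - sc l v = u"
proof (induction rule: gen_eig.induct)
  case zero
  then show ?case by (intro bexI[of _ 0]) (auto simp: X.zero gen_eig.zero)
next
  case (step m' u)
  then obtain v' where v': "v' \<in> GE {m}" "X v' - sc l v' = X u - sc m u" by auto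
  have uG: "u \<in> GE {m}" using step gen_eig.step by blast
  define v where "v = sc (inverse (m - l)) (u - v')"
  have "v \<in> GE {m}"
    unfolding v_def using uG v' subspace_gen_eig by (intro gen_eig_scale subspace_diff) auto
  moreover have "X v - sc l v = u"
  proof -
    have "X (u - v') - sc l (u - v') = (X u - sc l u) - (X v' - sc l v')"
      by (simp add: X.diff scale_right_diff_distrib)
    also have "\<dots> = sc (m - l) u"
      unfolding v' by (simp add: scale_left_diff_distrib)
    finally show ?thesis
      unfolding v_def shift_scale using step.prems by simp
  qed
  ultimately show ?case by blast
qed

lemma gen_eig_funpow: "v \<in> GE {m} \<Longrightarrow> \<exists>n. ((\<lambda>u. X u - sc m u) ^^ n) v = 0"
proof (induction rule: gen_eig.induct)
  case zero
  then show ?case by (intro exI[of _ 0]) simp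
next
  case (step m' v)
  then obtain n where "((\<lambda>u. X u - sc m u) ^^ n) (X v - sc m v) = 0" by auto
  then show ?case by (intro exI[of _ "Suc n"]) (simp only: funpow_Suc_right comp_apply)
qed

definition poly_act :: "'k poly \<Rightarrow> 'a \<Rightarrow> 'a" where
  "poly_act p v = (\<Sum>i\<le>degree p. sc (coeff p i) ((X ^^ i) v))"

lemma poly_act_bound: "degree p \<le> n \<Longrightarrow> poly_act p v = (\<Sum>i\<le>n. sc (coeff p i) ((X ^^ i) v))"
  unfolding poly_act_def by (intro sum.mono_neutral_left) (auto simp: coeff_eq_0)

lemma poly_act_root: "poly_act ([:-l, 1:] * q) v = poly_act q (X v - sc l v)"
proof -
  let ?n = "Suc (degree q)"
  have d: "degree ([:-l, 1:] * q) \<le> ?n"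
    using degree_mult_le[of "[:-l, 1:]" q] by simp
  have "poly_act ([:-l, 1:] * q) v = (\<Sum>i\<le>?n. sc (coeff ([:-l, 1:] * q) i) ((X ^^ i) v))"
    using d by (rule poly_act_bound)
  also have "\<dots> = (\<Sum>i\<le>?n. sc (coeff (pCons 0 q) i) ((X ^^ i) v) - sc (l * coeff q i) ((X ^^ i) v))"
    by (intro sum.cong) (auto simp: scale_left_diff_distrib algebra_simps)
  also have "\<dots> = (\<Sum>i\<le>?n. sc (coeff (pCons 0 q) i) ((X ^^ i) v)) - (\<Sum>i\<le>?n. sc (l * coeff q i) ((X ^^ i) v))"
    by (rule sum_subtractf)
  also have "(\<Sum>i\<le>?n. sc (coeff (pCons 0 q) i) ((X ^^ i) v)) = (\<Sum>i\<le>degree q. sc (coeff q i) ((X ^^ i) (X v)))"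
    by (subst sum.atMost_Suc_shift) (simp add: funpow_swap1)
  also have "(\<Sum>i\<le>?n. sc (l * coeff q i) ((X ^^ i) v)) = (\<Sum>i\<le>degree q. sc (l * coeff q i) ((X ^^ i) v))"
    by (simp add: coeff_eq_0)
  also have "(\<Sum>i\<le>degree q. sc (coeff q i) ((X ^^ i) (X v))) - \<dots>
      = (\<Sum>i\<le>degree q. sc (coeff q i) ((X ^^ i) (X v - sc l v)))"
  proof -
    have lin: "Vector_Spaces.linear sc sc (X ^^ i)" for i
      by (induction i) (auto simp: Vector_Spaces.linear_iff vector_space_axioms X.add X.scale)
    have "(X ^^ i) (X v - sc l v) = (X ^^ i) (X v) - sc l ((X ^^ i) v)" for i
      by (simp only: module_hom.diff[OF Vector_Spaces.linear.axioms(3)[OF lin[of i]]]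
        module_hom.scale[OF Vector_Spaces.linear.axioms(3)[OF lin[of i]]])
    then show ?thesis
      by (simp add: sum_subtractf scale_right_diff_distrib mult.commute)
  qed
  finally show ?thesis by (simp add: poly_act_def)
qed

text \<open>More iterates than the dimension admits are dependent. A repeated iterate is treated on
  its own, because the set of iterates then has too few elements for the dimension count.\<close>

lemma annihilating_poly: "\<exists>p. p \<noteq> 0 \<and> poly_act p v = 0"
proof -
  define n where "n = card (some_basis sc)"
  have "\<exists>c. (\<exists>i\<le>n. c i \<noteq> 0) \<and> (\<Sum>i\<le>n. sc (c i) ((X ^^ i) v)) = 0"
  proof (cases "inj_on (\<lambda>i. (X ^^ i) v) {..n}")
    case True
    let ?S = "(\<lambda>i. (X ^^ i) v) ` {..n}"
    have "card ?S = Suc n" using True by (simp add: card_image)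
    moreover have "dim ?S \<le> n" using fd.dim_subset_UNIV[of ?S] by (simp add: n_def fd.dimension_def)
    ultimately have "dependent ?S" by (intro fd.dependent_biggerset_general) simp
    then obtain u where u: "\<exists>s\<in>?S. u s \<noteq> 0" "(\<Sum>s\<in>?S. sc (u s) s) = 0"
      by (auto simp: dependent_finite)
    then show ?thesis
      by (intro exI[of _ "\<lambda>i. u ((X ^^ i) v)"]) (auto simp: sum.reindex[OF True])
  next
    case False
    then obtain i j where ij: "i \<le> n" "j \<le> n" "i \<noteq> j" "(X ^^ i) v = (X ^^ j) v"
      by (auto simp: inj_on_def)
    define c where "c = (\<lambda>k. if k = i then 1 else if k = j then - 1 else (0::'k))"
    have "(\<Sum>k\<le>n. sc (c k) ((X ^^ k) v)) = (\<Sum>k\<in>{i, j}. sc (c k) ((X ^^ k) v))"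
      using ij by (intro sum.mono_neutral_right) (auto simp: c_def)
    also have "\<dots> = 0" using ij by (simp add: c_def)
    finally show ?thesis using ij(1) by (intro exI[of _ c]) (auto simp: c_def)
  qed
  then obtain c where c: "\<exists>i\<le>n. c i \<noteq> 0" "(\<Sum>i\<le>n. sc (c i) ((X ^^ i) v)) = 0" by blast
  define p where "p = (\<Sum>i\<le>n. monom (c i) i)"
  have cp: "coeff p i = (if i \<le> n then c i else 0)" for i
    by (simp add: p_def coeff_sum)
  have "p \<noteq> 0" using c(1) cp by (metis coeff_0)
  moreover have "degree p \<le> n" by (intro degree_le) (simp add: cp)
  ultimately show ?thesis
    using c(2) by (intro exI[of _ p]) (auto simp: poly_act_bound[of p n] cp)
qed

end

text \<open>Let \<open>C\<close> be a basis of the span of the image of \<open>B\<close>. As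
  \<open>N\<close> maps the span of \<open>B\<close> into that of \<open>C\<close>,
  \<open>btrace_comm\<close> with the identity replaces \<open>B\<close> by \<open>C\<close>, on
  which the exponent drops by one. Exponent zero leaves only the empty basis.\<close>

lemma (in vector_space) btrace_nilpotent:
  assumes "Vector_Spaces.linear scale scale N"
  shows "finite B \<Longrightarrow> independent B \<Longrightarrow> N ` B \<subseteq> span B \<Longrightarrow> (\<And>b. b \<in> B \<Longrightarrow> (N ^^ k) b = 0)
    \<Longrightarrow> btrace scale B N = 0"
proof (induction k arbitrary: B)
  case 0
  then have "B \<subseteq> {0}" by auto
  then have "B = {}" using 0(2) dependent_zero by blast
  then show ?case by (simp add: btrace_def)
next
  case (Suc k)
  interpret N: Vector_Spaces.linear scale scale N by fact
  interpret p: vector_space_pair scale scale by unfold_locales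
  obtain C where C: "C \<subseteq> N ` B" "independent C" "N ` B \<subseteq> span C"
    using maximal_independent_subset by blast
  have CB: "C \<subseteq> span B" using C(1) Suc.prems(3) by blast
  have "N ` C \<subseteq> N ` span B" using CB by blast
  also have "\<dots> = span (N ` B)" using p.linear_span_image[OF assms] by simp
  also have "\<dots> \<subseteq> span C" using C(3) span_minimal by blast
  finally have NC: "N ` C \<subseteq> span C" .
  have "(N ^^ k) c = 0" if c: "c \<in> C" for c
  proof -
    obtain b where "b \<in> B" "c = N b" using c C(1) by auto
    then show ?thesis using Suc.prems(4)[of b] by (simp add: funpow_swap1)
  qed
  moreover have fC: "finite C" using C(1) Suc.prems(1) finite_subset by blast
  ultimately have "btrace scale C N = 0" using Suc.IH C NC by blast
  moreover have "btrace scale B (\<lambda>x. id (N x)) = btrace scale C (\<lambda>x. N (id x))"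
    using Suc.prems C CB fC assms by (intro p.btrace_comm linear_id) auto
  ultimately show ?case by simp
qed

section \<open>Primary decomposition over the complex numbers\<close>

locale fd_coperator = fd_operator sc X for sc :: "complex \<Rightarrow> 'a::ab_group_add \<Rightarrow> 'a" and X
begin

text \<open>Induction on the degree of a polynomial annihilating \<open>v\<close>. A root
  \<open>l\<close> is split off; the remaining factor annihilates \<open>X v - sc l v\<close>, which
  therefore is a sum of generalized eigenvectors, and \<open>X - l\<close> has to be undone on such
  a sum.\<close>

lemma gen_eig_spans: "v \<in> span (\<Union>m. GE {m})"
proof -
  have "p \<noteq> 0 \<Longrightarrow> poly_act p v = 0 \<Longrightarrow> v \<in> span (\<Union>m. GE {m})" for p v
  proof (induction "degree p" arbitrary: p v)
    case 0
    then obtain c where "p = [:c:]" "c \<noteq> 0" by (metis degree_eq_zeroE pCons_0_0)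
    then have "v = 0" using 0 by (simp add: poly_act_def)
    then show ?case by (simp add: span_zero)
  next
    case (Suc d)
    then have "\<not> constant (poly p)" by (simp add: constant_degree)
    then obtain l where "poly p l = 0" using fundamental_theorem_of_algebra by blast
    then obtain q where q: "p = [:-l, 1:] * q" unfolding poly_eq_0_iff_dvd by (rule dvdE)
    have "q \<noteq> 0" using q Suc by auto
    moreover have "degree q = d" using Suc(2) degree_mult_eq[of "[:-l, 1:]" q] \<open>q \<noteq> 0\<close> unfolding q by simp
    ultimately have "X v - sc l v \<in> span (\<Union>m. GE {m})"
      using Suc q poly_act_root by metis
    \<comment> \<open>\<open>X - l\<close> is onto on each component with an eigenvalue other than
      \<open>l\<close>. The component for \<open>l\<close> is left as an error: it only places
      \<open>w - v\<close> in the generalized eigenspace of \<open>l\<close>.\<close>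
    moreover have "\<exists>w\<in>span (\<Union>m. GE {m}). (X w - sc l w) - u \<in> GE {l}"
      if "u \<in> span (\<Union>m. GE {m})" for u
      using that
    proof (induction rule: span_induct_alt)
      case base
      show ?case by (intro bexI[of _ 0]) (auto simp: X.zero gen_eig.zero span_zero)
    next
      case (step c x y)
      then obtain m w where m: "sc c x \<in> GE {m}" and w: "w \<in> span (\<Union>m. GE {m})" "(X w - sc l w) - y \<in> GE {l}"
        using gen_eig_scale by blast
      show ?case
      proof (cases "m = l")
        case True
        have "((X w - sc l w) - y) - sc c x \<in> GE {l}"
          using subspace_diff[OF subspace_gen_eig] w m True by blast
        then show ?thesis using w(1) by (intro bexI[of _ w]) (simp_all add: algebra_simps)
      next
        case False
        then obtain w' where w': "w' \<in> GE {m}" "X w' - sc l w' = sc c x"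
          using gen_eig_solve m by metis
        then have "(X (w + w') - sc l (w + w')) - (sc c x + y) \<in> GE {l}"
          unfolding shift_add using w by simp
        then show ?thesis using w(1) w'(1) by (intro bexI[of _ "w + w'"]) (auto intro: span_add span_base)
      qed
    qed
    ultimately obtain w where w: "w \<in> span (\<Union>m. GE {m})" "(X w - sc l w) - (X v - sc l v) \<in> GE {l}"
      by blast
    moreover have "X (w - v) - sc l (w - v) = (X w - sc l w) - (X v - sc l v)"
      by (simp add: X.diff scale_right_diff_distrib)
    ultimately have "w - v \<in> GE {l}"
      using gen_eig.step[of l "{l}" X "w - v" sc] by simp
    then have "w - v \<in> span (\<Union>m. GE {m})"
      by (intro span_base) blast
    with w(1) have "w - (w - v) \<in> span (\<Union>m. GE {m})"
      by (rule span_diff)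
    then show ?case by simp
  qed
  then show ?thesis using annihilating_poly by blast
qed

lemma eigenbasis:
  obtains B ev where "finite B" "independent B" "span B = UNIV" "\<And>b. b \<in> B \<Longrightarrow> b \<in> GE {ev b}"
proof -
  obtain B where B: "B \<subseteq> (\<Union>m. GE {m})" "independent B" "(\<Union>m. GE {m}) \<subseteq> span B"
    using maximal_independent_subset by blast
  have "span B = UNIV"
    using gen_eig_spans B(3) span_minimal subspace_span by blast
  moreover have "finite B" using B(2) fd.finiteI_independent by blast
  moreover have "\<forall>b\<in>B. \<exists>m. b \<in> GE {m}" using B(1) by blast
  ultimately show ?thesis using that B(2) by metis
qed

context
  fixes B ev
  assumes B: "finite B" "independent B" "span B = UNIV" and ev: "\<And>b. b \<in> B \<Longrightarrow> b \<in> GE {ev b}"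
begin

text \<open>When \<open>v\<close> is expanded in the basis, the terms with another eigenvalue form a
  vector in \<open>GE {l}\<close> and in \<open>GE (- {l})\<close>, hence zero. Sets of eigenvalues
  in \<open>gen_eig\<close> make this a single disjointness statement.\<close>

lemma gen_eig_span_basis: "GE {l} \<subseteq> span {b\<in>B. ev b = l}"
proof
  fix v assume v: "v \<in> GE {l}"
  let ?f = "\<lambda>b. sc (representation B v b) b"
  have "v = (\<Sum>b\<in>B. ?f b)" using sum_representation_eq[OF B(2) _ B(1)] B(3) by simp
  also have "\<dots> = (\<Sum>b | b \<in> B \<and> ev b = l. ?f b) + (\<Sum>b | b \<in> B \<and> ev b \<noteq> l. ?f b)"
    using B(1) by (subst sum.union_disjoint[symmetric]) (auto intro: sum.cong)
  finally obtain s r where s_def: "s = (\<Sum>b | b \<in> B \<and> ev b = l. ?f b)"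
    and r_def: "r = (\<Sum>b | b \<in> B \<and> ev b \<noteq> l. ?f b)" and e: "v = s + r" by blast
  have s: "s \<in> GE {l}" unfolding s_def
    by (intro subspace_sum[OF subspace_gen_eig] gen_eig_scale) (use ev in auto)
  have "r \<in> GE (- {l})" unfolding r_def
  proof (intro subspace_sum[OF subspace_gen_eig] gen_eig_scale)
    fix b assume "b \<in> {b \<in> B. ev b \<noteq> l}"
    then show "b \<in> GE (- {l})" using gen_eig_mono[OF ev[of b], of "- {l}"] by auto
  qed
  moreover have "r \<in> GE {l}" using subspace_diff[OF subspace_gen_eig v s] e by simp
  ultimately have "r = 0" using gen_eig_disjoint by blast
  moreover have "s \<in> span {b\<in>B. ev b = l}" unfolding s_def
    by (intro span_sum span_scale span_base) auto
  ultimately show "v \<in> span {b\<in>B. ev b = l}" using e by simp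
qed

text \<open>\<open>T\<close> is the function \<open>g\<close> of the semisimple part of
  \<open>X\<close>. It is defined on the basis and then acts by the same scalar on every vector of a
  generalized eigenspace.\<close>

lemma semisimple_operator:
  obtains T where "Vector_Spaces.linear sc sc T" "\<And>l v. v \<in> GE {l} \<Longrightarrow> T v = sc (g l) v"
proof -
  interpret p: vector_space_pair sc sc by unfold_locales
  obtain T where T: "Vector_Spaces.linear sc sc T" "\<And>b. b \<in> B \<Longrightarrow> T b = sc (g (ev b)) b"
    using p.linear_independent_extend[OF B(2), of "\<lambda>b. sc (g (ev b)) b"] by blast
  have "T v = sc (g l) v" if "v \<in> GE {l}" for l v
    by (rule p.linear_eq_on[OF T(1) linear_scale_self[of "g l"], of v "{b\<in>B. ev b = l}"])
      (use that gen_eig_span_basis T(2) in auto)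
  then show ?thesis using that T(1) by blast
qed

text \<open>On the generalized eigenspace of \<open>l\<close> the operator \<open>T\<close> is the
  scalar \<open>g l\<close> and \<open>X - l\<close> is nilpotent, so the trace of \<open>X\<close>
  there is \<open>l\<close> times the number of basis vectors.\<close>

lemma trace_semisimple:
  assumes T: "Vector_Spaces.linear sc sc T" "\<And>l v. v \<in> GE {l} \<Longrightarrow> T v = sc (g l) v"
  shows "trace_F sc (\<lambda>v. T (X v)) = (\<Sum>b\<in>B. g (ev b) * ev b)"
proof -
  let ?C = "\<lambda>l. {b\<in>B. ev b = l}"
  have indC: "independent (?C l)" for l using B(2) by (rule independent_mono) auto
  have finC: "finite (?C l)" for l using B(1) by auto
  have tr: "(\<Sum>b\<in>?C l. representation B (X b) b) = of_nat (card (?C l)) * l" for l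
  proof -
    let ?N = "\<lambda>v. X v - sc l v"
    have inS: "b \<in> ?C l \<Longrightarrow> ?N b \<in> span (?C l)" for b
      using ev[of b] gen_eig_shift[of b "{l}" l] gen_eig_span_basis[of l] by auto
    have linN: "Vector_Spaces.linear sc sc ?N"
      by (simp add: Vector_Spaces.linear_iff vector_space_axioms shift_add shift_scale del: scale_scale)
    have "\<forall>b\<in>?C l. \<exists>n. (?N ^^ n) b = 0" using ev gen_eig_funpow by auto
    then obtain n where n: "b \<in> ?C l \<Longrightarrow> (?N ^^ n b) b = 0" for b by metis
    define K where "K = Max (n ` ?C l)"
    have "(?N ^^ K) b = 0" if "b \<in> ?C l" for b
    proof -
      have "n b \<le> K" using that finC by (auto simp: K_def)
      then have "(?N ^^ K) b = (?N ^^ (K - n b)) ((?N ^^ n b) b)"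
        by (metis comp_apply funpow_add le_add_diff_inverse2)
      moreover have "(?N ^^ j) 0 = 0" for j by (induction j) (auto simp: X.zero)
      ultimately show ?thesis using n that by simp
    qed
    then have "btrace sc (?C l) ?N = 0"
      by (intro btrace_nilpotent[OF linN, of "?C l" K]) (use inS indC finC in auto)
    moreover have "representation B (X b) b = representation (?C l) (?N b) b + l" if "b \<in> ?C l" for b
    proof -
      have "representation B (X b) b = representation B (?N b + sc l b) b" by simp
      also have "\<dots> = representation B (?N b) b + l * representation B b b"
        by (subst representation_add, use B in simp, use B in simp, use B in simp)
          (simp add: representation_scale B)
      also have "representation B b b = 1" using that B by (simp add: representation_basis)
      also have "representation B (?N b) = representation (?C l) (?N b)"
        by (rule representation_extend[OF B(2)]) (use inS that in auto)
      finally show ?thesis by simp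
    qed
    ultimately show ?thesis by (simp add: btrace_def sum.distrib)
  qed
  have "trace_F sc (\<lambda>v. T (X v)) = btrace sc B (\<lambda>v. T (X v))"
    using B T linX by (intro trace_F_eq) (auto intro: Vector_Spaces.linear_compose[unfolded comp_def])
  also have "\<dots> = (\<Sum>b\<in>B. g (ev b) * representation B (X b) b)"
    unfolding btrace_def using T(2)[OF gen_eig_image[OF ev]]
    by (intro sum.cong) (auto simp: representation_scale B)
  also have "\<dots> = (\<Sum>l\<in>ev ` B. \<Sum>b\<in>?C l. g (ev b) * representation B (X b) b)"
    using B(1) by (rule sum.image_gen)
  also have "\<dots> = (\<Sum>l\<in>ev ` B. g l * (of_nat (card (?C l)) * l))"
    by (intro sum.cong refl) (simp add: sum_distrib_left flip: tr)
  also have "\<dots> = (\<Sum>l\<in>ev ` B. \<Sum>b\<in>?C l. g (ev b) * ev b)"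
    by (intro sum.cong refl) simp
  also have "\<dots> = (\<Sum>b\<in>B. g (ev b) * ev b)"
    using B(1) by (rule sum.image_gen[symmetric])
  finally show ?thesis .
qed

end
end

section \<open>Nondegeneracy of the Killing form\<close>

lemma (in fd_operator) gen_eig_has_eigenvector:
  "v \<in> GE {l} \<Longrightarrow> v \<noteq> 0 \<Longrightarrow> \<exists>w. w \<noteq> 0 \<and> X w = sc l w"
proof (induction rule: gen_eig.induct)
  case (step m v)
  then show ?case by (cases "X v - sc m v = 0") auto
qed simp

lemma (in vector_space) representation_lincomb:
  assumes "finite B" "independent B" "b0 \<in> B"
  shows "representation B (\<Sum>b\<in>B. scale (c b) b) b0 = c b0"
proof -
  have "representation B (\<Sum>b\<in>B. scale (c b) b) = (\<lambda>x. \<Sum>b\<in>B. representation B (scale (c b) b) x)"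
    using assms by (intro representation_sum) (auto intro: span_base span_scale)
  then have "representation B (\<Sum>b\<in>B. scale (c b) b) b0 = (\<Sum>b\<in>B. c b * (if b0 = b then 1 else 0))"
    using assms by (auto simp: representation_scale span_base representation_basis intro!: sum.cong)
  also have "\<dots> = c b0" using assms by (simp add: sum.delta if_distrib cong: if_cong)
  finally show ?thesis .
qed

section \<open>Complexification of a real Lie algebra, with \<open>(x, y)\<close> in the role of
  \<open>x + i y\<close>\<close>

definition csc :: "complex \<Rightarrow> 'a::real_vector \<times> 'a \<Rightarrow> 'a \<times> 'a" where
  "csc z p = (Re z *\<^sub>R fst p - Im z *\<^sub>R snd p, Re z *\<^sub>R snd p + Im z *\<^sub>R fst p)"

lemma vector_space_csc: "vector_space csc"
  by unfold_locales (auto simp: csc_def algebra_simps)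

lemma fst_csc [simp]: "fst (csc z p) = Re z *\<^sub>R fst p - Im z *\<^sub>R snd p"
  and snd_csc [simp]: "snd (csc z p) = Re z *\<^sub>R snd p + Im z *\<^sub>R fst p"
  by (simp_all add: csc_def)

lemma linear_map_prod_csc: "Vector_Spaces.linear scaleR scaleR f \<Longrightarrow> Vector_Spaces.linear csc csc (map_prod f f)"
  by (auto simp: Vector_Spaces.linear_iff vector_space_csc csc_def scaleR_diff_right
      algebra_simps module_hom.diff[OF Vector_Spaces.linear.axioms(3)]
      dest: Vector_Spaces.linear.axioms(3))

locale real_lie = fd_lie "scaleR :: real \<Rightarrow> 'a::real_vector \<Rightarrow> 'a" br for br
begin

lemma csc_basis:
  defines "B \<equiv> some_basis (scaleR :: real \<Rightarrow> 'a \<Rightarrow> 'a)"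
  shows "finite ((\<lambda>b. (b, 0::'a)) ` B)" "\<not> module.dependent csc ((\<lambda>b. (b, 0::'a)) ` B)"
    "module.span csc ((\<lambda>b. (b, 0::'a)) ` B) = UNIV"
    "p = (\<Sum>b\<in>(\<lambda>b. (b, 0)) ` B. csc (Complex (representation B (fst p) (fst b)) (representation B (snd p) (fst b))) b)"
proof -
  interpret c: vector_space csc by (rule vector_space_csc)
  have inj: "inj_on (\<lambda>b. (b, 0::'a)) B" by (simp add: inj_on_def)
  show fin: "finite ((\<lambda>b. (b, 0::'a)) ` B)" using some_basis by (simp add: B_def)
  show eq: "p = (\<Sum>b\<in>(\<lambda>b. (b, 0)) ` B. csc (Complex (representation B (fst p) (fst b)) (representation B (snd p) (fst b))) b)"
    for p
    using sum_representation_eq[of B "fst p" B] sum_representation_eq[of B "snd p" B] some_basis[folded B_def]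
    by (simp add: sum.reindex[OF inj] prod_eq_iff fst_sum snd_sum)
  show "module.span csc ((\<lambda>b. (b, 0::'a)) ` B) = UNIV"
  proof (intro equalityI subsetI UNIV_I)
    fix p :: "'a \<times> 'a"
    show "p \<in> c.span ((\<lambda>b. (b, 0::'a)) ` B)"
      by (subst eq) (intro c.span_sum c.span_scale c.span_base)
  qed
  show "\<not> module.dependent csc ((\<lambda>b. (b, 0::'a)) ` B)"
  proof (rule c.independent_if_scalars_zero[OF fin])
    fix f :: "'a \<times> 'a \<Rightarrow> complex" and x
    assume "(\<Sum>x\<in>(\<lambda>b. (b, 0)) ` B. csc (f x) x) = 0" and x: "x \<in> (\<lambda>b. (b, 0::'a)) ` B"
    then have "(\<Sum>b\<in>B. Re (f (b, 0)) *\<^sub>R b) = 0" "(\<Sum>b\<in>B. Im (f (b, 0)) *\<^sub>R b) = 0"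
      by (auto simp: sum.reindex[OF inj] prod_eq_iff fst_sum snd_sum)
    then have "\<forall>b\<in>B. Re (f (b, 0)) = 0" "\<forall>b\<in>B. Im (f (b, 0)) = 0"
      using independentD[OF some_basis(2,1) subset_refl, of "\<lambda>b. Re (f (b, 0))"]
        independentD[OF some_basis(2,1) subset_refl, of "\<lambda>b. Im (f (b, 0))"] unfolding B_def by blast+
    then show "f x = 0" using x by (auto simp: complex_eq_iff)
  qed
qed

sublocale c: fd_space "csc :: complex \<Rightarrow> 'a \<times> 'a \<Rightarrow> 'a \<times> 'a"
  unfolding fd_space_def fd_space_axioms_def fin_dim_def
  using vector_space_csc csc_basis by blast

lemma trace_csc:
  assumes "Vector_Spaces.linear scaleR scaleR f"
  shows "trace_F csc (map_prod f f :: 'a \<times> 'a \<Rightarrow> _) = of_real (trace_F scaleR f)"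
proof -
  let ?B = "some_basis (scaleR :: real \<Rightarrow> 'a \<Rightarrow> 'a)"
  let ?C = "(\<lambda>b. (b, 0::'a)) ` ?B"
  have f0: "f 0 = 0" using assms by (simp add: Vector_Spaces.linear_iff) (metis add_cancel_right_right)
  have "trace_F csc (map_prod f f) = btrace csc ?C (map_prod f f)"
    by (rule c.trace_F_eq[OF csc_basis(1-3) linear_map_prod_csc[OF assms]])
  also have "\<dots> = (\<Sum>b\<in>?C. of_real (representation ?B (f (fst b)) (fst b)))"
    unfolding btrace_def
  proof (intro sum.cong refl)
    fix b assume b: "b \<in> ?C"
    have "c.representation ?C (map_prod f f b) b = Complex (representation ?B (f (fst b)) (fst b)) (representation ?B (f (snd b)) (fst b))"
      by (subst csc_basis(4)[of "map_prod f f b"])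
        (use b c.representation_lincomb[OF csc_basis(1,2) b] in simp)
    then show "c.representation ?C (map_prod f f b) b = of_real (representation ?B (f (fst b)) (fst b))"
      using b f0 by (auto simp: representation_zero complex_of_real_def)
  qed
  also have "\<dots> = of_real (trace_F scaleR f)"
    by (simp add: sum.reindex inj_on_def trace_F_def)
  finally show ?thesis .
qed

definition cbr :: "'a \<times> 'a \<Rightarrow> 'a \<times> 'a \<Rightarrow> 'a \<times> 'a" where
  "cbr p q = (br (fst p) (fst q) - br (snd p) (snd q), br (fst p) (snd q) + br (snd p) (fst q))"

lemma cbr_left: "cbr (x, 0) q = map_prod (br x) (br x) q"
  by (cases q) (simp add: cbr_def brl.zero)

lemma cbr_add_left: "cbr (p + q) r = cbr p r + cbr q r"
  and cbr_add_right: "cbr p (q + r) = cbr p q + cbr p r"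
  and cbr_scale_left: "cbr (csc k p) q = csc k (cbr p q)"
  and cbr_scale_right: "cbr p (csc k q) = csc k (cbr p q)"
  by (simp_all add: cbr_def csc_def br_add_left br_add_right br.diff brl.diff br_scale_left br_scale_right
      algebra_simps)

text \<open>Cartan's argument: if the Killing form vanishes, the operator \<open>T\<close> acting on the generalized
  eigenspaces of \<open>ad x\<close> by the conjugate eigenvalues is a derivation, so the trace of
  \<open>T \<circ> ad x\<close>, a sum of \<open>\<bar>\<lambda>\<bar>\<^sup>2\<close>, vanishes for \<open>x\<close> in the derived algebra.\<close>

lemma killing_zero_imp_nilpotent:
  assumes k0: "\<And>x y. kil x y = 0" and x: "x \<in> span {br y z |y z. True}"
  shows "\<exists>n. (br x ^^ n) v = 0"
proof -
  let ?X = "map_prod (br x) (br x)"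
  interpret fd_coperator csc ?X
    by (intro fd_coperator.intro fd_operator.intro fd_operator_axioms.intro c.fd_space_axioms
        linear_map_prod_csc br_linear)
  obtain B ev where B: "finite B" "c.independent B" "c.span B = UNIV" and ev: "\<And>b. b \<in> B \<Longrightarrow> b \<in> GE {ev b}"
    using eigenbasis by blast
  obtain T where T: "Vector_Spaces.linear csc csc T" "\<And>l v. v \<in> GE {l} \<Longrightarrow> T v = csc (cnj l) v"
    using semisimple_operator[OF B ev] by blast
  interpret T: Vector_Spaces.linear csc csc T by (rule T(1))
  have der: "?X (cbr v w) = cbr (?X v) w + cbr v (?X w)" for v w
    by (simp add: cbr_def br.diff br.add br_br_right[of x] algebra_simps)
  have cbr0: "cbr 0 w = 0" "cbr v 0 = 0" for v w
    by (simp_all add: cbr_def brl.zero zero_prod_def)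
  \<comment> \<open>The derivation property of ad \<open>x\<close> splits the shift by
    \<open>l + m\<close> of a bracket into shifts of its factors; brackets therefore add
    eigenvalues.\<close>
  have sub_left: "cbr (?X v - csc l v) w + cbr v (?X w - csc m w) = ?X (cbr v w) - csc (l + m) (cbr v w)" for v w l m
    unfolding der
    by (simp add: cbr_def csc_def br_add_left br_add_right br.diff brl.diff br_scale_left br_scale_right
      algebra_simps)
  have cbr_GE: "v \<in> GE {l} \<Longrightarrow> w \<in> GE {m} \<Longrightarrow> cbr v w \<in> GE {l + m}" for v w l m
  proof (induction arbitrary: w rule: gen_eig.induct)
    case zero
    show ?case by (simp add: cbr0 gen_eig.zero)
  next
    case (step l' v)
    have v: "v \<in> GE {l}" using step.hyps gen_eig.step[of l' "{l}" ?X v csc] by blast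
    from step.prems show ?case
    proof (induction rule: gen_eig.induct)
      case zero
      show ?case by (simp add: cbr0 gen_eig.zero)
    next
      case (step m' w)
      have w: "w \<in> GE {m}" using step.hyps gen_eig.step[of m' "{m}" ?X w csc] by blast
      have "cbr (?X v - csc l v) w + cbr v (?X w - csc m w) \<in> GE {l + m}"
        using \<open>\<And>w. w \<in> GE {m} \<Longrightarrow> cbr (?X v - csc l' v) w \<in> GE {l + m}\<close>[OF w] \<open>l' \<in> {l}\<close> step.hyps step.IH
        by (intro gen_eig_add) auto
      then show ?case unfolding sub_left using gen_eig.step[of "l + m" "{l + m}" ?X "cbr v w" csc] by blast
    qed
  qed
  have Tder: "T (cbr p q) = cbr (T p) q + cbr p (T q)" for p q
  proof -
    have 1: "T (cbr p q) = cbr (T p) q + cbr p (T q)" if q: "q \<in> GE {m}" for p q m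
      using gen_eig_spans[of p]
    proof (induction rule: c.span_induct_alt)
      case base
      show ?case by (simp add: cbr0 T.zero)
    next
      case (step k p1 p2)
      then obtain l where l: "p1 \<in> GE {l}" by blast
      have "T (cbr p1 q) = cbr (T p1) q + cbr p1 (T q)"
        using T(2)[OF l] T(2)[OF q] T(2)[OF cbr_GE[OF l q]]
        by (simp add: cbr_scale_left cbr_scale_right c.scale_left_distrib)
      then show ?case
        by (simp add: step.IH T.add T.scale cbr_add_left cbr_scale_left c.scale_right_distrib)
    qed
    show ?thesis using gen_eig_spans[of q]
    proof (induction rule: c.span_induct_alt)
      case base
      show ?case by (simp add: cbr0 T.zero)
    next
      case (step k q1 q2)
      then obtain l where l: "q1 \<in> GE {l}" by blast
      show ?case
        by (simp add: step.IH T.add T.scale cbr_add_right cbr_scale_right c.scale_right_distrib 1[OF l])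
    qed
  qed
  \<comment> \<open>Write ad of \<open>br y z\<close> as a commutator and move one factor
    cyclically: as \<open>T\<close> is a derivation, the trace becomes that of ad
    \<open>(T y)\<close> composed with ad \<open>z\<close>. \<open>T\<close> need not preserve the
    real form, so \<open>T (y, 0)\<close> is split into real and imaginary parts, each contributing
    a value of the vanishing Killing form.\<close>
  have tr0: "trace_F csc (\<lambda>v. T (map_prod (br (br y z)) (br (br y z)) v)) = 0" for y z
  proof -
    let ?Y = "map_prod (br y) (br y)" and ?Z = "map_prod (br z) (br z)"
    obtain a b where ab: "T (y, 0) = (a, b)" by (cases "T (y, 0)")
    have lY: "Vector_Spaces.linear csc csc ?Y" and lZ: "Vector_Spaces.linear csc csc ?Z"
      by (rule linear_map_prod_csc[OF br_linear])+
    have "(\<lambda>v. T (map_prod (br (br y z)) (br (br y z)) v)) = (\<lambda>v. T (?Y (?Z v)) - T (?Z (?Y v)))"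
      by (auto simp: br_br_left simp flip: T.diff)
    then have "trace_F csc (\<lambda>v. T (map_prod (br (br y z)) (br (br y z)) v))
        = trace_F csc (\<lambda>v. T (?Y (?Z v))) - trace_F csc (\<lambda>v. T (?Z (?Y v)))"
      by (simp add: c.trace_F_diff)
    also have "trace_F csc (\<lambda>v. T (?Z (?Y v))) = trace_F csc (\<lambda>v. ?Y (T (?Z v)))"
      by (rule c.trace_F_comm_self[OF Vector_Spaces.linear_compose[OF lZ T(1), unfolded comp_def] lY])
    also have "trace_F csc (\<lambda>v. T (?Y (?Z v))) - \<dots> = trace_F csc (\<lambda>v. cbr (a, b) (?Z v))"
      by (simp add: Tder ab flip: c.trace_F_diff cbr_left)
    also have "\<dots> = trace_F csc (\<lambda>v. map_prod (\<lambda>u. br a (br z u)) (\<lambda>u. br a (br z u)) v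
        + csc \<i> (map_prod (\<lambda>u. br b (br z u)) (\<lambda>u. br b (br z u)) v))"
      by (rule arg_cong[of _ _ "trace_F csc"]) (auto simp: cbr_def csc_def)
    also have "\<dots> = of_real (kil a z) + \<i> * of_real (kil b z)"
      by (simp add: c.trace_F_add c.trace_F_scale trace_csc linear_brbr killing_def)
    finally show ?thesis by (simp add: k0)
  qed
  have "trace_F csc (\<lambda>v. T (map_prod (br x) (br x) v)) = 0"
    using x
  proof (induction rule: span_induct_alt)
    case base
    have "T (map_prod (br 0) (br 0) v) = 0" for v
      by (cases v) (simp add: brl.zero T.zero flip: zero_prod_def)
    then show ?case by (simp only: c.trace_F_zero)
  next
    case (step k y y')
    then obtain u z where u: "y = br u z" by blast
    have "T (map_prod (br (k *\<^sub>R y + y')) (br (k *\<^sub>R y + y')) v)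
        = csc (of_real k) (T (map_prod (br y) (br y) v)) + T (map_prod (br y') (br y') v)" for v
      unfolding T.scale[symmetric] T.add[symmetric]
      by (cases v) (simp add: csc_def br_add_left br_scale_left)
    then show ?case
      by (simp add: c.trace_F_add c.trace_F_scale step.IH u tr0)
  qed
  then have "(\<Sum>b\<in>B. cnj (ev b) * ev b) = 0"
    using trace_semisimple[OF B ev T] by simp
  then have "complex_of_real (\<Sum>b\<in>B. (cmod (ev b))\<^sup>2) = 0"
    unfolding of_real_sum complex_norm_square by (simp add: mult.commute)
  then have "(\<Sum>b\<in>B. (cmod (ev b))\<^sup>2) = 0"
    using of_real_eq_0_iff by blast
  then have "ev b = 0" if "b \<in> B" for b
    using that B(1) by (simp add: sum_nonneg_eq_0_iff)
  then have "B \<subseteq> GE {0}" using ev by force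
  then have "(v, 0) \<in> GE {0}"
    using c.span_minimal[OF _ subspace_gen_eig] B(3) by blast
  then obtain n where "((\<lambda>u. ?X u - csc 0 u) ^^ n) (v, 0) = 0"
    using gen_eig_funpow by blast
  moreover have "((\<lambda>u. ?X u - csc 0 u) ^^ n) (v, 0) = ((br x ^^ n) v, 0)" for n
    by (induction n) (auto simp: csc_def)
  ultimately show ?thesis by (metis fst_conv fst_zero)
qed

end

context fd_lie
begin

text \<open>Engel's theorem in a relative form that avoids quotient modules.\<close>

lemma engel_relative:
  assumes nil: "\<And>x v. \<exists>n. (br x ^^ n) v = 0"
  shows "subspace K \<Longrightarrow> (\<And>x y. x \<in> K \<Longrightarrow> y \<in> K \<Longrightarrow> br x y \<in> K) \<Longrightarrow> subspace U \<Longrightarrow> subspace V \<Longrightarrow> U \<subset> V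
    \<Longrightarrow> (\<And>k u. k \<in> K \<Longrightarrow> u \<in> U \<Longrightarrow> br k u \<in> U) \<Longrightarrow> (\<And>k u. k \<in> K \<Longrightarrow> u \<in> V \<Longrightarrow> br k u \<in> V)
    \<Longrightarrow> \<exists>v\<in>V - U. \<forall>k\<in>K. br k v \<in> U"
proof (induction "dim K" arbitrary: K U V rule: less_induct)
  case less
  show ?case
  proof (cases "K = {0}")
    case True
    then show ?thesis using less.prems(3,5) by (auto simp: brl.zero subspace_0)
  next
    case False
    define P where "P M \<longleftrightarrow> subspace M \<and> (\<forall>x\<in>M. \<forall>y\<in>M. br x y \<in> M) \<and> M \<subset> K" for M
    have "P {0}" using False subspace_0[OF less.prems(1)] by (auto simp: P_def brl.zero)
    moreover have "\<forall>M. P M \<longrightarrow> dim M < Suc (dim K)"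
      using fd.dim_subset by (auto simp: P_def less_Suc_eq_le)
    ultimately obtain M where M: "P M" and max: "\<And>M'. P M' \<Longrightarrow> dim M' \<le> dim M"
      using ex_has_greatest_nat[of P "{0}" dim "Suc (dim K)"] by blast
    have Ms: "subspace M" and Mc: "x \<in> M \<Longrightarrow> y \<in> M \<Longrightarrow> br x y \<in> M" and MK: "M \<subset> K" for x y
      using M by (auto simp: P_def)
    have dless: "dim M' < dim M''" if "subspace M'" "subspace M''" "M' \<subset> M''" for M' M''
      using that fd.dim_psubset span_eq_iff by metis
    have dMK: "dim M < dim K" using dless[OF Ms less.prems(1) MK] .
    have MKx: "m \<in> M \<Longrightarrow> m \<in> K" for m using MK by blast
    \<comment> \<open>The smaller algebra \<open>M\<close> acts on \<open>K\<close> modulo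
      \<open>M\<close>; the induction hypothesis gives an element outside \<open>M\<close> that
      normalizes \<open>M\<close>.\<close>
    obtain x where x: "x \<in> K - M" "\<And>m. m \<in> M \<Longrightarrow> br m x \<in> M"
      using less.hyps[OF dMK Ms Mc Ms less.prems(1) MK Mc] MKx less.prems(2) by blast
    \<comment> \<open>\<open>M\<close> and \<open>x\<close> together span a subalgebra, which is all
      of \<open>K\<close> because \<open>M\<close> has maximal dimension. Beyond \<open>M\<close>
      only \<open>x\<close> has to be treated.\<close>
    define M' where "M' = {m + sc c x |m c. m \<in> M}"
    have M'I: "m \<in> M \<Longrightarrow> m + sc c x \<in> M'" for m c by (auto simp: M'_def)
    have "M' = K"
    proof (rule ccontr)
      assume "M' \<noteq> K"
      have "M' \<subseteq> K"
        using x MKx less.prems(1) by (auto simp: M'_def subspace_add subspace_scale)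
      moreover have sub: "subspace M'"
      proof (rule subspaceI)
        show "0 \<in> M'" using M'I[of 0 0] subspace_0[OF Ms] by simp
        show "v + w \<in> M'" if vw: "v \<in> M'" "w \<in> M'" for v w
        proof -
          obtain m c m' c' where "v = m + sc c x" "w = m' + sc c' x" "m \<in> M" "m' \<in> M"
            using vw by (auto simp: M'_def)
          then have "v + w = (m + m') + sc (c + c') x" "m + m' \<in> M"
            by (simp_all add: scale_left_distrib subspace_add[OF Ms] algebra_simps)
          then show ?thesis using M'I by metis
        qed
        show "sc k v \<in> M'" if vw: "v \<in> M'" for v k
        proof -
          obtain m c where "v = m + sc c x" "m \<in> M" using vw by (auto simp: M'_def)
          then have "sc k v = sc k m + sc (k * c) x" "sc k m \<in> M"
            by (simp_all add: scale_right_distrib subspace_scale[OF Ms])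
          then show ?thesis using M'I by metis
        qed
      qed
      moreover have "br v w \<in> M'" if vw: "v \<in> M'" "w \<in> M'" for v w
      proof -
        obtain m c m' c' where vw': "v = m + sc c x" "w = m' + sc c' x" and m: "m \<in> M" "m' \<in> M"
          using vw by (auto simp: M'_def)
        have "br v w = br m m' + sc c' (br m x) - sc c (br m' x)"
          unfolding vw' using br_swap[of x m'] by (simp add: br_add_left br_add_right br_scale_left br_scale_right algebra_simps)
        then have "br v w \<in> M"
          using Mc x(2) m by (auto intro!: subspace_diff[OF Ms] subspace_add[OF Ms] subspace_scale[OF Ms])
        then show ?thesis using M'I[of "br v w" 0] by simp
      qed
      ultimately have "P M'" using \<open>M' \<noteq> K\<close> by (auto simp: P_def)
      moreover have "M \<subset> M'"
      proof -
        have "x \<in> M'" using M'I[of 0 1] subspace_0[OF Ms] by simp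
        moreover have "M \<subseteq> M'" using M'I[of _ 0] by auto
        ultimately show ?thesis using x by blast
      qed
      then have "dim M < dim M'" using dless Ms sub by blast
      ultimately show False using max by fastforce
    qed
    \<comment> \<open>The vectors that \<open>M\<close> annihilates modulo \<open>U\<close>. They
      are stable under \<open>x\<close> because \<open>x\<close> normalizes \<open>M\<close>, and
      the last iterate of \<open>v\<close> under \<open>br x\<close> outside \<open>U\<close> is
      annihilated modulo \<open>U\<close> by \<open>x\<close> as well.\<close>
    define W where "W = {v\<in>V. \<forall>m\<in>M. br m v \<in> U}"
    obtain v where v: "v \<in> W" "v \<notin> U"
      using less.hyps[OF dMK Ms Mc less.prems(3-5)] less.prems(6,7) MKx by (auto simp: W_def)
    have xW: "br x w \<in> W" if "w \<in> W" for w
    proof -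
      have "br m (br x w) = br (br m x) w + br x (br m w)" for m by (rule br_br_right)
      then show ?thesis
        using that x less.prems(6,7) subspace_add[OF less.prems(3)] by (auto simp: W_def)
    qed
    have pow: "(br x ^^ n) v \<in> W" for n by (induction n) (use v xW in auto)
    obtain n where "(br x ^^ n) v = 0" using nil by blast
    then have ex: "\<exists>n. (br x ^^ n) v \<in> U" using subspace_0[OF less.prems(3)] by metis
    define n where "n = (LEAST n. (br x ^^ n) v \<in> U)"
    have n: "(br x ^^ n) v \<in> U" unfolding n_def using ex by (rule LeastI_ex)
    then have "n \<noteq> 0" using v by (metis funpow_0)
    then obtain j where j: "n = Suc j" using not0_implies_Suc by blast
    define v' where "v' = (br x ^^ j) v"
    have v': "v' \<in> W" "v' \<notin> U" "br x v' \<in> U"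
      using pow n j not_less_Least[of j "\<lambda>n. (br x ^^ n) v \<in> U"] by (auto simp: v'_def n_def)
    have "br k v' \<in> U" if k: "k \<in> K" for k
    proof -
      obtain m c where "k = m + sc c x" "m \<in> M" using k \<open>M' = K\<close> by (auto simp: M'_def)
      then show ?thesis
        using v' subspace_add[OF less.prems(3)] subspace_scale[OF less.prems(3)]
        by (auto simp: W_def br_add_left br_scale_left)
    qed
    then show ?thesis using v' by (auto simp: W_def)
  qed
qed

end

locale simple_alg = fd_lie +
  assumes simple: "simple_lie sc br"
begin

lemma ideal_trivial: "subspace I \<Longrightarrow> (\<And>x y. x \<in> I \<Longrightarrow> br y x \<in> I) \<Longrightarrow> I = {0} \<or> I = UNIV"
  using simple by (auto simp: simple_lie_def)

lemma nonabelian: "\<exists>x y. br x y \<noteq> 0"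
  using simple by (auto simp: simple_lie_def)

lemma perfect: "span {br y z |y z. True} = UNIV"
proof -
  have "span {br y z |y z. True} = {0} \<or> span {br y z |y z. True} = UNIV"
    by (intro ideal_trivial) (auto intro: span_base)
  then show ?thesis using nonabelian span_base[of _ "{br y z |y z. True}"] by blast
qed

lemma center_trivial: "(\<And>y. br y x = 0) \<Longrightarrow> x = 0"
proof -
  have "{x. \<forall>y. br y x = 0} = {0} \<or> {x. \<forall>y. br y x = 0} = UNIV"
    by (intro ideal_trivial) (auto simp: subspace_def br.zero br_add_right br_scale_right)
  then show "(\<And>y. br y x = 0) \<Longrightarrow> x = 0" using nonabelian by blast
qed

lemma kil_radical: "(\<And>y. kil x y = 0) \<Longrightarrow> \<exists>x y. kil x y \<noteq> 0 \<Longrightarrow> x = 0"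
proof -
  have "{x. \<forall>y. kil x y = 0} = {0} \<or> {x. \<forall>y. kil x y = 0} = UNIV"
  proof (intro ideal_trivial)
    show "subspace {x. \<forall>y. kil x y = 0}"
      by (auto simp: subspace_def kil_add_left kil_scale_left kil_scale_left[of 0 0, simplified])
    fix x y assume x: "x \<in> {x. \<forall>y. kil x y = 0}"
    have "kil (br y x) z = kil x (br z y)" for z
      unfolding kil_commute[of "br y x" z] kil_assoc[of z y x, symmetric] kil_commute[of "br z y" x] ..
    then show "br y x \<in> {x. \<forall>y. kil x y = 0}" using x by simp
  qed
  then show "(\<And>y. kil x y = 0) \<Longrightarrow> \<exists>x y. kil x y \<noteq> 0 \<Longrightarrow> x = 0" by blast
qed

text \<open>Otherwise \<open>engel_relative\<close>, with the whole algebra acting on itself and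
  \<open>U = {0}\<close>, would produce a nonzero central element.\<close>

lemma not_all_nilpotent: "\<exists>x v. \<forall>n. (br x ^^ n) v \<noteq> 0"
proof (rule ccontr)
  assume "\<not> ?thesis"
  then have nil: "\<exists>n. (br x ^^ n) v = 0" for x v by blast
  have "\<exists>v\<in>UNIV - {0}. \<forall>k\<in>UNIV. br k v \<in> {0}"
    by (rule engel_relative[OF nil]) (use nonabelian br.zero in \<open>auto simp: subspace_def\<close>)
  then show False using center_trivial by blast
qed

end

section \<open>The Killing form and the centroid of a real simple Lie algebra\<close>

locale real_simple = real_lie br + simple_alg "scaleR :: real \<Rightarrow> 'a::real_vector \<Rightarrow> 'a" br for br
begin

text \<open>A vanishing form would make every element of the derived algebra, that is every element,
  ad-nilpotent, in contradiction to Engel's theorem.\<close>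

lemma kil_nonzero: "\<exists>x y. kil x y \<noteq> 0"
  using killing_zero_imp_nilpotent perfect not_all_nilpotent by (metis UNIV_I)

lemma kil_nondegenerate: "(\<And>y. kil x y = 0) \<Longrightarrow> x = 0"
  using kil_radical kil_nonzero by blast

text \<open>Schur's lemma over the reals: a centroid element becomes, after subtracting a real scalar,
  a square root of a nonpositive scalar.\<close>

definition centroid :: "('a \<Rightarrow> 'a) set" where
  "centroid = {f. Vector_Spaces.linear scaleR scaleR f \<and> (\<forall>x y. f (br x y) = br (f x) y)}"

lemma centroidD:
  assumes "f \<in> centroid"
  shows "Vector_Spaces.linear scaleR scaleR f" "f (br x y) = br (f x) y" "f (br x y) = br x (f y)"
proof -
  show l: "Vector_Spaces.linear scaleR scaleR f" and e: "f (br x y) = br (f x) y" for x y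
    using assms by (auto simp: centroid_def)
  interpret Vector_Spaces.linear scaleR scaleR f by (rule l)
  show "f (br x y) = br x (f y)"
    using br_swap[of x y] br_swap[of x "f y"] by (simp add: neg e)
qed

text \<open>On a bracket both orders give \<open>br (f u) (g v)\<close>, and brackets span.\<close>

lemma centroid_commute:
  assumes "f \<in> centroid" "g \<in> centroid"
  shows "f (g x) = g (f x)"
proof -
  have "x \<in> span {br y z |y z. True}" using perfect by simp
  then show ?thesis
  proof (induction rule: span_induct_alt)
    case base
    show ?case
      using centroidD(1)[OF assms(1)] centroidD(1)[OF assms(2)]
      by (metis module_hom.zero Vector_Spaces.linear.axioms(3))
  next
    case (step c x y)
    interpret f: Vector_Spaces.linear scaleR scaleR f by (rule centroidD(1)[OF assms(1)])
    interpret g: Vector_Spaces.linear scaleR scaleR g by (rule centroidD(1)[OF assms(2)])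
    obtain u v where "x = br u v" using step by blast
    then have "f (g x) = g (f x)"
      by (metis centroidD(2)[OF assms(1)] centroidD(3)[OF assms(2)])
    then show ?case by (simp add: f.add f.scale g.add g.scale step.IH)
  qed
qed

text \<open>The kernel of a centroid element is an ideal. In its applications this says that the
  centroid has no zero divisors.\<close>

lemma centroid_zero:
  assumes "f \<in> centroid" "f x = 0" "x \<noteq> 0"
  shows "f y = 0"
proof -
  interpret f: Vector_Spaces.linear scaleR scaleR f by (rule centroidD(1)[OF assms(1)])
  have "{x. f x = 0} = {0} \<or> {x. f x = 0} = UNIV"
    by (intro ideal_trivial)
      (auto simp: subspace_def f.add f.scale f.zero centroidD(3)[OF assms(1)] br.zero)
  then show ?thesis using assms(2,3) by blast
qed

text \<open>An eigenvalue \<open>\<alpha> + i \<beta>\<close> of the complexified \<open>f\<close>,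
  with eigenvector \<open>x + i y\<close>, makes \<open>(f - \<alpha>)^2 + \<beta>^2\<close> vanish
  on \<open>x\<close> and on \<open>y\<close>. This operator lies in the centroid, so it vanishes
  identically.\<close>

lemma centroid_square:
  assumes "f \<in> centroid"
  shows "\<exists>a b. \<forall>x. f (f x - a *\<^sub>R x) - a *\<^sub>R (f x - a *\<^sub>R x) = - (b * b) *\<^sub>R x"
proof -
  interpret f: Vector_Spaces.linear scaleR scaleR f by (rule centroidD(1)[OF assms])
  interpret fd_coperator csc "map_prod f f"
    by (intro fd_coperator.intro fd_operator.intro fd_operator_axioms.intro c.fd_space_axioms
        linear_map_prod_csc centroidD assms)
  obtain x0 :: 'a where x0: "x0 \<noteq> 0" using nonabelian by blast
  obtain B ev where "finite B" and B: "c.independent B" "c.span B = UNIV" and ev: "\<And>b. b \<in> B \<Longrightarrow> b \<in> GE {ev b}"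
    by (rule eigenbasis, rule that)
  have "B \<noteq> {}"
  proof
    assume "B = {}"
    then have "{0} = (UNIV :: ('a \<times> 'a) set)" using B(2) unfolding \<open>B = {}\<close> c.span_empty by blast
    then have "(x0, x0) = 0" by blast
    then show False using x0 by (simp add: zero_prod_def)
  qed
  then obtain b where b: "b \<in> B" by blast
  then have "b \<noteq> 0" using B(1) c.dependent_zero by blast
  then obtain w where w: "w \<noteq> 0" "map_prod f f w = csc (ev b) w"
    using gen_eig_has_eigenvector[OF ev[OF b]] by blast
  define \<alpha> \<beta> where "\<alpha> = Re (ev b)" and "\<beta> = Im (ev b)"
  obtain x y where xy: "w = (x, y)" by (cases w)
  have fx: "f x = \<alpha> *\<^sub>R x - \<beta> *\<^sub>R y" and fy: "f y = \<alpha> *\<^sub>R y + \<beta> *\<^sub>R x"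
    using w(2) by (auto simp: xy csc_def \<alpha>_def \<beta>_def)
  define g where "g x = f (f x - \<alpha> *\<^sub>R x) - \<alpha> *\<^sub>R (f x - \<alpha> *\<^sub>R x) + (\<beta> * \<beta>) *\<^sub>R x" for x
  have "g \<in> centroid"
    unfolding centroid_def
  proof (intro CollectI conjI allI)
    show "Vector_Spaces.linear scaleR scaleR g"
      by (simp add: Vector_Spaces.linear_iff vector_space_axioms g_def f.add f.scale f.diff algebra_simps)
    show "g (br u v) = br (g u) v" for u v
      by (simp add: g_def f.diff f.scale centroidD(2)[OF assms] br_add_left brl.diff br_scale_left)
  qed
  moreover have "g x = 0" "g y = 0"
    by (simp_all add: g_def fx fy f.diff f.add f.scale f.neg algebra_simps)
  moreover have "x \<noteq> 0 \<or> y \<noteq> 0" using w(1) xy by (auto simp: zero_prod_def)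
  ultimately have "g z = 0" for z using centroid_zero by blast
  then have "f (f z - \<alpha> *\<^sub>R z) - \<alpha> *\<^sub>R (f z - \<alpha> *\<^sub>R z) = - (\<beta> * \<beta>) *\<^sub>R z" for z
    unfolding g_def by (simp add: eq_neg_iff_add_eq_0)
  then show ?thesis by blast
qed

text \<open>For \<open>b = 0\<close> the operator \<open>h\<close> squares to zero, hence has a
  kernel and vanishes. Otherwise \<open>h / b\<close> is a complex structure.\<close>

lemma centroid_cases:
  assumes "f \<in> centroid"
  obtains (scalar) a where "f = (\<lambda>x. a *\<^sub>R x)"
  | (complex) a b J where "J \<in> centroid" "\<And>x. J (J x) = - x" "f = (\<lambda>x. a *\<^sub>R x + b *\<^sub>R J x)" "b \<noteq> 0"
proof -
  interpret f: Vector_Spaces.linear scaleR scaleR f by (rule centroidD(1)[OF assms])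
  obtain a b where ab: "\<And>x. f (f x - a *\<^sub>R x) - a *\<^sub>R (f x - a *\<^sub>R x) = - (b * b) *\<^sub>R x"
    using centroid_square[OF assms] by blast
  define h where "h x = f x - a *\<^sub>R x" for x
  have lh: "Vector_Spaces.linear scaleR scaleR h"
    by (simp add: Vector_Spaces.linear_iff vector_space_axioms h_def f.add f.scale algebra_simps)
  interpret h: Vector_Spaces.linear scaleR scaleR h by (rule lh)
  have hc: "h \<in> centroid"
  proof -
    have "h (br x y) = br (h x) y" for x y
      unfolding h_def centroidD(2)[OF assms] brl.diff br_scale_left ..
    then show ?thesis using lh unfolding centroid_def by blast
  qed
  have hh: "h (h x) = - (b * b) *\<^sub>R x" for x
    using ab by (simp add: h_def)
  show ?thesis
  proof (cases "b = 0")
    case True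
    have "h x = 0" for x
    proof (cases "h x = 0")
      case False
      moreover have "h (h x) = 0" unfolding hh using True by simp
      ultimately show ?thesis using centroid_zero[OF hc] by blast
    qed
    then have "f = (\<lambda>x. a *\<^sub>R x)" unfolding h_def by (intro ext) (simp only: right_minus_eq)
    then show ?thesis by (rule scalar)
  next
    case False
    define J where "J x = (1 / b) *\<^sub>R h x" for x
    have "J \<in> centroid"
    proof -
      have "J (br x y) = br (J x) y" for x y
        unfolding J_def br_scale_left centroidD(2)[OF hc] ..
      moreover have "Vector_Spaces.linear scaleR scaleR J"
        by (simp add: Vector_Spaces.linear_iff vector_space_axioms J_def h.add h.scale scaleR_add_right)
      ultimately show ?thesis unfolding centroid_def by blast
    qed
    moreover have "J (J x) = - x" for x
      using False by (simp add: J_def h.scale hh)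
    moreover have "f = (\<lambda>x. a *\<^sub>R x + b *\<^sub>R J x)"
      using False by (auto simp: J_def h_def)
    ultimately show ?thesis using False complex by blast
  qed
qed

text \<open>The roots commute, hence \<open>(K - J)(K + J) = 0\<close>, and the centroid has no zero
  divisors.\<close>

lemma centroid_root_unique:
  assumes "J \<in> centroid" "K \<in> centroid" "\<And>x. J (J x) = - x" "\<And>x. K (K x) = - x"
  shows "K = J \<or> K = (\<lambda>x. - J x)"
proof (rule disjCI)
  assume "K \<noteq> (\<lambda>x. - J x)"
  then obtain x where x: "K x + J x \<noteq> 0" by (metis eq_neg_iff_add_eq_0)
  interpret J: Vector_Spaces.linear scaleR scaleR J by (rule centroidD(1)[OF assms(1)])
  interpret K: Vector_Spaces.linear scaleR scaleR K by (rule centroidD(1)[OF assms(2)])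
  have "(\<lambda>x. K x - J x) \<in> centroid"
    by (auto simp: centroid_def Vector_Spaces.linear_iff vector_space_axioms K.add J.add K.scale J.scale
        algebra_simps centroidD(2)[OF assms(1)] centroidD(2)[OF assms(2)] brl.diff)
  moreover have "K (K x + J x) - J (K x + J x) = 0"
    by (simp add: K.add J.add assms(3,4) centroid_commute[OF assms(1,2)])
  ultimately have "K y - J y = 0" for y
    using centroid_zero x by blast
  then show "K = J" by auto
qed

end

section \<open>Trigonometric polynomials\<close>

text \<open>The finite sums in \<open>loop_set\<close> given by generators, so that additive
  statements reduce to one cosine and one sine; \<open>trig_iff\<close> restores the sums.\<close>

inductive trig :: "nat \<Rightarrow> (real \<Rightarrow> 'v::real_vector) \<Rightarrow> bool" for l where
  cos: "trig l (\<lambda>t. cos (real n * t / real l) *\<^sub>R a)"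
| sin: "trig l (\<lambda>t. sin (real n * t / real l) *\<^sub>R a)"
| add: "trig l u \<Longrightarrow> trig l v \<Longrightarrow> trig l (\<lambda>t. u t + v t)"

lemma trig_iff:
  "trig l u \<longleftrightarrow> (\<exists>N a b. \<forall>t. u t = (\<Sum>n\<le>N. cos (real n * t / real l) *\<^sub>R a n + sin (real n * t / real l) *\<^sub>R b n))"
proof
  assume "trig l u"
  then show "\<exists>N a b. \<forall>t. u t = (\<Sum>n\<le>N. cos (real n * t / real l) *\<^sub>R a n + sin (real n * t / real l) *\<^sub>R b n)"
  proof induction
    case (cos n x)
    show ?case
      by (rule exI[of _ n], rule exI[of _ "\<lambda>m. if m = n then x else 0"], rule exI[of _ "\<lambda>m. 0"])
        (simp add: if_distrib[of "scaleR _"] cong: if_cong)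
  next
    case (sin n x)
    show ?case
      by (rule exI[of _ n], rule exI[of _ "\<lambda>m. 0"], rule exI[of _ "\<lambda>m. if m = n then x else 0"])
        (simp add: if_distrib[of "scaleR _"] cong: if_cong)
  next
    case (add u v)
    then obtain N a b M c d where
      u: "\<And>t. u t = (\<Sum>n\<le>N. cos (real n * t / real l) *\<^sub>R a n + sin (real n * t / real l) *\<^sub>R b n)" and
      v: "\<And>t. v t = (\<Sum>n\<le>M. cos (real n * t / real l) *\<^sub>R c n + sin (real n * t / real l) *\<^sub>R d n)"
      by blast
    have pad: "(\<Sum>n\<le>N. cos (real n * t / real l) *\<^sub>R a n + sin (real n * t / real l) *\<^sub>R b n)
      = (\<Sum>n\<le>K. cos (real n * t / real l) *\<^sub>R (if n \<le> N then a n else 0) + sin (real n * t / real l) *\<^sub>R (if n \<le> N then b n else 0))"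
      if "N \<le> K" for N K and a b :: "nat \<Rightarrow> 'a" and t
      using that by (intro sum.mono_neutral_cong_left) auto
    define a' where "a' n = (if n \<le> N then a n else 0) + (if n \<le> M then c n else 0)" for n
    define b' where "b' n = (if n \<le> N then b n else 0) + (if n \<le> M then d n else 0)" for n
    have "u t + v t = (\<Sum>n\<le>max N M. cos (real n * t / real l) *\<^sub>R a' n + sin (real n * t / real l) *\<^sub>R b' n)" for t
      unfolding u v pad[of N "max N M", OF max.cobounded1] pad[of M "max N M", OF max.cobounded2]
        sum.distrib[symmetric] a'_def b'_def scaleR_add_right
      by (intro sum.cong refl) (simp add: add_ac)
    then show ?case by blast
  qed
next
  assume "\<exists>N a b. \<forall>t. u t = (\<Sum>n\<le>N. cos (real n * t / real l) *\<^sub>R a n + sin (real n * t / real l) *\<^sub>R b n)"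
  then obtain N a b where u: "u = (\<lambda>t. \<Sum>n\<le>N. cos (real n * t / real l) *\<^sub>R a n + sin (real n * t / real l) *\<^sub>R b n)"
    by blast
  show "trig l u"
    unfolding u
  proof (induction N)
    case 0
    show ?case using trig.add[OF trig.cos[of l 0 "a 0"] trig.sin[of l 0 "b 0"]] by simp
  next
    case (Suc N)
    show ?case
      unfolding sum.atMost_Suc
      by (rule trig.add[OF Suc trig.add[OF trig.cos trig.sin]])
  qed
qed

lemma trig_const: "trig l (\<lambda>t. a)"
  using trig.cos[of l 0 a] by simp

lemma trig_linear:
  assumes "linear A" "trig l u"
  shows "trig l (\<lambda>t. A (u t))"
  using assms(2)
proof induction
  case (cos n a)
  show ?case unfolding linear_cmul[OF assms(1)] by (rule trig.cos)
next
  case (sin n a)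
  show ?case unfolding linear_cmul[OF assms(1)] by (rule trig.sin)
next
  case (add u v)
  show ?case unfolding linear_add[OF assms(1)] by (intro trig.add add.IH)
qed

lemma trig_scaleR: "trig l u \<Longrightarrow> trig l (\<lambda>t. c *\<^sub>R u t)"
  by (rule trig_linear[OF linear_scale_self])

lemma trig_minus: "trig l u \<Longrightarrow> trig l (\<lambda>t. - u t)"
  using trig_scaleR[of l u "-1"] by simp

lemma trig_diff: "trig l u \<Longrightarrow> trig l v \<Longrightarrow> trig l (\<lambda>t. u t - v t)"
  using trig.add[of l u "\<lambda>t. - v t"] trig_minus[of l v] by simp

lemma trig_sum: "(\<And>i. i \<in> I \<Longrightarrow> trig l (u i)) \<Longrightarrow> trig l (\<lambda>t. \<Sum>i\<in>I. u i t)"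
proof (induction I rule: infinite_finite_induct)
  case (insert i I)
  have "trig l (\<lambda>t. u i t + (\<Sum>i\<in>I. u i t))"
    using insert.IH insert.prems by (intro trig.add[of l "u i"]) blast+
  then show ?case using insert.hyps by simp
qed (simp_all add: trig_const)

lemma trig_cos_int: "trig l (\<lambda>t. cos (of_int m * t / real l) *\<^sub>R a)"
proof (cases "m \<ge> 0")
  case True
  then show ?thesis using trig.cos[of l "nat m" a] by simp
next
  case False
  then have "real (nat (- m)) * t / real l = - (of_int m * t / real l)" for t by simp
  then have "cos (of_int m * t / real l) = cos (real (nat (- m)) * t / real l)" for t
    by (simp only: cos_minus)
  then show ?thesis using trig.cos[of l "nat (- m)" a] by simp
qed

lemma trig_sin_int: "trig l (\<lambda>t. sin (of_int m * t / real l) *\<^sub>R a)"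
proof (cases "m \<ge> 0")
  case True
  then show ?thesis using trig.sin[of l "nat m" a] by simp
next
  case False
  then have "real (nat (- m)) * t / real l = - (of_int m * t / real l)" for t by simp
  then have "sin (of_int m * t / real l) *\<^sub>R a = sin (real (nat (- m)) * t / real l) *\<^sub>R (- a)" for t
    by (simp only: sin_minus scaleR_minus_left scaleR_minus_right minus_minus)
  then show ?thesis using trig.sin[of l "nat (- m)" "- a"] by simp
qed

lemma trig_cos_phase: "trig l (\<lambda>t. cos (of_int m * t / real l + c) *\<^sub>R a)"
  using trig_diff[OF trig_cos_int[of l m "cos c *\<^sub>R a"] trig_sin_int[of l m "sin c *\<^sub>R a"]]
  by (simp add: cos_add scaleR_diff_left)

lemma trig_sin_phase: "trig l (\<lambda>t. sin (of_int m * t / real l + c) *\<^sub>R a)"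
  using trig.add[OF trig_sin_int[of l m "cos c *\<^sub>R a"] trig_cos_int[of l m "sin c *\<^sub>R a"]]
  by (simp add: sin_add scaleR_add_left)

text \<open>Product formulas on generators. Differences of frequencies may be negative, whence the
  versions with integer frequencies.\<close>

lemma trig_bilinear:
  assumes f: "\<And>x. linear (f x)" "\<And>y. linear (\<lambda>x. f x y)" and "trig l u" "trig l v"
  shows "trig l (\<lambda>t. f (u t) (v t))"
proof -
  have fl: "f (r *\<^sub>R x) y = r *\<^sub>R f x y" "f x (r *\<^sub>R y) = r *\<^sub>R f x y" "f (x + x') y = f x y + f x' y" "f x (y + y') = f x y + f x y'"
    for r x x' y y'
    using linear_cmul[OF f(1)] linear_cmul[OF f(2)] linear_add[OF f(1)] linear_add[OF f(2)] by auto
  have p: "cos x *\<^sub>R (cos y *\<^sub>R z) = cos (x - y) *\<^sub>R (z /\<^sub>R 2) + cos (x + y) *\<^sub>R (z /\<^sub>R 2)"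
    "sin x *\<^sub>R (sin y *\<^sub>R z) = cos (x - y) *\<^sub>R (z /\<^sub>R 2) - cos (x + y) *\<^sub>R (z /\<^sub>R 2)"
    "sin x *\<^sub>R (cos y *\<^sub>R z) = sin (x + y) *\<^sub>R (z /\<^sub>R 2) + sin (x - y) *\<^sub>R (z /\<^sub>R 2)"
    "cos x *\<^sub>R (sin y *\<^sub>R z) = sin (x + y) *\<^sub>R (z /\<^sub>R 2) - sin (x - y) *\<^sub>R (z /\<^sub>R 2)" for x y and z :: 'c
    by (simp_all add: cos_add cos_diff sin_add sin_diff flip: scaleR_add_left scaleR_diff_left)
      (simp_all add: field_simps)
  have q: "real n * t / real l - real m * t / real l = of_int (int n - int m) * t / real l"
    "real n * t / real l + real m * t / real l = of_int (int n + int m) * t / real l" for n m t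
    by (simp_all add: diff_divide_distrib add_divide_distrib algebra_simps)
  note gens = trig_cos_int trig_sin_int
  from assms(3) show ?thesis
  proof induction
    case (cos n a)
    from assms(4) show ?case
    proof induction
      case (cos m b)
      show ?case unfolding fl p q by (intro trig.add trig_diff gens)
    next
      case (sin m b)
      show ?case unfolding fl p q by (intro trig.add trig_diff gens)
    next
      case (add v w)
      show ?case using add.IH unfolding fl scaleR_add_right by (rule trig.add)
    qed
  next
    case (sin n a)
    from assms(4) show ?case
    proof induction
      case (cos m b)
      show ?case unfolding fl p q by (intro trig.add trig_diff gens)
    next
      case (sin m b)
      show ?case unfolding fl p q by (intro trig.add trig_diff gens)
    next
      case (add v w)
      show ?case using add.IH unfolding fl scaleR_add_right by (rule trig.add)
    qed
  next
    case (add u v)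
    show ?case using add.IH unfolding fl by (rule trig.add)
  qed
qed

lemma trig_mult: "trig l p \<Longrightarrow> trig l u \<Longrightarrow> trig l (\<lambda>t. p t *\<^sub>R u t)"
  by (rule trig_bilinear[where f = scaleR]) (simp_all add: linear_iff scaleR_add_left scaleR_add_right)

lemma trig_affine:
  assumes "trig l u" "\<bar>e\<bar> = 1"
  shows "trig l (\<lambda>t. u (e * t + c))"
  using assms(1)
proof induction
  obtain m :: int where e: "e = of_int m" using assms(2) by (metis abs_eq_iff of_int_1 of_int_minus abs_one)
  have q: "real n * (e * t + c) / real l = of_int (int n * m) * t / real l + real n * c / real l" for n t
    by (simp add: e distrib_left add_divide_distrib mult.assoc)
  {
    case (cos n a)
    show ?case unfolding q by (rule trig_cos_phase)
  next
    case (sin n a)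
    show ?case unfolding q by (rule trig_sin_phase)
  }
qed (rule trig.add)

lemma trig_periodic:
  assumes "trig l u" "0 < l"
  shows "u (t + 2 * pi * real l) = u t"
  using assms(1)
proof induction
  have q: "real n * (t + 2 * pi * real l) / real l = real n * t / real l + 2 * pi * of_int (int n)" for n
    using assms(2) by (simp add: field_simps)
  {
    case (cos n a)
    show ?case unfolding q cos_add cos_int_2pin sin_int_2pin by simp
  next
    case (sin n a)
    show ?case unfolding q sin_add cos_int_2pin sin_int_2pin by simp
  }
qed simp

lemma trig_deriv:
  fixes u :: "real \<Rightarrow> 'v::real_normed_vector"
  assumes "trig l u"
  shows "trig l (deriv_loop u) \<and> (\<forall>t. (u has_vector_derivative deriv_loop u t) (at t))"
proof -
  have "\<exists>v. trig l v \<and> (\<forall>t. (u has_vector_derivative v t) (at t))"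
    using assms
  proof induction
    have c: "((\<lambda>t. cos (c * t) *\<^sub>R a) has_vector_derivative sin (c * t) *\<^sub>R (- c *\<^sub>R a)) (at t)"
      "((\<lambda>t. sin (c * t) *\<^sub>R a) has_vector_derivative cos (c * t) *\<^sub>R (c *\<^sub>R a)) (at t)" for c t and a :: 'v
      by (auto intro!: derivative_eq_intros simp: mult.commute)
    {
      case (cos n a)
      show ?case using c(1)[of "real n / real l" a] trig.sin[of l n "- (real n / real l) *\<^sub>R a"] by auto
    next
      case (sin n a)
      show ?case using c(2)[of "real n / real l" a] trig.cos[of l n "(real n / real l) *\<^sub>R a"] by auto
    }
  next
    case (add u v)
    then obtain u' v' where "trig l u'" "trig l v'" "\<And>t. (u has_vector_derivative u' t) (at t)" "\<And>t. (v has_vector_derivative v' t) (at t)"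
      by blast
    then show ?case
      by (intro exI[of _ "\<lambda>t. u' t + v' t"]) (auto intro: trig.add has_vector_derivative_add)
  qed
  then obtain v where v: "trig l v" "\<And>t. (u has_vector_derivative v t) (at t)" by blast
  then have "deriv_loop u = v" by (auto simp: deriv_loop_def intro: vector_derivative_at)
  then show ?thesis using v by simp
qed

lemma trig_continuous: "trig l u \<Longrightarrow> continuous_on S u" for u :: "real \<Rightarrow> 'v::real_normed_vector"
  by (meson trig_deriv has_vector_derivative_continuous continuous_at_imp_continuous_on)

lemma cis_int: "cis (2 * pi * of_int j) = 1"
  by (rule complex_eqI) (simp_all only: cis.sel cos_int_2pin sin_int_2pin one_complex.sel)

lemma sum_cos_roots:
  assumes "0 < l"
  shows "(\<Sum>k<l. cos (2 * pi * of_int m * real k / real l)) = (if int l dvd m then real l else 0)"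
    and "(\<Sum>k<l. sin (2 * pi * of_int m * real k / real l)) = 0"
proof -
  define z where "z = cis (2 * pi * of_int m / real l)"
  have zk: "z ^ k = cis (2 * pi * of_int m * real k / real l)" for k
    unfolding z_def Complex.DeMoivre by (simp add: mult_ac)
  have "z ^ l = cis (2 * pi * of_int m)" using assms by (simp add: zk)
  also have "\<dots> = 1" by (rule cis_int)
  finally have zl: "z ^ l = 1" .
  have "(\<Sum>k<l. z ^ k) = (if int l dvd m then of_nat l else 0)"
  proof (cases "int l dvd m")
    case True
    then obtain j where "m = int l * j" by blast
    then have "2 * pi * of_int m / real l = 2 * pi * of_int j" using assms by simp
    then have "z = cis (2 * pi * of_int j)" unfolding z_def by (rule arg_cong)
    also have "\<dots> = 1" by (rule cis_int)
    finally show ?thesis using True by simp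
  next
    case False
    have "z \<noteq> 1"
    proof
      assume "z = 1"
      then have "cos (2 * pi * of_int m / real l) = 1" by (simp add: z_def complex_eq_iff)
      then obtain j :: int where "2 * pi * of_int m / real l = of_int j * 2 * pi" by (auto simp: cos_one_2pi_int)
      then have "real_of_int m = of_int (j * int l)" using assms by (simp add: field_simps)
      then have "m = j * int l" using of_int_eq_iff by blast
      then show False using False by simp
    qed
    then have "(1 - z) * (\<Sum>k<l. z ^ k) = 0" "1 - z \<noteq> 0" using zl one_diff_power_eq[of z l] by auto
    then show ?thesis using False by simp
  qed
  then have "Re (\<Sum>k<l. z ^ k) = (if int l dvd m then real l else 0)" "Im (\<Sum>k<l. z ^ k) = 0"
    by (auto split: if_splits)
  then show "(\<Sum>k<l. cos (2 * pi * of_int m * real k / real l)) = (if int l dvd m then real l else 0)"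
    and "(\<Sum>k<l. sin (2 * pi * of_int m * real k / real l)) = 0"
    by (simp_all add: zk)
qed

lemma sum_cos_delta:
  assumes "0 < l" "j < l" "k < l"
  shows "(\<Sum>r<l. cos (2 * pi * real r * (real j - real k) / real l)) = (if j = k then real l else 0)"
proof -
  have "int l dvd int j - int k \<longleftrightarrow> j = k"
  proof
    assume "int l dvd int j - int k"
    moreover have "\<not> \<bar>int l\<bar> \<le> \<bar>int j - int k\<bar>" using assms by linarith
    ultimately have "int j - int k = 0" using dvd_imp_le_int[of "int j - int k" "int l"] by blast
    then show "j = k" by simp
  qed simp
  moreover have "real r * (real j - real k) = of_int (int j - int k) * real r" for r
    by (simp only: of_int_diff of_int_of_nat_eq mult.commute)
  then have "2 * pi * real r * (real j - real k) / real l = 2 * pi * of_int (int j - int k) * real r / real l" for r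
    by (simp only: mult.assoc)
  ultimately show ?thesis using sum_cos_roots(1)[OF assms(1), of "int j - int k"] by (simp only:)
qed

section \<open>Twisted loop algebras\<close>

lemma sum_cos_phase:
  assumes "0 < l"
  shows "(\<Sum>k<l. cos (x - 2 * pi * of_int m * real k / real l)) = (if int l dvd m then real l * cos x else 0)"
  using sum_cos_roots[OF assms, of m]
  by (simp add: cos_diff sum.distrib flip: sum_distrib_left)

lemma sum_dvd_delta:
  assumes "0 < l"
  shows "(\<Sum>j<l. if int l dvd (int j - m) then x else 0) = (x :: 'v::comm_monoid_add)"
proof -
  have "int l dvd (int j - m) \<longleftrightarrow> j = nat (m mod int l)" if "j < l" for j
  proof -
    have "int l dvd (int j - m) \<longleftrightarrow> int j mod int l = m mod int l" by (simp add: mod_eq_dvd_iff)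
    also have "int j mod int l = int j" using that by simp
    also have "int j = m mod int l \<longleftrightarrow> j = nat (m mod int l)" using assms by auto
    finally show ?thesis .
  qed
  then have "(\<Sum>j<l. if int l dvd (int j - m) then x else 0) = (\<Sum>j<l. if j = nat (m mod int l) then x else 0)"
    by (intro sum.cong) auto
  also have "\<dots> = x" using assms by (simp add: sum.delta nat_less_iff)
  finally show ?thesis .
qed

text \<open>\<open>A\<close> is linear without a given bound, so no chain rule for bounded maps
  applies. On a generator it acts on a constant coefficient only.\<close>

lemma trig_deriv_linear:
  fixes u :: "real \<Rightarrow> 'v::real_normed_vector" and A :: "'v \<Rightarrow> 'w::real_normed_vector"
  assumes A: "linear A" and u: "trig l u"
  shows "((\<lambda>s. A (u s)) has_vector_derivative A (deriv_loop u t)) (at t)"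
proof -
  have "\<exists>v. \<forall>t. (u has_vector_derivative v t) (at t) \<and> ((\<lambda>s. A (u s)) has_vector_derivative A (v t)) (at t)"
    using u
  proof induction
    have c: "((\<lambda>t. cos (c * t) *\<^sub>R a) has_vector_derivative sin (c * t) *\<^sub>R (- c *\<^sub>R a)) (at t)"
      "((\<lambda>t. sin (c * t) *\<^sub>R a) has_vector_derivative cos (c * t) *\<^sub>R (c *\<^sub>R a)) (at t)"
      for c t and a :: "'z::real_normed_vector"
      by (auto intro!: derivative_eq_intros simp: mult.commute)
    {
      case (cos n a)
      show ?case
        using c(1)[of "real n / real l" a] c(1)[of "real n / real l" "A a"]
        by (intro exI[of _ "\<lambda>t. sin (real n / real l * t) *\<^sub>R (- (real n / real l) *\<^sub>R a)"])
          (simp add: linear_cmul[OF A] linear_neg[OF A])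
    next
      case (sin n a)
      show ?case
        using c(2)[of "real n / real l" a] c(2)[of "real n / real l" "A a"]
        by (intro exI[of _ "\<lambda>t. cos (real n / real l * t) *\<^sub>R ((real n / real l) *\<^sub>R a)"])
          (simp add: linear_cmul[OF A])
    }
  next
    case (add u v)
    then obtain u' v' where "\<And>t. (u has_vector_derivative u' t) (at t) \<and> ((\<lambda>s. A (u s)) has_vector_derivative A (u' t)) (at t)"
      "\<And>t. (v has_vector_derivative v' t) (at t) \<and> ((\<lambda>s. A (v s)) has_vector_derivative A (v' t)) (at t)"
      by blast
    then show ?case
      by (intro exI[of _ "\<lambda>t. u' t + v' t"]) (auto intro: has_vector_derivative_add simp: linear_add[OF A])
  qed
  then obtain v where v: "\<And>t. (u has_vector_derivative v t) (at t)" "\<And>t. ((\<lambda>s. A (u s)) has_vector_derivative A (v t)) (at t)"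
    by blast
  then have "deriv_loop u = v" by (auto simp: deriv_loop_def intro: vector_derivative_at)
  then show ?thesis using v by simp
qed

section \<open>Interpolation at the points \<open>t0 + 2 * pi * k\<close> and divisibility\<close>

definition dirichlet :: "nat \<Rightarrow> real \<Rightarrow> real" where
  "dirichlet l s = (\<Sum>j<l. cos (real j * s / real l)) / real l"

lemma trig_dirichlet: "trig l (\<lambda>s. dirichlet l s *\<^sub>R a)"
proof -
  have "trig l (\<lambda>s. \<Sum>j<l. cos (real j * s / real l) *\<^sub>R (a /\<^sub>R real l))"
    by (intro trig_sum trig.cos)
  then show ?thesis
    by (simp add: dirichlet_def scaleR_sum_left sum_distrib_right divide_inverse)
qed

lemma trig_dirichlet_shift: "trig l (\<lambda>s. dirichlet l (s - c) *\<^sub>R a)"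
  using trig_affine[OF trig_dirichlet[of l a], of 1 "- c"] by simp

text \<open>A sum of roots of unity. It makes \<open>dirichlet l\<close> an interpolation kernel for
  the \<open>l\<close> nodes that lie over one point of the circle of length
  \<open>2 * pi\<close>.\<close>

lemma dirichlet_root: "0 < l \<Longrightarrow> j < l \<Longrightarrow> dirichlet l (- (2 * pi * real j)) = (if j = 0 then 1 else 0)"
proof -
  assume l: "0 < l" "j < l"
  have "cos (real r * - (2 * pi * real j) / real l) = cos (2 * pi * real r * (real j - real 0) / real l)" for r
    using cos_minus[of "2 * pi * real r * (real j - real 0) / real l"] by (simp add: mult_ac)
  then show ?thesis
    unfolding dirichlet_def using sum_cos_delta[of l j 0] l by simp
qed

text \<open>\<open>divides_at l t0 u\<close> states that \<open>u\<close> lies in the ideal generated by the \<open>2\<pi>\<close>-periodic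
  trigonometric polynomials vanishing at \<open>t0\<close>.\<close>

definition divides_at :: "nat \<Rightarrow> real \<Rightarrow> (real \<Rightarrow> 'v::real_vector) \<Rightarrow> bool" where
  "divides_at l t0 u \<longleftrightarrow> (\<exists>v w. trig l v \<and> trig l w \<and> (\<forall>t. u t = (1 - cos (t - t0)) *\<^sub>R v t + sin (t - t0) *\<^sub>R w t))"

lemma divides_at_zero: "divides_at l t0 (\<lambda>t. 0)"
  unfolding divides_at_def by (rule exI[of _ "\<lambda>t. 0"])+ (simp add: trig_const)

lemma divides_at_add:
  assumes "divides_at l t0 u" "divides_at l t0 u'"
  shows "divides_at l t0 (\<lambda>t. u t + u' t)"
proof -
  from assms obtain v w v' w' where
    "trig l v" "trig l w" "\<And>t. u t = (1 - cos (t - t0)) *\<^sub>R v t + sin (t - t0) *\<^sub>R w t"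
    "trig l v'" "trig l w'" "\<And>t. u' t = (1 - cos (t - t0)) *\<^sub>R v' t + sin (t - t0) *\<^sub>R w' t"
    unfolding divides_at_def by blast
  then show ?thesis
    unfolding divides_at_def
    by (intro exI[of _ "\<lambda>t. v t + v' t"] exI[of _ "\<lambda>t. w t + w' t"] conjI trig.add)
      (simp_all add: scaleR_add_right)
qed

lemma divides_at_scale:
  assumes "divides_at l t0 u"
  shows "divides_at l t0 (\<lambda>t. c *\<^sub>R u t)"
proof -
  from assms obtain v w where
    "trig l v" "trig l w" "\<And>t. u t = (1 - cos (t - t0)) *\<^sub>R v t + sin (t - t0) *\<^sub>R w t"
    unfolding divides_at_def by blast
  then show ?thesis
    unfolding divides_at_def
    by (intro exI[of _ "\<lambda>t. c *\<^sub>R v t"] exI[of _ "\<lambda>t. c *\<^sub>R w t"] conjI trig_scaleR)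
      (simp_all add: scaleR_add_right mult.commute)
qed

lemma divides_at_sum: "(\<And>i. i \<in> I \<Longrightarrow> divides_at l t0 (u i)) \<Longrightarrow> divides_at l t0 (\<lambda>t. \<Sum>i\<in>I. u i t)"
proof (induction I rule: infinite_finite_induct)
  case (insert i I)
  have 1: "divides_at l t0 (u i)" by (rule insert.prems) simp
  have 2: "divides_at l t0 (\<lambda>t. \<Sum>i\<in>I. u i t)" by (rule insert.IH) (rule insert.prems, simp)
  show ?case unfolding sum.insert[OF insert.hyps(1,2)] by (rule divides_at_add[OF 1 2])
qed (simp_all add: divides_at_zero)

text \<open>Telescoping in steps of \<open>l\<close> in the frequency, which add \<open>s\<close> to
  the angle: \<open>cos (X + s) - cos X\<close> equals
  \<open>- (1 - cos s) * cos X - sin s * sin X\<close>.\<close>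

lemma divides_at_cos_diff:
  assumes "0 < l" "int l dvd m - n"
  shows "divides_at l 0 (\<lambda>s. (cos (of_int m * s / real l + c) - cos (of_int n * s / real l + c)) *\<^sub>R a)"
proof -
  obtain q where "m - n = int l * q" using assms(2) by blast
  then have m: "m = n + int l * q" by simp
  have e: "of_int (n + int l * q) * s / real l + c = of_int n * s / real l + c + of_int q * s" for q s
    using assms(1) by (simp add: field_simps)
  let ?X = "\<lambda>q s. of_int (n + int l * q) * s / real l + c"
  have step: "divides_at l 0 (\<lambda>s. (cos (?X (q + 1) s) - cos (?X q s)) *\<^sub>R a)" for q
  proof -
    have alg: "(- (1 - x) * y - z * w) *\<^sub>R a = (1 - x) *\<^sub>R (y *\<^sub>R - a) + z *\<^sub>R (w *\<^sub>R - a)" for x y z w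
      by (simp add: algebra_simps)
    have *: "cos (?X (q + 1) s) - cos (?X q s) = - (1 - cos s) * cos (?X q s) - sin s * sin (?X q s)" for s
    proof -
      have "?X (q + 1) s = ?X q s + s" unfolding e by (simp add: distrib_right)
      then show ?thesis unfolding \<open>?X (q + 1) s = ?X q s + s\<close> cos_add[of "?X q s" s] by algebra
    qed
    then show ?thesis
      unfolding divides_at_def
      by (intro exI[of _ "\<lambda>s. cos (?X q s) *\<^sub>R (- a)"] exI[of _ "\<lambda>s. sin (?X q s) *\<^sub>R (- a)"]
          conjI trig_cos_phase trig_sin_phase allI)
        (simp only: * diff_0_right alg)
  qed
  have "divides_at l 0 (\<lambda>s. (cos (?X q s) - cos (of_int n * s / real l + c)) *\<^sub>R a)"
  proof (induction q rule: int_induct[of _ 0])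
    case base
    then show ?case by (simp add: divides_at_zero)
  next
    case (step1 i)
    show ?case using divides_at_add[OF step1(2) step[of i]] by (simp add: algebra_simps)
  next
    case (step2 i)
    show ?case using divides_at_add[OF step2(2) divides_at_scale[OF step[of "i - 1"], of "-1"]]
      by (simp add: algebra_simps)
  qed
  then show ?thesis unfolding m .
qed

text \<open>Interpolating one cosine gives, by the product formula and sums of roots of unity, half
  the sum of two cosines whose frequencies below \<open>l\<close> are congruent to \<open>n\<close>
  and \<open>- n\<close> modulo \<open>l\<close>. The error is thus a sum of differences as in
  \<open>divides_at_cos_diff\<close>. A phase \<open>c\<close> is carried along so that the sine is
  the case \<open>c = - pi / 2\<close>.\<close>

lemma divides_at_interpolation0:
  assumes l: "0 < l" and u: "trig l u"
  shows "divides_at l 0 (\<lambda>s. u s - (\<Sum>k<l. dirichlet l (s - 2 * pi * real k) *\<^sub>R u (2 * pi * real k)))"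
proof -
  have gen: "divides_at l 0 (\<lambda>s. cos (real n * s / real l + c) *\<^sub>R a
      - (\<Sum>k<l. dirichlet l (s - 2 * pi * real k) *\<^sub>R cos (real n * (2 * pi * real k) / real l + c) *\<^sub>R a))"
    for n c and a :: 'a
  proof -
    let ?c = "\<lambda>s. cos (real n * s / real l + c)"
    let ?p = "\<lambda>j. int l dvd int j - - int n" and ?q = "\<lambda>j. int l dvd int j - int n"
    have I: "(\<Sum>k<l. dirichlet l (s - 2 * pi * real k) * cos (real n * (2 * pi * real k) / real l + c))
      = (\<Sum>j<l. (if ?p j then cos (real j * s / real l - c) / 2 else 0) + (if ?q j then cos (real j * s / real l + c) / 2 else 0))"
      (is "?L = ?R") for s
    proof -
      have "?L = (\<Sum>k<l. \<Sum>j<l. cos (real j * (s - 2 * pi * real k) / real l) * cos (real n * (2 * pi * real k) / real l + c) / real l)"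
        by (simp add: dirichlet_def sum_divide_distrib sum_distrib_right)
      also have "\<dots> = (\<Sum>j<l. \<Sum>k<l. cos (real j * (s - 2 * pi * real k) / real l) * cos (real n * (2 * pi * real k) / real l + c) / real l)"
        by (rule sum.swap)
      also have "\<dots> = ?R"
      proof (intro sum.cong refl)
        fix j
        have e: "cos (real j * (s - 2 * pi * real k) / real l) * cos (real n * (2 * pi * real k) / real l + c) / real l
          = (cos ((real j * s / real l - c) - 2 * pi * of_int (int j - - int n) * real k / real l)
            + cos ((real j * s / real l + c) - 2 * pi * of_int (int j - int n) * real k / real l)) * (1 / (2 * real l))" for k
        proof -
          have x1: "real j * (s - 2 * pi * real k) / real l - (real n * (2 * pi * real k) / real l + c)
            = (real j * s / real l - c) - 2 * pi * of_int (int j - - int n) * real k / real l"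
            and x2: "real j * (s - 2 * pi * real k) / real l + (real n * (2 * pi * real k) / real l + c)
            = (real j * s / real l + c) - 2 * pi * of_int (int j - int n) * real k / real l"
            using l by (simp_all add: field_simps)
          show ?thesis unfolding cos_times_cos x1 x2 by simp
        qed
        show "(\<Sum>k<l. cos (real j * (s - 2 * pi * real k) / real l) * cos (real n * (2 * pi * real k) / real l + c) / real l)
          = (if ?p j then cos (real j * s / real l - c) / 2 else 0) + (if ?q j then cos (real j * s / real l + c) / 2 else 0)"
          unfolding e sum_distrib_right[symmetric] sum.distrib sum_cos_phase[OF l] using l by (auto simp: add_divide_distrib)
      qed
      finally show ?thesis .
    qed
    \<comment> \<open>Exactly one \<open>j < l\<close> lies in each of the two residue classes.
      Writing the cosine as two halves under the same conditions lets the difference be taken term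
      by term.\<close>
    have d: "?c s = (\<Sum>j<l. (if ?p j then ?c s / 2 else 0) + (if ?q j then ?c s / 2 else 0))" for s
      unfolding sum.distrib sum_dvd_delta[OF l] by simp
    have "?c s *\<^sub>R a - (\<Sum>k<l. dirichlet l (s - 2 * pi * real k) *\<^sub>R cos (real n * (2 * pi * real k) / real l + c) *\<^sub>R a)
      = (\<Sum>j<l. (if ?p j then (-1/2) *\<^sub>R ((cos (real j * s / real l - c) - ?c s) *\<^sub>R a) else 0)
          + (if ?q j then (-1/2) *\<^sub>R ((cos (real j * s / real l + c) - ?c s) *\<^sub>R a) else 0))" for s
    proof -
      have "?c s *\<^sub>R a - (\<Sum>k<l. dirichlet l (s - 2 * pi * real k) *\<^sub>R cos (real n * (2 * pi * real k) / real l + c) *\<^sub>R a)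
        = (?c s - (\<Sum>k<l. dirichlet l (s - 2 * pi * real k) * cos (real n * (2 * pi * real k) / real l + c))) *\<^sub>R a"
        by (simp add: scaleR_diff_left scaleR_sum_left)
      also have "\<dots> = (\<Sum>j<l. ((if ?p j then ?c s / 2 else 0) + (if ?q j then ?c s / 2 else 0)
          - ((if ?p j then cos (real j * s / real l - c) / 2 else 0) + (if ?q j then cos (real j * s / real l + c) / 2 else 0))) *\<^sub>R a)"
        unfolding I by (subst d) (simp only: sum_subtractf[symmetric] scaleR_sum_left)
      also have "\<dots> = (\<Sum>j<l. (if ?p j then (-1/2) *\<^sub>R ((cos (real j * s / real l - c) - ?c s) *\<^sub>R a) else 0)
          + (if ?q j then (-1/2) *\<^sub>R ((cos (real j * s / real l + c) - ?c s) *\<^sub>R a) else 0))"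
        by (intro sum.cong refl) (auto simp: algebra_simps simp flip: scaleR_add_left)
      finally show ?thesis .
    qed
    moreover have "divides_at l 0 (\<lambda>s. \<Sum>j<l. (if ?p j then (-1/2) *\<^sub>R ((cos (real j * s / real l - c) - ?c s) *\<^sub>R a) else 0)
          + (if ?q j then (-1/2) *\<^sub>R ((cos (real j * s / real l + c) - ?c s) *\<^sub>R a) else 0))"
    proof (intro divides_at_sum divides_at_add)
      fix j
      show "divides_at l 0 (\<lambda>s. if ?p j then (-1/2) *\<^sub>R ((cos (real j * s / real l - c) - ?c s) *\<^sub>R a) else 0)"
      proof (cases "?p j")
        case True
        have "of_int (- int n) * s / real l + - c = - (real n * s / real l + c)" for s by simp
        then have "cos (of_int (- int n) * s / real l + - c) = ?c s" for s by (simp only: cos_minus)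
        then have "divides_at l 0 (\<lambda>s. (cos (real j * s / real l - c) - ?c s) *\<^sub>R a)"
          using divides_at_cos_diff[OF l True, of "- c" a] by simp
        then show ?thesis unfolding if_P[OF True] by (rule divides_at_scale)
      qed (simp add: divides_at_zero)
      show "divides_at l 0 (\<lambda>s. if ?q j then (-1/2) *\<^sub>R ((cos (real j * s / real l + c) - ?c s) *\<^sub>R a) else 0)"
      proof (cases "?q j")
        case True
        then have "divides_at l 0 (\<lambda>s. (cos (real j * s / real l + c) - ?c s) *\<^sub>R a)"
          using divides_at_cos_diff[OF l True, of c a] by simp
        then show ?thesis unfolding if_P[OF True] by (rule divides_at_scale)
      qed (simp add: divides_at_zero)
    qed
    ultimately show ?thesis by simp
  qed
  show ?thesis
    using u
  proof induction
    case (cos n a)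
    show ?case using gen[of n 0 a] by simp
  next
    case (sin n a)
    have "cos (x + - (pi / 2)) = sin x" for x by (simp add: cos_diff)
    then show ?case using gen[of n "- (pi / 2)" a] by simp
  next
    case (add u v)
    have "(\<lambda>s. (u s - (\<Sum>k<l. dirichlet l (s - 2 * pi * real k) *\<^sub>R u (2 * pi * real k)))
         + (v s - (\<Sum>k<l. dirichlet l (s - 2 * pi * real k) *\<^sub>R v (2 * pi * real k))))
      = (\<lambda>s. u s + v s - (\<Sum>k<l. dirichlet l (s - 2 * pi * real k) *\<^sub>R (u (2 * pi * real k) + v (2 * pi * real k))))"
      by (rule ext) (simp add: scaleR_add_right sum.distrib)
    then show ?case using divides_at_add[OF add.IH] by simp
  qed
qed

lemma divides_at_interpolation:
  assumes l: "0 < l" and u: "trig l u"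
  shows "divides_at l t0 (\<lambda>t. u t - (\<Sum>k<l. dirichlet l (t - t0 - 2 * pi * real k) *\<^sub>R u (t0 + 2 * pi * real k)))"
proof -
  have "trig l (\<lambda>s. u (s + t0))" using trig_affine[OF u, of 1 t0] by simp
  from divides_at_interpolation0[OF l this] obtain v w where
    v: "trig l v" "trig l w" "\<And>s. u (s + t0) - (\<Sum>k<l. dirichlet l (s - 2 * pi * real k) *\<^sub>R u (2 * pi * real k + t0))
      = (1 - cos s) *\<^sub>R v s + sin s *\<^sub>R w s"
    unfolding divides_at_def by auto
  show ?thesis
    unfolding divides_at_def
  proof (intro exI conjI allI)
    show "trig l (\<lambda>t. v (t - t0))" "trig l (\<lambda>t. w (t - t0))"
      using trig_affine[OF v(1), of 1 "- t0"] trig_affine[OF v(2), of 1 "- t0"] by simp_all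
    show "u t - (\<Sum>k<l. dirichlet l (t - t0 - 2 * pi * real k) *\<^sub>R u (t0 + 2 * pi * real k))
      = (1 - cos (t - t0)) *\<^sub>R v (t - t0) + sin (t - t0) *\<^sub>R w (t - t0)" for t
      using v(3)[of "t - t0"] by (simp add: add.commute)
  qed
qed

section \<open>Twisted loops: averaging, evaluation, perfectness\<close>

locale loop_alg = real_simple br
  for br :: "'a::real_normed_vector \<Rightarrow> 'a \<Rightarrow> 'a" +
  fixes \<sigma> :: "'a \<Rightarrow> 'a" and l :: nat
  assumes l_pos: "0 < l" and \<sigma>_linear: "linear \<sigma>" and \<sigma>_br: "\<sigma> (br x y) = br (\<sigma> x) (\<sigma> y)"
    and \<sigma>_pow: "(\<sigma> ^^ l) x = x"
begin

sublocale \<sigma>: linear \<sigma> by (rule \<sigma>_linear)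

lemma lin_br: "linear (br x)" "linear (\<lambda>x. br x y)"
  by (simp_all add: linear_iff br_add_left br_add_right br_scale_left br_scale_right)

lemma lin_kil: "linear (kil x)" "linear (\<lambda>x. kil x y)"
  by (simp_all add: linear_iff kil_add_left kil_add_right kil_scale_left kil_scale_right)

definition L :: "(real \<Rightarrow> 'a) set" where
  "L = {u. (\<forall>t. u (t + 2 * pi) = \<sigma> (u t)) \<and> trig l u}"

lemma LI: "(\<And>t. u (t + 2 * pi) = \<sigma> (u t)) \<Longrightarrow> trig l u \<Longrightarrow> u \<in> L"
  and L_twist: "u \<in> L \<Longrightarrow> u (t + 2 * pi) = \<sigma> (u t)"
  and L_trig: "u \<in> L \<Longrightarrow> trig l u"
  by (auto simp: L_def)

lemma L_zero: "(\<lambda>t. 0) \<in> L"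
  by (intro LI) (simp_all add: \<sigma>.zero trig_const)

lemma L_add: "u \<in> L \<Longrightarrow> v \<in> L \<Longrightarrow> (\<lambda>t. u t + v t) \<in> L"
  by (intro LI trig.add) (simp_all add: \<sigma>.add L_twist L_trig)

lemma L_diff: "u \<in> L \<Longrightarrow> v \<in> L \<Longrightarrow> (\<lambda>t. u t - v t) \<in> L"
  by (intro LI trig_diff) (simp_all add: \<sigma>.diff L_twist L_trig)

lemma L_scale: "u \<in> L \<Longrightarrow> (\<lambda>t. c *\<^sub>R u t) \<in> L"
  by (intro LI trig_scaleR) (simp_all add: \<sigma>.scaleR L_twist L_trig)

lemma L_bracket: "u \<in> L \<Longrightarrow> v \<in> L \<Longrightarrow> (\<lambda>t. br (u t) (v t)) \<in> L"
  by (rule LI) (simp add: \<sigma>_br L_twist, rule trig_bilinear[OF lin_br L_trig L_trig])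

lemma L_mult:
  assumes "u \<in> L" "trig l p" "\<And>t. p (t + 2 * pi) = p t"
  shows "(\<lambda>t. p t *\<^sub>R u t) \<in> L"
  by (rule LI) (simp add: assms \<sigma>.scaleR L_twist, rule trig_mult[OF assms(2) L_trig[OF assms(1)]])

lemma trig_cos_nat: "trig l (\<lambda>t. cos (real n * t + c))" and trig_sin_nat: "trig l (\<lambda>t. sin (real n * t + c))"
  using trig_cos_phase[of l "int (n * l)" c "1::real"] trig_sin_phase[of l "int (n * l)" c "1::real"] l_pos by simp_all

lemma trig_cos1: "trig l (\<lambda>t. cos (t - c))" and trig_sin1: "trig l (\<lambda>t. sin (t - c))"
  using trig_cos_nat[of 1 "- c"] trig_sin_nat[of 1 "- c"] by simp_all

lemma L_cos: "u \<in> L \<Longrightarrow> (\<lambda>t. cos (t - c) *\<^sub>R u t) \<in> L"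
  using L_mult[OF _ trig_cos1[of c]] by (simp add: cos_periodic flip: diff_add_eq)

lemma L_sin: "u \<in> L \<Longrightarrow> (\<lambda>t. sin (t - c) *\<^sub>R u t) \<in> L"
  using L_mult[OF _ trig_sin1[of c]] by (simp add: sin_periodic flip: diff_add_eq)

lemma L_has_deriv: "u \<in> L \<Longrightarrow> (u has_vector_derivative deriv_loop u t) (at t)"
  using trig_deriv L_trig by blast

lemma L_deriv:
  assumes "u \<in> L"
  shows "deriv_loop u \<in> L"
proof (intro LI)
  show "trig l (deriv_loop u)" using trig_deriv L_trig assms by blast
  fix t
  have "((\<lambda>s. u (s + 2 * pi)) has_vector_derivative deriv_loop u (t + 2 * pi)) (at t)"
    using vector_diff_chain_at[of "\<lambda>s. s + 2 * pi" 1 t u] L_has_deriv[OF assms]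
    by (simp add: comp_def has_vector_derivative_add_const has_vector_derivative_id)
  moreover have "((\<lambda>s. u (s + 2 * pi)) has_vector_derivative \<sigma> (deriv_loop u t)) (at t)"
  proof -
    have "((\<lambda>s. \<sigma> (u s)) has_vector_derivative \<sigma> (deriv_loop u t)) (at t)"
      by (rule trig_deriv_linear[OF \<sigma>_linear L_trig[OF assms]])
    then show ?thesis using L_twist[OF assms] by simp
  qed
  ultimately show "deriv_loop u (t + 2 * pi) = \<sigma> (deriv_loop u t)"
    by (rule vector_derivative_unique_at)
qed

lemma \<sigma>_pow_linear: "linear (\<sigma> ^^ j)"
  by (induction j) (simp_all add: linear_iff \<sigma>.add \<sigma>.scaleR)

lemma L_twist_pow: "u \<in> L \<Longrightarrow> u (t + 2 * pi * real k) = (\<sigma> ^^ k) (u t)"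
proof (induction k)
  case (Suc k)
  have e: "t + 2 * pi * real (Suc k) = (t + 2 * pi * real k) + 2 * pi" by (simp add: algebra_simps)
  show ?case unfolding e using Suc L_twist[OF Suc.prems, of "t + 2 * pi * real k"] by simp
qed simp

text \<open>\<open>l\<close> times the projection of the loops of period \<open>2 * pi * l\<close>
  onto the twisted ones: the sum over the cyclic group generated by the operator that sends
  \<open>u\<close> to the loop \<open>\<sigma> (u (t - 2 * pi))\<close>.\<close>

definition Av :: "(real \<Rightarrow> 'a) \<Rightarrow> real \<Rightarrow> 'a" where
  "Av u t = (\<Sum>j<l. (\<sigma> ^^ j) (u (t - 2 * pi * real j)))"

lemma Av_add: "Av (\<lambda>t. u t + v t) = (\<lambda>t. Av u t + Av v t)"
  by (simp add: Av_def fun_eq_iff linear_add[OF \<sigma>_pow_linear] sum.distrib)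

lemma Av_scale: "Av (\<lambda>t. c *\<^sub>R u t) = (\<lambda>t. c *\<^sub>R Av u t)"
  by (simp add: Av_def fun_eq_iff linear_cmul[OF \<sigma>_pow_linear] scaleR_sum_right)

lemma Av_in_L:
  assumes "trig l u"
  shows "Av u \<in> L"
proof (intro LI)
  have sh: "trig l (\<lambda>t. u (t - c))" for c
    using trig_affine[OF assms, of 1 "- c"] by simp
  show "trig l (Av u)"
    unfolding Av_def[abs_def] by (intro trig_sum trig_linear[OF \<sigma>_pow_linear] sh)
  fix t
  let ?g = "\<lambda>j. (\<sigma> ^^ j) (u (t + 2 * pi - 2 * pi * real j))"
  have "?g l = ?g 0"
    using trig_periodic[OF assms l_pos, of "t + 2 * pi - 2 * pi * real l"] \<sigma>_pow by (simp add: algebra_simps)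
  moreover have "?g 0 + (\<Sum>j<l. ?g (Suc j)) = (\<Sum>j<l. ?g j) + ?g l"
    by (rule trans[OF sum.lessThan_Suc_shift[of ?g l, symmetric] sum.lessThan_Suc[of ?g l]])
  ultimately have "(\<Sum>j<l. ?g j) = (\<Sum>j<l. ?g (Suc j))" by simp
  also have "\<dots> = \<sigma> (Av u t)"
    by (simp add: Av_def \<sigma>.sum algebra_simps)
  finally show "Av u (t + 2 * pi) = \<sigma> (Av u t)" by (simp add: Av_def)
qed

lemma Av_L: "u \<in> L \<Longrightarrow> Av u = (\<lambda>t. real l *\<^sub>R u t)"
proof -
  assume u: "u \<in> L"
  have "(\<sigma> ^^ j) (u (t - 2 * pi * real j)) = u t" for j t
    using L_twist_pow[OF u, of "t - 2 * pi * real j" j] by simp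
  then show ?thesis by (simp add: Av_def fun_eq_iff sum_constant_scaleR)
qed

lemma L_eq_Av: "u \<in> L \<Longrightarrow> u = Av (\<lambda>t. (1 / real l) *\<^sub>R u t)"
  using l_pos by (simp add: Av_scale Av_L)

text \<open>A linear right inverse of evaluation at \<open>t0\<close>: there the kernel vanishes in
  every summand of the average except that for \<open>j = 0\<close>.\<close>

definition sec :: "real \<Rightarrow> 'a \<Rightarrow> real \<Rightarrow> 'a" where
  "sec t0 x = Av (\<lambda>t. dirichlet l (t - t0) *\<^sub>R x)"

lemma sec_in_L: "sec t0 x \<in> L"
  unfolding sec_def by (intro Av_in_L trig_dirichlet_shift)

lemma sec_eval: "sec t0 x t0 = x"
proof -
  have "sec t0 x t0 = (\<Sum>j<l. if j = 0 then x else 0)"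
    unfolding sec_def Av_def
    by (intro sum.cong refl) (auto simp: dirichlet_root[OF l_pos] linear_cmul[OF \<sigma>_pow_linear])
  also have "\<dots> = x" using l_pos by (simp add: sum.delta)
  finally show ?thesis .
qed

lemma sec_add: "sec t0 (x + y) = (\<lambda>t. sec t0 x t + sec t0 y t)"
  by (simp add: sec_def scaleR_add_right Av_add)

lemma sec_scale: "sec t0 (c *\<^sub>R x) = (\<lambda>t. c *\<^sub>R sec t0 x t)"
  unfolding sec_def scaleR_left_commute[of _ c] Av_scale ..

text \<open>By the twist \<open>u\<close> vanishes at all nodes over \<open>t0\<close>, so it equals
  its interpolation error. The coefficients obtained there need not be twisted; averaging makes them
  so, because \<open>1 - cos (t - t0)\<close> and \<open>sin (t - t0)\<close> have period
  \<open>2 * pi\<close> and pass through \<open>Av\<close>.\<close>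

lemma L_divides:
  assumes u: "u \<in> L" and "u t0 = 0"
  obtains v w where "v \<in> L" "w \<in> L" "u = (\<lambda>t. (1 - cos (t - t0)) *\<^sub>R v t + sin (t - t0) *\<^sub>R w t)"
proof -
  have "u (t0 + 2 * pi * real k) = 0" for k
    using L_twist_pow[OF u] assms(2) linear_0[OF \<sigma>_pow_linear] by simp
  then have "divides_at l t0 u"
    using divides_at_interpolation[OF l_pos L_trig[OF u], of t0] by simp
  then obtain v w where vw: "trig l v" "trig l w"
    "\<And>t. u t = (1 - cos (t - t0)) *\<^sub>R v t + sin (t - t0) *\<^sub>R w t"
    unfolding divides_at_def by blast
  have per: "cos (t - 2 * pi * real j - t0) = cos (t - t0)" "sin (t - 2 * pi * real j - t0) = sin (t - t0)" for t j
  proof -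
    have e: "t - 2 * pi * real j - t0 = (t - t0) - 2 * pi * of_int (int j)" by simp
    show "cos (t - 2 * pi * real j - t0) = cos (t - t0)" "sin (t - 2 * pi * real j - t0) = sin (t - t0)"
      unfolding e cos_diff sin_diff cos_int_2pin sin_int_2pin by simp_all
  qed
  have lu: "real l *\<^sub>R u t = (1 - cos (t - t0)) *\<^sub>R Av v t + sin (t - t0) *\<^sub>R Av w t" for t
    unfolding fun_cong[OF Av_L[OF u], of t, symmetric]
    by (simp add: Av_def vw(3) per linear_add[OF \<sigma>_pow_linear] linear_cmul[OF \<sigma>_pow_linear] sum.distrib scaleR_sum_right)
  then have "u t = (1 / real l) *\<^sub>R ((1 - cos (t - t0)) *\<^sub>R Av v t + sin (t - t0) *\<^sub>R Av w t)" for t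
  proof -
    have "u t = (1 / real l) *\<^sub>R (real l *\<^sub>R u t)" for t using l_pos by simp
    then show ?thesis unfolding lu by blast
  qed
  then have "u = (\<lambda>t. (1 - cos (t - t0)) *\<^sub>R ((1 / real l) *\<^sub>R Av v t) + sin (t - t0) *\<^sub>R ((1 / real l) *\<^sub>R Av w t))"
    by (simp add: fun_eq_iff scaleR_add_right mult.commute)
  then show ?thesis
    using that[of "\<lambda>t. (1 / real l) *\<^sub>R Av v t" "\<lambda>t. (1 / real l) *\<^sub>R Av w t"] L_scale Av_in_L vw by blast
qed

lemma kernel:
  assumes "j < l" "k < l"
  shows "(\<Sum>r<l. cos (real r * (t - 2 * pi * real j) / real l) * cos (real r * (t - 2 * pi * real k) / real l)
    + sin (real r * (t - 2 * pi * real j) / real l) * sin (real r * (t - 2 * pi * real k) / real l)) = (if j = k then real l else 0)"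
proof -
  have "cos (real r * (t - 2 * pi * real j) / real l) * cos (real r * (t - 2 * pi * real k) / real l)
    + sin (real r * (t - 2 * pi * real j) / real l) * sin (real r * (t - 2 * pi * real k) / real l)
    = cos (2 * pi * real r * (real k - real j) / real l)" for r
  proof -
    have e: "real r * (t - 2 * pi * real j) / real l - real r * (t - 2 * pi * real k) / real l
      = 2 * pi * real r * (real k - real j) / real l"
      using l_pos by (simp add: field_simps)
    show ?thesis unfolding cos_diff[symmetric] e ..
  qed
  then show ?thesis using sum_cos_delta[OF l_pos assms(2,1)] by simp
qed

text \<open>A bilinear map of two averages is a double sum over the cyclic group; summing over the
  frequencies \<open>r\<close> extracts its diagonal by \<open>kernel\<close>. An average of a
  product thus becomes a sum of products of averages, for the bracket in \<open>L_perfect\<close>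
  and for the Killing form in \<open>cocycle_nontrivial\<close>.\<close>

lemma bilinear_kernel:
  assumes f: "\<And>x. linear (f x)" "\<And>y. linear (\<lambda>x. f x y)"
  shows "real l *\<^sub>R (\<Sum>j<l. H (t - 2 * pi * real j) *\<^sub>R f ((\<sigma> ^^ j) x) ((\<sigma> ^^ j) y)) =
    (\<Sum>r<l. f (Av (\<lambda>t. (H t * cos (real r * t / real l)) *\<^sub>R x) t) (Av (\<lambda>t. cos (real r * t / real l) *\<^sub>R y) t)
      + f (Av (\<lambda>t. (H t * sin (real r * t / real l)) *\<^sub>R x) t) (Av (\<lambda>t. sin (real r * t / real l) *\<^sub>R y) t))"
proof -
  let ?h = "\<lambda>j. H (t - 2 * pi * real j)"
  let ?c = "\<lambda>r j. cos (real r * (t - 2 * pi * real j) / real l)" and ?s = "\<lambda>r j. sin (real r * (t - 2 * pi * real j) / real l)"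
  let ?F = "\<lambda>j k. f ((\<sigma> ^^ j) x) ((\<sigma> ^^ k) y)"
  have ff: "f (\<Sum>j<l. (\<sigma> ^^ j) (a j *\<^sub>R x)) (\<Sum>k<l. (\<sigma> ^^ k) (b k *\<^sub>R y)) = (\<Sum>j<l. \<Sum>k<l. (a j * b k) *\<^sub>R ?F j k)" for a b
    by (simp add: linear_sum[OF f(1)] linear_sum[OF f(2)] linear_cmul[OF \<sigma>_pow_linear] linear_cmul[OF f(1)]
        linear_cmul[OF f(2)] scaleR_sum_right)
      (subst sum.swap, simp add: mult.commute)
  have "(\<Sum>r<l. f (Av (\<lambda>t. (H t * cos (real r * t / real l)) *\<^sub>R x) t) (Av (\<lambda>t. cos (real r * t / real l) *\<^sub>R y) t)
      + f (Av (\<lambda>t. (H t * sin (real r * t / real l)) *\<^sub>R x) t) (Av (\<lambda>t. sin (real r * t / real l) *\<^sub>R y) t))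
    = (\<Sum>r<l. \<Sum>j<l. \<Sum>k<l. (?h j * (?c r j * ?c r k + ?s r j * ?s r k)) *\<^sub>R ?F j k)"
    unfolding Av_def ff sum.distrib[symmetric] scaleR_add_left[symmetric]
    by (simp add: distrib_left mult.assoc)
  also have "\<dots> = (\<Sum>j<l. \<Sum>k<l. \<Sum>r<l. (?h j * (?c r j * ?c r k + ?s r j * ?s r k)) *\<^sub>R ?F j k)"
    by (subst sum.swap) (intro sum.cong refl sum.swap)
  also have "\<dots> = (\<Sum>j<l. \<Sum>k<l. (?h j * (if j = k then real l else 0)) *\<^sub>R ?F j k)"
    by (intro sum.cong refl) (simp add: kernel flip: scaleR_sum_left sum_distrib_left)
  also have "\<dots> = (\<Sum>j<l. \<Sum>k<l. if j = k then (?h j * real l) *\<^sub>R ?F j k else 0)"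
    by (intro sum.cong refl) simp
  also have "\<dots> = real l *\<^sub>R (\<Sum>j<l. ?h j *\<^sub>R ?F j j)"
    by (simp add: scaleR_sum_right mult.commute)
  finally show ?thesis by simp
qed

lemma L_induct [consumes 1, case_names gen add]:
  assumes u: "u \<in> L" and gen: "\<And>H x. trig l H \<Longrightarrow> Q (Av (\<lambda>t. H t *\<^sub>R x))"
    and add: "\<And>u v. Q u \<Longrightarrow> Q v \<Longrightarrow> Q (\<lambda>t. u t + v t)"
  shows "Q u"
proof -
  have "Q (Av v)" if "trig l v" for v
    using that
  proof induction
    case (cos n a)
    show ?case using gen[OF trig.cos[of l n "1::real"], of a] by simp
  next
    case (sin n a)
    show ?case using gen[OF trig.sin[of l n "1::real"], of a] by simp
  next
    case (add u v)
    show ?case unfolding Av_add by (rule assms(3)[OF add.IH])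
  qed
  then show ?thesis using L_eq_Av[OF u] trig_scaleR[OF L_trig[OF u]] by metis
qed

text \<open>Perfectness of the loop algebra as an induction rule. By \<open>bilinear_kernel\<close>
  the loop \<open>Av (\<lambda>t. H t *\<^sub>R br y z)\<close> is a finite sum of brackets of
  twisted loops, and the Lie algebra itself is perfect.\<close>

lemma L_perfect [consumes 1, case_names bracket add]:
  assumes u: "u \<in> L" and br: "\<And>u v. u \<in> L \<Longrightarrow> v \<in> L \<Longrightarrow> Q (\<lambda>t. br (u t) (v t))"
    and add: "\<And>u v. u \<in> L \<Longrightarrow> v \<in> L \<Longrightarrow> Q u \<Longrightarrow> Q v \<Longrightarrow> Q (\<lambda>t. u t + v t)"
  shows "Q u"
proof -
  have Q0: "Q (\<lambda>t. 0)" using br[OF L_zero L_zero] by simp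
  have sum: "finite I \<Longrightarrow> (\<And>i. i \<in> I \<Longrightarrow> u i \<in> L \<and> Q (u i)) \<Longrightarrow> (\<lambda>t. \<Sum>i\<in>I. u i t) \<in> L \<and> Q (\<lambda>t. \<Sum>i\<in>I. u i t)" for I :: "nat set" and u
  proof (induction I rule: finite_induct)
    case (insert i I)
    have 1: "u i \<in> L \<and> Q (u i)" by (rule insert.prems) simp
    have 2: "(\<lambda>t. \<Sum>i\<in>I. u i t) \<in> L \<and> Q (\<lambda>t. \<Sum>i\<in>I. u i t)" by (rule insert.IH) (rule insert.prems, simp)
    show ?case unfolding sum.insert[OF insert.hyps(1,2)] using 1 2 add L_add by blast
  qed (simp add: Q0 L_zero)
  have gen: "Av (\<lambda>t. H t *\<^sub>R x) \<in> L \<and> Q (Av (\<lambda>t. H t *\<^sub>R x))" if H: "trig l H" for H x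
  proof -
    have trH: "trig l (\<lambda>t. H t *\<^sub>R x)" for x :: 'a
      by (rule trig_mult[OF H trig_const])
    have "x \<in> span {br y z |y z. True}" using perfect by simp
    then have "Q (Av (\<lambda>t. H t *\<^sub>R x))"
    proof (induction rule: span_induct_alt)
      case base
      show ?case using Q0 by (simp add: Av_def linear_0[OF \<sigma>_pow_linear])
    next
      case (step c x x')
      obtain y0 z where "x = br y0 z" using step(1) by blast
      then have x: "c *\<^sub>R x = br (c *\<^sub>R y0) z" by (simp only: br_scale_left)
      define y where "y = c *\<^sub>R y0"
      note x = x[folded y_def]
      let ?c = "\<lambda>r t. cos (real r * t / real l)" and ?s = "\<lambda>r t. sin (real r * t / real l)"
      let ?T = "\<lambda>r t. br (Av (\<lambda>t. ((H t / real l) * ?c r t) *\<^sub>R y) t) (Av (\<lambda>t. ?c r t *\<^sub>R z) t)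
          + br (Av (\<lambda>t. ((H t / real l) * ?s r t) *\<^sub>R y) t) (Av (\<lambda>t. ?s r t *\<^sub>R z) t)"
      have \<sigma>b: "(\<sigma> ^^ j) (br y z) = br ((\<sigma> ^^ j) y) ((\<sigma> ^^ j) z)" for j
        by (induction j) (simp_all add: \<sigma>_br)
      have "Av (\<lambda>t. H t *\<^sub>R br y z) t = (\<Sum>r<l. ?T r t)" for t
        using bilinear_kernel[OF lin_br, of "\<lambda>t. H t / real l" t y z] l_pos
        by (simp add: Av_def linear_cmul[OF \<sigma>_pow_linear] \<sigma>b scaleR_sum_right)
      moreover have "(\<lambda>t. \<Sum>r<l. ?T r t) \<in> L \<and> Q (\<lambda>t. \<Sum>r<l. ?T r t)"
      proof (intro sum)
        fix r
        have tr: "trig l (\<lambda>t. ?c r t *\<^sub>R z)" "trig l (\<lambda>t. ?s r t *\<^sub>R z)"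
          "trig l (\<lambda>t. ((H t / real l) * ?c r t) *\<^sub>R y)" "trig l (\<lambda>t. ((H t / real l) * ?s r t) *\<^sub>R y)"
        proof -
          show "trig l (\<lambda>t. ?c r t *\<^sub>R z)" "trig l (\<lambda>t. ?s r t *\<^sub>R z)" by (rule trig.cos trig.sin)+
          have hl: "trig l (\<lambda>t. H t / real l)" using trig_scaleR[OF H, of "1 / real l"] by simp
          show "trig l (\<lambda>t. ((H t / real l) * ?c r t) *\<^sub>R y)" "trig l (\<lambda>t. ((H t / real l) * ?s r t) *\<^sub>R y)"
            unfolding scaleR_scaleR[symmetric] by (rule trig_mult[OF hl trig.cos] trig_mult[OF hl trig.sin])+
        qed
        show "?T r \<in> L \<and> Q (?T r)"
          using br[OF Av_in_L[OF tr(3)] Av_in_L[OF tr(1)]] br[OF Av_in_L[OF tr(4)] Av_in_L[OF tr(2)]]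
            L_bracket[OF Av_in_L[OF tr(3)] Av_in_L[OF tr(1)]] L_bracket[OF Av_in_L[OF tr(4)] Av_in_L[OF tr(2)]]
            add L_add by blast
      qed simp
      ultimately have "Q (Av (\<lambda>t. H t *\<^sub>R (c *\<^sub>R x)))" unfolding x by presburger
      then show ?case
        using add[OF Av_in_L[OF trH] Av_in_L[OF trH], of "c *\<^sub>R x" x'] step.IH
        by (simp only: scaleR_add_right Av_add)
    qed
    then show ?thesis using Av_in_L trH by blast
  qed
  have "u \<in> L \<and> Q u"
    by (rule L_induct[OF u, where Q = "\<lambda>u. u \<in> L \<and> Q u", OF gen]) (use L_add add in blast)+
  then show ?thesis by blast
qed

end

section \<open>Units among trigonometric polynomials\<close>

text \<open>With \<open>z = cis (t / l)\<close> a trigonometric polynomial is a Laurent polynomial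
  in \<open>z\<close>; the power \<open>N\<close> clears the negative exponents.\<close>

lemma trig_poly:
  fixes h :: "real \<Rightarrow> complex"
  assumes "trig l h"
  shows "\<exists>N p. \<forall>t. cis (t / real l) ^ N * h t = poly p (cis (t / real l))"
  using assms
proof induction
  have z: "cis (t / real l) ^ n = Complex (cos (real n * t / real l)) (sin (real n * t / real l))" for n t
    unfolding Complex.DeMoivre by (simp add: complex_eq_iff)
  {
    case (cos n a)
    have "cis (t / real l) ^ n * (cos (real n * t / real l) *\<^sub>R a)
      = poly (monom (a / 2) (n + n) + [:a / 2:]) (cis (t / real l))" for t
    proof -
      have "2 * (cis (t / real l) ^ n * of_real (cos (real n * t / real l))) = cis (t / real l) ^ n * cis (t / real l) ^ n + 1"
        unfolding z using sin_cos_squared_add3[of "real n * t / real l"] by (simp add: complex_eq_iff algebra_simps)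
      then have "2 * (cis (t / real l) ^ n * of_real (cos (real n * t / real l))) * (a / 2) = (cis (t / real l) ^ n * cis (t / real l) ^ n + 1) * (a / 2)"
        by (rule arg_cong)
      then show ?thesis by (simp add: poly_monom power_add scaleR_conv_of_real algebra_simps)
    qed
    then show ?case by blast
  next
    case (sin n a)
    have "cis (t / real l) ^ n * (sin (real n * t / real l) *\<^sub>R a)
      = poly (monom (a / (2 * \<i>)) (n + n) + [:- a / (2 * \<i>):]) (cis (t / real l))" for t
    proof -
      have "(2 * \<i>) * (cis (t / real l) ^ n * of_real (sin (real n * t / real l))) = cis (t / real l) ^ n * cis (t / real l) ^ n - 1"
        unfolding z using sin_cos_squared_add3[of "real n * t / real l"] by (simp add: complex_eq_iff algebra_simps)
      then have "(2 * \<i>) * (cis (t / real l) ^ n * of_real (sin (real n * t / real l))) * (a / (2 * \<i>)) = (cis (t / real l) ^ n * cis (t / real l) ^ n - 1) * (a / (2 * \<i>))"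
        by (rule arg_cong)
      then show ?thesis by (simp add: poly_monom power_add scaleR_conv_of_real algebra_simps)
    qed
    then show ?case by blast
  }
next
  case (add u v)
  then obtain N p M q where N: "\<And>t. cis (t / real l) ^ N * u t = poly p (cis (t / real l))"
    and M: "\<And>t. cis (t / real l) ^ M * v t = poly q (cis (t / real l))" by blast
  have "cis (t / real l) ^ (N + M) * (u t + v t) = poly (monom 1 M * p + monom 1 N * q) (cis (t / real l))" for t
    by (simp add: poly_monom power_add distrib_left N[symmetric] M[symmetric] algebra_simps)
  then show ?case by blast
qed

text \<open>Evaluation at zero shows from which of the two factors the variable can be
  cancelled.\<close>

lemma poly_dvd_monom:
  fixes p q :: "'k::field poly"
  assumes "p * q = monom 1 K"
  shows "\<exists>a k. p = monom a k"
  using assms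
proof (induction K arbitrary: p q)
  case 0
  then have "p dvd 1" by (metis dvd_triv_left monom_0 one_pCons)
  then obtain a where "p = [:a:]" using is_unit_polyE by metis
  then show ?case by (metis monom_0)
next
  case (Suc K)
  have "poly (p * q) 0 = 0" unfolding Suc.prems by (simp add: poly_monom)
  then consider "poly p 0 = 0" | "poly q 0 = 0" by auto
  then show ?case
  proof cases
    case 1
    then obtain p1 where p: "p = pCons 0 p1" by (metis pCons_cases poly_0_coeff_0 coeff_pCons_0)
    then have "p1 * q = monom 1 K" using Suc.prems by (simp add: monom_Suc)
    then obtain a k where "p1 = monom a k" using Suc.IH by blast
    then have "p = monom a (Suc k)" by (simp add: p monom_Suc)
    then show ?thesis by blast
  next
    case 2
    then obtain q1 where q: "q = pCons 0 q1" by (metis pCons_cases poly_0_coeff_0 coeff_pCons_0)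
    then have "p * q1 = monom 1 K" using Suc.prems by (simp add: monom_Suc)
    then show ?thesis using Suc.IH by blast
  qed
qed

lemma poly_zero_on_circle:
  assumes "\<And>t. poly p (cis t) = 0"
  shows "p = 0"
proof (rule ccontr)
  assume "p \<noteq> 0"
  then have "finite {z. poly p z = 0}" by (rule poly_roots_finite)
  moreover have "cis ` {0..1} \<subseteq> {z. poly p z = 0}" using assms by auto
  ultimately have f: "finite (cis ` {0..1})" by (rule rev_finite_subset)
  have "inj_on cis {0..1}"
  proof (rule inj_onI)
    fix x y :: real assume "x \<in> {0..1}" "y \<in> {0..1}" "cis x = cis y"
    then have "cos x = cos y" "0 \<le> x" "x \<le> pi" "0 \<le> y" "y \<le> pi"
      using pi_gt3 by (auto simp: complex_eq_iff)
    then show "x = y" using cos_inj_pi by blast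
  qed
  then have "finite {0..1::real}" using f finite_imageD by blast
  then show False by (simp add: infinite_Icc)
qed

text \<open>Clearing denominators turns the equation on the circle into an identity of polynomials,
  and factors of a monomial are monomials. These are the units among the Laurent
  polynomials.\<close>

lemma trig_unit:
  fixes h h' :: "real \<Rightarrow> complex"
  assumes l: "0 < l" and h: "trig l h" "trig l h'" and 1: "\<And>t. h t * h' t = 1"
  obtains a and m :: int where "a \<noteq> 0" "\<And>t. h t = a * cis (of_int m * t / real l)"
proof -
  let ?z = "\<lambda>t. cis (t / real l)"
  obtain N p where N: "\<And>t. ?z t ^ N * h t = poly p (?z t)" using trig_poly[OF h(1)] by blast
  obtain M q where M: "\<And>t. ?z t ^ M * h' t = poly q (?z t)" using trig_poly[OF h(2)] by blast
  have eq: "poly (p * q - monom 1 (N + M)) (?z t) = 0" for t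
  proof -
    have "poly (p * q) (?z t) = ?z t ^ (N + M) * (h t * h' t)"
      by (simp add: N[symmetric] M[symmetric] power_add mult_ac)
    then show ?thesis by (simp add: 1 poly_monom)
  qed
  have "p * q - monom 1 (N + M) = 0"
  proof (rule poly_zero_on_circle)
    fix t show "poly (p * q - monom 1 (N + M)) (cis t) = 0" using eq[of "t * real l"] l by simp
  qed
  then have "p * q = monom 1 (N + M)" by simp
  then obtain a k where p: "p = monom a k" using poly_dvd_monom by blast
  have ht: "h t = a * cis (of_int (int k - int N) * t / real l)" for t
  proof -
    have c: "cis (x / real l) ^ n = cis (real n * x / real l)" for x n
      unfolding Complex.DeMoivre by simp
    have "h t = poly p (?z t) / ?z t ^ N" unfolding N[symmetric] by simp
    also have "\<dots> = a * (?z t ^ k / ?z t ^ N)" by (simp add: p poly_monom)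
    also have "?z t ^ k / ?z t ^ N = cis (real k * t / real l - real N * t / real l)"
      unfolding c cis_divide ..
    also have "real k * t / real l - real N * t / real l = of_int (int k - int N) * t / real l"
      by (simp add: diff_divide_distrib left_diff_distrib)
    finally show ?thesis .
  qed
  moreover have "a \<noteq> 0" using 1[of 0] ht[of 0] by auto
  ultimately show ?thesis using that by blast
qed

lemma cis_frac_eq_1:
  assumes "0 < l" "cis (2 * pi * of_int m / real l) = 1"
  shows "int l dvd m"
proof -
  have "cos (2 * pi * of_int m / real l) = 1" using assms(2) by (simp add: complex_eq_iff)
  then obtain j :: int where "2 * pi * of_int m / real l = of_int j * 2 * pi" by (auto simp: cos_one_2pi_int)
  then have "real_of_int m = of_int (j * int l)" using assms(1) by (simp add: field_simps)
  then have "m = j * int l" using of_int_eq_iff by blast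
  then show ?thesis by simp
qed

text \<open>Both the real-valued case and the case of a conjugation twist are covered by the
  hypothesis \<open>F (t + 2 * pi) = cnj (F t)\<close>; it forces the frequency to be integral and the phase to be real.\<close>

lemma trig_circle_pair:
  fixes F G :: "real \<Rightarrow> complex"
  assumes l: "0 < l" and F: "trig l F" "\<And>t. F (t + 2 * pi) = cnj (F t)"
    and G: "trig l G" "\<And>t. G (t + 2 * pi) = cnj (G t)" and 1: "\<And>t. F t * F t + G t * G t = 1"
  obtains m :: int and c where "\<And>t. F t = of_real (cos (of_int m * t + c))" "\<And>t. G t = of_real (sin (of_int m * t + c))"
proof -
  have lin: "linear (\<lambda>z. \<i> * z)" by (simp add: linear_iff algebra_simps)
  have h: "trig l (\<lambda>t. F t + \<i> * G t)" "trig l (\<lambda>t. F t - \<i> * G t)"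
    by (rule trig.add[OF F(1) trig_linear[OF lin G(1)]] trig_diff[OF F(1) trig_linear[OF lin G(1)]])+
  have hh: "(F t + \<i> * G t) * (F t - \<i> * G t) = 1" for t
    using 1[of t] by (simp add: algebra_simps)
  obtain a k where a: "a \<noteq> 0" "\<And>t. F t + \<i> * G t = a * cis (of_int k * t / real l)"
    using trig_unit[OF l h hh] by blast
  have inv: "F t - \<i> * G t = inverse a * cis (- (of_int k * t / real l))" for t
  proof -
    have "F t - \<i> * G t = inverse (F t + \<i> * G t)" using hh[of t] by (simp add: inverse_unique)
    then show ?thesis by (simp add: a(2) cis_inverse)
  qed
  \<comment> \<open>The twist at \<open>t = 0\<close> compares the unit with the conjugate of its
    inverse. The modulus of the result gives \<open>cmod a = 1\<close>, its argument that
    \<open>l\<close> divides \<open>k\<close>.\<close>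
  have "a * cis (of_int k * (0 + 2 * pi) / real l) = F (0 + 2 * pi) + \<i> * G (0 + 2 * pi)" by (simp only: a(2))
  also have "\<dots> = cnj (F 0 - \<i> * G 0)" unfolding F(2) G(2) by simp
  also have "\<dots> = inverse (cnj a)" unfolding inv by simp
  finally have "a * cnj a * cis (2 * pi * of_int k / real l) = 1"
    using a(1) by (simp add: field_simps)
  then have e: "of_real ((cmod a)\<^sup>2) * cis (2 * pi * of_int k / real l) = 1"
    by (simp add: complex_norm_square[symmetric])
  then have "(cmod a)\<^sup>2 = 1" by (metis norm_mult norm_cis mult.right_neutral norm_one norm_of_real abs_power2)
  then have na: "cmod a = 1" and "cis (2 * pi * of_int k / real l) = 1"
    using e norm_ge_zero[of a] by (auto simp: power2_eq_1_iff simp del: norm_ge_zero)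
  then obtain m where m: "k = int l * m" using cis_frac_eq_1[OF l] by blast
  obtain c where c: "a = cis c" using na by (metis cis_Arg norm_zero zero_neq_one rcis_cmod_Arg rcis_def mult_1 of_real_1)
  have km: "of_int k * t / real l = of_int m * t" for t using l by (simp add: m)
  have p: "F t + \<i> * G t = cis (of_int m * t + c)" for t
    unfolding a(2) km c by (simp add: cis_mult add.commute)
  have n: "F t - \<i> * G t = cis (- (of_int m * t + c))" for t
    unfolding inv km c by (simp add: cis_inverse cis_mult algebra_simps)
  have cs: "cis x + cis (- x) = 2 * of_real (cos x)" "cis x - cis (- x) = 2 * (\<i> * of_real (sin x))" for x
    by (simp_all add: complex_eq_iff)
  have "F t = of_real (cos (of_int m * t + c))" for t
  proof -
    have "2 * F t = cis (of_int m * t + c) + cis (- (of_int m * t + c))"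
      unfolding p[of t, symmetric] n[of t, symmetric] by simp
    also have "\<dots> = 2 * of_real (cos (of_int m * t + c))" by (rule cs)
    finally show ?thesis by simp
  qed
  moreover have "G t = of_real (sin (of_int m * t + c))" for t
  proof -
    have "2 * (\<i> * G t) = cis (of_int m * t + c) - cis (- (of_int m * t + c))"
      unfolding p[of t, symmetric] n[of t, symmetric] by simp
    also have "\<dots> = 2 * (\<i> * of_real (sin (of_int m * t + c)))" by (rule cs)
    finally show ?thesis by simp
  qed
  ultimately show ?thesis using that by blast
qed

text \<open>The second derivatives at zero give \<open>M * M * cos c = 1\<close>, the values at zero
  give \<open>cos c = 1\<close>.\<close>

lemma frequency_pm1:
  assumes "\<And>t::real. cos (of_int M * t + c) = cos t"
  shows "\<bar>M\<bar> = (1::int)"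
proof -
  have "((\<lambda>t. - (of_int M * of_int M) * cos (of_int M * t + c)) ) = (\<lambda>t. - cos t)"
  proof -
    have 1: "((\<lambda>t. cos (of_int M * t + c)) has_real_derivative - of_int M * sin (of_int M * t + c)) (at t)" for t
      by (auto intro!: derivative_eq_intros)
    have f: "(\<lambda>t. - of_int M * sin (of_int M * t + c)) = (\<lambda>t. - sin t)"
    proof
      fix t
      show "- of_int M * sin (of_int M * t + c) = - sin t"
        using DERIV_unique[OF 1[of t, unfolded assms] DERIV_cos[of t]] .
    qed
    have 2: "((\<lambda>t. - of_int M * sin (of_int M * t + c)) has_real_derivative - (of_int M * of_int M) * cos (of_int M * t + c)) (at t)" for t
      by (auto intro!: derivative_eq_intros)
    have 3: "((\<lambda>t. - sin t) has_real_derivative - cos t) (at t)" for t :: real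
      by (auto intro!: derivative_eq_intros)
    show ?thesis
    proof
      fix t
      show "- (of_int M * of_int M) * cos (of_int M * t + c) = - cos t"
        using DERIV_unique[OF 2[of t, unfolded f] 3[of t]] .
    qed
  qed
  from fun_cong[OF this, of 0] have "of_int M * of_int M * cos c = (1::real)" by simp
  moreover have "cos c = 1" using assms[of 0] by simp
  ultimately have "real_of_int (M * M) = of_int 1" by simp
  then have "M * M = 1" by (simp only: of_int_eq_iff)
  then show ?thesis using zmult_eq_1_iff by auto
qed

section \<open>Integrals over a period\<close>

lemma trig_antiderivative:
  fixes u :: "real \<Rightarrow> 'v::real_normed_vector"
  assumes "trig l u" "0 < l"
  shows "\<exists>Q. \<forall>t. (Q has_vector_derivative u t) (at t)"
  using assms(1)
proof induction
  {
    case (cos n a)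
    show ?case
    proof (cases "n = 0")
      case True
      then show ?thesis by (intro exI[of _ "\<lambda>t. t *\<^sub>R a"]) (auto intro!: derivative_eq_intros)
    next
      case False
      have "((\<lambda>t. sin (c * t) *\<^sub>R (a /\<^sub>R c)) has_vector_derivative cos (c * t) *\<^sub>R a) (at t)" if "c \<noteq> 0" for c t
        using that by (auto intro!: derivative_eq_intros simp: mult.commute)
      from this[of "real n / real l"] show ?thesis using False assms(2) by auto
    qed
  next
    case (sin n a)
    show ?case
    proof (cases "n = 0")
      case True
      then show ?thesis by (intro exI[of _ "\<lambda>t. 0"]) simp
    next
      case False
      have "((\<lambda>t. cos (c * t) *\<^sub>R (- a /\<^sub>R c)) has_vector_derivative sin (c * t) *\<^sub>R a) (at t)" if "c \<noteq> 0" for c t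
        using that by (auto intro!: derivative_eq_intros simp: mult.commute)
      from this[of "real n / real l"] show ?thesis using False assms(2) by auto
    qed
  }
next
  case (add u v)
  then obtain P Q where "\<And>t. (P has_vector_derivative u t) (at t)" "\<And>t. (Q has_vector_derivative v t) (at t)" by blast
  then show ?case by (intro exI[of _ "\<lambda>t. P t + Q t"]) (auto intro: has_vector_derivative_add)
qed

text \<open>An antiderivative grows by the same amount over every interval of length
  \<open>2 * pi\<close>; for \<open>e = -1\<close> the factor \<open>e\<close> corrects the
  orientation.\<close>

lemma integral_periodic_affine:
  fixes K :: "real \<Rightarrow> real"
  assumes K: "trig l K" "0 < l" "\<And>t. K (t + 2 * pi) = K t" and e: "e = 1 \<or> e = -1"
  shows "integral {0..2 * pi} (\<lambda>t. K (e * t + c)) = integral {0..2 * pi} K"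
proof -
  obtain Q where Q: "\<And>t. (Q has_real_derivative K t) (at t)"
    using trig_antiderivative[OF K(1,2)] unfolding has_real_derivative_iff_has_vector_derivative by blast
  have "((\<lambda>t. Q (t + 2 * pi) - Q t) has_real_derivative 0) (at t)" for t
  proof -
    have "((\<lambda>t. Q (t + 2 * pi)) has_real_derivative K (t + 2 * pi)) (at t)"
      using DERIV_shift Q by blast
    from DERIV_diff[OF this Q[of t]] show ?thesis using K(3) by simp
  qed
  then have const: "Q (x + 2 * pi) - Q x = Q (y + 2 * pi) - Q y" for x y
    using DERIV_isconst_all by blast
  have int: "integral {0..2 * pi} (\<lambda>t. K (e * t + c)) = e * Q (e * (2 * pi) + c) - e * Q (e * 0 + c)" if "e = 1 \<or> e = -1" for e c
  proof (rule integral_unique, rule fundamental_theorem_of_calculus)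
    fix x
    have "((\<lambda>t. e * t + c) has_real_derivative e) (at x)" by (auto intro!: derivative_eq_intros)
    then have "((\<lambda>t. Q (e * t + c)) has_real_derivative K (e * x + c) * e) (at x)"
      using DERIV_chain2[OF Q] by blast
    then have "((\<lambda>t. e * Q (e * t + c)) has_real_derivative e * (K (e * x + c) * e)) (at x)"
      by (rule DERIV_cmult)
    moreover have "e * (K (e * x + c) * e) = K (e * x + c)" using that by auto
    ultimately show "((\<lambda>t. e * Q (e * t + c)) has_vector_derivative K (e * x + c)) (at x within {0..2 * pi})"
      by (metis has_real_derivative_iff_has_vector_derivative has_vector_derivative_at_within)
  qed simp
  show ?thesis
    using e int[of 1 0] int[OF e, of c] const[of 0 c] const[of 0 "c - 2 * pi"] by (auto simp: add.commute)
qed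

section \<open>Pointwise families and the centroid\<close>

context loop_alg
begin

text \<open>With \<open>u\<close> as in \<open>L_divides\<close>, the hypotheses replace the
  multipliers \<open>cos t\<close> and \<open>sin t\<close> by their values at
  \<open>\<tau>\<close>, and the coefficients of \<open>G v t\<close> and \<open>G w t\<close>
  become \<open>1 - cos^2 - sin^2\<close> and zero. The point \<open>\<tau>\<close> may differ from
  \<open>t\<close>, which admits a change of parameter.\<close>

lemma vanish_criterion:
  assumes add: "\<And>u v. u \<in> L \<Longrightarrow> v \<in> L \<Longrightarrow> G (\<lambda>t. u t + v t) = (\<lambda>t. G u t + (G v t :: 'b::real_vector))"
    and scale: "\<And>c u. u \<in> L \<Longrightarrow> G (\<lambda>t. c *\<^sub>R u t) = (\<lambda>t. c *\<^sub>R G u t)"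
    and cs: "\<And>u. u \<in> L \<Longrightarrow> G (\<lambda>t. cos t *\<^sub>R u t) t = cos \<tau> *\<^sub>R G u t"
    and sn: "\<And>u. u \<in> L \<Longrightarrow> G (\<lambda>t. sin t *\<^sub>R u t) t = sin \<tau> *\<^sub>R G u t"
    and u: "u \<in> L" "u \<tau> = 0"
  shows "G u t = 0"
proof -
  obtain v w where vw: "v \<in> L" "w \<in> L" and ue: "u = (\<lambda>t. (1 - cos (t - \<tau>)) *\<^sub>R v t + sin (t - \<tau>) *\<^sub>R w t)"
    using L_divides[OF u] by blast
  note cl = L_cos[of _ 0, simplified] L_sin[of _ 0, simplified]
  have "u = (\<lambda>t. v t + ((- cos \<tau>) *\<^sub>R (cos t *\<^sub>R v t) + ((- sin \<tau>) *\<^sub>R (sin t *\<^sub>R v t)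
      + (cos \<tau> *\<^sub>R (sin t *\<^sub>R w t) + (- sin \<tau>) *\<^sub>R (cos t *\<^sub>R w t)))))"
    unfolding ue by (rule ext) (simp add: cos_diff sin_diff algebra_simps)
  then have "G u t = G v t + ((- cos \<tau>) *\<^sub>R G (\<lambda>t. cos t *\<^sub>R v t) t + ((- sin \<tau>) *\<^sub>R G (\<lambda>t. sin t *\<^sub>R v t) t
      + (cos \<tau> *\<^sub>R G (\<lambda>t. sin t *\<^sub>R w t) t + (- sin \<tau>) *\<^sub>R G (\<lambda>t. cos t *\<^sub>R w t) t)))"
    by (simp only: add scale L_add L_scale cl vw)
  also have "\<dots> = (1 - (cos \<tau> * cos \<tau> + sin \<tau> * sin \<tau>)) *\<^sub>R G v t"
    by (simp only: cs sn vw) (simp add: algebra_simps, simp flip: scaleR_add_left)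
  also have "\<dots> = 0" by simp
  finally show ?thesis .
qed

lemma sec_sub:
  assumes "u \<in> L"
  shows "(\<lambda>t. u t - sec \<tau> (u \<tau>) t) \<in> L" "u \<tau> - sec \<tau> (u \<tau>) \<tau> = 0"
  by (simp_all add: L_diff sec_in_L assms sec_eval)

text \<open>The fibre map is \<open>F t x = A (sec t x) t\<close>. The section
  \<open>sec t x\<close> itself moves with \<open>t\<close>, which hides the trigonometric
  dependence; a constant \<open>x\<close> is therefore rewritten by means of fixed loops in
  \<open>L\<close>.\<close>

lemma pointwise_family:
  assumes A: "\<And>u. u \<in> L \<Longrightarrow> A u \<in> L"
    and add: "\<And>u v. u \<in> L \<Longrightarrow> v \<in> L \<Longrightarrow> A (\<lambda>t. u t + v t) = (\<lambda>t. A u t + A v t)"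
    and scale: "\<And>c u. u \<in> L \<Longrightarrow> A (\<lambda>t. c *\<^sub>R u t) = (\<lambda>t. c *\<^sub>R A u t)"
    and van: "\<And>u t. u \<in> L \<Longrightarrow> u t = 0 \<Longrightarrow> A u t = 0"
  obtains F where "\<And>u t. u \<in> L \<Longrightarrow> A u t = F t (u t)" "\<And>t. linear (F t)"
    "\<And>t x. F (t + 2 * pi) (\<sigma> x) = \<sigma> (F t x)" "\<And>x. trig l (\<lambda>t. F t x)"
proof -
  define F where "F t x = A (sec t x) t" for t x
  have AF: "A u t = F t (u t)" if u: "u \<in> L" for u t
  proof -
    have "u = (\<lambda>s. sec t (u t) s + (u s - sec t (u t) s))" by simp
    then have "A u t = A (sec t (u t)) t + A (\<lambda>s. u s - sec t (u t) s) t"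
      using add[OF sec_in_L sec_sub(1)[OF u]] by metis
    also have "A (\<lambda>s. u s - sec t (u t) s) t = 0"
      by (rule van[OF sec_sub(1)[OF u] sec_sub(2)[OF u]])
    finally show ?thesis by (simp add: F_def)
  qed
  have lin: "linear (F t)" for t
    by (simp add: linear_iff F_def sec_add sec_scale add scale sec_in_L)
  have tw: "F (t + 2 * pi) (\<sigma> x) = \<sigma> (F t x)" for t x
  proof -
    have "\<sigma> (F t x) = A (sec t x) (t + 2 * pi)"
      unfolding F_def by (simp add: L_twist[OF A[OF sec_in_L]])
    also have "\<dots> = F (t + 2 * pi) (sec t x (t + 2 * pi))" by (rule AF[OF sec_in_L])
    also have "sec t x (t + 2 * pi) = \<sigma> x" by (simp add: L_twist[OF sec_in_L] sec_eval)
    finally show ?thesis by simp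
  qed
  have tr: "trig l (\<lambda>t. F t x)" for x
  proof -
    let ?c = "\<lambda>r t. cos (real r * t / real l)" and ?s = "\<lambda>r t. sin (real r * t / real l)"
    let ?C = "\<lambda>r. Av (\<lambda>t. ?c r t *\<^sub>R x)" and ?S = "\<lambda>r. Av (\<lambda>t. ?s r t *\<^sub>R x)"
    have inL: "?C r \<in> L" "?S r \<in> L" for r by (rule Av_in_L[OF trig.cos] Av_in_L[OF trig.sin])+
    \<comment> \<open>The constant \<open>x\<close> need not be a twisted loop, but \<open>l\<close>
      times it is a combination of averages with trigonometric coefficients. Under
      \<open>F t\<close> the coefficients come out and \<open>A\<close> is applied to loops that do
      not depend on \<open>t\<close>.\<close>
    have "(\<Sum>r<l. ?c r t *\<^sub>R ?C r t + ?s r t *\<^sub>R ?S r t) = real l *\<^sub>R x" for t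
    proof -
      have "(\<Sum>r<l. ?c r t *\<^sub>R ?C r t + ?s r t *\<^sub>R ?S r t) = (\<Sum>r<l. \<Sum>k<l.
        (?c r (t - 2 * pi * real 0) * ?c r (t - 2 * pi * real k) + ?s r (t - 2 * pi * real 0) * ?s r (t - 2 * pi * real k)) *\<^sub>R (\<sigma> ^^ k) x)"
        by (simp add: Av_def linear_cmul[OF \<sigma>_pow_linear] scaleR_sum_right scaleR_add_left sum.distrib)
      also have "\<dots> = (\<Sum>k<l. (if 0 = k then real l else 0) *\<^sub>R (\<sigma> ^^ k) x)"
        by (subst sum.swap) (intro sum.cong refl, simp only: scaleR_sum_left[symmetric], subst kernel, use l_pos in auto)
      also have "\<dots> = (\<Sum>k<l. if 0 = k then real l *\<^sub>R (\<sigma> ^^ k) x else 0)"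
        by (intro sum.cong refl) simp
      also have "\<dots> = real l *\<^sub>R x" using l_pos by (simp add: sum.delta')
      finally show ?thesis .
    qed
    then have "F t (real l *\<^sub>R x) = F t (\<Sum>r<l. ?c r t *\<^sub>R ?C r t + ?s r t *\<^sub>R ?S r t)" for t
      by (simp only:)
    then have lx: "real l *\<^sub>R F t x = (\<Sum>r<l. ?c r t *\<^sub>R A (?C r) t + ?s r t *\<^sub>R A (?S r) t)" for t
      by (simp add: linear_sum[OF lin] linear_add[OF lin] linear_cmul[OF lin] AF[OF inL(1)] AF[OF inL(2)])
    have e: "F t x = (1 / real l) *\<^sub>R (\<Sum>r<l. ?c r t *\<^sub>R A (?C r) t + ?s r t *\<^sub>R A (?S r) t)" for t
      unfolding lx[symmetric] using l_pos by simp
    have tr2: "trig l (?c r)" "trig l (?s r)" for r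
      using trig.cos[of l r "1::real"] trig.sin[of l r "1::real"] by simp_all
    have "trig l (\<lambda>t. ?c r t *\<^sub>R A (?C r) t + ?s r t *\<^sub>R A (?S r) t)" for r
      by (rule trig.add[OF trig_mult[OF tr2(1) L_trig[OF A[OF inL(1)]]] trig_mult[OF tr2(2) L_trig[OF A[OF inL(2)]]]])
    then show ?thesis unfolding e by (rule trig_scaleR[OF trig_sum])
  qed
  show ?thesis using that AF lin tw tr by blast
qed

definition loop_centroid :: "((real \<Rightarrow> 'a) \<Rightarrow> (real \<Rightarrow> 'a)) \<Rightarrow> bool" where
  "loop_centroid T \<longleftrightarrow> (\<forall>u\<in>L. T u \<in> L) \<and> (\<forall>u\<in>L. \<forall>v\<in>L. T (\<lambda>t. u t + v t) = (\<lambda>t. T u t + T v t))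
    \<and> (\<forall>c. \<forall>u\<in>L. T (\<lambda>t. c *\<^sub>R u t) = (\<lambda>t. c *\<^sub>R T u t))
    \<and> (\<forall>u\<in>L. \<forall>v\<in>L. T (\<lambda>t. br (u t) (v t)) = (\<lambda>t. br (T u t) (v t)))"

text \<open>If \<open>u t = 0\<close>, then
  \<open>br y (T u t) = br (T (sec t y) t) (u t) = 0\<close> for every \<open>y\<close>. So
  \<open>T u t\<close> is central and vanishes, which makes \<open>T\<close> a pointwise
  family.\<close>

lemma loop_centroid_pointwise:
  assumes "loop_centroid T"
  obtains F where "\<And>u t. u \<in> L \<Longrightarrow> T u t = F t (u t)" "\<And>t. F t \<in> centroid"
    "\<And>t x. F (t + 2 * pi) (\<sigma> x) = \<sigma> (F t x)" "\<And>x. trig l (\<lambda>t. F t x)"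
proof -
  have T: "\<And>u. u \<in> L \<Longrightarrow> T u \<in> L" "\<And>u v. u \<in> L \<Longrightarrow> v \<in> L \<Longrightarrow> T (\<lambda>t. u t + v t) = (\<lambda>t. T u t + T v t)"
    "\<And>c u. u \<in> L \<Longrightarrow> T (\<lambda>t. c *\<^sub>R u t) = (\<lambda>t. c *\<^sub>R T u t)"
    "\<And>u v. u \<in> L \<Longrightarrow> v \<in> L \<Longrightarrow> T (\<lambda>t. br (u t) (v t)) = (\<lambda>t. br (T u t) (v t))"
    using assms by (auto simp: loop_centroid_def)
  have Tr: "T (\<lambda>t. br (u t) (v t)) = (\<lambda>t. br (u t) (T v t))" if "u \<in> L" "v \<in> L" for u v
  proof -
    have "(\<lambda>t. br (u t) (v t)) = (\<lambda>t. (-1) *\<^sub>R br (v t) (u t))"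
      by (rule ext) (simp add: br_swap[of "u _"])
    then have "T (\<lambda>t. br (u t) (v t)) = (\<lambda>t. (-1) *\<^sub>R br (T v t) (u t))"
      using T(3)[OF L_bracket[OF that(2,1)], of "-1"] T(4)[OF that(2,1)] by simp
    also have "\<dots> = (\<lambda>t. br (u t) (T v t))"
      by (rule ext) (simp add: br_swap[of "u _"])
    finally show ?thesis .
  qed
  have van: "T u t = 0" if u: "u \<in> L" "u t = 0" for u t
  proof (rule center_trivial)
    fix y
    have "br (sec t y t) (T u t) = br (T (sec t y) t) (u t)"
      using T(4)[OF sec_in_L u(1)] Tr[OF sec_in_L u(1)] by metis
    then show "br y (T u t) = 0" by (simp add: sec_eval u(2) br.zero)
  qed
  obtain F where F: "\<And>u t. u \<in> L \<Longrightarrow> T u t = F t (u t)" "\<And>t. linear (F t)"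
    "\<And>t x. F (t + 2 * pi) (\<sigma> x) = \<sigma> (F t x)" "\<And>x. trig l (\<lambda>t. F t x)"
    using pointwise_family[of T, OF T(1-3) van] by blast
  have "F t \<in> centroid" for t
    unfolding centroid_def
  proof (intro CollectI conjI allI)
    show "Vector_Spaces.linear scaleR scaleR (F t)" using F(2)[of t] by (simp add: linear_def)
    fix x y
    have "F t (br (sec t x t) (sec t y t)) = br (F t (sec t x t)) (sec t y t)"
      using fun_cong[OF T(4)[OF sec_in_L sec_in_L, of t x t y], of t]
      by (simp add: F(1)[OF L_bracket[OF sec_in_L sec_in_L]] F(1)[OF sec_in_L])
    then show "F t (br x y) = br (F t x) y" by (simp add: sec_eval)
  qed
  then show ?thesis using that F by blast
qed

end

section \<open>Isomorphisms of twisted loop algebras\<close>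

locale loop_iso = A: loop_alg br \<sigma> l + B: loop_alg br' \<sigma>' l'
  for br :: "'a::real_normed_vector \<Rightarrow> 'a \<Rightarrow> 'a" and \<sigma> l
    and br' :: "'b::real_normed_vector \<Rightarrow> 'b \<Rightarrow> 'b" and \<sigma>' l' +
  fixes \<phi> :: "(real \<Rightarrow> 'a) \<Rightarrow> (real \<Rightarrow> 'b)"
  assumes bij: "bij_betw \<phi> A.L B.L"
    and add: "u \<in> A.L \<Longrightarrow> v \<in> A.L \<Longrightarrow> \<phi> (\<lambda>t. u t + v t) = (\<lambda>t. \<phi> u t + \<phi> v t)"
    and scale: "u \<in> A.L \<Longrightarrow> \<phi> (\<lambda>t. c *\<^sub>R u t) = (\<lambda>t. c *\<^sub>R \<phi> u t)"
    and bracket: "u \<in> A.L \<Longrightarrow> v \<in> A.L \<Longrightarrow> \<phi> (\<lambda>t. br (u t) (v t)) = (\<lambda>t. br' (\<phi> u t) (\<phi> v t))"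
begin

definition \<psi> :: "(real \<Rightarrow> 'b) \<Rightarrow> (real \<Rightarrow> 'a)" where "\<psi> = inv_into A.L \<phi>"

lemma \<phi>_in: "u \<in> A.L \<Longrightarrow> \<phi> u \<in> B.L" using bij bij_betwE by blast
lemma \<psi>_in: "v \<in> B.L \<Longrightarrow> \<psi> v \<in> A.L" unfolding \<psi>_def by (metis bij bij_betw_def inv_into_into)
lemma \<psi>\<phi>: "u \<in> A.L \<Longrightarrow> \<psi> (\<phi> u) = u" unfolding \<psi>_def using bij bij_betw_inv_into_left by metis
lemma \<phi>\<psi>: "v \<in> B.L \<Longrightarrow> \<phi> (\<psi> v) = v" unfolding \<psi>_def using bij bij_betw_inv_into_right by metis

lemma \<psi>_add: "u \<in> B.L \<Longrightarrow> v \<in> B.L \<Longrightarrow> \<psi> (\<lambda>t. u t + v t) = (\<lambda>t. \<psi> u t + \<psi> v t)"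
  using \<psi>\<phi>[OF A.L_add[OF \<psi>_in \<psi>_in]] by (simp add: add \<psi>_in \<phi>\<psi>)

lemma \<psi>_scale: "u \<in> B.L \<Longrightarrow> \<psi> (\<lambda>t. c *\<^sub>R u t) = (\<lambda>t. c *\<^sub>R \<psi> u t)"
  using \<psi>\<phi>[OF A.L_scale[OF \<psi>_in]] by (simp add: scale \<psi>_in \<phi>\<psi>)

lemma \<psi>_bracket: "u \<in> B.L \<Longrightarrow> v \<in> B.L \<Longrightarrow> \<psi> (\<lambda>t. br' (u t) (v t)) = (\<lambda>t. br (\<psi> u t) (\<psi> v t))"
  using \<psi>\<phi>[OF A.L_bracket[OF \<psi>_in \<psi>_in]] by (simp add: bracket \<psi>_in \<phi>\<psi>)

lemma inverse: "loop_iso br' \<sigma>' l' br \<sigma> l \<psi>"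
proof unfold_locales
  show "bij_betw \<psi> B.L A.L" unfolding \<psi>_def by (rule bij_betw_inv_into[OF bij])
qed (rule \<psi>_add \<psi>_scale \<psi>_bracket; assumption)+

lemma transport_centroid:
  assumes "A.loop_centroid T"
  shows "B.loop_centroid (\<lambda>v. \<phi> (T (\<psi> v)))"
proof -
  have T: "\<And>u. u \<in> A.L \<Longrightarrow> T u \<in> A.L" "\<And>u v. u \<in> A.L \<Longrightarrow> v \<in> A.L \<Longrightarrow> T (\<lambda>t. u t + v t) = (\<lambda>t. T u t + T v t)"
    "\<And>c u. u \<in> A.L \<Longrightarrow> T (\<lambda>t. c *\<^sub>R u t) = (\<lambda>t. c *\<^sub>R T u t)"
    "\<And>u v. u \<in> A.L \<Longrightarrow> v \<in> A.L \<Longrightarrow> T (\<lambda>t. br (u t) (v t)) = (\<lambda>t. br (T u t) (v t))"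
    using assms by (auto simp: A.loop_centroid_def)
  show ?thesis
    unfolding B.loop_centroid_def
    by (simp add: \<psi>_in \<psi>_add \<psi>_scale \<psi>_bracket T \<phi>_in add scale bracket \<phi>\<psi>)
qed

end

section \<open>Isomorphisms compatible with a reparametrization of the circle\<close>

lemma trig_deriv_bilinear:
  fixes f :: "'v::real_normed_vector \<Rightarrow> 'v \<Rightarrow> 'w::real_normed_vector"
  assumes f: "\<And>x. linear (f x)" "\<And>y. linear (\<lambda>x. f x y)" and u: "trig l u" and v: "trig l v"
  shows "((\<lambda>t. f (u t) (v t)) has_vector_derivative f (deriv_loop u t) (v t) + f (u t) (deriv_loop v t)) (at t)"
proof -
  have dv: "((\<lambda>s. f a (v s)) has_vector_derivative f a (deriv_loop v t)) (at t)" for a t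
    by (rule trig_deriv_linear[OF f(1) v])
  have fl: "f (r *\<^sub>R x) y = r *\<^sub>R f x y" "f (x + x') y = f x y + f x' y" "f (- x) y = - f x y" for r x x' y
    using linear_cmul[OF f(2)] linear_add[OF f(2)] linear_neg[OF f(2)] by auto
  have prod: "((\<lambda>t. p t *\<^sub>R w t) has_vector_derivative p t *\<^sub>R w' + p' *\<^sub>R w t) (at t)"
    if "(p has_real_derivative p') (at t)" "(w has_vector_derivative w') (at t)" for p p' t and w :: "real \<Rightarrow> 'w" and w'
    using has_vector_derivative_scaleR[OF that] .
  have prodv: "((\<lambda>t. p t *\<^sub>R a) has_vector_derivative p' *\<^sub>R a) (at t)"
    if "(p has_real_derivative p') (at t)" for p p' t and a :: 'v
    using has_vector_derivative_scaleR[OF that has_vector_derivative_const[of a "at t"]] by simp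
  have "\<exists>u'. \<forall>t. (u has_vector_derivative u' t) (at t)
      \<and> ((\<lambda>t. f (u t) (v t)) has_vector_derivative f (u' t) (v t) + f (u t) (deriv_loop v t)) (at t)"
    using u
  proof induction
    have dc: "((\<lambda>t. cos (k * t)) has_real_derivative - (k * sin (k * t))) (at t)"
      "((\<lambda>t. sin (k * t)) has_real_derivative k * cos (k * t)) (at t)" for k t :: real
      by (auto intro!: derivative_eq_intros)
    {
      case (cos n a)
      let ?k = "real n / real l"
      note d = dc(1)[of ?k]
      have "((\<lambda>t. cos (?k * t) *\<^sub>R a) has_vector_derivative (- (?k * sin (?k * t))) *\<^sub>R a) (at t)" for t
        by (rule prodv[OF d])
      moreover have "((\<lambda>t. cos (?k * t) *\<^sub>R f a (v t)) has_vector_derivative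
        (- (?k * sin (?k * t))) *\<^sub>R f a (v t) + cos (?k * t) *\<^sub>R f a (deriv_loop v t)) (at t)" for t
        using prod[OF d dv[of a t]] by (simp add: add.commute)
      ultimately show ?case
        by (intro exI[of _ "\<lambda>t. (- (?k * sin (?k * t))) *\<^sub>R a"]) (simp add: fl)
    next
      case (sin n a)
      let ?k = "real n / real l"
      note d = dc(2)[of ?k]
      have "((\<lambda>t. sin (?k * t) *\<^sub>R a) has_vector_derivative (?k * cos (?k * t)) *\<^sub>R a) (at t)" for t
        by (rule prodv[OF d])
      moreover have "((\<lambda>t. sin (?k * t) *\<^sub>R f a (v t)) has_vector_derivative
        (?k * cos (?k * t)) *\<^sub>R f a (v t) + sin (?k * t) *\<^sub>R f a (deriv_loop v t)) (at t)" for t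
        using prod[OF d dv[of a t]] by (simp add: add.commute)
      ultimately show ?case
        by (intro exI[of _ "\<lambda>t. (?k * cos (?k * t)) *\<^sub>R a"]) (simp add: fl)
    }
  next
    case (add u w)
    then obtain u' w' where
      u': "\<And>t. (u has_vector_derivative u' t) (at t)" "\<And>t. ((\<lambda>t. f (u t) (v t)) has_vector_derivative f (u' t) (v t) + f (u t) (deriv_loop v t)) (at t)" and
      w': "\<And>t. (w has_vector_derivative w' t) (at t)" "\<And>t. ((\<lambda>t. f (w t) (v t)) has_vector_derivative f (w' t) (v t) + f (w t) (deriv_loop v t)) (at t)"
      by blast
    have "((\<lambda>t. u t + w t) has_vector_derivative u' t + w' t) (at t)"
      "((\<lambda>t. f (u t + w t) (v t)) has_vector_derivative f (u' t + w' t) (v t) + f (u t + w t) (deriv_loop v t)) (at t)" for t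
      using has_vector_derivative_add[OF u'(1) w'(1)] has_vector_derivative_add[OF u'(2) w'(2), of t]
      by (simp_all add: fl algebra_simps)
    then show ?case by (intro exI[of _ "\<lambda>t. u' t + w' t"]) simp
  qed
  then obtain u' where u': "\<And>t. (u has_vector_derivative u' t) (at t)"
      "\<And>t. ((\<lambda>t. f (u t) (v t)) has_vector_derivative f (u' t) (v t) + f (u t) (deriv_loop v t)) (at t)" by blast
  then have "deriv_loop u = u'" by (auto simp: deriv_loop_def intro: vector_derivative_at)
  then show ?thesis using u' by simp
qed

context loop_alg
begin

lemma deriv_add: "u \<in> L \<Longrightarrow> v \<in> L \<Longrightarrow> deriv_loop (\<lambda>t. u t + v t) = (\<lambda>t. deriv_loop u t + deriv_loop v t)"
  unfolding deriv_loop_def[of "\<lambda>t. u t + v t"]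
  by (intro ext vector_derivative_at has_vector_derivative_add L_has_deriv)

lemma deriv_mult:
  assumes "u \<in> L" "\<And>t. (p has_real_derivative p' t) (at t)"
  shows "deriv_loop (\<lambda>t. p t *\<^sub>R u t) = (\<lambda>t. p t *\<^sub>R deriv_loop u t + p' t *\<^sub>R u t)"
  unfolding deriv_loop_def[of "\<lambda>t. p t *\<^sub>R u t"]
  by (intro ext vector_derivative_at has_vector_derivative_scaleR assms L_has_deriv)

lemma deriv_scale: "u \<in> L \<Longrightarrow> deriv_loop (\<lambda>t. c *\<^sub>R u t) = (\<lambda>t. c *\<^sub>R deriv_loop u t)"
  using deriv_mult[of u "\<lambda>t. c" "\<lambda>t. 0"] by simp

lemma deriv_bracket:
  "u \<in> L \<Longrightarrow> v \<in> L \<Longrightarrow> deriv_loop (\<lambda>t. br (u t) (v t)) = (\<lambda>t. br (deriv_loop u t) (v t) + br (u t) (deriv_loop v t))"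
  unfolding deriv_loop_def[of "\<lambda>t. br (u t) (v t)"]
  by (intro ext vector_derivative_at trig_deriv_bilinear[OF lin_br L_trig L_trig])

lemma L_cos_affine:
  assumes "e = 1 \<or> e = -1" "u \<in> L"
  shows "(\<lambda>t. cos (e * t + c) *\<^sub>R u t) \<in> L" "(\<lambda>t. sin (e * t + c) *\<^sub>R u t) \<in> L"
proof -
  have "(\<lambda>t. cos (e * t + c) *\<^sub>R u t) = (\<lambda>t. cos (t - (- e * c)) *\<^sub>R u t)"
    using assms(1) cos_minus[of "_ - c"] by auto
  then show "(\<lambda>t. cos (e * t + c) *\<^sub>R u t) \<in> L" using L_cos[OF assms(2), of "- e * c"] by simp
  have "(\<lambda>t. sin (e * t + c) *\<^sub>R u t) = (\<lambda>t. e *\<^sub>R (sin (t - (- e * c)) *\<^sub>R u t))"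
    using assms(1) sin_minus[of "_ - c"] by auto
  then show "(\<lambda>t. sin (e * t + c) *\<^sub>R u t) \<in> L" using L_scale[OF L_sin[OF assms(2), of "- e * c"], of e] by simp
qed

lemma \<sigma>_surj: "\<exists>y. \<sigma> y = x"
proof -
  obtain k where "l = Suc k" using l_pos gr0_implies_Suc by blast
  then show ?thesis using \<sigma>_pow[of x] by auto
qed

text \<open>The fibre maps are derivations, hence inner, with \<open>w t\<close> determined by the
  functional \<open>x \<mapsto> tr (F t \<circ> ad x)\<close>. As \<open>M\<close> is one fixed
  linear map, \<open>w\<close> is trigonometric; its twist follows from uniqueness, that is from the
  trivial center.\<close>

lemma derivation_family_inner:
  assumes D: "\<And>u. u \<in> L \<Longrightarrow> D u \<in> L"
    and add: "\<And>u v. u \<in> L \<Longrightarrow> v \<in> L \<Longrightarrow> D (\<lambda>t. u t + v t) = (\<lambda>t. D u t + D v t)"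
    and scale: "\<And>c u. u \<in> L \<Longrightarrow> D (\<lambda>t. c *\<^sub>R u t) = (\<lambda>t. c *\<^sub>R D u t)"
    and van: "\<And>u t. u \<in> L \<Longrightarrow> u t = 0 \<Longrightarrow> D u t = 0"
    and der: "\<And>u v. u \<in> L \<Longrightarrow> v \<in> L \<Longrightarrow> D (\<lambda>t. br (u t) (v t)) = (\<lambda>t. br (D u t) (v t) + br (u t) (D v t))"
  obtains w where "w \<in> L" "\<And>u t. u \<in> L \<Longrightarrow> D u t = br (w t) (u t)"
proof -
  obtain F where F: "\<And>u t. u \<in> L \<Longrightarrow> D u t = F t (u t)" "\<And>t. linear (F t)"
    "\<And>t x. F (t + 2 * pi) (\<sigma> x) = \<sigma> (F t x)" "\<And>x. trig l (\<lambda>t. F t x)"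
    using pointwise_family[of D, OF D add scale van] by blast
  have Fder: "F t (br x y) = br (F t x) y + br x (F t y)" for t x y
  proof -
    have "F t (br (sec t x t) (sec t y t)) = br (F t (sec t x t)) (sec t y t) + br (sec t x t) (F t (sec t y t))"
      using fun_cong[OF der[OF sec_in_L sec_in_L, of t x t y], of t]
      by (simp add: F(1)[OF L_bracket[OF sec_in_L sec_in_L]] F(1)[OF sec_in_L])
    then show ?thesis by (simp add: sec_eval)
  qed
  obtain M where M: "Vector_Spaces.linear scaleR scaleR M"
    "\<And>f x. Vector_Spaces.linear scaleR (*) f \<Longrightarrow> kil (M (\<Sum>b\<in>some_basis scaleR. f b *\<^sub>R b)) x = f x"
  proof (rule kil_nondegenerate_functional)
    fix x assume "\<And>y. kil x y = 0"
    then show "x = 0" by (rule kil_nondegenerate)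
  qed (rule that)
  define f where "f t x = trace_F scaleR (\<lambda>z. F t (br x z))" for t x
  have f_lin: "Vector_Spaces.linear scaleR (*) (f t)" for t
    by (simp add: Vector_Spaces.linear_iff vector_space_axioms vector_space_mult f_def br_add_left br_scale_left
        linear_add[OF F(2)] linear_cmul[OF F(2)] trace_F_add trace_F_scale)
  define w where "w t = M (\<Sum>b\<in>some_basis scaleR. f t b *\<^sub>R b)" for t
  have kw: "kil (w t) x = f t x" for t x unfolding w_def by (rule M(2)[OF f_lin])
  have Fw: "F t x = br (w t) x" for t x
    by (rule derivation_inner[OF kil_nondegenerate, of "F t" "w t"])
      (use F(2)[of t] Fder kw f_def in \<open>auto simp: linear_def\<close>)
  have "trig l w"
  proof -
    have lr: "linear (\<lambda>v. representation (some_basis scaleR) v b')" for b' :: 'a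
      by (simp add: linear_iff representation_add representation_scale some_basis)
    have "trig l (\<lambda>t. f t b)" for b
      unfolding f_def trace_F_def by (rule trig_sum) (rule trig_linear[OF lr F(4)])
    then have fb: "trig l (\<lambda>t. f t b *\<^sub>R b)" for b
      by (rule trig_mult[OF _ trig_const])
    show ?thesis
      unfolding w_def[abs_def] by (rule trig_linear[OF _ trig_sum[OF fb]]) (use M(1) in \<open>simp add: linear_def\<close>)
  qed
  moreover have "w (t + 2 * pi) = \<sigma> (w t)" for t
  proof -
    have "br y (w (t + 2 * pi) - \<sigma> (w t)) = 0" for y
    proof -
      obtain x where x: "y = \<sigma> x" using \<sigma>_surj by metis
      have "br (w (t + 2 * pi)) y = br (\<sigma> (w t)) y"
        unfolding Fw[symmetric] x F(3) unfolding Fw \<sigma>_br ..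
      then show ?thesis using br_swap[of y "w (t + 2 * pi)"] br_swap[of y "\<sigma> (w t)"] by (simp add: br.diff)
    qed
    then show ?thesis using center_trivial by fastforce
  qed
  ultimately have "w \<in> L" by (intro LI)
  then show ?thesis using that F(1) Fw by simp
qed

end

context loop_iso
begin

context
  fixes e c :: real
  assumes e: "e = 1 \<or> e = -1"
    and cs: "\<And>u. u \<in> A.L \<Longrightarrow> \<phi> (\<lambda>t. cos t *\<^sub>R u t) = (\<lambda>t. cos (e * t + c) *\<^sub>R \<phi> u t)"
    and sn: "\<And>u. u \<in> A.L \<Longrightarrow> \<phi> (\<lambda>t. sin t *\<^sub>R u t) = (\<lambda>t. sin (e * t + c) *\<^sub>R \<phi> u t)"
begin

lemma reparam_vanish: "u \<in> A.L \<Longrightarrow> u (e * t + c) = 0 \<Longrightarrow> \<phi> u t = 0"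
  by (rule A.vanish_criterion[of \<phi> t "e * t + c"]) (simp_all add: add scale cs sn)

text \<open>\<open>P\<close> maps the fibre at \<open>e * t + c\<close> to the fibre at
  \<open>t\<close>. It is onto because evaluation and \<open>\<phi>\<close> are, and one-to-one
  because its kernel is a proper ideal; isomorphisms preserve Killing forms.\<close>

lemma reparam_killing:
  assumes uv: "u \<in> A.L" "v \<in> A.L"
  shows "B.kil (\<phi> u t) (\<phi> v t) = A.kil (u (e * t + c)) (v (e * t + c))"
proof -
  let ?\<tau> = "e * t + c"
  define P where "P x = \<phi> (A.sec ?\<tau> x) t" for x
  have P: "\<phi> u t = P (u ?\<tau>)" if u: "u \<in> A.L" for u
  proof -
    have "u = (\<lambda>s. A.sec ?\<tau> (u ?\<tau>) s + (u s - A.sec ?\<tau> (u ?\<tau>) s))" by simp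
    then have "\<phi> u t = \<phi> (A.sec ?\<tau> (u ?\<tau>)) t + \<phi> (\<lambda>s. u s - A.sec ?\<tau> (u ?\<tau>) s) t"
      using add[OF A.sec_in_L A.sec_sub(1)[OF u]] by metis
    also have "\<phi> (\<lambda>s. u s - A.sec ?\<tau> (u ?\<tau>) s) t = 0"
      by (rule reparam_vanish[OF A.sec_sub(1)[OF u] A.sec_sub(2)[OF u]])
    finally show ?thesis by (simp add: P_def)
  qed
  have lin: "Vector_Spaces.linear scaleR scaleR P"
    by (simp add: Vector_Spaces.linear_iff A.vector_space_axioms B.vector_space_axioms P_def A.sec_add A.sec_scale
        add scale A.sec_in_L)
  interpret P: Vector_Spaces.linear scaleR scaleR P by (rule lin)
  have hom: "P (br x y) = br' (P x) (P y)" for x y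
  proof -
    have "\<phi> (\<lambda>s. br (A.sec ?\<tau> x s) (A.sec ?\<tau> y s)) t = br' (P x) (P y)"
      by (simp add: bracket A.sec_in_L P_def)
    then show ?thesis by (simp add: P[OF A.L_bracket[OF A.sec_in_L A.sec_in_L]] A.sec_eval)
  qed
  have surj: "\<exists>x. P x = y" for y
  proof -
    have "P (\<psi> (B.sec t y) ?\<tau>) = \<phi> (\<psi> (B.sec t y)) t"
      by (rule P[symmetric, OF \<psi>_in[OF B.sec_in_L]])
    then show ?thesis by (metis \<phi>\<psi> B.sec_in_L B.sec_eval)
  qed
  have "{x. P x = 0} = {0} \<or> {x. P x = 0} = UNIV"
    by (intro A.ideal_trivial) (auto simp: A.subspace_def P.add P.scale P.zero hom B.br.zero)
  moreover have "{x. P x = 0} \<noteq> UNIV"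
  proof
    assume a: "{x. P x = 0} = UNIV"
    obtain x y where xy: "br' x y \<noteq> 0" using B.nonabelian by blast
    obtain z where "P z = br' x y" using surj by blast
    moreover have "z \<in> {x. P x = 0}" unfolding a by (rule UNIV_I)
    ultimately show False using xy by simp
  qed
  ultimately have ker: "{x. P x = 0} = {0}" by argo
  have "x = 0" if "P x = 0" for x
  proof -
    have "x \<in> {x. P x = 0}" using that by simp
    then show ?thesis unfolding ker by simp
  qed
  then have inj: "inj P" unfolding P.inj_iff_eq_0 by blast
  have "surj P" by (rule surjI[of P "\<lambda>y. SOME x. P x = y"]) (rule someI_ex[OF surj])
  with inj have "bij P" by (rule bijI)
  have "killing scaleR br' (P (u ?\<tau>)) (P (v ?\<tau>)) = killing scaleR br (u ?\<tau>) (v ?\<tau>)"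
    by (rule killing_iso[of scaleR br scaleR br' P, OF A.fd_lie_axioms B.fd_lie_axioms lin \<open>bij P\<close> hom])
  then show ?thesis by (simp add: P uv)
qed

lemma reparam_integral:
  assumes uv: "u \<in> A.L" "v \<in> A.L"
  shows "integral {0..2 * pi} (\<lambda>t. B.kil (\<phi> u t) (\<phi> v t)) = integral {0..2 * pi} (\<lambda>t. A.kil (u t) (v t))"
proof -
  have "trig l (\<lambda>t. A.kil (u t) (v t))"
    by (rule trig_bilinear[OF A.lin_kil A.L_trig A.L_trig]) (rule uv)+
  moreover have "A.kil (u (t + 2 * pi)) (v (t + 2 * pi)) = A.kil (u t) (v t)" for t
  proof -
    have "inj \<sigma>"
    proof (rule injI)
      fix x y assume "\<sigma> x = \<sigma> y"
      then have "(\<sigma> ^^ Suc (l - 1)) x = (\<sigma> ^^ Suc (l - 1)) y" unfolding funpow_Suc_right comp_apply by (rule arg_cong)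
      then show "x = y" using A.l_pos A.\<sigma>_pow by simp
    qed
    moreover have "surj \<sigma>" by (rule surjI[of \<sigma> "\<lambda>y. SOME x. \<sigma> x = y"]) (rule someI_ex[OF A.\<sigma>_surj])
    ultimately have "bij \<sigma>" by (rule bijI)
    moreover have "Vector_Spaces.linear scaleR scaleR \<sigma>" using A.\<sigma>_linear by (simp add: linear_def)
    ultimately show ?thesis
      unfolding A.L_twist[OF uv(1)] A.L_twist[OF uv(2)]
      by (intro killing_iso[of scaleR br scaleR br \<sigma>, OF A.fd_lie_axioms A.fd_lie_axioms] A.\<sigma>_br)
  qed
  ultimately show ?thesis
    unfolding reparam_killing[OF uv] using A.l_pos e by (intro integral_periodic_affine[of l]) auto
qed

text \<open>Conjugating differentiation by \<open>\<phi>\<close> and subtracting \<open>e\<close>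
  times differentiation leaves a derivation \<open>D\<close> of the target. The contributions of the
  derivatives of \<open>cos (e * t + c)\<close> and \<open>sin (e * t + c)\<close> cancel since
  \<open>e * e = 1\<close>, so \<open>D\<close> commutes with these multipliers, is a pointwise
  family and hence inner.\<close>

lemma reparam_derivation:
  obtains w where "w \<in> B.L" "\<And>u t. u \<in> A.L \<Longrightarrow> \<phi> (deriv_loop u) t = e *\<^sub>R deriv_loop (\<phi> u) t + br' (w t) (\<phi> u t)"
proof -
  define D where "D v = (\<lambda>t. \<phi> (deriv_loop (\<psi> v)) t - e *\<^sub>R deriv_loop v t)" for v
  have ee: "e * (e * x) = x" for x using e by auto
  have DL: "D v \<in> B.L" if "v \<in> B.L" for v
    unfolding D_def by (intro B.L_diff B.L_scale \<phi>_in A.L_deriv \<psi>_in B.L_deriv that)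
  have Dadd: "D (\<lambda>t. u t + v t) = (\<lambda>t. D u t + D v t)" if "u \<in> B.L" "v \<in> B.L" for u v
    using that by (simp add: D_def \<psi>_add A.deriv_add B.deriv_add \<psi>_in add A.L_deriv algebra_simps)
  have Dscale: "D (\<lambda>t. r *\<^sub>R u t) = (\<lambda>t. r *\<^sub>R D u t)" if "u \<in> B.L" for r u
    using that by (simp add: D_def \<psi>_scale A.deriv_scale B.deriv_scale \<psi>_in scale A.L_deriv scaleR_diff_right mult.commute)
  have Dder: "D (\<lambda>t. br' (u t) (v t)) = (\<lambda>t. br' (D u t) (v t) + br' (u t) (D v t))" if "u \<in> B.L" "v \<in> B.L" for u v
    using that by (simp add: D_def \<psi>_bracket A.deriv_bracket B.deriv_bracket \<psi>_in add bracket A.L_deriv A.L_bracket \<phi>\<psi>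
        B.brl.diff B.br.diff B.br_scale_left B.br_scale_right algebra_simps)
  have dcos: "(cos has_real_derivative - sin t) (at t)" "(sin has_real_derivative cos t) (at t)" for t
    by (rule DERIV_cos DERIV_sin)+
  have dcosa: "((\<lambda>t. cos (e * t + c)) has_real_derivative - (e * sin (e * t + c))) (at t)"
    "((\<lambda>t. sin (e * t + c)) has_real_derivative e * cos (e * t + c)) (at t)" for t
    by (auto intro!: derivative_eq_intros)
  note clA = A.L_cos[of _ 0, simplified] A.L_sin[of _ 0, simplified]
  have Dcos: "D (\<lambda>t. cos (e * t + c) *\<^sub>R v t) = (\<lambda>t. cos (e * t + c) *\<^sub>R D v t)" if v: "v \<in> B.L" for v
  proof -
    have "\<phi> (\<lambda>t. cos t *\<^sub>R \<psi> v t) = (\<lambda>t. cos (e * t + c) *\<^sub>R v t)" by (simp add: cs \<psi>_in v \<phi>\<psi>)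
    then have p: "\<psi> (\<lambda>t. cos (e * t + c) *\<^sub>R v t) = (\<lambda>t. cos t *\<^sub>R \<psi> v t)"
      using \<psi>\<phi>[OF clA(1)[OF \<psi>_in[OF v]]] by simp
    have "(\<lambda>t. cos t *\<^sub>R deriv_loop (\<psi> v) t + - sin t *\<^sub>R \<psi> v t)
      = (\<lambda>t. cos t *\<^sub>R deriv_loop (\<psi> v) t + (-1) *\<^sub>R (sin t *\<^sub>R \<psi> v t))" by simp
    then have "\<phi> (\<lambda>t. cos t *\<^sub>R deriv_loop (\<psi> v) t + - sin t *\<^sub>R \<psi> v t)
      = (\<lambda>t. cos (e * t + c) *\<^sub>R \<phi> (deriv_loop (\<psi> v)) t + (-1) *\<^sub>R (sin (e * t + c) *\<^sub>R v t))"
      by (simp only: add scale cs sn clA A.L_scale \<psi>_in v A.L_deriv \<phi>\<psi>)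
    then show ?thesis
      unfolding D_def p A.deriv_mult[OF \<psi>_in[OF v] dcos(1)] B.deriv_mult[OF v dcosa(1)]
      by (simp add: algebra_simps ee)
  qed
  have Dsin: "D (\<lambda>t. sin (e * t + c) *\<^sub>R v t) = (\<lambda>t. sin (e * t + c) *\<^sub>R D v t)" if v: "v \<in> B.L" for v
  proof -
    have "\<phi> (\<lambda>t. sin t *\<^sub>R \<psi> v t) = (\<lambda>t. sin (e * t + c) *\<^sub>R v t)" by (simp add: sn \<psi>_in v \<phi>\<psi>)
    then have p: "\<psi> (\<lambda>t. sin (e * t + c) *\<^sub>R v t) = (\<lambda>t. sin t *\<^sub>R \<psi> v t)"
      using \<psi>\<phi>[OF clA(2)[OF \<psi>_in[OF v]]] by simp
    have "\<phi> (\<lambda>t. sin t *\<^sub>R deriv_loop (\<psi> v) t + cos t *\<^sub>R \<psi> v t)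
      = (\<lambda>t. sin (e * t + c) *\<^sub>R \<phi> (deriv_loop (\<psi> v)) t + cos (e * t + c) *\<^sub>R v t)"
      by (simp only: add cs sn clA \<psi>_in v A.L_deriv \<phi>\<psi>)
    then show ?thesis
      unfolding D_def p A.deriv_mult[OF \<psi>_in[OF v] dcos(2)] B.deriv_mult[OF v dcosa(2)]
      by (simp add: algebra_simps ee)
  qed
  \<comment> \<open>The multipliers known to commute with \<open>D\<close> are reparametrized; the
    addition theorems express \<open>cos t\<close> and \<open>sin t\<close> by them, as
    \<open>vanish_criterion\<close> asks.\<close>
  have ct: "cos t = cos c * cos (e * t + c) + sin c * sin (e * t + c)"
    "sin t = (e * cos c) * sin (e * t + c) + (- e * sin c) * cos (e * t + c)" for t
  proof -
    have "cos c * cos (e * t + c) + sin c * sin (e * t + c) = cos ((e * t + c) - c)" by (simp only: cos_diff mult.commute)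
    then show "cos t = cos c * cos (e * t + c) + sin c * sin (e * t + c)" using e by auto
    have "(e * cos c) * sin (e * t + c) + (- e * sin c) * cos (e * t + c) = e * sin ((e * t + c) - c)"
      unfolding sin_diff by (simp add: algebra_simps)
    then show "sin t = (e * cos c) * sin (e * t + c) + (- e * sin c) * cos (e * t + c)" using e by auto
  qed
  note clB = B.L_cos_affine[OF e, of _ c]
  have Dc: "D (\<lambda>t. cos t *\<^sub>R v t) = (\<lambda>t. cos t *\<^sub>R D v t)" and Ds: "D (\<lambda>t. sin t *\<^sub>R v t) = (\<lambda>t. sin t *\<^sub>R D v t)"
    if v: "v \<in> B.L" for v
  proof -
    have c: "(\<lambda>t. cos t *\<^sub>R y t) = (\<lambda>t. cos c *\<^sub>R (cos (e * t + c) *\<^sub>R y t) + sin c *\<^sub>R (sin (e * t + c) *\<^sub>R y t))"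
      and s: "(\<lambda>t. sin t *\<^sub>R y t) = (\<lambda>t. (e * cos c) *\<^sub>R (sin (e * t + c) *\<^sub>R y t) + (- e * sin c) *\<^sub>R (cos (e * t + c) *\<^sub>R y t))"
      for y :: "real \<Rightarrow> 'b"
    proof -
      have h: "cos t *\<^sub>R y t = cos c *\<^sub>R (cos (e * t + c) *\<^sub>R y t) + sin c *\<^sub>R (sin (e * t + c) *\<^sub>R y t)"
        "sin t *\<^sub>R y t = (e * cos c) *\<^sub>R (sin (e * t + c) *\<^sub>R y t) + (- e * sin c) *\<^sub>R (cos (e * t + c) *\<^sub>R y t)" for t
        unfolding scaleR_scaleR scaleR_add_left[symmetric] ct[of t, symmetric] by (rule refl)+
      show "(\<lambda>t. cos t *\<^sub>R y t) = (\<lambda>t. cos c *\<^sub>R (cos (e * t + c) *\<^sub>R y t) + sin c *\<^sub>R (sin (e * t + c) *\<^sub>R y t))"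
        "(\<lambda>t. sin t *\<^sub>R y t) = (\<lambda>t. (e * cos c) *\<^sub>R (sin (e * t + c) *\<^sub>R y t) + (- e * sin c) *\<^sub>R (cos (e * t + c) *\<^sub>R y t))"
        by (rule ext, rule h)+
    qed
    show "D (\<lambda>t. cos t *\<^sub>R v t) = (\<lambda>t. cos t *\<^sub>R D v t)"
      unfolding c[of v] c[of "D v"] by (simp only: Dadd Dscale Dcos Dsin clB B.L_scale v)
    show "D (\<lambda>t. sin t *\<^sub>R v t) = (\<lambda>t. sin t *\<^sub>R D v t)"
      unfolding s[of v] s[of "D v"] by (simp only: Dadd Dscale Dcos Dsin clB B.L_scale v)
  qed
  have van: "D v t = 0" if "v \<in> B.L" "v t = 0" for v t
    by (rule B.vanish_criterion[of D t t, OF Dadd Dscale _ _ that]) (simp_all only: Dc Ds)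
  obtain w where w: "w \<in> B.L" "\<And>v t. v \<in> B.L \<Longrightarrow> D v t = br' (w t) (v t)"
    using B.derivation_family_inner[of D, OF DL Dadd Dscale van Dder] by blast
  have "\<phi> (deriv_loop u) t = e *\<^sub>R deriv_loop (\<phi> u) t + br' (w t) (\<phi> u t)" if "u \<in> A.L" for u t
    using w(2)[OF \<phi>_in[OF that], of t] unfolding D_def \<psi>\<phi>[OF that] by (simp add: algebra_simps)
  then show ?thesis using that w(1) by blast
qed

end

end

section \<open>Action of an isomorphism on the centroid\<close>

context loop_alg
begin

text \<open>The inverse of \<open>\<sigma>\<close>, in a form that inherits linearity from
  \<open>\<sigma>_pow_linear\<close>.\<close>

definition \<tau> :: "'a \<Rightarrow> 'a" where "\<tau> = \<sigma> ^^ (l - 1)"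

lemma \<sigma>\<tau>: "\<sigma> (\<tau> x) = x" and \<tau>\<sigma>: "\<tau> (\<sigma> x) = x"
proof -
  have "(\<sigma> ^^ Suc (l - 1)) x = x" using l_pos \<sigma>_pow by simp
  then show "\<sigma> (\<tau> x) = x" "\<tau> (\<sigma> x) = x" by (simp_all add: \<tau>_def funpow_swap1)
qed

lemma \<tau>_linear: "linear \<tau>" unfolding \<tau>_def by (rule \<sigma>_pow_linear)

lemma \<tau>_br: "\<tau> (br x y) = br (\<tau> x) (\<tau> y)"
  by (metis \<sigma>\<tau> \<tau>\<sigma> \<sigma>_br)

lemma \<sigma>_nz: "x \<noteq> 0 \<Longrightarrow> \<sigma> x \<noteq> 0"
  by (metis \<tau>\<sigma> linear_0[OF \<tau>_linear])

text \<open>The complex structures that act pointwise on the twisted loops; their existence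
  separates the two cases in \<open>ex_standard\<close>.\<close>

definition commuting_root :: "('a \<Rightarrow> 'a) \<Rightarrow> bool" where
  "commuting_root J \<longleftrightarrow> J \<in> centroid \<and> (\<forall>x. J (J x) = - x) \<and> (\<forall>x. J (\<sigma> x) = \<sigma> (J x))"

text \<open>Conjugation by \<open>\<sigma>\<close> turns \<open>J\<close> into another square root
  of \<open>-1\<close> in the centroid, hence into \<open>J\<close> or \<open>- J\<close>.\<close>

lemma root_twist:
  assumes "J \<in> centroid" "\<And>x. J (J x) = - x" "\<not> commuting_root J"
  shows "\<sigma> (J x) = - J (\<sigma> x)"
proof -
  interpret J: Vector_Spaces.linear scaleR scaleR J by (rule centroidD(1)[OF assms(1)])
  define K where "K x = \<sigma> (J (\<tau> x))" for x
  have "K \<in> centroid"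
    unfolding centroid_def
  proof (intro CollectI conjI allI)
    show "Vector_Spaces.linear scaleR scaleR K"
      by (simp add: Vector_Spaces.linear_iff vector_space_axioms K_def \<sigma>.add \<sigma>.scaleR J.add J.scale
          linear_add[OF \<tau>_linear] linear_cmul[OF \<tau>_linear])
    show "K (br x y) = br (K x) y" for x y
      by (simp add: K_def \<tau>_br centroidD(2)[OF assms(1)] \<sigma>_br \<sigma>\<tau>)
  qed
  moreover have "K (K x) = - x" for x
    by (simp add: K_def \<tau>\<sigma> assms(2) \<sigma>.neg \<sigma>\<tau>)
  ultimately have "K = J \<or> K = (\<lambda>x. - J x)"
    by (rule centroid_root_unique[OF assms(1) _ assms(2)])
  moreover have KJ: "K (\<sigma> x) = \<sigma> (J x)" for x by (simp add: K_def \<tau>\<sigma>)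
  ultimately show ?thesis
    using assms by (metis commuting_root_def)
qed

text \<open>The operator \<open>(a - c) + (b - d) J\<close> annihilates \<open>y\<close>; its
  conjugate turns this into a sum of two squares times \<open>y\<close>.\<close>

lemma root_independent:
  assumes "J \<in> centroid" "\<And>x. J (J x) = - x" "a *\<^sub>R y + b *\<^sub>R J y = c *\<^sub>R y + d *\<^sub>R J y" "y \<noteq> 0"
  shows "a = c \<and> b = d"
proof -
  interpret J: Vector_Spaces.linear scaleR scaleR J by (rule centroidD(1)[OF assms(1)])
  have e: "(a - c) *\<^sub>R y + (b - d) *\<^sub>R J y = 0" using assms(3) by (simp add: algebra_simps)
  then have "J ((a - c) *\<^sub>R y + (b - d) *\<^sub>R J y) = 0" by (simp only: J.zero)
  then have f: "(a - c) *\<^sub>R J y - (b - d) *\<^sub>R y = 0" by (simp add: J.add J.scale assms(2))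
  have gen: "(p * p + q * q) *\<^sub>R y = p *\<^sub>R (p *\<^sub>R y + q *\<^sub>R z) - q *\<^sub>R (p *\<^sub>R z - q *\<^sub>R y)" for p q z
    by (simp add: algebra_simps)
  have "((a - c) * (a - c) + (b - d) * (b - d)) *\<^sub>R y
    = (a - c) *\<^sub>R ((a - c) *\<^sub>R y + (b - d) *\<^sub>R J y) - (b - d) *\<^sub>R ((a - c) *\<^sub>R J y - (b - d) *\<^sub>R y)"
    by (rule gen)
  also have "\<dots> = 0" unfolding e f by simp
  finally have "(a - c) * (a - c) + (b - d) * (b - d) = 0" using assms(4) by simp
  then show ?thesis by (simp add: sum_squares_eq_zero_iff)
qed

text \<open>A real linear \<open>g\<close> with \<open>g y = 1\<close> and
  \<open>g (J y) = \<i>\<close> becomes complex linear by averaging over \<open>J\<close>.\<close>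

lemma root_functional:
  assumes "J \<in> centroid" "\<And>x. J (J x) = - x" "y \<noteq> 0"
  obtains h :: "'a \<Rightarrow> complex" where "linear h" "\<And>x. h (J x) = \<i> * h x" "h y = 1"
proof -
  interpret J: Vector_Spaces.linear scaleR scaleR J by (rule centroidD(1)[OF assms(1)])
  have "J y \<notin> span {y}"
  proof
    assume "J y \<in> span {y}"
    then obtain k where "J y = k *\<^sub>R y" unfolding span_singleton by blast
    then have "k *\<^sub>R y + 0 *\<^sub>R J y = 0 *\<^sub>R y + 1 *\<^sub>R J y" by simp
    from root_independent[OF assms(1,2) this assms(3)] show False by simp
  qed
  then have "independent {J y, y}" using assms(3) by (simp add: independent_insert)
  moreover have "J y \<noteq> y" using \<open>J y \<notin> span {y}\<close> span_base[of y "{y}"] by auto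
  ultimately obtain g :: "'a \<Rightarrow> complex" where g: "linear g" "g y = 1" "g (J y) = \<i>"
    using linear_independent_extend[unfolded dependent_raw_def, of "{J y, y}" "\<lambda>x. if x = y then 1 else \<i>"]
    by auto
  define h where "h x = (g x - \<i> * g (J x)) / 2" for x
  have "linear h"
    by (simp add: linear_iff h_def J.add J.scale linear_add[OF g(1)] linear_cmul[OF g(1)] scaleR_conv_of_real
        field_simps)
  moreover have "h (J x) = \<i> * h x" for x
    by (simp add: h_def assms(2) linear_neg[OF g(1)] algebra_simps)
  moreover have "h y = 1" by (simp add: h_def g)
  ultimately show ?thesis using that by blast
qed

lemma real_functional:
  assumes "(y::'a) \<noteq> 0"
  obtains h :: "'a \<Rightarrow> complex" where "linear h" "h y = 1"
proof -
  have "independent {y}" using assms by simp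
  then show ?thesis
    using linear_independent_extend[unfolded dependent_raw_def, of "{y}" "\<lambda>x. 1 :: complex"] that by blast
qed

lemma centroid_in_root:
  assumes "J \<in> centroid" "\<And>x. J (J x) = - x" "f \<in> centroid"
  obtains z where "\<And>x. f x = Re z *\<^sub>R x + Im z *\<^sub>R J x"
  using assms(3)
proof (cases rule: centroid_cases)
  case (scalar a)
  then show ?thesis using that[of "of_real a"] by simp
next
  case (complex a b K)
  have "K = J \<or> K = (\<lambda>x. - J x)" by (rule centroid_root_unique[OF assms(1) complex(1) assms(2) complex(2)])
  then show ?thesis
    using that[of "Complex a b"] that[of "Complex a (- b)"] complex(3) by auto
qed

text \<open>\<open>S\<close> and \<open>T\<close> stand for the transported multiplications by
  \<open>cos\<close> and \<open>sin\<close>. If the centroid contains a root \<open>J\<close>, this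
  root anticommutes with \<open>\<sigma>\<close>, so a shift by \<open>2 * pi\<close> conjugates the
  complex coordinates of the fibre maps; if the centroid is real, so are the coordinates. Either way
  \<open>trig_circle_pair\<close> applies.\<close>

lemma centroid_pair:
  assumes no: "\<not> (\<exists>J. commuting_root J)" and S: "loop_centroid S" and T: "loop_centroid T"
    and 1: "\<And>u t. u \<in> L \<Longrightarrow> S (S u) t + T (T u) t = u t"
  obtains m :: int and c where "\<And>u. u \<in> L \<Longrightarrow> S u = (\<lambda>t. cos (of_int m * t + c) *\<^sub>R u t)"
    "\<And>u. u \<in> L \<Longrightarrow> T u = (\<lambda>t. sin (of_int m * t + c) *\<^sub>R u t)"
proof -
  obtain F where F: "\<And>u t. u \<in> L \<Longrightarrow> S u t = F t (u t)" "\<And>t. F t \<in> centroid"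
    "\<And>t x. F (t + 2 * pi) (\<sigma> x) = \<sigma> (F t x)" "\<And>x. trig l (\<lambda>t. F t x)"
    using loop_centroid_pointwise[OF S] by blast
  obtain G where G: "\<And>u t. u \<in> L \<Longrightarrow> T u t = G t (u t)" "\<And>t. G t \<in> centroid"
    "\<And>t x. G (t + 2 * pi) (\<sigma> x) = \<sigma> (G t x)" "\<And>x. trig l (\<lambda>t. G t x)"
    using loop_centroid_pointwise[OF T] by blast
  have inL: "u \<in> L \<Longrightarrow> S u \<in> L" "u \<in> L \<Longrightarrow> T u \<in> L" for u
    using S T by (auto simp: loop_centroid_def)
  have sq: "F t (F t x) + G t (G t x) = x" for t x
    using 1[OF sec_in_L, of t x t] by (simp add: F(1) G(1) inL sec_in_L sec_eval)
  obtain x0 :: 'a where x0: "x0 \<noteq> 0" using nonabelian by blast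
  \<comment> \<open>The fibre maps are described only where the coordinates are real. This gives one
    statement for both cases, and \<open>trig_circle_pair\<close> shows that the coordinates are
    real everywhere.\<close>
  have "\<exists>f g. (\<forall>t x. (Im (f t) = 0 \<longrightarrow> F t x = Re (f t) *\<^sub>R x) \<and> (Im (g t) = 0 \<longrightarrow> G t x = Re (g t) *\<^sub>R x)) \<and> trig l f \<and> trig l g
    \<and> (\<forall>t. f (t + 2 * pi) = cnj (f t)) \<and> (\<forall>t. g (t + 2 * pi) = cnj (g t)) \<and> (\<forall>t. f t * f t + g t * g t = 1)"
  proof (cases "\<exists>J\<in>centroid. \<forall>x. J (J x) = - x")
    case True
    then obtain J where J: "J \<in> centroid" "\<And>x. J (J x) = - x" by blast
    interpret J: Vector_Spaces.linear scaleR scaleR J by (rule centroidD(1)[OF J(1)])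
    have tw: "\<sigma> (J x) = - J (\<sigma> x)" for x using root_twist[OF J] no by blast
    obtain h where h: "linear h" "\<And>x. h (J x) = \<i> * h x" "h x0 = 1" using root_functional[OF J x0] by blast
    have hz: "h (Re z *\<^sub>R x0 + Im z *\<^sub>R J x0) = z" for z
      by (simp add: linear_add[OF h(1)] linear_cmul[OF h(1)] h complex_eq_iff)
    have rep: "H t x = Re (h (H t x0)) *\<^sub>R x + Im (h (H t x0)) *\<^sub>R J x" if Hc: "\<And>t. H t \<in> centroid" for H t x
    proof -
      obtain z where z: "\<And>x. H t x = Re z *\<^sub>R x + Im z *\<^sub>R J x" using centroid_in_root[OF J Hc[of t]] by blast
      have "h (H t x0) = z" unfolding z by (rule hz)
      then show ?thesis using z by simp
    qed
    have cn: "h (H (t + 2 * pi) x0) = cnj (h (H t x0))"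
      if H: "\<And>t. H t \<in> centroid" "\<And>t x. H (t + 2 * pi) (\<sigma> x) = \<sigma> (H t x)" for H t
    proof -
      have "Re (h (H (t + 2 * pi) x0)) *\<^sub>R \<sigma> x0 + Im (h (H (t + 2 * pi) x0)) *\<^sub>R J (\<sigma> x0) = \<sigma> (H t x0)"
        using rep[of H "t + 2 * pi" "\<sigma> x0", OF H(1)] H(2) by simp
      also have "\<dots> = Re (h (H t x0)) *\<^sub>R \<sigma> x0 + (- Im (h (H t x0))) *\<^sub>R J (\<sigma> x0)"
        by (subst rep[of H t x0, OF H(1)]) (simp add: \<sigma>.add \<sigma>.scaleR tw)
      finally have e: "Re (h (H (t + 2 * pi) x0)) *\<^sub>R \<sigma> x0 + Im (h (H (t + 2 * pi) x0)) *\<^sub>R J (\<sigma> x0)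
        = Re (h (H t x0)) *\<^sub>R \<sigma> x0 + (- Im (h (H t x0))) *\<^sub>R J (\<sigma> x0)" .
      from root_independent[OF J e \<sigma>_nz[OF x0]] show ?thesis by (simp add: complex_eq_iff)
    qed
    have hh: "h (H t (H t x0)) = h (H t x0) * h (H t x0)" if H: "\<And>t. H t \<in> centroid" for H t
      by (subst rep[of H t "H t x0", OF H], simp add: linear_add[OF h(1)] linear_cmul[OF h(1)] h(2))
        (simp add: complex_eq_iff algebra_simps)
    show ?thesis
    proof (intro exI conjI allI)
      show "Im (h (F t x0)) = 0 \<longrightarrow> F t x = Re (h (F t x0)) *\<^sub>R x" for t x
        using rep[of F t x, OF F(2)] by simp
      show "Im (h (G t x0)) = 0 \<longrightarrow> G t x = Re (h (G t x0)) *\<^sub>R x" for t x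
        using rep[of G t x, OF G(2)] by simp
      show "trig l (\<lambda>t. h (F t x0))" "trig l (\<lambda>t. h (G t x0))" by (rule trig_linear[OF h(1)], rule F(4) G(4))+
      show "h (F (t + 2 * pi) x0) = cnj (h (F t x0))" "h (G (t + 2 * pi) x0) = cnj (h (G t x0))" for t
        by (rule cn[of F, OF F(2,3)] cn[of G, OF G(2,3)])+
      show "h (F t x0) * h (F t x0) + h (G t x0) * h (G t x0) = 1" for t
        using arg_cong[OF sq[of t x0], of h] by (simp add: linear_add[OF h(1)] hh F(2) G(2) h(3))
    qed
  next
    case False
    obtain h where h: "linear h" "h x0 = (1::complex)" using real_functional[OF x0] by blast
    have rep: "H t x = Re (h (H t x0)) *\<^sub>R x \<and> Im (h (H t x0)) = 0" if Hc: "\<And>t. H t \<in> centroid" for H t x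
    proof -
      obtain a where "H t = (\<lambda>x. a *\<^sub>R x)"
        using Hc[of t] False by (cases rule: centroid_cases) blast+
      then show ?thesis by (simp add: linear_cmul[OF h(1)] h(2))
    qed
    have cn: "h (H (t + 2 * pi) x0) = cnj (h (H t x0))"
      if H: "\<And>t. H t \<in> centroid" "\<And>t x. H (t + 2 * pi) (\<sigma> x) = \<sigma> (H t x)" for H t
    proof -
      have "Re (h (H (t + 2 * pi) x0)) *\<^sub>R \<sigma> x0 = \<sigma> (H t x0)"
        using rep[of H "t + 2 * pi" "\<sigma> x0", OF H(1)] H(2) by simp
      also have "\<dots> = Re (h (H t x0)) *\<^sub>R \<sigma> x0"
        using rep[of H t x0, OF H(1)] \<sigma>.scaleR by metis
      finally show ?thesis
        using \<sigma>_nz[OF x0] rep[of H _ x0, OF H(1)] by (simp add: complex_eq_iff)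
    qed
    have hh: "h (H t (H t x0)) = h (H t x0) * h (H t x0)" if H: "\<And>t. H t \<in> centroid" for H t
      using rep[of H t "H t x0", OF H] rep[of H t x0, OF H]
      by (simp add: linear_cmul[OF h(1)] complex_eq_iff)
    show ?thesis
    proof (intro exI conjI allI)
      show "Im (h (F t x0)) = 0 \<longrightarrow> F t x = Re (h (F t x0)) *\<^sub>R x" for t x
        using rep[of F t x, OF F(2)] by simp
      show "Im (h (G t x0)) = 0 \<longrightarrow> G t x = Re (h (G t x0)) *\<^sub>R x" for t x
        using rep[of G t x, OF G(2)] by simp
      show "trig l (\<lambda>t. h (F t x0))" "trig l (\<lambda>t. h (G t x0))" by (rule trig_linear[OF h(1)], rule F(4) G(4))+
      show "h (F (t + 2 * pi) x0) = cnj (h (F t x0))" "h (G (t + 2 * pi) x0) = cnj (h (G t x0))" for t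
        by (rule cn[of F, OF F(2,3)] cn[of G, OF G(2,3)])+
      show "h (F t x0) * h (F t x0) + h (G t x0) * h (G t x0) = 1" for t
        using arg_cong[OF sq[of t x0], of h] by (simp add: linear_add[OF h(1)] hh F(2) G(2) h(2))
    qed
  qed
  then obtain f g where fg: "\<And>t x. Im (f t) = 0 \<longrightarrow> F t x = Re (f t) *\<^sub>R x" "\<And>t x. Im (g t) = 0 \<longrightarrow> G t x = Re (g t) *\<^sub>R x"
    "trig l f" "trig l g" "\<And>t. f (t + 2 * pi) = cnj (f t)" "\<And>t. g (t + 2 * pi) = cnj (g t)" "\<And>t. f t * f t + g t * g t = 1"
    by blast
  obtain m c where mc: "\<And>t. f t = of_real (cos (of_int m * t + c))" "\<And>t. g t = of_real (sin (of_int m * t + c))"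
    using trig_circle_pair[OF l_pos fg(3,5,4,6,7)] by blast
  show ?thesis
  proof (rule that)
    fix u assume u: "u \<in> L"
    show "S u = (\<lambda>t. cos (of_int m * t + c) *\<^sub>R u t)" using F(1)[OF u] fg(1) by (auto simp: mc)
    show "T u = (\<lambda>t. sin (of_int m * t + c) *\<^sub>R u t)" using G(1)[OF u] fg(2) by (auto simp: mc)
  qed
qed

lemma loop_centroid_cos: "loop_centroid (\<lambda>u t. cos t *\<^sub>R u t)" and loop_centroid_sin: "loop_centroid (\<lambda>u t. sin t *\<^sub>R u t)"
  using L_cos[of _ 0] L_sin[of _ 0] by (simp_all add: loop_centroid_def scaleR_add_right mult.commute br_scale_left)

end

section \<open>Frequencies in the absence of a commuting complex structure\<close>

context loop_iso
begin

lemma centroid_rotation: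
  assumes "\<not> (\<exists>J. B.commuting_root J)"
  obtains m :: int and c where "\<And>u. u \<in> A.L \<Longrightarrow> \<phi> (\<lambda>t. cos t *\<^sub>R u t) = (\<lambda>t. cos (of_int m * t + c) *\<^sub>R \<phi> u t)"
    "\<And>u. u \<in> A.L \<Longrightarrow> \<phi> (\<lambda>t. sin t *\<^sub>R u t) = (\<lambda>t. sin (of_int m * t + c) *\<^sub>R \<phi> u t)"
proof -
  note cl = A.L_cos[of _ 0, simplified] A.L_sin[of _ 0, simplified]
  let ?S = "\<lambda>v. \<phi> (\<lambda>t. cos t *\<^sub>R \<psi> v t)" and ?T = "\<lambda>v. \<phi> (\<lambda>t. sin t *\<^sub>R \<psi> v t)"
  have 1: "?S (?S v) t + ?T (?T v) t = v t" if v: "v \<in> B.L" for v t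
  proof -
    have "(\<lambda>t. ?S (?S v) t + ?T (?T v) t) = \<phi> (\<lambda>t. cos t *\<^sub>R cos t *\<^sub>R \<psi> v t + sin t *\<^sub>R sin t *\<^sub>R \<psi> v t)"
      by (simp only: \<psi>\<phi> cl \<psi>_in v add)
    also have "(\<lambda>t. cos t *\<^sub>R cos t *\<^sub>R \<psi> v t + sin t *\<^sub>R sin t *\<^sub>R \<psi> v t) = \<psi> v"
      by (simp flip: scaleR_add_left)
    finally show ?thesis using \<phi>\<psi>[OF v] by metis
  qed
  obtain m c where mc: "\<And>v. v \<in> B.L \<Longrightarrow> ?S v = (\<lambda>t. cos (of_int m * t + c) *\<^sub>R v t)"
    "\<And>v. v \<in> B.L \<Longrightarrow> ?T v = (\<lambda>t. sin (of_int m * t + c) *\<^sub>R v t)"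
    using B.centroid_pair[OF assms transport_centroid[OF A.loop_centroid_cos] transport_centroid[OF A.loop_centroid_sin] 1] by blast
  show ?thesis
  proof (rule that)
    fix u assume u: "u \<in> A.L"
    show "\<phi> (\<lambda>t. cos t *\<^sub>R u t) = (\<lambda>t. cos (of_int m * t + c) *\<^sub>R \<phi> u t)" using mc(1)[OF \<phi>_in[OF u]] \<psi>\<phi>[OF u] by simp
    show "\<phi> (\<lambda>t. sin t *\<^sub>R u t) = (\<lambda>t. sin (of_int m * t + c) *\<^sub>R \<phi> u t)" using mc(2)[OF \<phi>_in[OF u]] \<psi>\<phi>[OF u] by simp
  qed
qed

lemma rotation_power:
  assumes cs: "\<And>u. u \<in> A.L \<Longrightarrow> \<phi> (\<lambda>t. cos t *\<^sub>R u t) = (\<lambda>t. cos (\<theta> t) *\<^sub>R \<phi> u t)"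
    and sn: "\<And>u. u \<in> A.L \<Longrightarrow> \<phi> (\<lambda>t. sin t *\<^sub>R u t) = (\<lambda>t. sin (\<theta> t) *\<^sub>R \<phi> u t)" and u: "u \<in> A.L"
  shows "\<phi> (\<lambda>t. cos (real k * t + d) *\<^sub>R u t) = (\<lambda>t. cos (real k * \<theta> t + d) *\<^sub>R \<phi> u t)"
proof -
  note cl = A.L_cos[of _ 0, simplified] A.L_sin[of _ 0, simplified]
  have trigL: "(\<lambda>t. cos (real k * t) *\<^sub>R u t) \<in> A.L" "(\<lambda>t. sin (real k * t) *\<^sub>R u t) \<in> A.L" for k
  proof -
    have "cos (real k * (t + 2 * pi)) = cos (real k * t)" "sin (real k * (t + 2 * pi)) = sin (real k * t)" for t
    proof -
      have e: "real k * (t + 2 * pi) = real k * t + 2 * pi * of_int (int k)" by (simp add: algebra_simps)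
      show "cos (real k * (t + 2 * pi)) = cos (real k * t)" "sin (real k * (t + 2 * pi)) = sin (real k * t)"
        unfolding e cos_add sin_add cos_int_2pin sin_int_2pin by simp_all
    qed
    then show "(\<lambda>t. cos (real k * t) *\<^sub>R u t) \<in> A.L" "(\<lambda>t. sin (real k * t) *\<^sub>R u t) \<in> A.L"
      using A.L_mult[OF u] A.trig_cos_nat[of k 0] A.trig_sin_nat[of k 0] by simp_all
  qed
  have "\<phi> (\<lambda>t. cos (real k * t) *\<^sub>R u t) = (\<lambda>t. cos (real k * \<theta> t) *\<^sub>R \<phi> u t)
    \<and> \<phi> (\<lambda>t. sin (real k * t) *\<^sub>R u t) = (\<lambda>t. sin (real k * \<theta> t) *\<^sub>R \<phi> u t)" for k
  proof (induction k)
    case 0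
    show ?case using scale[OF u, of 0] by simp
  next
    case (Suc k)
    have e: "real (Suc k) * x = x + real k * x" for x by (simp add: distrib_right)
    have c': "cos (real (Suc k) * x) *\<^sub>R y = cos x *\<^sub>R cos (real k * x) *\<^sub>R y + (-1) *\<^sub>R (sin x *\<^sub>R sin (real k * x) *\<^sub>R y)"
      and s': "sin (real (Suc k) * x) *\<^sub>R y = sin x *\<^sub>R cos (real k * x) *\<^sub>R y + cos x *\<^sub>R sin (real k * x) *\<^sub>R y"
      for x and y :: 'a
      unfolding e cos_add sin_add by (simp_all add: scaleR_diff_left scaleR_add_left)
    have c'': "cos (real (Suc k) * x) *\<^sub>R y = cos x *\<^sub>R cos (real k * x) *\<^sub>R y + (-1) *\<^sub>R (sin x *\<^sub>R sin (real k * x) *\<^sub>R y)"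
      and s'': "sin (real (Suc k) * x) *\<^sub>R y = sin x *\<^sub>R cos (real k * x) *\<^sub>R y + cos x *\<^sub>R sin (real k * x) *\<^sub>R y"
      for x and y :: 'b
      unfolding e cos_add sin_add by (simp_all add: scaleR_diff_left scaleR_add_left)
    show ?case
      unfolding c' s' c'' s''
      by (simp only: add scale cs sn trigL cl A.L_scale Suc.IH)
  qed
  note IH = this
  have d: "cos (x + d) *\<^sub>R y = cos d *\<^sub>R (cos x *\<^sub>R y) + (- sin d) *\<^sub>R (sin x *\<^sub>R y)" for x and y :: 'a
    by (simp add: cos_add scaleR_diff_left mult.commute)
  have d': "cos (x + d) *\<^sub>R y = cos d *\<^sub>R (cos x *\<^sub>R y) + (- sin d) *\<^sub>R (sin x *\<^sub>R y)" for x and y :: 'b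
    by (simp add: cos_add scaleR_diff_left mult.commute)
  show ?thesis
    unfolding d d' by (simp only: add scale trigL A.L_scale IH)
qed

text \<open>\<open>\<phi>\<close> multiplies frequencies by \<open>m\<close> and its inverse by
  \<open>m'\<close>; as their composition is the identity, \<open>frequency_pm1\<close> applies to
  the product.\<close>

lemma rotation_pm1:
  assumes A: "\<not> (\<exists>J. A.commuting_root J)" and B: "\<not> (\<exists>J. B.commuting_root J)"
  obtains e c where "e = 1 \<or> e = -1" "\<And>u. u \<in> A.L \<Longrightarrow> \<phi> (\<lambda>t. cos t *\<^sub>R u t) = (\<lambda>t. cos (e * t + c) *\<^sub>R \<phi> u t)"
    "\<And>u. u \<in> A.L \<Longrightarrow> \<phi> (\<lambda>t. sin t *\<^sub>R u t) = (\<lambda>t. sin (e * t + c) *\<^sub>R \<phi> u t)"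
proof -
  interpret inv: loop_iso br' \<sigma>' l' br \<sigma> l \<psi> by (rule inverse)
  obtain m c where mc: "\<And>u. u \<in> A.L \<Longrightarrow> \<phi> (\<lambda>t. cos t *\<^sub>R u t) = (\<lambda>t. cos (of_int m * t + c) *\<^sub>R \<phi> u t)"
    "\<And>u. u \<in> A.L \<Longrightarrow> \<phi> (\<lambda>t. sin t *\<^sub>R u t) = (\<lambda>t. sin (of_int m * t + c) *\<^sub>R \<phi> u t)"
    using centroid_rotation[OF B] by blast
  obtain m' c' where mc': "\<And>v. v \<in> B.L \<Longrightarrow> \<psi> (\<lambda>t. cos t *\<^sub>R v t) = (\<lambda>t. cos (of_int m' * t + c') *\<^sub>R \<psi> v t)"
    using inv.centroid_rotation[OF A] by metis
  \<comment> \<open>The cosine is even, so a negative \<open>m'\<close> is replaced by its absolute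
    value, which brings the claim into the range of \<open>rotation_power\<close>.\<close>
  define k where "k = nat \<bar>m'\<bar>"
  define d where "d = (if m' \<ge> 0 then c' else - c')"
  have kd: "cos (of_int m' * t + c') = cos (real k * t + d)" for t
    using cos_minus[of "real k * t + d"] by (auto simp: k_def d_def)
  obtain y :: 'b where y: "y \<noteq> 0" using B.nonabelian by blast
  have "cos (of_int (int k * m) * t + (real k * c + d)) = cos t" for t :: real
  proof -
    let ?v = "B.sec t y"
    have v: "?v \<in> B.L" by (rule B.sec_in_L)
    have "(\<lambda>t. cos t *\<^sub>R ?v t) = \<phi> (\<psi> (\<lambda>t. cos t *\<^sub>R ?v t))"
      using \<phi>\<psi> B.L_cos[OF v, of 0] by simp
    also have "\<dots> = \<phi> (\<lambda>t. cos (real k * t + d) *\<^sub>R \<psi> ?v t)" by (simp only: mc'[OF v] kd)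
    also have "\<dots> = (\<lambda>t. cos (real k * (of_int m * t + c) + d) *\<^sub>R ?v t)"
      using rotation_power[OF mc \<psi>_in[OF v], of k d] \<phi>\<psi>[OF v] by simp
    finally have "cos t *\<^sub>R y = cos (real k * (of_int m * t + c) + d) *\<^sub>R y"
      by (metis B.sec_eval)
    then show ?thesis using y by (simp add: algebra_simps)
  qed
  then have "\<bar>int k * m\<bar> = 1" by (rule frequency_pm1)
  then have "\<bar>m\<bar> = 1" by (metis abs_mult abs_zmult_eq_1 mult.commute)
  then have "real_of_int m = 1 \<or> real_of_int m = -1" by auto
  then show ?thesis using that mc by blast
qed

end

section \<open>Complex translations of loops\<close>

locale loop_alg_root = loop_alg br \<sigma> l for br :: "'a::real_normed_vector \<Rightarrow> 'a \<Rightarrow> 'a" and \<sigma> l +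
  fixes J :: "'a \<Rightarrow> 'a"
  assumes root: "commuting_root J"
begin

lemma J_centroid: "J \<in> centroid" and JJ [simp]: "J (J x) = - x" and J\<sigma>: "J (\<sigma> x) = \<sigma> (J x)"
  using root by (auto simp: commuting_root_def)

sublocale J: linear J
  using centroidD(1)[OF J_centroid] by (simp add: linear_def)

lemma J_br_left: "br (J x) y = J (br x y)" and J_br_right: "br x (J y) = J (br x y)"
  using centroidD(2,3)[OF J_centroid] by simp_all

lemma J_kil: "kil (J x) y = kil x (J y)"
  by (rule kil_centroid[OF centroidD(1)[OF J_centroid] J_br_left])

definition zs :: "complex \<Rightarrow> 'a \<Rightarrow> 'a" where "zs z x = Re z *\<^sub>R x + Im z *\<^sub>R J x"

lemma zs_mult: "zs z (zs w x) = zs (z * w) x"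
  by (simp add: zs_def J.add J.scaleR algebra_simps)

lemma zs_add: "zs z (x + y) = zs z x + zs z y" and zs_scale: "zs z (r *\<^sub>R x) = r *\<^sub>R zs z x"
  and zs_plus: "zs (z + w) x = zs z x + zs w x" and zs_real: "zs (of_real r) x = r *\<^sub>R x"
  and zs_br: "br (zs z x) (zs w y) = zs (z * w) (br x y)" and zs_\<sigma>: "\<sigma> (zs z x) = zs z (\<sigma> x)"
  and zs_minus: "zs z (- x) = - zs z x"
  by (simp_all add: zs_def J.add J.scaleR J.neg br_add_left br_add_right br_scale_left br_scale_right J_br_left J_br_right J\<sigma>
      \<sigma>.add \<sigma>.scaleR algebra_simps)

lemma zs_linear: "linear (zs z)" by (simp add: linear_iff zs_add zs_scale)

lemma zs_1 [simp]: "zs 1 x = x" by (simp add: zs_def)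

definition ex :: "int \<Rightarrow> 'a \<Rightarrow> real \<Rightarrow> 'a" where "ex n x t = zs (cis (of_int n * t / real l)) x"

lemma ex_trig: "trig l (ex n x)"
  unfolding ex_def[abs_def] zs_def cis.sel by (rule trig.add[OF trig_cos_int trig_sin_int])

lemma ex_br: "br (ex n x t) (ex m y t) = ex (n + m) (br x y) t"
  by (simp add: ex_def zs_br cis_mult distrib_right add_divide_distrib)

lemma ex_scale: "ex n (r *\<^sub>R x) t = r *\<^sub>R ex n x t" by (simp add: ex_def zs_scale)

lemma ex_deriv: "(ex n x has_vector_derivative ex n ((of_int n / real l) *\<^sub>R J x) t) (at t)"
proof -
  have "((\<lambda>t. cos (k * t)) has_real_derivative - (k * sin (k * t))) (at t)"
    "((\<lambda>t. sin (k * t)) has_real_derivative k * cos (k * t)) (at t)" for k t :: real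
    by (auto intro!: derivative_eq_intros)
  note d = this[of "of_int n / real l" t]
  have "((\<lambda>t. cos (of_int n / real l * t) *\<^sub>R x + sin (of_int n / real l * t) *\<^sub>R J x) has_vector_derivative
    (cos (of_int n / real l * t) *\<^sub>R 0 + (- (of_int n / real l * sin (of_int n / real l * t))) *\<^sub>R x)
    + (sin (of_int n / real l * t) *\<^sub>R 0 + (of_int n / real l * cos (of_int n / real l * t)) *\<^sub>R J x)) (at t)"
    by (intro has_vector_derivative_add has_vector_derivative_scaleR d has_vector_derivative_const)
  then show ?thesis
    unfolding ex_def[abs_def] zs_def cis.sel by (simp add: J.scaleR algebra_simps)
qed

text \<open>\<open>transl s u v\<close>: \<open>v\<close> is obtained from \<open>u\<close> by the substitution \<open>z \<mapsto> s z\<close>, where \<open>z\<close> stands for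
  \<open>e\<^bsup>it/l\<^esup>\<close>; for \<open>s \<noteq> 1\<close> this is a translation of the loop parameter in an imaginary direction.\<close>

inductive transl :: "real \<Rightarrow> (real \<Rightarrow> 'a) \<Rightarrow> (real \<Rightarrow> 'a) \<Rightarrow> bool" for s where
  gen: "transl s (ex n x) (ex n ((s powi n) *\<^sub>R x))"
| add: "transl s u v \<Longrightarrow> transl s u' v' \<Longrightarrow> transl s (\<lambda>t. u t + u' t) (\<lambda>t. v t + v' t)"

lemma transl_trig: "transl s u v \<Longrightarrow> trig l v"
proof (induction rule: transl.induct)
  case (gen n x)
  show ?case by (rule ex_trig)
next
  case (add u v u' v')
  show ?case by (rule trig.add[OF add.IH])
qed

lemma transl_left_trig: "transl s u v \<Longrightarrow> trig l u"
proof (induction rule: transl.induct)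
  case (gen n x)
  show ?case by (rule ex_trig)
next
  case (add u v u' v')
  show ?case by (rule trig.add[OF add.IH])
qed

lemma transl_scale: "transl s u v \<Longrightarrow> transl s (\<lambda>t. r *\<^sub>R u t) (\<lambda>t. r *\<^sub>R v t)"
proof (induction rule: transl.induct)
  case (gen n x)
  show ?case using transl.gen[of s n "r *\<^sub>R x"] by (simp add: ex_scale[abs_def] mult.commute)
next
  case (add u v u' v')
  show ?case unfolding scaleR_add_right by (rule transl.add[OF add.IH])
qed

lemma transl_total: "trig l u \<Longrightarrow> \<exists>v. transl s u v"
proof (induction rule: trig.induct)
  {
    case (cos n a)
    have "cos (real n * t / real l) *\<^sub>R a = ex (int n) (a /\<^sub>R 2) t + ex (- int n) (a /\<^sub>R 2) t" for t
      by (simp add: ex_def zs_def J.scaleR flip: scaleR_add_left)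
    then show ?case using transl.add[OF transl.gen[of s "int n" "a /\<^sub>R 2"] transl.gen[of s "- int n" "a /\<^sub>R 2"]] by auto
  next
    case (sin n a)
    have "sin (real n * t / real l) *\<^sub>R a = ex (int n) (- J (a /\<^sub>R 2)) t + ex (- int n) (J (a /\<^sub>R 2)) t" for t
      by (simp add: ex_def zs_def J.scaleR J.neg flip: scaleR_add_left)
    then show ?case using transl.add[OF transl.gen[of s "int n" "- J (a /\<^sub>R 2)"] transl.gen[of s "- int n" "J (a /\<^sub>R 2)"]] by auto
  }
next
  case (add u v)
  then show ?case using transl.add by blast
qed

lemma transl_bracket:
  assumes "s \<noteq> 0" "transl s u v" "transl s u' v'"
  shows "transl s (\<lambda>t. br (u t) (u' t)) (\<lambda>t. br (v t) (v' t))"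
  using assms(2)
proof (induction rule: transl.induct)
  case (gen n x)
  from assms(3) show ?case
  proof (induction rule: transl.induct)
    case (gen m y)
    show ?case
      using transl.gen[of s "n + m" "br x y"] assms(1)
      unfolding ex_br by (simp add: br_scale_left br_scale_right power_int_add mult.commute)
  next
    case (add u v u' v')
    show ?case unfolding br_add_right by (rule transl.add[OF add.IH])
  qed
next
  case (add u v u' v')
  show ?case unfolding br_add_left by (rule transl.add[OF add.IH])
qed

lemma transl_inverse:
  assumes "s \<noteq> 0" "transl s u v"
  shows "transl (inverse s) v u"
  using assms(2)
proof (induction rule: transl.induct)
  case (gen n x)
  show ?case
    using transl.gen[of "inverse s" n "(s powi n) *\<^sub>R x"] assms(1) by (simp add: power_int_inverse)
next
  case (add u v u' v')
  show ?case by (rule transl.add[OF add.IH])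
qed

lemma transl_deriv: "transl s u v \<Longrightarrow> transl s (deriv_loop u) (deriv_loop v)"
proof (induction rule: transl.induct)
  case (gen n x)
  have d: "deriv_loop (ex n y) = ex n ((of_int n / real l) *\<^sub>R J y)" for y
    unfolding deriv_loop_def by (intro ext vector_derivative_at ex_deriv)
  show ?case
    unfolding d using transl.gen[of s n "(of_int n / real l) *\<^sub>R J x"] by (simp add: J.scaleR mult.commute)
next
  case (add u v u' v')
  have "trig l u" "trig l u'" "trig l v" "trig l v'"
    using add transl_trig transl_left_trig by blast+
  then have "deriv_loop (\<lambda>t. u t + u' t) = (\<lambda>t. deriv_loop u t + deriv_loop u' t)"
    "deriv_loop (\<lambda>t. v t + v' t) = (\<lambda>t. deriv_loop v t + deriv_loop v' t)"
    unfolding deriv_loop_def[of "\<lambda>t. u t + u' t"] deriv_loop_def[of "\<lambda>t. v t + v' t"]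
    by (intro ext vector_derivative_at has_vector_derivative_add; use trig_deriv in blast)+
  then show ?case using transl.add[OF add.IH] by simp
qed

text \<open>\<open>cis t\<close> is the power \<open>z ^ l\<close>, which the substitution
  multiplies by \<open>s ^ l\<close>.\<close>

lemma transl_rotate:
  assumes "s \<noteq> 0" "transl s u v"
  shows "transl s (\<lambda>t. zs (cis t) (u t)) (\<lambda>t. zs (of_real (s ^ l) * cis t) (v t))"
  using assms(2)
proof (induction rule: transl.induct)
  case (gen n x)
  have e: "zs (cis t) (ex n y t) = ex (n + int l) y t" for y t
    using l_pos by (simp add: ex_def zs_mult cis_mult distrib_right add_divide_distrib add.commute)
  have "zs (of_real (s ^ l) * cis t) (ex n (s powi n *\<^sub>R x) t) = ex (n + int l) (s powi (n + int l) *\<^sub>R x) t" for t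
    using assms(1) unfolding zs_mult[symmetric] e by (simp add: zs_real ex_scale power_int_add mult.commute del: of_real_power)
  then show ?case unfolding e using transl.gen[of s "n + int l" x] by simp
next
  case (add u v u' v')
  show ?case unfolding zs_add by (rule transl.add[OF add.IH])
qed

lemma transl_\<sigma>: "transl s u v \<Longrightarrow> transl s (\<lambda>t. \<sigma> (u t)) (\<lambda>t. \<sigma> (v t))"
proof (induction rule: transl.induct)
  case (gen n x)
  show ?case using transl.gen[of s n "\<sigma> x"] by (simp add: ex_def[abs_def] zs_\<sigma> zs_scale \<sigma>.scaleR)
next
  case (add u v u' v')
  show ?case unfolding \<sigma>.add by (rule transl.add[OF add.IH])
qed

lemma transl_shift: "transl s u v \<Longrightarrow> transl s (\<lambda>t. u (t + c)) (\<lambda>t. v (t + c))"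
proof (induction rule: transl.induct)
  case (gen n x)
  have "ex n y (t + c) = ex n (zs (cis (of_int n * c / real l)) y) t" for y t
    by (simp add: ex_def zs_mult cis_mult distrib_left add_divide_distrib)
  then show ?case using transl.gen[of s n "zs (cis (of_int n * c / real l)) x"] by (simp add: zs_scale)
next
  case (add u v u' v')
  show ?case by (rule transl.add[OF add.IH])
qed

text \<open>This is what makes the substitution well defined. After composition with a complex
  linear functional and clearing of denominators, \<open>u\<close> and \<open>v\<close> are the
  values of one polynomial at \<open>z\<close> and at \<open>s * z\<close>; it vanishes on the
  circle, hence identically.\<close>

lemma transl_zero:
  assumes s: "s \<noteq> 0" and T: "transl s u v" and u0: "\<And>t. u t = 0"
  shows "v t = 0"
proof (rule ccontr)
  assume y: "v t \<noteq> 0"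
  obtain h where h: "linear h" "\<And>x. h (J x) = \<i> * h x" "h (v t) = 1"
    by (rule root_functional[OF J_centroid JJ y], rule that)
  have hz: "h (zs z x) = z * h x" for z x
    by (simp add: zs_def linear_add[OF h(1)] linear_cmul[OF h(1)] h(2) complex_eq_iff)
  have hex: "h (ex n x t) = cis (t / real l) powi n * h x" for n x t
    by (simp add: ex_def hz cis_power_int)
  have "\<exists>N p. \<forall>t. cis (t / real l) ^ N * h (u t) = poly p (cis (t / real l))
      \<and> (of_real s * cis (t / real l)) ^ N * h (v t) = poly p (of_real s * cis (t / real l))"
    using T
  proof (induction rule: transl.induct)
    case (gen n x)
    define N where "N = nat \<bar>n\<bar>"
    have N: "z ^ N * z powi n = z ^ nat (int N + n)" if "z \<noteq> 0" for z :: complex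
    proof -
      have "z ^ N * z powi n = z powi (int N + n)" using that by (simp add: power_int_add)
      also have "\<dots> = z ^ nat (int N + n)" by (simp add: power_int_def N_def)
      finally show ?thesis .
    qed
    have "(of_real s * cis (t / real l)) ^ N * h (ex n (s powi n *\<^sub>R x) t) = (of_real s * cis (t / real l)) ^ nat (int N + n) * h x" for t
    proof -
      have "h (ex n (s powi n *\<^sub>R x) t) = (of_real s * cis (t / real l)) powi n * h x"
        by (simp add: hex linear_cmul[OF h(1)] power_int_mult_distrib scaleR_conv_of_real of_real_power_int)
      then show ?thesis using N[of "of_real s * cis (t / real l)"] s by simp
    qed
    moreover have "cis (t / real l) ^ N * h (ex n x t) = cis (t / real l) ^ nat (int N + n) * h x" for t
      using N[of "cis (t / real l)"] by (simp add: hex)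
    ultimately show ?case
      by (intro exI[of _ N] exI[of _ "monom (h x) (nat (int N + n))"]) (simp add: poly_monom mult.commute)
  next
    case (add u v u' v')
    then obtain N p N' p' where
      p: "\<And>t. cis (t / real l) ^ N * h (u t) = poly p (cis (t / real l))" "\<And>t. (of_real s * cis (t / real l)) ^ N * h (v t) = poly p (of_real s * cis (t / real l))" and
      p': "\<And>t. cis (t / real l) ^ N' * h (u' t) = poly p' (cis (t / real l))" "\<And>t. (of_real s * cis (t / real l)) ^ N' * h (v' t) = poly p' (of_real s * cis (t / real l))"
      by blast
    have q: "z ^ (N + N') * (a + b) = z ^ N' * (z ^ N * a) + z ^ N * (z ^ N' * b)" for z a b :: complex
      by (simp add: power_add algebra_simps)
    show ?case
      by (intro exI[of _ "N + N'"] exI[of _ "monom 1 N' * p + monom 1 N * p'"] allI conjI)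
        (simp_all only: linear_add[OF h(1)] q p p' poly_add poly_mult poly_monom mult_1)
  qed
  then obtain N p where p: "\<And>t. cis (t / real l) ^ N * h (u t) = poly p (cis (t / real l))"
    "\<And>t. (of_real s * cis (t / real l)) ^ N * h (v t) = poly p (of_real s * cis (t / real l))" by blast
  have "poly p (cis t) = 0" for t
    using p(1)[of "t * real l"] l_pos by (simp add: u0 linear_0[OF h(1)])
  then have "p = 0" by (rule poly_zero_on_circle)
  then have "(of_real s * cis (t / real l)) ^ N * h (v t) = 0" using p(2)[of t] by simp
  then show False using h(3) s by simp
qed

lemma transl_fun:
  assumes "s \<noteq> 0" "transl s u v" "transl s u v'"
  shows "v = v'"
proof
  fix t
  have "transl s (\<lambda>t. u t + (-1) *\<^sub>R u t) (\<lambda>t. v t + (-1) *\<^sub>R v' t)"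
    by (rule transl.add[OF assms(2) transl_scale[OF assms(3)]])
  from transl_zero[OF assms(1) this, of t] show "v t = v' t" by simp
qed

text \<open>The component of frequency \<open>n + m\<close> of the integrand is multiplied by
  \<open>s powi (n + m)\<close>. Frequency zero is unaffected and all others integrate to zero, over
  \<open>2 * pi * l\<close> since frequencies are multiples of \<open>1 / l\<close>.\<close>

lemma transl_integral:
  assumes s: "s \<noteq> 0" and T: "transl s u v" "transl s u' v'"
  shows "((\<lambda>t. kil (v t) (v' t) - kil (u t) (u' t)) has_integral 0) {0..2 * pi * real l}"
  using T(1)
proof (induction rule: transl.induct)
  case (gen n x)
  from T(2) show ?case
  proof (induction rule: transl.induct)
    case (gen m y)
    have k: "kil (ex n a t) (ex m b t) = cos (of_int (n + m) / real l * t) * kil a b + sin (of_int (n + m) / real l * t) * kil (J a) b" for a b t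
    proof -
      have z: "kil (zs z a) (zs w b) = Re (z * w) * kil a b + Im (z * w) * kil (J a) b" for z w
        by (simp add: zs_def kil_add_left kil_add_right kil_scale_left kil_scale_right kil_scale_right[of _ "-1", simplified] kil_scale_left[of "-1", simplified]
            linear_diff[OF lin_kil(2)] J_kil[symmetric] J.add J.scaleR algebra_simps)
      show ?thesis
        unfolding ex_def z cis_mult by (simp add: distrib_right add_divide_distrib)
    qed
    have sc: "kil (ex n (s powi n *\<^sub>R x) t) (ex m (s powi m *\<^sub>R y) t) = s powi (n + m) * kil (ex n x t) (ex m y t)" for t
      using s by (simp add: ex_scale kil_scale_left kil_scale_right power_int_add)
    show ?case
    proof (cases "n + m = 0")
      case True
      then show ?thesis unfolding sc by simp
    next
      case False
      define k where "k = of_int (n + m) / real l"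
      have k0: "k \<noteq> 0" using False l_pos by (simp add: k_def)
      have kl: "k * (2 * pi * real l) = 2 * pi * of_int (n + m)" using l_pos by (simp add: k_def)
      have "((\<lambda>t. cos (k * t) * a + sin (k * t) * b) has_integral
        (sin (k * (2 * pi * real l)) / k * a - cos (k * (2 * pi * real l)) / k * b) - (sin (k * 0) / k * a - cos (k * 0) / k * b)) {0..2 * pi * real l}" for a b
        using k0 l_pos by (intro fundamental_theorem_of_calculus)
          (auto intro!: derivative_eq_intros simp: has_real_derivative_iff_has_vector_derivative[symmetric])
      from has_integral_mult_right[OF this, of "s powi (n + m) - 1" "kil x y" "kil (J x) y"]
      show ?thesis
        unfolding sc unfolding k k_def[symmetric] kl cos_int_2pin sin_int_2pin by (simp add: algebra_simps)
    qed
  next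
    case (add u v u' v')
    show ?case using has_integral_add[OF add.IH] by (simp add: kil_add_right algebra_simps)
  qed
next
  case (add u v u' v')
  show ?case using has_integral_add[OF add.IH] by (simp add: kil_add_left algebra_simps)
qed

end

text \<open>The increment of an antiderivative over a period is constant, so the integral over
  \<open>2 * pi * l\<close> is \<open>l\<close> times that over one period.\<close>

lemma integral_period_multiple:
  fixes K :: "real \<Rightarrow> real"
  assumes K: "trig l K" "0 < l" "\<And>t. K (t + 2 * pi) = K t" and I: "(K has_integral 0) {0..2 * pi * real l}"
  shows "integral {0..2 * pi} K = 0"
proof -
  obtain Q where Q: "\<And>t. (Q has_real_derivative K t) (at t)"
    using trig_antiderivative[OF K(1,2)] unfolding has_real_derivative_iff_has_vector_derivative by blast
  have "((\<lambda>t. Q (t + 2 * pi) - Q t) has_real_derivative 0) (at t)" for t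
  proof -
    have "((\<lambda>t. Q (t + 2 * pi)) has_real_derivative K (t + 2 * pi)) (at t)"
      using DERIV_shift Q by blast
    from DERIV_diff[OF this Q[of t]] show ?thesis using K(3) by simp
  qed
  then have const: "Q (x + 2 * pi) - Q x = Q (0 + 2 * pi) - Q 0" for x
    using DERIV_isconst_all by blast
  have mult: "Q (2 * pi * real k) - Q 0 = real k * (Q (2 * pi) - Q 0)" for k
  proof (induction k)
    case (Suc k)
    have "2 * pi * real (Suc k) = 2 * pi * real k + 2 * pi" by (simp add: algebra_simps)
    then show ?case using const[of "2 * pi * real k"] Suc by (simp add: algebra_simps)
  qed simp
  have int: "(K has_integral Q b - Q 0) {0..b}" if "0 \<le> b" for b
    using that Q by (intro fundamental_theorem_of_calculus)
      (auto simp: has_real_derivative_iff_has_vector_derivative intro: has_vector_derivative_at_within)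
  have "Q (2 * pi * real l) - Q 0 = 0" using has_integral_unique[OF int I] by simp
  then have "Q (2 * pi) - Q 0 = 0" using mult[of l] K(2) by simp
  then show ?thesis using integral_unique[OF int[of "2 * pi"]] by simp
qed

context loop_alg
begin

lemma kil_\<sigma>: "kil (\<sigma> x) (\<sigma> y) = kil x y"
proof -
  have "bij \<sigma>" by (rule o_bij[of \<tau>]) (auto simp: \<sigma>\<tau> \<tau>\<sigma>)
  moreover have "Vector_Spaces.linear scaleR scaleR \<sigma>" using \<sigma>_linear by (simp add: linear_def)
  ultimately show ?thesis
    by (intro killing_iso[of scaleR br scaleR br \<sigma>, OF fd_lie_axioms fd_lie_axioms] \<sigma>_br)
qed

lemma kil_loops: "u \<in> L \<Longrightarrow> v \<in> L \<Longrightarrow> trig l (\<lambda>t. kil (u t) (v t))"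
  "u \<in> L \<Longrightarrow> v \<in> L \<Longrightarrow> kil (u (t + 2 * pi)) (v (t + 2 * pi)) = kil (u t) (v t)"
  by (rule trig_bilinear[OF lin_kil L_trig L_trig]) (simp_all add: L_twist kil_\<sigma>)

end

section \<open>The substitution as an isometric automorphism of the twisted loops\<close>

context loop_alg_root
begin

lemma J_L: "u \<in> L \<Longrightarrow> (\<lambda>t. J (u t)) \<in> L"
  by (rule LI) (simp add: L_twist J\<sigma>, rule trig_linear[OF J.linear_axioms L_trig])

lemma zs_L: "u \<in> L \<Longrightarrow> (\<lambda>t. zs z (u t)) \<in> L"
  by (rule LI) (simp add: L_twist zs_\<sigma>, rule trig_linear[OF zs_linear L_trig])

lemma zs_cis_L: "e = 1 \<or> e = -1 \<Longrightarrow> u \<in> L \<Longrightarrow> (\<lambda>t. zs (cis (e * t + c)) (u t)) \<in> L"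
  unfolding zs_def cis.sel by (rule L_add[OF L_cos_affine(1) L_cos_affine(2)[OF _ J_L]])

lemma zs_inj: "zs z y = zs w y \<Longrightarrow> y \<noteq> 0 \<Longrightarrow> z = w"
  using root_independent[OF J_centroid JJ, of "Re z" y "Im z" "Re w" "Im w"] by (simp add: zs_def complex_eq_iff)

lemma transl_J: "transl s u v \<Longrightarrow> transl s (\<lambda>t. J (u t)) (\<lambda>t. J (v t))"
proof (induction rule: transl.induct)
  case (gen n x)
  have "J (ex n y t) = ex n (J y) t" for y t by (simp add: ex_def zs_def J.add J.scaleR)
  then show ?case using transl.gen[of s n "J x"] by (simp add: J.scaleR)
next
  case (add u v u' v')
  show ?case unfolding J.add by (rule transl.add[OF add.IH])
qed

definition rho :: "real \<Rightarrow> (real \<Rightarrow> 'a) \<Rightarrow> (real \<Rightarrow> 'a)" where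
  "rho s u = (THE v. transl s u v)"

lemma rho_transl: "s \<noteq> 0 \<Longrightarrow> trig l u \<Longrightarrow> transl s u (rho s u)"
  unfolding rho_def using transl_total[of u s] transl_fun by (metis (no_types, lifting) theI)

lemma rho_eq: "s \<noteq> 0 \<Longrightarrow> transl s u v \<Longrightarrow> rho s u = v"
  using rho_transl[OF _ transl_left_trig] transl_fun by blast

lemma rho_L:
  assumes "s \<noteq> 0" "u \<in> L"
  shows "rho s u \<in> L"
proof (rule LI)
  have T: "transl s u (rho s u)" by (rule rho_transl[OF assms(1) L_trig[OF assms(2)]])
  then show "trig l (rho s u)" by (rule transl_trig)
  have "transl s (\<lambda>t. \<sigma> (u t)) (\<lambda>t. rho s u (t + 2 * pi))"
    using transl_shift[OF T, of "2 * pi"] by (simp add: L_twist[OF assms(2)])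
  from transl_fun[OF assms(1) this transl_\<sigma>[OF T]]
  show "rho s u (t + 2 * pi) = \<sigma> (rho s u t)" for t by metis
qed

lemma rho_inverse: "s \<noteq> 0 \<Longrightarrow> u \<in> L \<Longrightarrow> rho (inverse s) (rho s u) = u"
  by (rule rho_eq[OF _ transl_inverse[OF _ rho_transl]]) (simp_all add: L_trig)

lemma rho_iso:
  assumes "s \<noteq> 0"
  shows "loop_iso br \<sigma> l br \<sigma> l (rho s)"
proof unfold_locales
  note T = rho_transl[OF assms L_trig]
  show "bij_betw (rho s) L L"
    using rho_inverse[OF assms] rho_inverse[of "inverse s"] rho_L[of s] rho_L[of "inverse s"] assms
    by (intro bij_betw_byWitness[of _ "rho (inverse s)"]) auto
  show "rho s (\<lambda>t. u t + v t) = (\<lambda>t. rho s u t + rho s v t)" if "u \<in> L" "v \<in> L" for u v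
    by (rule rho_eq[OF assms transl.add[OF T[OF that(1)] T[OF that(2)]]])
  show "rho s (\<lambda>t. c *\<^sub>R u t) = (\<lambda>t. c *\<^sub>R rho s u t)" if "u \<in> L" for u c
    by (rule rho_eq[OF assms transl_scale[OF T[OF that]]])
  show "rho s (\<lambda>t. br (u t) (v t)) = (\<lambda>t. br (rho s u t) (rho s v t))" if "u \<in> L" "v \<in> L" for u v
    by (rule rho_eq[OF assms transl_bracket[OF assms T[OF that(1)] T[OF that(2)]]])
qed

lemma rho_integral:
  assumes "s \<noteq> 0" "u \<in> L" "v \<in> L"
  shows "integral {0..2 * pi} (\<lambda>t. kil (rho s u t) (rho s v t)) = integral {0..2 * pi} (\<lambda>t. kil (u t) (v t))"
proof -
  have r: "rho s u \<in> L" "rho s v \<in> L" by (rule rho_L[OF assms(1)], fact)+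
  have "integral {0..2 * pi} (\<lambda>t. kil (rho s u t) (rho s v t) - kil (u t) (v t)) = 0"
    by (rule integral_period_multiple[OF trig_diff[OF kil_loops(1)[OF r] kil_loops(1)[OF assms(2,3)]] l_pos _
          transl_integral[OF assms(1) rho_transl[OF assms(1) L_trig] rho_transl[OF assms(1) L_trig]]])
      (simp_all add: kil_loops(2) r assms)
  moreover have "integral {0..2 * pi} (\<lambda>t. kil (rho s u t) (rho s v t) - kil (u t) (v t))
    = integral {0..2 * pi} (\<lambda>t. kil (rho s u t) (rho s v t)) - integral {0..2 * pi} (\<lambda>t. kil (u t) (v t))"
    by (intro Henstock_Kurzweil_Integration.integral_diff integrable_continuous_interval trig_continuous[OF kil_loops(1)] r assms)
  ultimately show ?thesis by simp
qed

end

section \<open>Isomorphisms in the presence of a complex structure\<close>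

context loop_iso
begin

text \<open>The transported \<open>J\<close> is a family of square roots of \<open>-1\<close> in the
  centroid, each equal to \<open>K\<close> or \<open>- K\<close> with \<open>K\<close> its member at
  zero. Continuity rules out a change of sign, and the twist of the family then becomes commutation
  of \<open>K\<close> with \<open>\<sigma>'\<close>.\<close>

lemma root_transport:
  assumes "A.commuting_root J"
  obtains J' where "B.commuting_root J'" "\<And>u. u \<in> A.L \<Longrightarrow> \<phi> (\<lambda>t. J (u t)) = (\<lambda>t. J' (\<phi> u t))"
proof -
  interpret R: loop_alg_root br \<sigma> l J by unfold_locales (rule assms)
  have "A.loop_centroid (\<lambda>u t. J (u t))"
    by (simp add: A.loop_centroid_def R.J_L R.J.add R.J.scaleR R.J_br_left)
  from B.loop_centroid_pointwise[OF transport_centroid[OF this]]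
  obtain F where F: "\<And>v t. v \<in> B.L \<Longrightarrow> \<phi> (\<lambda>t. J (\<psi> v t)) t = F t (v t)" "\<And>t. F t \<in> B.centroid"
    "\<And>t x. F (t + 2 * pi) (\<sigma>' x) = \<sigma>' (F t x)" "\<And>x. trig l' (\<lambda>t. F t x)" by blast
  have FF: "F t (F t x) = - x" for t x
  proof -
    let ?v = "B.sec t x" and ?F = "\<lambda>v. \<phi> (\<lambda>t. J (\<psi> v t))"
    have in1: "(\<lambda>t. J (\<psi> ?v t)) \<in> A.L" by (rule R.J_L[OF \<psi>_in[OF B.sec_in_L]])
    have "?F (?F ?v) = \<phi> (\<lambda>t. (-1) *\<^sub>R \<psi> ?v t)" by (simp add: \<psi>\<phi>[OF in1])
    also have "\<dots> = (\<lambda>t. - ?v t)" using scale[OF \<psi>_in[OF B.sec_in_L], of "-1"] by (simp add: \<phi>\<psi>[OF B.sec_in_L])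
    finally have "?F (?F ?v) t = - x" by (simp add: B.sec_eval)
    moreover have "?F (?F ?v) t = F t (F t x)"
      using F(1)[OF \<phi>_in[OF in1], of t] F(1)[OF B.sec_in_L, of t x t] by (simp add: B.sec_eval)
    ultimately show ?thesis by simp
  qed
  obtain y :: 'b where y: "y \<noteq> 0" using B.nonabelian by blast
  define K where "K = F 0"
  have K: "K \<in> B.centroid" "\<And>x. K (K x) = - x" by (simp_all add: K_def F(2) FF)
  have Kl: "linear K" using B.centroidD(1)[OF K(1)] by (simp add: linear_def)
  obtain h where h: "linear h" "\<And>x. h (K x) = \<i> * h x" "h y = 1" by (rule B.root_functional[OF K y], rule that)
  \<comment> \<open>The sign of \<open>F t\<close> relative to \<open>K\<close>, either
    \<open>1\<close> or \<open>-1\<close>; as a continuous function it cannot jump over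
    zero.\<close>
  define g where "g t = Im (h (F t y))" for t
  have FK: "F t = K \<or> F t = (\<lambda>x. - K x)" for t
    by (rule B.centroid_root_unique[OF K(1) F(2) K(2) FF])
  have g1: "g t = 1 \<and> F t = K \<or> g t = -1 \<and> F t = (\<lambda>x. - K x)" for t
  proof -
    have hK: "h (K y) = \<i>" by (simp add: h)
    from FK[of t] show ?thesis
    proof
      assume "F t = K"
      then show ?thesis by (simp add: g_def hK)
    next
      assume "F t = (\<lambda>x. - K x)"
      then show ?thesis by (simp add: g_def hK linear_neg[OF h(1)])
    qed
  qed
  have "continuous_on UNIV (\<lambda>t. h (F t y))"
    by (rule trig_continuous[OF trig_linear[OF h(1) F(4)]])
  then have cont: "continuous_on S g" for S
    unfolding g_def using continuous_on_Im continuous_on_subset by blast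
  have "g 0 = 1" by (simp add: g_def K_def[symmetric] h)
  have "F t = K" for t
  proof (rule ccontr)
    assume "F t \<noteq> K"
    then have "g t = -1" using g1 by blast
    have "connected (g ` UNIV)" by (rule connected_continuous_image[OF cont connected_UNIV])
    moreover have "-1 \<in> g ` UNIV" "1 \<in> g ` UNIV" using \<open>g t = -1\<close> \<open>g 0 = 1\<close> by (metis rangeI)+
    ultimately have "0 \<in> g ` UNIV" using connectedD_interval[of "g ` UNIV" "-1" 1 0] by simp
    then obtain t0 where "g t0 = 0" by auto
    then show False using g1[of t0] by auto
  qed
  then have "B.commuting_root K"
    unfolding B.commuting_root_def using K F(3)[of 0] by simp
  moreover have "\<phi> (\<lambda>t. J (u t)) = (\<lambda>t. K (\<phi> u t))" if "u \<in> A.L" for u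
    using F(1)[OF \<phi>_in[OF that]] \<open>\<And>t. F t = K\<close> by (auto simp: \<psi>\<phi>[OF that])
  ultimately show ?thesis using that by blast
qed

end

locale loop_iso_root = loop_iso br \<sigma> l br' \<sigma>' l' \<phi> + A: loop_alg_root br \<sigma> l J + B: loop_alg_root br' \<sigma>' l' J'
  for br :: "'a::real_normed_vector \<Rightarrow> 'a \<Rightarrow> 'a" and \<sigma> l
    and br' :: "'b::real_normed_vector \<Rightarrow> 'b \<Rightarrow> 'b" and \<sigma>' l' \<phi> J J' +
  assumes \<phi>J: "u \<in> A.L \<Longrightarrow> \<phi> (\<lambda>t. J (u t)) = (\<lambda>t. J' (\<phi> u t))"
begin

lemma \<phi>_zs: "u \<in> A.L \<Longrightarrow> \<phi> (\<lambda>t. A.zs z (u t)) = (\<lambda>t. B.zs z (\<phi> u t))"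
  unfolding A.zs_def B.zs_def by (simp only: add scale \<phi>J A.L_scale A.J_L)

lemma root_inverse: "loop_iso_root br' \<sigma>' l' br \<sigma> l \<psi> J' J"
proof (rule loop_iso_root.intro[OF inverse B.loop_alg_root_axioms A.loop_alg_root_axioms], unfold_locales)
  fix v assume v: "v \<in> B.L"
  show "\<psi> (\<lambda>t. J' (v t)) = (\<lambda>t. J (\<psi> v t))"
    using \<psi>\<phi>[OF A.J_L[OF \<psi>_in[OF v]]] by (simp add: \<phi>J \<psi>_in v \<phi>\<psi>)
qed

text \<open>Multiplication by \<open>cis t\<close> is invertible in the centroid, so its image is
  multiplication by a unit among the complex trigonometric polynomials. Since \<open>J'\<close>
  commutes with the twist, this unit has period \<open>2 * pi\<close>, which makes its frequency
  integral but leaves the modulus of \<open>a\<close> free.\<close>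

lemma rotation_unit:
  obtains a and m :: int where "a \<noteq> 0" "\<And>u. u \<in> A.L \<Longrightarrow> \<phi> (\<lambda>t. A.zs (cis t) (u t)) = (\<lambda>t. B.zs (a * cis (of_int m * t)) (\<phi> u t))"
proof -
  have cisL: "u \<in> A.L \<Longrightarrow> (\<lambda>t. A.zs (cis t) (u t)) \<in> A.L" "u \<in> A.L \<Longrightarrow> (\<lambda>t. A.zs (cis (- t)) (u t)) \<in> A.L" for u
    using A.zs_cis_L[of 1 u 0] A.zs_cis_L[of "-1" u 0] by simp_all
  have cent: "A.loop_centroid (\<lambda>u t. A.zs (cis t) (u t))" "A.loop_centroid (\<lambda>u t. A.zs (cis (- t)) (u t))"
    using cisL A.zs_br[of _ _ 1] by (simp_all add: A.loop_centroid_def A.zs_add A.zs_scale)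
  obtain F where F: "\<And>v t. v \<in> B.L \<Longrightarrow> \<phi> (\<lambda>t. A.zs (cis t) (\<psi> v t)) t = F t (v t)" "\<And>t. F t \<in> B.centroid"
    "\<And>t x. F (t + 2 * pi) (\<sigma>' x) = \<sigma>' (F t x)" "\<And>x. trig l' (\<lambda>t. F t x)"
    using B.loop_centroid_pointwise[OF transport_centroid[OF cent(1)]] by blast
  obtain G where G: "\<And>v t. v \<in> B.L \<Longrightarrow> \<phi> (\<lambda>t. A.zs (cis (- t)) (\<psi> v t)) t = G t (v t)" "\<And>t. G t \<in> B.centroid"
    "\<And>t x. G (t + 2 * pi) (\<sigma>' x) = \<sigma>' (G t x)" "\<And>x. trig l' (\<lambda>t. G t x)"
    using B.loop_centroid_pointwise[OF transport_centroid[OF cent(2)]] by blast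
  have FG: "F t (G t x) = x" for t x
  proof -
    let ?v = "B.sec t x"
    have p: "\<psi> ?v \<in> A.L" by (rule \<psi>_in[OF B.sec_in_L])
    have "\<phi> (\<lambda>t. A.zs (cis t) (\<psi> (\<phi> (\<lambda>t. A.zs (cis (- t)) (\<psi> ?v t))) t)) = ?v"
      using \<psi>\<phi>[OF cisL(2)[OF p]] by (simp add: A.zs_mult cis_mult \<phi>\<psi>[OF B.sec_in_L])
    then have "F t (\<phi> (\<lambda>t. A.zs (cis (- t)) (\<psi> ?v t)) t) = ?v t"
      using F(1)[OF \<phi>_in[OF cisL(2)[OF p]], of t] by simp
    then show ?thesis using G(1)[OF B.sec_in_L, of t x t] by (simp add: B.sec_eval)
  qed
  obtain y :: 'b where y: "y \<noteq> 0" using B.nonabelian by blast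
  obtain h where h: "linear h" "\<And>x. h (J' x) = \<i> * h x" "h y = 1" by (rule B.root_functional[OF B.J_centroid B.JJ y], rule that)
  have hz: "h (B.zs z x) = z * h x" for z x
    by (simp add: B.zs_def linear_add[OF h(1)] linear_cmul[OF h(1)] h(2) complex_eq_iff)
  have rep: "H = B.zs (h (H y))" if H: "H \<in> B.centroid" for H
  proof -
    obtain z where z: "\<And>x. H x = Re z *\<^sub>R x + Im z *\<^sub>R J' x" by (rule B.centroid_in_root[OF B.J_centroid B.JJ H], rule that)
    then have "H = B.zs z" by (auto simp: B.zs_def)
    then show ?thesis by (simp add: hz h(3))
  qed
  define f where "f t = h (F t y)" for t
  define g where "g t = h (G t y)" for t
  have Ff: "F t = B.zs (f t)" and Gg: "G t = B.zs (g t)" for t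
    unfolding f_def g_def by (rule rep[OF F(2)] rep[OF G(2)])+
  have "f t * g t = 1" for t
    using FG[of t y] B.zs_inj[of "f t * g t" y 1] y by (simp add: Ff Gg B.zs_mult)
  moreover have "trig l' f" "trig l' g" unfolding f_def g_def by (rule trig_linear[OF h(1) F(4)] trig_linear[OF h(1) G(4)])+
  ultimately obtain a k where a: "a \<noteq> 0" "\<And>t. f t = a * cis (of_int k * t / real l')"
    using trig_unit[OF B.l_pos] by metis
  have "B.zs (f (0 + 2 * pi)) (\<sigma>' y) = B.zs (f 0) (\<sigma>' y)"
    using F(3)[of 0 y] by (simp add: Ff B.zs_\<sigma>)
  then have "f (0 + 2 * pi) = f 0" by (rule B.zs_inj[OF _ B.\<sigma>_nz[OF y]])
  then have "cis (2 * pi * of_int k / real l') = 1" using a(1) by (simp add: a(2) mult.commute)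
  then obtain m where m: "k = int l' * m" using cis_frac_eq_1[OF B.l_pos] by blast
  have "\<phi> (\<lambda>t. A.zs (cis t) (u t)) = (\<lambda>t. B.zs (a * cis (of_int m * t)) (\<phi> u t))" if u: "u \<in> A.L" for u
    using F(1)[OF \<phi>_in[OF u]] B.l_pos by (auto simp: \<psi>\<phi>[OF u] Ff a(2) m)
  then show ?thesis using that a(1) by blast
qed

lemma rotation_inverse:
  assumes "\<And>u. u \<in> A.L \<Longrightarrow> \<phi> (\<lambda>t. A.zs (cis t) (u t)) = (\<lambda>t. B.zs (f t) (\<phi> u t))" "\<And>t. f t \<noteq> 0" "u \<in> A.L"
  shows "\<phi> (\<lambda>t. A.zs (cis (- t)) (u t)) = (\<lambda>t. B.zs (inverse (f t)) (\<phi> u t))"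
proof -
  have L: "(\<lambda>t. A.zs (cis (- t)) (u t)) \<in> A.L" using A.zs_cis_L[of "-1" u 0] assms(3) by simp
  have "(\<lambda>t. B.zs (f t) (\<phi> (\<lambda>t. A.zs (cis (- t)) (u t)) t)) = \<phi> u"
    using assms(1)[OF L] by (simp add: A.zs_mult cis_mult)
  then have "\<phi> u t = B.zs (f t) (\<phi> (\<lambda>t. A.zs (cis (- t)) (u t)) t)" for t by metis
  then show ?thesis using assms(2) by (simp add: B.zs_mult)
qed

lemma rotation_powers:
  assumes f: "\<And>u. u \<in> A.L \<Longrightarrow> \<phi> (\<lambda>t. A.zs (cis t) (u t)) = (\<lambda>t. B.zs (f t) (\<phi> u t))" "\<And>t. f t \<noteq> 0" and u: "u \<in> A.L"
  shows "\<phi> (\<lambda>t. A.zs (cis (real k * t)) (u t)) = (\<lambda>t. B.zs (f t ^ k) (\<phi> u t))"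
    "\<phi> (\<lambda>t. A.zs (cis (- (real k * t))) (u t)) = (\<lambda>t. B.zs (inverse (f t) ^ k) (\<phi> u t))"
proof -
  have cisL: "u \<in> A.L \<Longrightarrow> (\<lambda>t. A.zs (cis t) (u t)) \<in> A.L" "u \<in> A.L \<Longrightarrow> (\<lambda>t. A.zs (cis (- t)) (u t)) \<in> A.L" for u
    using A.zs_cis_L[of 1 u 0] A.zs_cis_L[of "-1" u 0] by simp_all
  have "(\<lambda>t. A.zs (cis (real k * t)) (u t)) \<in> A.L \<and> (\<lambda>t. A.zs (cis (- (real k * t))) (u t)) \<in> A.L
    \<and> \<phi> (\<lambda>t. A.zs (cis (real k * t)) (u t)) = (\<lambda>t. B.zs (f t ^ k) (\<phi> u t))
    \<and> \<phi> (\<lambda>t. A.zs (cis (- (real k * t))) (u t)) = (\<lambda>t. B.zs (inverse (f t) ^ k) (\<phi> u t))"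
  proof (induction k)
    case 0
    then show ?case using u by (simp add: cis_zero)
  next
    case (Suc k)
    have e: "A.zs (cis (real (Suc k) * t)) x = A.zs (cis t) (A.zs (cis (real k * t)) x)"
      "A.zs (cis (- (real (Suc k) * t))) x = A.zs (cis (- t)) (A.zs (cis (- (real k * t))) x)" for t x
      by (simp_all add: A.zs_mult cis_mult algebra_simps)
    show ?case unfolding e
      using Suc.IH cisL f(1) rotation_inverse[OF f] by (simp add: B.zs_mult)
  qed
  then show "\<phi> (\<lambda>t. A.zs (cis (real k * t)) (u t)) = (\<lambda>t. B.zs (f t ^ k) (\<phi> u t))"
    "\<phi> (\<lambda>t. A.zs (cis (- (real k * t))) (u t)) = (\<lambda>t. B.zs (inverse (f t) ^ k) (\<phi> u t))" by blast+
qed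

text \<open>Applied to \<open>\<phi>\<close> and to its inverse, \<open>rotation_unit\<close> gives
  \<open>cis t = C * cis (k * m * t)\<close>; at \<open>t = 0\<close> this yields
  \<open>C = 1\<close>, and \<open>frequency_pm1\<close> applies to \<open>k * m\<close>.\<close>

lemma rotation_unit_pm1:
  obtains a and m :: int where "a \<noteq> 0" "\<bar>m\<bar> = 1"
    "\<And>u. u \<in> A.L \<Longrightarrow> \<phi> (\<lambda>t. A.zs (cis t) (u t)) = (\<lambda>t. B.zs (a * cis (of_int m * t)) (\<phi> u t))"
proof -
  interpret inv: loop_iso_root br' \<sigma>' l' br \<sigma> l \<psi> J' J by (rule root_inverse)
  obtain a m where a: "a \<noteq> 0" and am: "\<And>u. u \<in> A.L \<Longrightarrow> \<phi> (\<lambda>t. A.zs (cis t) (u t)) = (\<lambda>t. B.zs (a * cis (of_int m * t)) (\<phi> u t))"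
    by (rule rotation_unit, rule that)
  obtain b k where b: "b \<noteq> 0" and bk: "\<And>v. v \<in> B.L \<Longrightarrow> \<psi> (\<lambda>t. B.zs (cis t) (v t)) = (\<lambda>t. A.zs (b * cis (of_int k * t)) (\<psi> v t))"
    by (rule inv.rotation_unit, rule that)
  obtain y :: 'b where y: "y \<noteq> 0" using B.nonabelian by blast
  have nz: "a * cis (of_int m * t) \<noteq> 0" for t using a by simp
  define n where "n = nat \<bar>k\<bar>"
  have pw: "\<phi> (\<lambda>t. A.zs (cis (of_int k * t)) (u t))
    = (\<lambda>t. B.zs ((if k \<ge> 0 then a ^ n else inverse a ^ n) * cis (of_int (k * m) * t)) (\<phi> u t))" if u: "u \<in> A.L" for u
  proof (cases "k \<ge> 0")
    case True
    then have "real_of_int k = real n" by (simp add: n_def)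
    moreover have "(a * cis (of_int m * t)) ^ n = a ^ n * cis (of_int (k * m) * t)" for t
      using True by (simp add: power_mult_distrib Complex.DeMoivre n_def mult.assoc)
    ultimately show ?thesis using rotation_powers(1)[OF am nz u, of n] True by simp
  next
    case False
    then have "real_of_int k = - real n" by (simp add: n_def)
    moreover have "inverse (a * cis (of_int m * t)) ^ n = inverse a ^ n * cis (of_int (k * m) * t)" for t
      using False by (simp add: power_mult_distrib Complex.DeMoivre cis_inverse n_def mult.assoc)
    ultimately show ?thesis using rotation_powers(2)[OF am nz u, of n] False by simp
  qed
  define C where "C = b * (if k \<ge> 0 then a ^ n else inverse a ^ n)"
  have key: "cis t = C * cis (of_int (k * m) * t)" for t
  proof -
    let ?v = "B.sec t y"
    have v: "?v \<in> B.L" and p: "\<psi> ?v \<in> A.L" by (rule B.sec_in_L, rule \<psi>_in[OF B.sec_in_L])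
    have L: "(\<lambda>t. B.zs (cis t) (?v t)) \<in> B.L" using B.zs_cis_L[of 1 ?v 0] v by simp
    have L2: "(\<lambda>t. A.zs (cis (of_int k * t)) (\<psi> ?v t)) \<in> A.L"
    proof -
      have "(\<lambda>t. A.zs (b * cis (of_int k * t)) (\<psi> ?v t)) \<in> A.L" unfolding bk[OF v, symmetric] by (rule \<psi>_in[OF L])
      from A.zs_L[OF this, of "inverse b"] show ?thesis using b by (simp add: A.zs_mult mult.assoc[symmetric])
    qed
    have "(\<lambda>t. B.zs (cis t) (?v t)) = \<phi> (\<lambda>t. A.zs (b * cis (of_int k * t)) (\<psi> ?v t))"
      using \<phi>\<psi>[OF L] bk[OF v] by simp
    also have "\<dots> = \<phi> (\<lambda>t. A.zs b (A.zs (cis (of_int k * t)) (\<psi> ?v t)))" by (simp add: A.zs_mult)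
    also have "\<dots> = (\<lambda>t. B.zs (C * cis (of_int (k * m) * t)) (?v t))"
      by (simp only: \<phi>_zs[OF L2] pw[OF p] \<phi>\<psi>[OF v] B.zs_mult C_def mult.assoc)
    finally have "B.zs (cis t) (?v t) = B.zs (C * cis (of_int (k * m) * t)) (?v t)" by metis
    then show ?thesis using B.zs_inj y by (simp add: B.sec_eval)
  qed
  have "C = 1" using key[of 0] by (simp add: cis_zero)
  then have "cos (of_int (k * m) * t + 0) = cos t" for t :: real
    using arg_cong[OF key[of t], of Re] by simp
  then have "\<bar>k * m\<bar> = 1" by (rule frequency_pm1)
  then have "\<bar>m\<bar> = 1" by (metis abs_mult abs_zmult_eq_1 mult.commute)
  then show ?thesis using that a am by blast
qed

lemma unit_rotation_reparam:
  assumes "\<And>u. u \<in> A.L \<Longrightarrow> \<phi> (\<lambda>t. A.zs (cis t) (u t)) = (\<lambda>t. B.zs (cis (\<theta> t)) (\<phi> u t))" and u: "u \<in> A.L"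
  shows "\<phi> (\<lambda>t. cos t *\<^sub>R u t) = (\<lambda>t. cos (\<theta> t) *\<^sub>R \<phi> u t)" "\<phi> (\<lambda>t. sin t *\<^sub>R u t) = (\<lambda>t. sin (\<theta> t) *\<^sub>R \<phi> u t)"
proof -
  have cisL: "(\<lambda>t. A.zs (cis t) (u t)) \<in> A.L" "(\<lambda>t. A.zs (cis (- t)) (u t)) \<in> A.L"
    using A.zs_cis_L[of 1 u 0] A.zs_cis_L[of "-1" u 0] u by simp_all
  have m: "\<phi> (\<lambda>t. A.zs (cis (- t)) (u t)) = (\<lambda>t. B.zs (cis (- \<theta> t)) (\<phi> u t))"
    using rotation_inverse[OF assms(1) _ u] by (simp add: cis_inverse)
  have c: "cos x *\<^sub>R y = A.zs (1 / 2) (A.zs (cis x) y + A.zs (cis (- x)) y)"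
    and s: "sin x *\<^sub>R y = A.zs (- \<i> / 2) (A.zs (cis x) y + A.zs (-1) (A.zs (cis (- x)) y))" for x y
    by (simp_all add: A.zs_def A.J.add A.J.scaleR A.J.neg A.J.diff algebra_simps flip: scaleR_add_left)
  have c': "cos x *\<^sub>R y = B.zs (1 / 2) (B.zs (cis x) y + B.zs (cis (- x)) y)"
    and s': "sin x *\<^sub>R y = B.zs (- \<i> / 2) (B.zs (cis x) y + B.zs (-1) (B.zs (cis (- x)) y))" for x y
    by (simp_all add: B.zs_def B.J.add B.J.scaleR B.J.neg B.J.diff algebra_simps flip: scaleR_add_left)
  show "\<phi> (\<lambda>t. cos t *\<^sub>R u t) = (\<lambda>t. cos (\<theta> t) *\<^sub>R \<phi> u t)" "\<phi> (\<lambda>t. sin t *\<^sub>R u t) = (\<lambda>t. sin (\<theta> t) *\<^sub>R \<phi> u t)"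
    unfolding c s c' s' by (simp_all only: \<phi>_zs add A.L_add A.zs_L cisL m assms(1)[OF u])
qed

end

lemma (in loop_iso) compose_iso:
  assumes "loop_iso br' \<sigma>' l' br' \<sigma>' l' \<rho>"
  shows "loop_iso br \<sigma> l br' \<sigma>' l' (\<lambda>u. \<rho> (\<phi> u))"
proof unfold_locales
  interpret r: loop_iso br' \<sigma>' l' br' \<sigma>' l' \<rho> by (rule assms)
  show "bij_betw (\<lambda>u. \<rho> (\<phi> u)) A.L B.L" using bij_betw_trans[OF bij r.bij] by (simp add: comp_def)
  show "\<rho> (\<phi> (\<lambda>t. u t + v t)) = (\<lambda>t. \<rho> (\<phi> u) t + \<rho> (\<phi> v) t)" if "u \<in> A.L" "v \<in> A.L" for u v
    using that by (simp add: add r.add \<phi>_in)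
  show "\<rho> (\<phi> (\<lambda>t. c *\<^sub>R u t)) = (\<lambda>t. c *\<^sub>R \<rho> (\<phi> u) t)" if "u \<in> A.L" for u c
    using that by (simp add: scale r.scale \<phi>_in)
  show "\<rho> (\<phi> (\<lambda>t. br (u t) (v t))) = (\<lambda>t. br' (\<rho> (\<phi> u) t) (\<rho> (\<phi> v) t))" if "u \<in> A.L" "v \<in> A.L" for u v
    using that by (simp add: bracket r.bracket \<phi>_in)
qed

definition (in loop_iso) standard :: "real \<Rightarrow> (real \<Rightarrow> 'b) \<Rightarrow> bool" where
  "standard e w \<longleftrightarrow> (e = 1 \<or> e = -1) \<and> w \<in> B.L
    \<and> (\<forall>u\<in>A.L. \<forall>t. \<phi> (deriv_loop u) t = e *\<^sub>R deriv_loop (\<phi> u) t + br' (w t) (\<phi> u t))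
    \<and> (\<forall>u\<in>A.L. \<forall>v\<in>A.L. integral {0..2 * pi} (\<lambda>t. B.kil (\<phi> u t) (\<phi> v t)) = integral {0..2 * pi} (\<lambda>t. A.kil (u t) (v t)))"

lemma (in loop_iso) reparam_standard:
  assumes e: "e = 1 \<or> e = -1"
    and cs: "\<And>u. u \<in> A.L \<Longrightarrow> \<phi> (\<lambda>t. cos t *\<^sub>R u t) = (\<lambda>t. cos (e * t + c) *\<^sub>R \<phi> u t)"
    and sn: "\<And>u. u \<in> A.L \<Longrightarrow> \<phi> (\<lambda>t. sin t *\<^sub>R u t) = (\<lambda>t. sin (e * t + c) *\<^sub>R \<phi> u t)"
  shows "\<exists>w. standard e w"
proof -
  obtain w where "w \<in> B.L" "\<And>u t. u \<in> A.L \<Longrightarrow> \<phi> (deriv_loop u) t = e *\<^sub>R deriv_loop (\<phi> u) t + br' (w t) (\<phi> u t)"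
    by (rule reparam_derivation[OF e cs sn], assumption, assumption, rule that)
  then show ?thesis using e reparam_integral[OF e cs sn] unfolding standard_def by blast
qed

text \<open>Composition with the translation \<open>B.rho s\<close> makes the multiplier unimodular,
  so \<open>reparam_standard\<close> applies to the composite. As \<open>B.rho s\<close> preserves
  the integrals and commutes with differentiation, both properties return to \<open>\<phi>\<close>,
  with \<open>W\<close> the preimage of \<open>w\<close>.\<close>

lemma (in loop_iso_root) root_standard: "\<exists>e w. standard e w"
proof -
  obtain a m where a: "a \<noteq> 0" and m: "\<bar>m\<bar> = 1"
    and am: "\<And>u. u \<in> A.L \<Longrightarrow> \<phi> (\<lambda>t. A.zs (cis t) (u t)) = (\<lambda>t. B.zs (a * cis (of_int m * t)) (\<phi> u t))"
    by (rule rotation_unit_pm1, rule that)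
  have m1: "m = 1 \<or> m = -1" using m by auto
  \<comment> \<open>\<open>B.rho s\<close> multiplies \<open>cis t\<close> by \<open>s ^ l'\<close>
    and hence \<open>cis (- t)\<close> by its inverse; \<open>s\<close> is chosen so that the factor
    of \<open>cis (m * t)\<close> is \<open>inverse (cmod a)\<close>.\<close>
  define s where "s = root l' (if m = 1 then inverse (cmod a) else cmod a)"
  have sl: "s ^ l' = (if m = 1 then inverse (cmod a) else cmod a)"
    unfolding s_def by (rule real_root_pow_pos2[OF B.l_pos]) simp
  have s0: "s \<noteq> 0" using sl a B.l_pos by (auto split: if_splits simp: power_0_left)
  let ?\<Phi> = "\<lambda>u. B.rho s (\<phi> u)"
  interpret r: loop_iso br' \<sigma>' l' br' \<sigma>' l' "B.rho s" by (rule B.rho_iso[OF s0])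
  interpret r: loop_iso_root br' \<sigma>' l' br' \<sigma>' l' "B.rho s" J' J'
    by unfold_locales (rule B.rho_eq[OF s0 B.transl_J[OF B.rho_transl[OF s0 B.L_trig]]])
  interpret c: loop_iso br \<sigma> l br' \<sigma>' l' ?\<Phi> by (rule compose_iso[OF r.loop_iso_axioms])
  interpret c: loop_iso_root br \<sigma> l br' \<sigma>' l' ?\<Phi> J J'
    by unfold_locales (simp add: \<phi>J r.\<phi>J \<phi>_in)
  have rot: "B.rho s (\<lambda>t. B.zs (cis t) (v t)) = (\<lambda>t. B.zs (of_real (s ^ l') * cis t) (B.rho s v t))" if "v \<in> B.L" for v
    by (rule B.rho_eq[OF s0 B.transl_rotate[OF s0 B.rho_transl[OF s0 B.L_trig[OF that]]]])
  have rotm: "B.rho s (\<lambda>t. B.zs (cis (of_int m * t)) (v t)) = (\<lambda>t. B.zs (of_real (inverse (cmod a)) * cis (of_int m * t)) (B.rho s v t))"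
    if v: "v \<in> B.L" for v
    using m1
  proof
    assume "m = 1"
    then show ?thesis using rot[OF v] sl by simp
  next
    assume m: "m = -1"
    have nz: "of_real (s ^ l') * cis t \<noteq> (0::complex)" for t using s0 by simp
    show ?thesis using r.rotation_inverse[OF rot nz v] sl m by (simp add: cis_inverse del: of_real_power)
  qed
  obtain c where c: "a = of_real (cmod a) * cis c"
    by (metis rcis_cmod_Arg rcis_def)
  have "?\<Phi> (\<lambda>t. A.zs (cis t) (u t)) = (\<lambda>t. B.zs (cis (of_int m * t + c)) (?\<Phi> u t))" if u: "u \<in> A.L" for u
  proof -
    have v: "\<phi> u \<in> B.L" by (rule \<phi>_in[OF u])
    have L: "(\<lambda>t. B.zs (cis (of_int m * t)) (\<phi> u t)) \<in> B.L"
      using B.zs_cis_L[of "of_int m" "\<phi> u" 0] m1 v by auto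
    have key: "a * (of_real (inverse (cmod a)) * cis (of_int m * t)) = cis (of_int m * t + c)" for t
    proof -
      have "a * of_real (inverse (cmod a)) = (of_real (cmod a) * of_real (inverse (cmod a))) * cis c"
        by (subst c) (simp only: mult_ac)
      also have "\<dots> = cis c" using a by simp
      finally have ac: "a * of_real (inverse (cmod a)) = cis c" .
      show ?thesis unfolding mult.assoc[symmetric] ac cis_mult by (simp only: add.commute)
    qed
    have "?\<Phi> (\<lambda>t. A.zs (cis t) (u t)) = B.rho s (\<lambda>t. B.zs a (B.zs (cis (of_int m * t)) (\<phi> u t)))"
      by (simp add: am[OF u] B.zs_mult)
    also have "\<dots> = (\<lambda>t. B.zs (a * (of_real (inverse (cmod a)) * cis (of_int m * t))) (?\<Phi> u t))"
      by (subst r.\<phi>_zs[OF L], subst rotm[OF v]) (simp only: B.zs_mult)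
    also have "\<dots> = (\<lambda>t. B.zs (cis (of_int m * t + c)) (?\<Phi> u t))" by (simp only: key)
    finally show ?thesis .
  qed
  note cs = c.unit_rotation_reparam[OF this]
  have e: "real_of_int m = 1 \<or> real_of_int m = -1" using m1 by auto
  obtain w where w: "c.standard (of_int m) w" using c.reparam_standard[OF e cs] by blast
  have wL: "w \<in> B.L" and wd: "\<And>u t. u \<in> A.L \<Longrightarrow> ?\<Phi> (deriv_loop u) t = of_int m *\<^sub>R deriv_loop (?\<Phi> u) t + br' (w t) (?\<Phi> u t)"
    and wi: "\<And>u v. u \<in> A.L \<Longrightarrow> v \<in> A.L \<Longrightarrow>
      integral {0..2 * pi} (\<lambda>t. B.kil (?\<Phi> u t) (?\<Phi> v t)) = integral {0..2 * pi} (\<lambda>t. A.kil (u t) (v t))"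
    using w unfolding c.standard_def by blast+
  define W where "W = r.\<psi> w"
  have W: "W \<in> B.L" "B.rho s W = w" by (simp_all add: W_def r.\<psi>_in r.\<phi>\<psi> wL)
  have "standard (of_int m) W"
    unfolding standard_def
  proof (intro conjI ballI allI)
    show "real_of_int m = 1 \<or> real_of_int m = -1" by (rule e)
    show "W \<in> B.L" by (rule W(1))
    fix u assume u: "u \<in> A.L"
    have v: "\<phi> u \<in> B.L" by (rule \<phi>_in[OF u])
    have d: "B.rho s (deriv_loop (\<phi> u)) = deriv_loop (?\<Phi> u)"
      by (rule B.rho_eq[OF s0 B.transl_deriv[OF B.rho_transl[OF s0 B.L_trig[OF v]]]])
    have RL: "(\<lambda>t. of_int m *\<^sub>R deriv_loop (\<phi> u) t + br' (W t) (\<phi> u t)) \<in> B.L"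
      by (intro B.L_add B.L_scale B.L_deriv B.L_bracket v W(1))
    have e1: "B.rho s (\<lambda>t. of_int m *\<^sub>R deriv_loop (\<phi> u) t) = (\<lambda>t. of_int m *\<^sub>R deriv_loop (?\<Phi> u) t)"
      unfolding d[symmetric] by (rule r.scale[OF B.L_deriv[OF v]])
    have e2: "B.rho s (\<lambda>t. br' (W t) (\<phi> u t)) = (\<lambda>t. br' (w t) (?\<Phi> u t))"
      unfolding W(2)[symmetric] by (rule r.bracket[OF W(1) v])
    note r.add[OF B.L_scale[OF B.L_deriv[OF v], of "of_int m"] B.L_bracket[OF W(1) v], unfolded e1 e2]
    also have "(\<lambda>t. of_int m *\<^sub>R deriv_loop (?\<Phi> u) t + br' (w t) (?\<Phi> u t)) = B.rho s (\<phi> (deriv_loop u))"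
      by (rule ext) (rule wd[OF u, symmetric])
    finally have "(\<lambda>t. of_int m *\<^sub>R deriv_loop (\<phi> u) t + br' (W t) (\<phi> u t)) = \<phi> (deriv_loop u)"
      by (rule r.bij[THEN bij_betw_imp_inj_on, THEN inj_onD]) (rule RL, rule \<phi>_in[OF A.L_deriv[OF u]])
    then show "\<phi> (deriv_loop u) t = of_int m *\<^sub>R deriv_loop (\<phi> u) t + br' (W t) (\<phi> u t)" for t by metis
    fix v assume v': "v \<in> A.L"
    show "integral {0..2 * pi} (\<lambda>t. B.kil (\<phi> u t) (\<phi> v t)) = integral {0..2 * pi} (\<lambda>t. A.kil (u t) (v t))"
      using B.rho_integral[OF s0 v \<phi>_in[OF v']] wi[OF u v'] by simp
  qed
  then show ?thesis by blast
qed

text \<open>By \<open>root_transport\<close> for \<open>\<phi>\<close> and for its inverse, either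
  both algebras have a commuting root or neither does.\<close>

theorem (in loop_iso) ex_standard: "\<exists>e w. standard e w"
proof (cases "\<exists>J. A.commuting_root J")
  case True
  then obtain J where J: "A.commuting_root J" by blast
  obtain J' where J': "B.commuting_root J'" "\<And>u. u \<in> A.L \<Longrightarrow> \<phi> (\<lambda>t. J (u t)) = (\<lambda>t. J' (\<phi> u t))"
    by (rule root_transport[OF J], rule that)
  interpret loop_iso_root br \<sigma> l br' \<sigma>' l' \<phi> J J'
    by unfold_locales (rule J J')+
  show ?thesis by (rule root_standard)
next
  case False
  interpret inv: loop_iso br' \<sigma>' l' br \<sigma> l \<psi> by (rule inverse)
  have B: "\<not> (\<exists>J. B.commuting_root J)"
    using inv.root_transport False by metis
  obtain e c where "e = 1 \<or> e = -1" "\<And>u. u \<in> A.L \<Longrightarrow> \<phi> (\<lambda>t. cos t *\<^sub>R u t) = (\<lambda>t. cos (e * t + c) *\<^sub>R \<phi> u t)"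
    "\<And>u. u \<in> A.L \<Longrightarrow> \<phi> (\<lambda>t. sin t *\<^sub>R u t) = (\<lambda>t. sin (e * t + c) *\<^sub>R \<phi> u t)"
    by (rule rotation_pm1[OF False B], rule that)
  then show ?thesis using reparam_standard by blast
qed

section \<open>Affine algebras\<close>

text \<open>The scalars \<open>'k\<close> enter through a functional \<open>\<rho>\<close> on \<open>'k\<close> (the identity on the reals, \<open>2 Re\<close> on the complex numbers) that turns the Killing form over
  \<open>'k\<close> into the one over the reals.\<close>

locale floop = loop_alg br \<sigma> "order_of \<sigma>" for br :: "'a::real_normed_vector \<Rightarrow> 'a \<Rightarrow> 'a" and \<sigma> +
  fixes sc :: "'k::{real_normed_field, banach} \<Rightarrow> 'a \<Rightarrow> 'a" and \<rho> :: "'k \<Rightarrow> real"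
  assumes sc_space: "F_vector_space sc" and sc_lie: "lie_algebra sc br" and sc_fin: "fin_dim sc"
    and \<sigma>_sc: "\<sigma> (sc k x) = sc k (\<sigma> x)"
    and \<rho>: "bounded_linear \<rho>" and \<rho>_sep: "(\<And>c. \<rho> (c * z) = 0) \<Longrightarrow> z = 0"
    and \<rho>_killing: "killing scaleR br x y = \<rho> (killing sc br x y)"
begin

sublocale f: fd_lie sc br
  unfolding fd_lie_def fd_space_def fd_space_axioms_def fd_lie_axioms_def
  using sc_space sc_lie sc_fin by (auto simp: F_vector_space_def)

lemma sc_real: "sc (of_real r) x = r *\<^sub>R x"
  using sc_space by (simp add: F_vector_space_def)

lemma sc_linear: "linear (sc k)"
  unfolding linear_iff
  by (simp add: f.scale_right_distrib flip: sc_real)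

lemma kF_linear: "linear (f.kil x)" "linear (\<lambda>x. f.kil x y)"
  by (simp_all add: linear_iff f.kil_add_left f.kil_add_right f.kil_scale_left f.kil_scale_right scaleR_conv_of_real flip: sc_real)

lemma loop_set_eq: "loop_set \<sigma> = L"
  unfolding loop_set_def L_def trig_iff by blast

lemma L_sc: "u \<in> L \<Longrightarrow> (\<lambda>t. sc k (u t)) \<in> L"
  by (rule LI) (simp add: L_twist \<sigma>_sc, rule trig_linear[OF sc_linear L_trig])

lemma deriv_sc: "u \<in> L \<Longrightarrow> deriv_loop (\<lambda>t. sc k (u t)) = (\<lambda>t. sc k (deriv_loop u t))"
  unfolding deriv_loop_def[of "\<lambda>t. sc k (u t)"]
  by (intro ext vector_derivative_at trig_deriv_linear[OF sc_linear L_trig])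

abbreviation "pr \<equiv> loop_pair sc br"

lemma pr_int: "u \<in> L \<Longrightarrow> v \<in> L \<Longrightarrow> (\<lambda>t. f.kil (u t) (v t)) integrable_on {0..2 * pi}"
  by (intro integrable_continuous_interval trig_continuous[OF trig_bilinear[OF kF_linear L_trig L_trig]])

lemma pr_add_left: "u \<in> L \<Longrightarrow> v \<in> L \<Longrightarrow> w \<in> L \<Longrightarrow> pr (\<lambda>t. u t + v t) w = pr u w + pr v w"
  unfolding loop_pair_def f.kil_add_left
  by (subst Henstock_Kurzweil_Integration.integral_add[OF pr_int pr_int]) (simp_all add: distrib_left)

lemma pr_commute: "pr u v = pr v u"
  unfolding loop_pair_def by (subst f.kil_commute) rule

lemma pr_add_right: "u \<in> L \<Longrightarrow> v \<in> L \<Longrightarrow> w \<in> L \<Longrightarrow> pr w (\<lambda>t. u t + v t) = pr w u + pr w v"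
  unfolding pr_commute[of w] by (rule pr_add_left)

lemma pr_scale_left: "u \<in> L \<Longrightarrow> v \<in> L \<Longrightarrow> pr (\<lambda>t. sc k (u t)) v = k * pr u v"
  unfolding loop_pair_def f.kil_scale_left
  using integral_linear[OF pr_int bounded_linear_mult_right[of k], of u v] by (simp add: comp_def mult.left_commute)

lemma pr_scale_right: "u \<in> L \<Longrightarrow> v \<in> L \<Longrightarrow> pr v (\<lambda>t. sc k (u t)) = k * pr v u"
  unfolding pr_commute[of v] by (rule pr_scale_left)

lemma pr_scale_real: "u \<in> L \<Longrightarrow> v \<in> L \<Longrightarrow> pr (\<lambda>t. r *\<^sub>R u t) v = of_real r * pr u v"
  "u \<in> L \<Longrightarrow> v \<in> L \<Longrightarrow> pr v (\<lambda>t. r *\<^sub>R u t) = of_real r * pr v u"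
  using pr_scale_left[of u v "of_real r"] pr_scale_right[of u v "of_real r"] by (simp_all add: sc_real)

lemma pr_assoc: "pr (\<lambda>t. br (u t) (v t)) w = pr u (\<lambda>t. br (v t) (w t))"
  by (simp add: loop_pair_def f.kil_assoc)

lemma \<rho>_pr: "u \<in> L \<Longrightarrow> v \<in> L \<Longrightarrow> \<rho> (pr u v) = integral {0..2 * pi} (\<lambda>t. kil (u t) (v t)) / (2 * pi)"
proof -
  assume uv: "u \<in> L" "v \<in> L"
  interpret \<rho>: bounded_linear \<rho> by (rule \<rho>)
  have "integral {0..2 * pi} (\<lambda>t. kil (u t) (v t)) = \<rho> (integral {0..2 * pi} (\<lambda>t. f.kil (u t) (v t)))"
    unfolding \<rho>_killing using integral_linear[OF pr_int[OF uv] \<rho>] by (simp add: comp_def)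
  then show ?thesis
    unfolding loop_pair_def scaleR_conv_of_real[symmetric] by (simp add: \<rho>.scaleR)
qed

text \<open>An identity in \<open>'k\<close> is tested by the real functionals
  \<open>z \<mapsto> \<rho> (c * z)\<close>, where \<open>c\<close> is moved into the first loop.
  Statements over \<open>'k\<close> thus follow from those over the reals.\<close>

lemma pr_eqI:
  assumes "u \<in> L" "v \<in> L" "u' \<in> L" "v' \<in> L"
    and "\<And>c. integral {0..2 * pi} (\<lambda>t. kil (sc c (u t)) (v t)) = integral {0..2 * pi} (\<lambda>t. kil (sc c (u' t)) (v' t))"
  shows "pr u v = pr u' v'"
proof -
  interpret \<rho>: bounded_linear \<rho> by (rule \<rho>)
  have "\<rho> (c * (pr u v - pr u' v')) = 0" for c
  proof -
    have "\<rho> (c * (pr u v - pr u' v')) = \<rho> (pr (\<lambda>t. sc c (u t)) v) - \<rho> (pr (\<lambda>t. sc c (u' t)) v')"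
      by (simp add: pr_scale_left assms right_diff_distrib \<rho>.diff)
    then show ?thesis by (simp add: \<rho>_pr L_sc assms)
  qed
  then have "pr u v - pr u' v' = 0" by (rule \<rho>_sep)
  then show ?thesis by simp
qed

text \<open>Integration by parts: the boundary terms cancel because the Killing form of two twisted
  loops has period \<open>2 * pi\<close>.\<close>

lemma pr_deriv: "u \<in> L \<Longrightarrow> v \<in> L \<Longrightarrow> pr (deriv_loop u) v = - pr u (deriv_loop v)"
proof -
  assume uv: "u \<in> L" "v \<in> L"
  have "integral {0..2 * pi} (\<lambda>t. kil (sc c (deriv_loop u t)) (v t)) = integral {0..2 * pi} (\<lambda>t. kil (sc c ((-1) *\<^sub>R u t)) (deriv_loop v t))" for c
  proof -
    let ?u = "\<lambda>t. sc c (u t)"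
    have u: "?u \<in> L" by (rule L_sc[OF uv(1)])
    have i: "(\<lambda>t. kil (deriv_loop ?u t) (v t)) integrable_on {0..2 * pi}" "(\<lambda>t. kil (?u t) (deriv_loop v t)) integrable_on {0..2 * pi}"
      by (intro integrable_continuous_interval trig_continuous[OF kil_loops(1)] L_deriv u uv)+
    have "((\<lambda>t. kil (deriv_loop ?u t) (v t) + kil (?u t) (deriv_loop v t)) has_integral
        (kil (?u (2 * pi)) (v (2 * pi)) - kil (?u 0) (v 0))) {0..2 * pi}"
      by (rule fundamental_theorem_of_calculus)
        (simp, rule has_vector_derivative_at_within[OF trig_deriv_bilinear[OF lin_kil L_trig[OF u] L_trig[OF uv(2)]]])
    moreover have "kil (?u (2 * pi)) (v (2 * pi)) = kil (?u 0) (v 0)"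
      using kil_loops(2)[OF u uv(2), of 0] by simp
    ultimately have "integral {0..2 * pi} (\<lambda>t. kil (deriv_loop ?u t) (v t) + kil (?u t) (deriv_loop v t)) = 0"
      by (simp add: integral_unique)
    then have "integral {0..2 * pi} (\<lambda>t. kil (deriv_loop ?u t) (v t)) = - integral {0..2 * pi} (\<lambda>t. kil (?u t) (deriv_loop v t))"
      by (subst (asm) Henstock_Kurzweil_Integration.integral_add[OF i]) simp
    moreover have "kil (sc c ((-1) *\<^sub>R u t)) (deriv_loop v t) = - kil (?u t) (deriv_loop v t)" for t
      using kil_scale_left[of "-1" "?u t" "deriv_loop v t"] by (simp add: linear_neg[OF sc_linear])
    ultimately show ?thesis by (simp add: deriv_sc[OF uv(1)])
  qed
  then have "pr (deriv_loop u) v = pr (\<lambda>t. (-1) *\<^sub>R u t) (deriv_loop v)"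
    by (intro pr_eqI L_deriv L_scale uv)
  then show ?thesis using pr_scale_real(1)[OF uv(1) L_deriv[OF uv(2)], of "-1"] by simp
qed

lemma pr_deriv_self: "w \<in> L \<Longrightarrow> pr (deriv_loop w) w = 0"
proof -
  assume w: "w \<in> L"
  have e: "pr (deriv_loop w) w = - pr (deriv_loop w) w"
    using pr_deriv[OF w w] unfolding pr_commute[of w "deriv_loop w"] .
  have "2 * pr (deriv_loop w) w = pr (deriv_loop w) w + pr (deriv_loop w) w" by (rule mult_2)
  also have "\<dots> = 0" using e unfolding eq_neg_iff_add_eq_0 .
  finally show ?thesis by simp
qed

lemma pr_br_self: "pr w (\<lambda>t. br (w t) (v t)) = 0"
  unfolding pr_assoc[symmetric] by (simp add: loop_pair_def f.kil_scale_left[of 0 0, simplified])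

text \<open>For a loop \<open>v\<close> the loops \<open>sin t *\<^sub>R v t\<close> and
  \<open>cos t *\<^sub>R v t\<close> commute at every \<open>t\<close>, and by integration by parts
  twice their cocycle is \<open>pr v v\<close>. It remains to find \<open>v\<close> with
  \<open>pr v v \<noteq> 0\<close>.\<close>

lemma cocycle_nontrivial:
  obtains u v where "u \<in> L" "v \<in> L" "\<And>t. br (u t) (v t) = 0" "pr (deriv_loop u) v \<noteq> 0"
proof -
  obtain x where x: "kil x x \<noteq> 0"
  proof -
    obtain x y where "kil x y \<noteq> 0" using kil_nonzero by blast
    moreover have "kil (x + y) (x + y) = kil x x + 2 * kil x y + kil y y"
      by (simp add: kil_add_left kil_add_right kil_commute[of y x])
    ultimately have "kil (x + y) (x + y) \<noteq> 0 \<or> kil x x \<noteq> 0 \<or> kil y y \<noteq> 0" by auto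
    then show ?thesis using that by blast
  qed
  let ?l = "order_of \<sigma>"
  let ?C = "\<lambda>r. Av (\<lambda>t. cos (real r * t / real ?l) *\<^sub>R x)" and ?S = "\<lambda>r. Av (\<lambda>t. sin (real r * t / real ?l) *\<^sub>R x)"
  have inL: "?C r \<in> L" "?S r \<in> L" for r by (rule Av_in_L[OF trig.cos] Av_in_L[OF trig.sin])+
  have \<sigma>k: "kil ((\<sigma> ^^ j) x) ((\<sigma> ^^ j) x) = kil x x" for j by (induction j) (simp_all add: kil_\<sigma>)
  \<comment> \<open>By \<open>bilinear_kernel\<close> the values of the Killing form on these
    averages add up to a nonzero constant, so their integrals cannot all vanish.\<close>
  have k: "(\<Sum>r<?l. kil (?C r t) (?C r t) + kil (?S r t) (?S r t)) = real ?l * (real ?l * kil x x)" for t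
    using bilinear_kernel[OF lin_kil, of "\<lambda>t. 1" t x x] by (simp add: \<sigma>k)
  have "\<exists>v\<in>L. integral {0..2 * pi} (\<lambda>t. kil (v t) (v t)) \<noteq> 0"
  proof (rule ccontr)
    assume "\<not> ?thesis"
    then have z: "v \<in> L \<Longrightarrow> integral {0..2 * pi} (\<lambda>t. kil (v t) (v t)) = 0" for v by blast
    have i: "v \<in> L \<Longrightarrow> (\<lambda>t. kil (v t) (v t)) integrable_on {0..2 * pi}" for v
      by (intro integrable_continuous_interval trig_continuous[OF kil_loops(1)])
    have hi: "((\<lambda>t. kil (v t) (v t)) has_integral 0) {0..2 * pi}" if "v \<in> L" for v
      using integrable_integral[OF i[OF that]] z[OF that] by simp
    have "((\<lambda>t. \<Sum>r<?l. kil (?C r t) (?C r t) + kil (?S r t) (?S r t)) has_integral (\<Sum>r<?l. 0 + 0)) {0..2 * pi}"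
      by (rule has_integral_sum) (simp, rule has_integral_add, (rule hi inL)+)
    then have "((\<lambda>t. real ?l * (real ?l * kil x x)) has_integral 0) {0..2 * pi}" unfolding k by simp
    then have "measure lborel {0..2 * pi} *\<^sub>R (real ?l * (real ?l * kil x x)) = 0"
      by (rule has_integral_unique[OF has_integral_const_real])
    then show False using x l_pos by simp
  qed
  then obtain v where v: "v \<in> L" "integral {0..2 * pi} (\<lambda>t. kil (v t) (v t)) \<noteq> 0" by blast
  then have "\<rho> (pr v v) \<noteq> 0" by (simp add: \<rho>_pr)
  then have pv: "pr v v \<noteq> 0" using linear_0[OF bounded_linear.linear[OF \<rho>]] by auto
  let ?a = "\<lambda>t. sin t *\<^sub>R v t" and ?b = "\<lambda>t. cos t *\<^sub>R v t"
  have ab: "?a \<in> L" "?b \<in> L" using L_sin[OF v(1), of 0] L_cos[OF v(1), of 0] by simp_all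
  have da: "deriv_loop ?a = (\<lambda>t. sin t *\<^sub>R deriv_loop v t + cos t *\<^sub>R v t)"
    by (rule deriv_mult[OF v(1) DERIV_sin])
  have db: "deriv_loop ?b = (\<lambda>t. cos t *\<^sub>R deriv_loop v t + - sin t *\<^sub>R v t)"
    by (rule deriv_mult[OF v(1) DERIV_cos])
  have fr: "f.kil (r *\<^sub>R y) z = of_real r * f.kil y z" "f.kil y (r *\<^sub>R z) = of_real r * f.kil y z" for r y z
    by (simp_all add: f.kil_scale_left f.kil_scale_right flip: sc_real)
  have "pr (deriv_loop ?a) ?b - pr ?a (deriv_loop ?b) = pr v v"
  proof -
    have "f.kil (deriv_loop ?a t) (?b t) - f.kil (?a t) (deriv_loop ?b t) = f.kil (v t) (v t)" for t
    proof -
      have "f.kil (deriv_loop ?a t) (?b t) - f.kil (?a t) (deriv_loop ?b t)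
        = of_real (cos t) * (of_real (cos t) * f.kil (v t) (v t)) + of_real (sin t) * (of_real (sin t) * f.kil (v t) (v t))"
        unfolding da db f.kil_add_left f.kil_add_right fr
        by (simp add: f.kil_commute[of "v t" "deriv_loop v t"] algebra_simps)
      also have "\<dots> = of_real (cos t * cos t + sin t * sin t) * f.kil (v t) (v t)"
        by (simp only: of_real_add of_real_mult distrib_right mult.assoc)
      finally show ?thesis unfolding sin_cos_squared_add3 by simp
    qed
    then have "integral {0..2 * pi} (\<lambda>t. f.kil (deriv_loop ?a t) (?b t)) - integral {0..2 * pi} (\<lambda>t. f.kil (?a t) (deriv_loop ?b t))
      = integral {0..2 * pi} (\<lambda>t. f.kil (v t) (v t))"
      by (subst Henstock_Kurzweil_Integration.integral_diff[symmetric]) (simp_all add: pr_int L_deriv ab)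
    then show ?thesis unfolding loop_pair_def right_diff_distrib[symmetric] by simp
  qed
  moreover have "pr ?a (deriv_loop ?b) = - pr (deriv_loop ?a) ?b" unfolding pr_deriv[OF ab] minus_minus ..
  ultimately have "pr (deriv_loop ?a) ?b + pr (deriv_loop ?a) ?b = pr v v" by (simp only: diff_minus_eq_add)
  then have "pr (deriv_loop ?a) ?b \<noteq> 0" using pv by auto
  moreover have "br (?a t) (?b t) = 0" for t by (simp add: br_scale_left br_scale_right)
  ultimately show ?thesis using that ab by blast
qed

text \<open>The loop \<open>cos t *\<^sub>R v t\<close> vanishes at \<open>pi / 2\<close>, and so
  does its bracket with \<open>w\<close>, whereas its derivative there is
  \<open>- v (pi / 2)\<close>, an arbitrary vector. Once \<open>c = 0\<close>, every
  \<open>w t\<close> is central.\<close>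

lemma derivation_not_inner:
  assumes "\<And>v t. v \<in> L \<Longrightarrow> sc c (deriv_loop v t) = br (w t) (v t)"
  shows "c = 0" "w t = 0"
proof -
  obtain y :: 'a where y: "y \<noteq> 0" using nonabelian by blast
  let ?v = "sec (pi / 2) y"
  have v: "?v \<in> L" by (rule sec_in_L)
  have "(\<lambda>t. cos t *\<^sub>R ?v t) \<in> L" using L_cos[OF v, of 0] by simp
  from assms[OF this, of "pi / 2"] have "sc c (- y) = 0"
    unfolding deriv_mult[OF v DERIV_cos] by (simp add: sec_eval br_scale_right)
  then show c: "c = 0" using y by simp
  show "w t = 0"
  proof (rule center_trivial)
    fix x
    have "br (w t) x = 0" using assms[OF sec_in_L, of t x t] by (simp add: c sec_eval)
    then show "br x (w t) = 0" using br_swap[of x "w t"] by simp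
  qed
qed

lemma center_loop: "u \<in> L \<Longrightarrow> (\<And>v. v \<in> L \<Longrightarrow> (\<lambda>t. br (u t) (v t)) = (\<lambda>t. 0)) \<Longrightarrow> u = (\<lambda>t. 0)"
proof
  fix t assume "u \<in> L" "\<And>v. v \<in> L \<Longrightarrow> (\<lambda>t. br (u t) (v t)) = (\<lambda>t. 0)"
  then have "br (u t) y = 0" for y using fun_cong[of "\<lambda>s. br (u s) (sec t y s)" "\<lambda>s. 0" t] sec_in_L by (simp add: sec_eval)
  then have "br y (u t) = 0" for y using br_swap[of y "u t"] by simp
  then show "u t = 0" by (rule center_trivial)
qed

end

lemmas alg_defs = Lalg_def Lhat_def Lhat'_def

section \<open>Extension of an isomorphism to the affine algebras\<close>

locale floop_iso = A: floop br \<sigma> sc \<rho> + B: floop br' \<sigma>' sc' \<rho>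
  for br :: "'a::real_normed_vector \<Rightarrow> 'a \<Rightarrow> 'a" and \<sigma> and sc :: "'k::{real_normed_field, banach} \<Rightarrow> 'a \<Rightarrow> 'a" and \<rho>
    and br' :: "'b::real_normed_vector \<Rightarrow> 'b \<Rightarrow> 'b" and \<sigma>' and sc' :: "'k \<Rightarrow> 'b \<Rightarrow> 'b" +
  fixes \<phi> :: "(real \<Rightarrow> 'a) \<Rightarrow> (real \<Rightarrow> 'b)"
  assumes \<phi>: "lie_iso (Lalg sc br \<sigma>) (Lalg sc' br' \<sigma>') \<phi>"
begin

lemma \<phi>_sc: "u \<in> A.L \<Longrightarrow> \<phi> (\<lambda>t. sc k (u t)) = (\<lambda>t. sc' k (\<phi> u t))"
  using \<phi> by (simp add: lie_iso_def Lalg_def A.loop_set_eq)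

sublocale loop_iso br \<sigma> "order_of \<sigma>" br' \<sigma>' "order_of \<sigma>'" \<phi>
proof unfold_locales
  show "\<phi> (\<lambda>t. c *\<^sub>R u t) = (\<lambda>t. c *\<^sub>R \<phi> u t)" if "u \<in> A.L" for u c
    using \<phi>_sc[OF that, of "of_real c"] by (simp add: A.sc_real B.sc_real)
qed (use \<phi> in \<open>simp_all add: lie_iso_def Lalg_def A.loop_set_eq B.loop_set_eq\<close>)

text \<open>\<open>standard\<close> read over \<open>'k\<close>: the sign is an element of the base
  field and the pairing has its values there.\<close>

definition std :: "'k \<Rightarrow> (real \<Rightarrow> 'b) \<Rightarrow> bool" where
  "std e w \<longleftrightarrow> e * e = 1 \<and> w \<in> B.L
    \<and> (\<forall>u\<in>A.L. \<phi> (deriv_loop u) = (\<lambda>t. sc' e (deriv_loop (\<phi> u) t) + br' (w t) (\<phi> u t)))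
    \<and> (\<forall>u\<in>A.L. \<forall>v\<in>A.L. B.pr (\<phi> u) (\<phi> v) = A.pr u v)"

lemma ex_std: "\<exists>e w. std e w"
proof -
  obtain e w where s: "standard e w" using ex_standard by blast
  have pr: "B.pr (\<phi> u) (\<phi> v) = A.pr u v" if uv: "u \<in> A.L" "v \<in> A.L" for u v
  proof -
    interpret \<rho>: bounded_linear \<rho> by (rule A.\<rho>)
    have "\<rho> (c * (B.pr (\<phi> u) (\<phi> v) - A.pr u v)) = 0" for c
    proof -
      have "\<rho> (c * (B.pr (\<phi> u) (\<phi> v) - A.pr u v)) = \<rho> (B.pr (\<phi> (\<lambda>t. sc c (u t))) (\<phi> v)) - \<rho> (A.pr (\<lambda>t. sc c (u t)) v)"
        by (simp add: \<phi>_sc uv \<phi>_in A.pr_scale_left B.pr_scale_left right_diff_distrib \<rho>.diff)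
      also have "\<dots> = 0"
        using s A.L_sc[OF uv(1), of c] uv(2) by (simp add: A.\<rho>_pr B.\<rho>_pr \<phi>_in standard_def)
      finally show ?thesis .
    qed
    then have "B.pr (\<phi> u) (\<phi> v) - A.pr u v = 0" by (rule A.\<rho>_sep)
    then show ?thesis by simp
  qed
  have "of_real e * of_real e = (1::'k)" using s by (auto simp: standard_def)
  then have "std (of_real e) w"
    using s pr by (auto simp: std_def standard_def B.sc_real)
  then show ?thesis by blast
qed

end

section \<open>Automorphism groups\<close>

definition closed_ops :: "('k, 'v) liealg \<Rightarrow> bool" where
  "closed_ops A \<longleftrightarrow> (\<forall>x\<in>carr A. \<forall>y\<in>carr A. ladd A x y \<in> carr A \<and> lbr A x y \<in> carr A)
    \<and> (\<forall>k. \<forall>x\<in>carr A. lsmul A k x \<in> carr A)"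

lemma lie_isoD:
  assumes "lie_iso A B f"
  shows "bij_betw f (carr A) (carr B)" "x \<in> carr A \<Longrightarrow> f x \<in> carr B"
    "x \<in> carr A \<Longrightarrow> y \<in> carr A \<Longrightarrow> f (ladd A x y) = ladd B (f x) (f y)"
    "x \<in> carr A \<Longrightarrow> f (lsmul A k x) = lsmul B k (f x)"
    "x \<in> carr A \<Longrightarrow> y \<in> carr A \<Longrightarrow> f (lbr A x y) = lbr B (f x) (f y)"
  using assms by (auto simp: lie_iso_def bij_betw_def)

lemma lie_iso_cong:
  assumes "closed_ops A" "lie_iso A B f" "\<And>x. x \<in> carr A \<Longrightarrow> g x = f x"
  shows "lie_iso A B g"
proof -
  have "bij_betw g (carr A) (carr B)"
    using assms bij_betw_cong[of "carr A" g f "carr B"] by (simp add: lie_iso_def)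
  then show ?thesis using assms by (simp add: lie_iso_def closed_ops_def)
qed

lemma lie_iso_comp:
  assumes "lie_iso A B f" "lie_iso B C g"
  shows "lie_iso A C (g \<circ> f)"
  unfolding lie_iso_def
  using bij_betw_trans[OF lie_isoD(1)[OF assms(1)] lie_isoD(1)[OF assms(2)]]
  by (simp add: lie_isoD[OF assms(1)] lie_isoD[OF assms(2)])

lemma AutG_simps:
  "f \<in> carrier (AutG A) \<longleftrightarrow> f \<in> extensional (carr A) \<and> lie_iso A A f"
  "f \<otimes>\<^bsub>AutG A\<^esub> g = compose (carr A) f g" "\<one>\<^bsub>AutG A\<^esub> = restrict id (carr A)"
  by (simp_all add: AutG_def)

lemma AutG_restrict: "closed_ops A \<Longrightarrow> lie_iso A A f \<Longrightarrow> restrict f (carr A) \<in> carrier (AutG A)"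
  unfolding AutG_simps by (auto intro: lie_iso_cong[of A A f])

lemma AutG_closed:
  assumes "closed_ops A" "f \<in> carrier (AutG A)" "g \<in> carrier (AutG A)"
  shows "compose (carr A) f g \<in> carrier (AutG A)"
  using AutG_restrict[OF assms(1) lie_iso_comp[of A A g A f]] assms(2,3) by (simp add: AutG_simps compose_def comp_def)

lemma AutG_eqI: "f \<in> carrier (AutG A) \<Longrightarrow> g \<in> carrier (AutG A) \<Longrightarrow> (\<And>x. x \<in> carr A \<Longrightarrow> f x = g x) \<Longrightarrow> f = g"
  unfolding AutG_simps by (auto intro: extensionalityI)

text \<open>The inverse of a bijective homomorphism is multiplicative once products stay in the
  carrier. In \<open>claim_iv\<close> the natural map goes out of the product, opposite to the
  stated direction.\<close>

lemma is_iso_sym_closed: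
  assumes h: "h \<in> iso G H" and c: "\<And>x y. x \<in> carrier G \<Longrightarrow> y \<in> carrier G \<Longrightarrow> x \<otimes>\<^bsub>G\<^esub> y \<in> carrier G"
  shows "H \<cong> G"
proof -
  let ?k = "inv_into (carrier G) h"
  have b: "bij_betw h (carrier G) (carrier H)"
    and m: "\<And>x y. x \<in> carrier G \<Longrightarrow> y \<in> carrier G \<Longrightarrow> h (x \<otimes>\<^bsub>G\<^esub> y) = h x \<otimes>\<^bsub>H\<^esub> h y"
    using h by (auto simp: iso_def hom_def)
  have kb: "bij_betw ?k (carrier H) (carrier G)" by (rule bij_betw_inv_into[OF b])
  then have k: "y \<in> carrier H \<Longrightarrow> ?k y \<in> carrier G" for y using bij_betwE by blast
  have hk: "y \<in> carrier H \<Longrightarrow> h (?k y) = y" for y by (rule bij_betw_inv_into_right[OF b])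
  have "?k \<in> hom H G"
  proof (rule homI)
    fix x y assume xy: "x \<in> carrier H" "y \<in> carrier H"
    have "?k (h (?k x \<otimes>\<^bsub>G\<^esub> ?k y)) = ?k x \<otimes>\<^bsub>G\<^esub> ?k y"
      by (rule bij_betw_inv_into_left[OF b c[OF k[OF xy(1)] k[OF xy(2)]]])
    then show "?k (x \<otimes>\<^bsub>H\<^esub> y) = ?k x \<otimes>\<^bsub>G\<^esub> ?k y" by (simp add: m k xy hk)
  qed (rule k)
  then show ?thesis by (rule is_isoI[OF isoI[OF _ kb]])
qed

section \<open>The affine algebra and the candidate isomorphisms\<close>

context floop
begin

abbreviation "La \<equiv> Lalg sc br \<sigma>"
abbreviation "Lh \<equiv> Lhat sc br \<sigma>"
abbreviation "Lh' \<equiv> Lhat' sc br \<sigma>"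

lemma alg_simps [simp]:
  "carr La = L" "carr Lh = L \<times> UNIV \<times> UNIV" "carr Lh' = L \<times> UNIV \<times> {0}"
  "ladd La = (\<lambda>u v t. u t + v t)" "lsmul La = (\<lambda>k u t. sc k (u t))" "lbr La = (\<lambda>u v t. br (u t) (v t))"
  "ladd Lh (u, a, b) (v, a', b') = (\<lambda>t. u t + v t, a + a', b + b')"
  "lsmul Lh k (u, a, b) = (\<lambda>t. sc k (u t), k * a, k * b)"
  "lbr Lh (u, a, b) (v, a', b') = (\<lambda>t. br (u t) (v t) + sc b (deriv_loop v t) - sc b' (deriv_loop u t),
         pr (deriv_loop u) v, 0)"
  "ladd Lh' = ladd Lh" "lsmul Lh' = lsmul Lh" "lbr Lh' = lbr Lh"
  by (simp_all add: alg_defs loop_set_eq)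

lemma closed_ops: "closed_ops La" "closed_ops Lh" "closed_ops Lh'"
  by (auto simp: closed_ops_def intro!: L_diff L_add L_bracket L_sc L_deriv)

lemma deriv_zero [simp]: "deriv_loop (\<lambda>t. 0::'a) = (\<lambda>t. 0)"
  by (simp add: deriv_loop_def)

lemma pr_zero_left [simp]: "pr (\<lambda>t. 0) v = 0"
  by (simp add: loop_pair_def f.kil_scale_left[of 0 0, simplified])

lemma pr_zero_right [simp]: "pr v (\<lambda>t. 0) = 0"
  unfolding pr_commute[of v] by simp

lemma pr_diff_right: "u \<in> L \<Longrightarrow> v \<in> L \<Longrightarrow> w \<in> L \<Longrightarrow> pr w (\<lambda>t. u t - v t) = pr w u - pr w v"
  using pr_add_right[OF L_diff, of u v v w] by simp

text \<open>The term \<open>- e * pr w (\<phi> u)\<close> compensates the coboundary in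
  \<open>cocycle_\<phi>\<close>. The parameter \<open>\<nu>\<close> is free because no bracket has a
  component along \<open>d\<close> and \<open>c\<close> is central.\<close>

definition mk :: "((real \<Rightarrow> 'c) \<Rightarrow> real \<Rightarrow> 'a) \<Rightarrow> 'k \<Rightarrow> (real \<Rightarrow> 'a) \<Rightarrow> 'k \<Rightarrow> (real \<Rightarrow> 'c) \<times> 'k \<times> 'k \<Rightarrow> (real \<Rightarrow> 'a) \<times> 'k \<times> 'k" where
  "mk \<phi> e w \<nu> = (\<lambda>(u, a, b). (\<lambda>t. \<phi> u t + sc b (w t), e * a + \<nu> * b - e * pr w (\<phi> u), e * b))"

end

context floop_iso
begin

lemma \<phi>_diff: "u \<in> A.L \<Longrightarrow> v \<in> A.L \<Longrightarrow> \<phi> (\<lambda>t. u t - v t) = (\<lambda>t. \<phi> u t - \<phi> v t)"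
  using add[OF A.L_diff, of u v v] by simp

context
  fixes e w assumes s: "std e w"
begin

lemma ee: "e * e = 1" and wL: "w \<in> B.L"
  and \<phi>_deriv: "u \<in> A.L \<Longrightarrow> \<phi> (deriv_loop u) = (\<lambda>t. sc' e (deriv_loop (\<phi> u) t) + br' (w t) (\<phi> u t))"
  and pr_\<phi>: "u \<in> A.L \<Longrightarrow> v \<in> A.L \<Longrightarrow> B.pr (\<phi> u) (\<phi> v) = A.pr u v"
  using s by (simp_all add: std_def)

lemma ee': "e * (e * x) = x" by (simp add: ee flip: mult.assoc)

lemma pr_w_deriv: "u \<in> A.L \<Longrightarrow> B.pr w (\<phi> (deriv_loop u)) = e * B.pr w (deriv_loop (\<phi> u))"
  by (simp add: \<phi>_deriv B.pr_add_right B.pr_scale_right B.pr_br_self B.L_sc B.L_deriv B.L_bracket wL \<phi>_in)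

text \<open>Isometry and the rule for \<open>\<phi> (deriv_loop u)\<close> carry
  \<open>pr (deriv_loop u) v\<close> to the target, where invariance turns the term with
  \<open>w\<close> into a function of the bracket, that is a coboundary. As
  \<open>e * e = 1\<close>, multiplication by \<open>e\<close> solves for the transported
  cocycle.\<close>

lemma cocycle_\<phi>:
  assumes uv: "u \<in> A.L" "v \<in> A.L"
  shows "B.pr (deriv_loop (\<phi> u)) (\<phi> v) = e * A.pr (deriv_loop u) v - e * B.pr w (\<phi> (\<lambda>t. br (u t) (v t)))"
proof -
  have "A.pr (deriv_loop u) v = B.pr (\<phi> (deriv_loop u)) (\<phi> v)" by (simp add: pr_\<phi> A.L_deriv uv)
  also have "\<dots> = e * B.pr (deriv_loop (\<phi> u)) (\<phi> v) + B.pr w (\<phi> (\<lambda>t. br (u t) (v t)))"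
    by (simp add: \<phi>_deriv B.pr_add_left B.pr_scale_left B.L_sc B.L_deriv B.L_bracket wL \<phi>_in uv B.pr_assoc bracket)
  finally have "e * A.pr (deriv_loop u) v = e * (e * B.pr (deriv_loop (\<phi> u)) (\<phi> v)) + e * B.pr w (\<phi> (\<lambda>t. br (u t) (v t)))"
    by (simp add: distrib_left)
  then show ?thesis unfolding ee' by simp
qed

lemma lie_iso_mk: "lie_iso A.Lh B.Lh (B.mk \<phi> e w \<nu>)"
  unfolding lie_iso_def
proof (intro conjI ballI allI)
  have e0: "e \<noteq> 0" using ee by auto
  show "bij_betw (B.mk \<phi> e w \<nu>) (carr A.Lh) (carr B.Lh)"
    unfolding bij_betw_def
  proof
    show "inj_on (B.mk \<phi> e w \<nu>) (carr A.Lh)"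
    proof (rule inj_onI)
      fix x y assume xy: "x \<in> carr A.Lh" "y \<in> carr A.Lh" and eq: "B.mk \<phi> e w \<nu> x = B.mk \<phi> e w \<nu> y"
      obtain u a b v a' b' where p: "x = (u, a, b)" "y = (v, a', b')" "u \<in> A.L" "v \<in> A.L" using xy by (cases x, cases y) auto
      have b: "b = b'" using eq e0 by (simp add: p B.mk_def)
      have "\<phi> u = \<phi> v" using eq by (simp add: p B.mk_def b fun_eq_iff)
      then have "\<psi> (\<phi> u) = \<psi> (\<phi> v)" by (rule arg_cong)
      then have u: "u = v" unfolding \<psi>\<phi>[OF p(3)] \<psi>\<phi>[OF p(4)] .
      show "x = y" using eq e0 unfolding p u b B.mk_def by simp
    qed
    show "B.mk \<phi> e w \<nu> ` carr A.Lh = carr B.Lh"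
    proof (intro equalityI subsetI)
      fix y assume "y \<in> carr B.Lh"
      then obtain v a b where y: "y = (v, a, b)" "v \<in> B.L" by (cases y) auto
      have v: "(\<lambda>t. v t - sc' (e * b) (w t)) \<in> B.L" by (intro B.L_diff B.L_sc y wL)
      let ?u = "\<psi> (\<lambda>t. v t - sc' (e * b) (w t))"
      have "y = B.mk \<phi> e w \<nu> (?u, e * (a - \<nu> * (e * b)) + B.pr w (\<phi> ?u), e * b)"
        by (simp add: y B.mk_def \<phi>\<psi>[OF v] distrib_left ee')
      then show "y \<in> B.mk \<phi> e w \<nu> ` carr A.Lh" using \<psi>_in[OF v] by auto
    qed (auto simp: B.mk_def intro!: B.L_add B.L_sc wL \<phi>_in)
  qed
  fix x y assume xy: "x \<in> carr A.Lh" "y \<in> carr A.Lh"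
  obtain u a b v a' b' where p: "x = (u, a, b)" "y = (v, a', b')" and uv: "u \<in> A.L" "v \<in> A.L" using xy by (cases x, cases y) auto
  show "B.mk \<phi> e w \<nu> (ladd A.Lh x y) = ladd B.Lh (B.mk \<phi> e w \<nu> x) (B.mk \<phi> e w \<nu> y)"
    by (simp add: p B.mk_def add uv B.f.scale_left_distrib B.pr_add_right \<phi>_in wL algebra_simps)
  have F: "\<phi> (\<lambda>t. br (u t) (v t) + sc b (deriv_loop v t) - sc b' (deriv_loop u t))
    = (\<lambda>t. br' (\<phi> u t) (\<phi> v t) + sc' b (\<phi> (deriv_loop v) t) - sc' b' (\<phi> (deriv_loop u) t))"
    by (simp add: \<phi>_diff add \<phi>_sc bracket A.L_add A.L_bracket A.L_sc A.L_deriv uv)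
  have D: "deriv_loop (\<lambda>t. \<phi> u t + sc' b (w t)) = (\<lambda>t. deriv_loop (\<phi> u) t + sc' b (deriv_loop w t))"
    if "u \<in> A.L" for u b
    by (simp add: B.deriv_add B.deriv_sc B.L_sc \<phi>_in wL that)
  \<comment> \<open>The brackets with \<open>w\<close> are supplied by \<open>\<phi>_deriv\<close>;
    \<open>[w, w] = 0\<close>, and the two terms with \<open>b * b'\<close> times the derivative of
    \<open>w\<close> cancel.\<close>
  have 1: "br' (\<phi> u t) (\<phi> v t) + sc' b (\<phi> (deriv_loop v) t) - sc' b' (\<phi> (deriv_loop u) t)
    = br' (\<phi> u t + sc' b (w t)) (\<phi> v t + sc' b' (w t)) + sc' (e * b) (deriv_loop (\<phi> v) t + sc' b' (deriv_loop w t))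
      - sc' (e * b') (deriv_loop (\<phi> u) t + sc' b (deriv_loop w t))" for t
    unfolding \<phi>_deriv[OF uv(1)] \<phi>_deriv[OF uv(2)] B.f.br_add_left B.f.br_add_right B.f.br_scale_left B.f.br_scale_right
      B.f.br_swap[of "\<phi> u t" "w t"] B.f.scale_right_distrib B.f.scale_scale B.f.scale_minus_right
    by (simp add: mult.commute mult.left_commute)
  \<comment> \<open>The term \<open>(w', w)\<close> is zero, and integration by parts moves the
    derivative from \<open>w\<close> to \<open>\<phi> v\<close>.\<close>
  have 2: "B.pr (\<lambda>t. deriv_loop (\<phi> u) t + sc' b (deriv_loop w t)) (\<lambda>t. \<phi> v t + sc' b' (w t))
    = B.pr (deriv_loop (\<phi> u)) (\<phi> v) + b' * B.pr w (deriv_loop (\<phi> u)) - b * B.pr w (deriv_loop (\<phi> v))"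
  proof -
    have "B.pr (\<lambda>t. deriv_loop (\<phi> u) t + sc' b (deriv_loop w t)) (\<lambda>t. \<phi> v t + sc' b' (w t))
      = B.pr (deriv_loop (\<phi> u)) (\<phi> v) + b' * B.pr (deriv_loop (\<phi> u)) w + b * B.pr (deriv_loop w) (\<phi> v)"
      by (simp add: B.pr_add_left B.pr_add_right B.pr_scale_left B.pr_scale_right B.pr_deriv_self B.L_add B.L_sc B.L_deriv wL \<phi>_in uv)
    then show ?thesis
      unfolding B.pr_deriv[OF wL \<phi>_in[OF uv(2)]] B.pr_commute[of "deriv_loop (\<phi> u)" w] by simp
  qed
  have 3: "B.pr w (\<lambda>t. br' (\<phi> u t) (\<phi> v t) + sc' b (\<phi> (deriv_loop v) t) - sc' b' (\<phi> (deriv_loop u) t))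
    = B.pr w (\<phi> (\<lambda>t. br (u t) (v t))) + b * (e * B.pr w (deriv_loop (\<phi> v))) - b' * (e * B.pr w (deriv_loop (\<phi> u)))"
    unfolding bracket[OF uv]
    by (simp add: B.pr_diff_right B.pr_add_right B.pr_scale_right B.L_add B.L_sc B.L_bracket A.L_deriv wL \<phi>_in uv pr_w_deriv)
  have 4: "e * A.pr (deriv_loop u) v - e * (B.pr w (\<phi> (\<lambda>t. br (u t) (v t))) + b * (e * B.pr w (deriv_loop (\<phi> v))) - b' * (e * B.pr w (deriv_loop (\<phi> u))))
    = B.pr (deriv_loop (\<phi> u)) (\<phi> v) + b' * B.pr w (deriv_loop (\<phi> u)) - b * B.pr w (deriv_loop (\<phi> v))"
  proof -
    have ebe: "e * (b * (e * x)) = b * x" for b x unfolding mult.left_commute[of b e x] ee' ..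
    show ?thesis unfolding cocycle_\<phi>[OF uv] right_diff_distrib distrib_left ebe by simp
  qed
  show "B.mk \<phi> e w \<nu> (lbr A.Lh x y) = lbr B.Lh (B.mk \<phi> e w \<nu> x) (B.mk \<phi> e w \<nu> y)"
    unfolding p B.mk_def prod.case A.alg_simps B.alg_simps F D[OF uv(1)] D[OF uv(2)] 2 4[symmetric]
    unfolding 3 unfolding 1 by simp
next
  fix x k assume x: "x \<in> carr A.Lh"
  obtain u a b where p: "x = (u, a, b)" and u: "u \<in> A.L" using x by (cases x) auto
  show "B.mk \<phi> e w \<nu> (lsmul A.Lh k x) = lsmul B.Lh k (B.mk \<phi> e w \<nu> x)"
    by (simp add: p B.mk_def \<phi>_sc u B.f.scale_right_distrib B.pr_scale_right \<phi>_in wL algebra_simps)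
qed

end

lemma ex_affine_iso:
  obtains \<Phi> where "lie_iso A.Lh B.Lh \<Phi>" "\<And>u. fst (\<Phi> (u, 0, 0)) = \<phi> u"
proof -
  obtain e w where "std e w" using ex_std by blast
  from lie_iso_mk[OF this, of 0] show thesis by (rule that) (simp add: B.mk_def)
qed

end

section \<open>Structure of the automorphisms of the derived and the affine algebra\<close>

context floop
begin

lemma self_iso: "lie_iso La La \<phi> \<Longrightarrow> floop_iso br \<sigma> sc \<rho> br \<sigma> sc \<phi>"
  by (intro floop_iso.intro floop_axioms floop_iso_axioms.intro)

text \<open>As \<open>c\<close> is central and the loop algebra has trivial center,
  \<open>\<Psi>\<close> has the form \<open>(\<phi> u, \<alpha> u + a * \<mu>, 0)\<close>. The
  formula for the transported cocycle is a hypothesis of the second claim, because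
  \<open>cocycle_\<phi>\<close> becomes available only once the first claim has shown that
  \<open>\<phi>\<close> is an isomorphism.\<close>

lemma derived_structure:
  fixes \<Psi>
  assumes \<Psi>: "lie_iso Lh' Lh' \<Psi>"
  defines "\<phi> \<equiv> \<lambda>u. fst (\<Psi> (u, 0, 0))"
  shows "lie_iso La La \<phi>"
    and "(\<And>u v. u \<in> L \<Longrightarrow> v \<in> L \<Longrightarrow> pr (deriv_loop (\<phi> u)) (\<phi> v) = e * pr (deriv_loop u) v - e * pr w (\<phi> (\<lambda>t. br (u t) (v t))))
      \<Longrightarrow> w \<in> L \<Longrightarrow> u \<in> L \<Longrightarrow> \<Psi> (u, a, 0) = (\<phi> u, e * a - e * pr w (\<phi> u), 0)"
proof -
  note b = lie_isoD(1)[OF \<Psi>]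
  define \<alpha> where "\<alpha> u = fst (snd (\<Psi> (u, 0, 0)))" for u
  have in\<Psi>: "\<exists>v k. \<Psi> (u, a, 0) = (v, k, 0) \<and> v \<in> L" if "u \<in> L" for u a
    using lie_isoD(2)[OF \<Psi>, of "(u, a, 0)"] that by (cases "\<Psi> (u, a, 0)") auto
  have \<phi>\<alpha>: "\<Psi> (u, 0, 0) = (\<phi> u, \<alpha> u, 0)" "\<phi> u \<in> L" if "u \<in> L" for u
    using in\<Psi>[OF that, of 0] by (auto simp: \<phi>_def \<alpha>_def)
  have ad: "\<Psi> (\<lambda>t. u t + v t, a + a', 0) = ladd Lh (\<Psi> (u, a, 0)) (\<Psi> (v, a', 0))" if "u \<in> L" "v \<in> L" for u v a a'
    using lie_isoD(3)[OF \<Psi>, of "(u, a, 0)" "(v, a', 0)"] that by simp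
  have scl: "\<Psi> (\<lambda>t. sc k (u t), k * a, 0) = lsmul Lh k (\<Psi> (u, a, 0))" if "u \<in> L" for u k a
    using lie_isoD(4)[OF \<Psi>, of "(u, a, 0)" k] that by simp
  have brk: "\<Psi> (\<lambda>t. br (u t) (v t), pr (deriv_loop u) v, 0) = lbr Lh (\<Psi> (u, a, 0)) (\<Psi> (v, a', 0))" if "u \<in> L" "v \<in> L" for u v a a'
    using lie_isoD(5)[OF \<Psi>, of "(u, a, 0)" "(v, a', 0)"] that by simp
  have Z: "\<Psi> (\<lambda>t. 0, 0, 0) = (\<lambda>t. 0, 0, 0)"
    using scl[OF L_zero, of 0 0] \<phi>\<alpha>[OF L_zero] by simp
  obtain z \<mu> where z: "\<Psi> (\<lambda>t. 0, 1, 0) = (z, \<mu>, 0)" "z \<in> L" using in\<Psi>[OF L_zero, of 1] by blast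
  have z0: "z = (\<lambda>t. 0)"
  proof (rule center_loop[OF z(2)])
    fix v assume v: "v \<in> L"
    then have "(v, 0, 0) \<in> \<Psi> ` carr Lh'" using b by (simp add: bij_betw_def)
    then obtain u a where u: "u \<in> L" "\<Psi> (u, a, 0) = (v, 0, 0)" by auto
    show "(\<lambda>t. br (z t) (v t)) = (\<lambda>t. 0)"
      using brk[OF L_zero u(1), of 1 a] by (simp add: z u Z f.brl.zero)
  qed
  have c: "\<Psi> (\<lambda>t. 0, a, 0) = (\<lambda>t. 0, a * \<mu>, 0)" for a
    using scl[OF L_zero, of a 1] by (simp add: z z0)
  have full: "\<Psi> (u, a, 0) = (\<phi> u, \<alpha> u + a * \<mu>, 0)" if "u \<in> L" for u a
    using ad[OF that L_zero, of 0 a] by (simp add: \<phi>\<alpha> c that)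
  have \<mu>: "\<mu> \<noteq> 0"
  proof
    assume "\<mu> = 0"
    then have "\<Psi> (\<lambda>t. 0, 1, 0) = \<Psi> (\<lambda>t. 0, 0, 0)" by (simp add: c)
    then show False using inj_onD[OF bij_betw_imp_inj_on[OF b], of "(\<lambda>t. 0, 1, 0)" "(\<lambda>t. 0, 0, 0)"] L_zero by simp
  qed
  have \<phi>add: "\<phi> (\<lambda>t. u t + v t) = (\<lambda>t. \<phi> u t + \<phi> v t)" "\<alpha> (\<lambda>t. u t + v t) = \<alpha> u + \<alpha> v" if "u \<in> L" "v \<in> L" for u v
    using ad[OF that, of 0 0] by (simp_all add: \<phi>\<alpha> that L_add)
  have \<phi>br: "\<phi> (\<lambda>t. br (u t) (v t)) = (\<lambda>t. br (\<phi> u t) (\<phi> v t))"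
    "\<alpha> (\<lambda>t. br (u t) (v t)) + pr (deriv_loop u) v * \<mu> = pr (deriv_loop (\<phi> u)) (\<phi> v)" if "u \<in> L" "v \<in> L" for u v
    using brk[OF that, of 0 0] by (simp_all add: full that L_bracket)
  have "bij_betw \<phi> L L"
    unfolding bij_betw_def
  proof (intro conjI inj_onI equalityI subsetI)
    fix u v assume uv: "u \<in> L" "v \<in> L" "\<phi> u = \<phi> v"
    then have "\<Psi> (u, (\<alpha> v - \<alpha> u) / \<mu>, 0) = \<Psi> (v, 0, 0)" using \<mu> by (simp add: full)
    then show "u = v" using inj_onD[OF bij_betw_imp_inj_on[OF b], of "(u, (\<alpha> v - \<alpha> u) / \<mu>, 0)" "(v, 0, 0)"] uv by simp
  next
    fix v assume v: "v \<in> L"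
    then have "(v, 0, 0) \<in> \<Psi> ` carr Lh'" using b by (simp add: bij_betw_def)
    then obtain u a where u: "u \<in> L" "\<Psi> (u, a, 0) = (v, 0, 0)" by auto
    then show "v \<in> \<phi> ` L" by (auto simp: full)
  qed (auto simp: \<phi>\<alpha>)
  then show "lie_iso La La \<phi>"
    unfolding lie_iso_def alg_simps using \<phi>add(1) \<phi>br(1)
    by (simp add: \<phi>\<alpha> L_sc) (use scl[of _ _ 0] in \<open>simp add: \<phi>\<alpha> L_sc\<close>)
  assume P: "\<And>u v. u \<in> L \<Longrightarrow> v \<in> L \<Longrightarrow> pr (deriv_loop (\<phi> u)) (\<phi> v) = e * pr (deriv_loop u) v - e * pr w (\<phi> (\<lambda>t. br (u t) (v t)))"
    and w: "w \<in> L" and u: "u \<in> L"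
  \<comment> \<open>On brackets the additive function
    \<open>\<alpha> u + e * pr w (\<phi> u)\<close> is a multiple of the cocycle. A commuting pair
    with nonzero cocycle forces \<open>\<mu> = e\<close>; the function then vanishes on brackets,
    and by perfectness everywhere.\<close>
  have \<beta>: "\<alpha> (\<lambda>t. br (u t) (v t)) + e * pr w (\<phi> (\<lambda>t. br (u t) (v t))) = (e - \<mu>) * pr (deriv_loop u) v" if "u \<in> L" "v \<in> L" for u v
    using \<phi>br(2)[OF that] unfolding P[OF that] by (simp add: algebra_simps)
  have \<mu>e: "\<mu> = e"
  proof -
    obtain u v where uv: "u \<in> L" "v \<in> L" "\<And>t. br (u t) (v t) = 0" "pr (deriv_loop u) v \<noteq> 0"
      by (rule cocycle_nontrivial, rule that)
    have "\<phi> (\<lambda>t. 0) = (\<lambda>t. 0)" "\<alpha> (\<lambda>t. 0) = 0" using Z by (simp_all add: \<phi>_def \<alpha>_def)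
    then show ?thesis using \<beta>[OF uv(1,2)] uv(4) by (simp add: uv(3))
  qed
  from u have "\<alpha> u + e * pr w (\<phi> u) = 0"
  proof (induction rule: L_perfect)
    case (bracket u v) then show ?case by (simp add: \<beta> \<mu>e)
  next
    case (add u v) then show ?case by (simp add: \<phi>add pr_add_right \<phi>\<alpha> w distrib_left add_eq_0_iff)
  qed
  then show "\<Psi> (u, a, 0) = (\<phi> u, e * a - e * pr w (\<phi> u), 0)"
    by (simp add: full[OF u] \<mu>e add_eq_0_iff2 mult.commute)
qed

text \<open>The coefficient \<open>T\<close> of \<open>d\<close> in the image is linear and vanishes
  on brackets, hence on \<open>c\<close>, a multiple of the bracket of two commuting loops, and on
  all loops by perfectness. Surjectivity prevents \<open>T\<close> from vanishing at
  \<open>d\<close>, so only elements of the derived algebra are mapped into it.\<close>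

lemma restricts_to_derived:
  assumes \<Phi>: "lie_iso Lh Lh \<Phi>"
  shows "lie_iso Lh' Lh' \<Phi>"
proof -
  define T where "T x = snd (snd (\<Phi> x))" for x
  have T: "T (lbr Lh x y) = 0" "T (ladd Lh x y) = T x + T y" "T (lsmul Lh k x) = k * T x"
    if "x \<in> carr Lh" "y \<in> carr Lh" for x y k
    unfolding T_def lie_isoD(3,5)[OF \<Phi> that] lie_isoD(4)[OF \<Phi> that(1)]
    by (cases "\<Phi> x", cases "\<Phi> y", simp)+
  have Tc: "T (\<lambda>t. 0, a, 0) = 0" for a
  proof -
    obtain u v where uv: "u \<in> L" "v \<in> L" "\<And>t. br (u t) (v t) = 0" "pr (deriv_loop u) v \<noteq> 0"
      by (rule cocycle_nontrivial, rule that)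
    have "T (\<lambda>t. 0, pr (deriv_loop u) v, 0) = 0" using T(1)[of "(u, 0, 0)" "(v, 0, 0)"] uv(1,2) by (simp add: uv(3))
    then show ?thesis
      using T(3)[of "(\<lambda>t. 0, pr (deriv_loop u) v, 0)" "(\<lambda>t. 0, pr (deriv_loop u) v, 0)" "a / pr (deriv_loop u) v"] uv(4) L_zero by simp
  qed
  have Tu: "T (u, 0, 0) = 0" if "u \<in> L" for u
    using that
  proof (induction rule: L_perfect)
    case (bracket u v)
    then have "T (\<lambda>t. br (u t) (v t), pr (deriv_loop u) v, 0) = 0"
      using T(1)[of "(u, 0, 0)" "(v, 0, 0)"] by simp
    then show ?case
      using T(2)[of "(\<lambda>t. br (u t) (v t), pr (deriv_loop u) v, 0)" "(\<lambda>t. 0, - pr (deriv_loop u) v, 0)"] bracket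
      by (simp add: Tc L_zero L_bracket)
  next
    case (add u v) then show ?case using T(2)[of "(u, 0, 0)" "(v, 0, 0)"] by simp
  qed
  have T': "T (u, a, b) = b * T (\<lambda>t. 0, 0, 1)" if "u \<in> L" for u a b
    using T(2)[of "(u, 0, 0)" "(\<lambda>t. 0, a, b)"] T(2)[of "(\<lambda>t. 0, a, 0)" "(\<lambda>t. 0, 0, b)"]
      T(3)[of "(\<lambda>t. 0, 0, 1)" "(\<lambda>t. 0, 0, 1)" b] that L_zero by (simp add: Tu Tc)
  note b = lie_isoD(1)[OF \<Phi>]
  have "bij_betw \<Phi> (L \<times> UNIV \<times> {0}) (L \<times> UNIV \<times> {0})"
    unfolding bij_betw_def
  proof (intro conjI equalityI subsetI)
    show "inj_on \<Phi> (L \<times> UNIV \<times> {0})" using bij_betw_imp_inj_on[OF b] by (rule inj_on_subset) auto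
  next
    fix y assume "y \<in> \<Phi> ` (L \<times> UNIV \<times> {0})"
    then obtain u a where u: "u \<in> L" "y = \<Phi> (u, a, 0)" by auto
    then show "y \<in> L \<times> UNIV \<times> {0}"
      using lie_isoD(2)[OF \<Phi>, of "(u, a, 0)"] T'[of u a 0] by (cases y) (auto simp: T_def)
  next
    fix y :: "(real \<Rightarrow> 'a) \<times> 'k \<times> 'k"
    assume y: "y \<in> L \<times> UNIV \<times> {0}"
    have sur: "\<exists>u a b. u \<in> L \<and> y = \<Phi> (u, a, b)" if "y \<in> carr Lh" for y :: "(real \<Rightarrow> 'a) \<times> 'k \<times> 'k"
    proof -
      have "y \<in> \<Phi> ` carr Lh" using that b by (simp add: bij_betw_def)
      then show ?thesis by auto
    qed
    have "T (\<lambda>t. 0, 0, 1) \<noteq> 0"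
    proof
      assume z: "T (\<lambda>t. 0, 0, 1) = 0"
      obtain u a b where ub: "u \<in> L" "(\<lambda>t. 0, 0, 1) = \<Phi> (u, a, b)" using sur[of "(\<lambda>t. 0, 0, 1)"] L_zero by auto
      have "T (u, a, b) = 1" unfolding T_def ub(2)[symmetric] by simp
      then show False using T'[OF ub(1)] z by simp
    qed
    moreover obtain u a b where ub: "u \<in> L" "y = \<Phi> (u, a, b)" using sur[of y] y by auto
    moreover have "T (u, a, b) = 0" unfolding T_def ub(2)[symmetric] using y by auto
    ultimately have "b = 0" using T'[of u a b] by simp
    then show "y \<in> \<Phi> ` (L \<times> UNIV \<times> {0})" using ub by auto
  qed
  moreover have "x \<in> carr Lh' \<Longrightarrow> x \<in> carr Lh" for x by auto
  ultimately show ?thesis unfolding lie_iso_def using lie_isoD[OF \<Phi>] by simp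
qed

text \<open>On the derived algebra \<open>derived_structure\<close> applies. The brackets of
  \<open>d\<close> with loops show that the deviation of its image from the one under
  \<open>mk\<close> would make a multiple of differentiation inner;
  \<open>derivation_not_inner\<close> leaves only \<open>e1 = e\<close> and
  \<open>w1 = w\<close>.\<close>

lemma affine_structure:
  assumes \<Phi>: "lie_iso Lh Lh \<Phi>"
  obtains \<phi> e w \<nu> where "\<And>u. u \<in> L \<Longrightarrow> \<phi> u \<in> L" "e * e = 1" "w \<in> L" "\<And>u v. u \<in> L \<Longrightarrow> v \<in> L \<Longrightarrow> pr (\<phi> u) (\<phi> v) = pr u v"
    "\<And>x. x \<in> carr Lh \<Longrightarrow> \<Phi> x = mk \<phi> e w \<nu> x" "\<And>\<nu>. lie_iso Lh Lh (mk \<phi> e w \<nu>)"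
proof -
  define \<phi> where "\<phi> = (\<lambda>u. fst (\<Phi> (u, 0, 0)))"
  note \<Psi> = restricts_to_derived[OF \<Phi>]
  interpret i: floop_iso br \<sigma> sc \<rho> br \<sigma> sc \<phi>
    unfolding \<phi>_def by (rule self_iso[OF derived_structure(1)[OF \<Psi>]])
  obtain e w where s: "i.std e w" using i.ex_std by blast
  have st: "\<Phi> (u, a, 0) = (\<phi> u, e * a - e * pr w (\<phi> u), 0)" if "u \<in> L" for u a
    unfolding \<phi>_def by (rule derived_structure(2)[OF \<Psi> i.cocycle_\<phi>[OF s, unfolded \<phi>_def] i.wL[OF s] that])
  obtain w1 \<nu> e1 where d: "\<Phi> (\<lambda>t. 0, 0, 1) = (w1, \<nu>, e1)" by (cases "\<Phi> (\<lambda>t. 0, 0, 1)")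
  have eq: "sc (e1 - e) (deriv_loop v t) = br (w t - w1 t) (v t)" if v: "v \<in> L" for v t
  proof -
    let ?u = "i.\<psi> v"
    have u: "?u \<in> L" "\<phi> ?u = v" by (rule i.\<psi>_in[OF v] i.\<phi>\<psi>[OF v])+
    have "\<phi> (deriv_loop ?u) = (\<lambda>t. br (w1 t) (v t) + sc e1 (deriv_loop v t))"
      using lie_isoD(5)[OF \<Phi>, of "(\<lambda>t. 0, 0, 1)" "(?u, 0, 0)"] u L_zero
      by (simp add: d st L_deriv f.brl.zero)
    then have "br (w1 t) (v t) + sc e1 (deriv_loop v t) = sc e (deriv_loop v t) + br (w t) (v t)"
      using i.\<phi>_deriv[OF s u(1)] by (simp add: u(2) fun_eq_iff)
    then show ?thesis by (simp add: f.scale_left_diff_distrib f.brl.diff algebra_simps)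
  qed
  have e1: "e1 = e" using derivation_not_inner(1)[of "e1 - e" "\<lambda>t. w t - w1 t"] eq by simp
  have w1: "w1 = w" using derivation_not_inner(2)[of "e1 - e" "\<lambda>t. w t - w1 t"] eq by (simp add: fun_eq_iff)
  show thesis
  proof (rule that)
    show "\<phi> u \<in> L" if "u \<in> L" for u by (rule i.\<phi>_in[OF that])
    show "e * e = 1" "w \<in> L" by (rule i.ee[OF s] i.wL[OF s])+
    show "pr (\<phi> u) (\<phi> v) = pr u v" if "u \<in> L" "v \<in> L" for u v by (rule i.pr_\<phi>[OF s that])
    show "lie_iso Lh Lh (mk \<phi> e w \<nu>)" for \<nu> by (rule i.lie_iso_mk[OF s])
    fix x assume "x \<in> carr Lh"
    then obtain u a b where x: "x = (u, a, b)" "u \<in> L" by auto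
    have "\<Phi> (\<lambda>t. 0, 0, b) = (\<lambda>t. sc b (w t), b * \<nu>, b * e)"
      using lie_isoD(4)[OF \<Phi>, of "(\<lambda>t. 0, 0, 1)" b] L_zero by (simp add: d e1 w1)
    then show "\<Phi> x = mk \<phi> e w \<nu> x"
      using lie_isoD(3)[OF \<Phi>, of "(u, a, 0)" "(\<lambda>t. 0, 0, b)"] x L_zero by (simp add: st mk_def algebra_simps)
  qed
qed

end

lemma claim_i:
  assumes "floop br \<sigma> sc \<rho>" "floop br' \<sigma>' sc' \<rho>"
  shows "claim_i sc br \<sigma> sc' br' \<sigma>'"
  unfolding claim_i_def
proof (intro allI impI)
  fix \<phi> assume "lie_iso (Lalg sc br \<sigma>) (Lalg sc' br' \<sigma>') \<phi>"
  then interpret floop_iso br \<sigma> sc \<rho> br' \<sigma>' sc' \<phi>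
    using assms by (intro floop_iso.intro floop_iso_axioms.intro)
  obtain \<Phi> where "lie_iso A.Lh B.Lh \<Phi>" "\<And>u. fst (\<Phi> (u, 0, 0)) = \<phi> u" by (rule ex_affine_iso, rule that)
  then show "\<exists>\<Phi>. lie_iso A.Lh B.Lh \<Phi> \<and> induces \<Phi> (loop_set \<sigma>) \<phi>" unfolding induces_def by blast
qed

section \<open>The automorphism groups\<close>

context floop
begin

text \<open>\<open>e\<close> and \<open>w\<close> are chosen from \<open>\<phi>\<close> alone,
  before \<open>\<Psi>\<close>; two lifts of the same \<open>\<phi>\<close> therefore coincide on
  the derived algebra.\<close>

lemma derived_form:
  assumes "lie_iso La La \<phi>"
  shows "\<exists>e w. \<forall>\<Psi>. lie_iso Lh' Lh' \<Psi> \<longrightarrow> (\<forall>u. fst (\<Psi> (u, 0, 0)) = \<phi> u)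
    \<longrightarrow> (\<forall>u\<in>L. \<forall>a. \<Psi> (u, a, 0) = (\<phi> u, e * a - e * pr w (\<phi> u), 0))"
proof -
  interpret i: floop_iso br \<sigma> sc \<rho> br \<sigma> sc \<phi> by (rule self_iso[OF assms])
  obtain e w where s: "i.std e w" using i.ex_std by blast
  have "\<Psi> (u, a, 0) = (\<phi> u, e * a - e * pr w (\<phi> u), 0)"
    if \<Psi>: "lie_iso Lh' Lh' \<Psi>" "\<forall>u. fst (\<Psi> (u, 0, 0)) = \<phi> u" and u: "u \<in> L" for \<Psi> u a
    using derived_structure(2)[OF \<Psi>(1), of e w u a] i.cocycle_\<phi>[OF s] i.wL[OF s] u by (simp add: \<Psi>(2))
  then show ?thesis by blast
qed

lemma derived_determined:
  assumes f: "lie_iso Lh' Lh' f" and u: "u \<in> L"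
  shows "fst (f (u, a, 0)) = fst (f (u, 0, 0))"
    and "lie_iso Lh' Lh' g \<Longrightarrow> (\<And>u. fst (g (u, 0, 0)) = fst (f (u, 0, 0))) \<Longrightarrow> f (u, a, 0) = g (u, a, 0)"
proof -
  obtain e w where *: "\<forall>\<Psi>. lie_iso Lh' Lh' \<Psi> \<longrightarrow> (\<forall>u. fst (\<Psi> (u, 0, 0)) = fst (f (u, 0, 0)))
    \<longrightarrow> (\<forall>u\<in>L. \<forall>a. \<Psi> (u, a, 0) = (fst (f (u, 0, 0)), e * a - e * pr w (fst (f (u, 0, 0))), 0))"
    using derived_form[OF derived_structure(1)[OF f]] by blast
  have fa: "f (u, a, 0) = (fst (f (u, 0, 0)), e * a - e * pr w (fst (f (u, 0, 0))), 0)" using * f u by blast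
  then show "fst (f (u, a, 0)) = fst (f (u, 0, 0))" by simp
  show "f (u, a, 0) = g (u, a, 0)" if "lie_iso Lh' Lh' g" "\<And>u. fst (g (u, 0, 0)) = fst (f (u, 0, 0))"
    unfolding fa using * that u by simp
qed

text \<open>Injectivity is \<open>derived_determined\<close>; for surjectivity an automorphism is
  lifted to the affine algebra and then restricted.\<close>

lemma claim_ii: "claim_ii sc br \<sigma>"
  unfolding claim_ii_def loop_set_eq
proof (rule isoI)
  let ?G = "AutG Lh'"
  have qin: "quot_map L f \<in> carrier (AutG La)" if "f \<in> carrier ?G" for f
    using AutG_restrict[OF closed_ops(1) derived_structure(1)] that by (simp add: quot_map_def AutG_simps)
  show "quot_map L \<in> hom ?G (AutG La)"
  proof (rule homI)
    fix f g assume fg: "f \<in> carrier ?G" "g \<in> carrier ?G"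
    have F: "lie_iso Lh' Lh' f" and G: "lie_iso Lh' Lh' g" using fg by (simp_all add: AutG_simps)
    have "fst (f (g (u, 0, 0))) = fst (f (fst (g (u, 0, 0)), 0, 0)) \<and> fst (g (u, 0, 0)) \<in> L" if u: "u \<in> L" for u
    proof -
      obtain v a where "g (u, 0, 0) = (v, a, 0)" "v \<in> L"
        using lie_isoD(2)[OF G, of "(u, 0, 0)"] u by (cases "g (u, 0, 0)") auto
      then show ?thesis using derived_determined(1)[OF F, of v a] by simp
    qed
    then show "quot_map L (f \<otimes>\<^bsub>?G\<^esub> g) = quot_map L f \<otimes>\<^bsub>AutG La\<^esub> quot_map L g"
      by (auto simp: AutG_simps quot_map_def compose_def fun_eq_iff)
  qed (rule qin)
  show "bij_betw (quot_map L) (carrier ?G) (carrier (AutG La))"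
    unfolding bij_betw_def
  proof (intro conjI inj_onI equalityI subsetI)
    fix f g assume f: "f \<in> carrier ?G" and g: "g \<in> carrier ?G" and eq: "quot_map L f = quot_map L g"
    have F: "lie_iso Lh' Lh' f" and G: "lie_iso Lh' Lh' g" using f g by (simp_all add: AutG_simps)
    have "fst (g (u, 0, 0)) = fst (f (u, 0, 0))" for u
    proof (cases "u \<in> L")
      case True
      then show ?thesis using fun_cong[OF eq, of u] by (simp add: quot_map_def)
    next
      case False
      \<comment> \<open>Extensional maps share the value \<open>undefined\<close> outside the
        carrier, which settles the arguments that are not loops.\<close>
      then have n: "(u, 0, 0) \<notin> carr Lh'" by simp
      have e: "f \<in> extensional (carr Lh')" "g \<in> extensional (carr Lh')" using f g by (simp_all only: AutG_simps)
      show ?thesis unfolding extensional_arb[OF e(1) n] extensional_arb[OF e(2) n] ..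
    qed
    then have "f (u, a, 0) = g (u, a, 0)" if "u \<in> L" for u a by (rule derived_determined(2)[OF F that G])
    then show "f = g" by (intro AutG_eqI[OF f g]) auto
  next
    fix \<phi> assume \<phi>: "\<phi> \<in> carrier (AutG La)"
    interpret i: floop_iso br \<sigma> sc \<rho> br \<sigma> sc \<phi> using self_iso \<phi> by (simp add: AutG_simps)
    obtain \<Phi> where \<Phi>: "lie_iso Lh Lh \<Phi>" "\<And>u. fst (\<Phi> (u, 0, 0)) = \<phi> u" by (rule i.ex_affine_iso, rule that)
    have "restrict \<Phi> (carr Lh') \<in> carrier ?G" by (rule AutG_restrict[OF closed_ops(3) restricts_to_derived[OF \<Phi>(1)]])
    moreover have "quot_map L (restrict \<Phi> (carr Lh')) = \<phi>"
    proof
      fix u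
      have e: "\<phi> \<in> extensional L" using \<phi> by (simp add: AutG_simps)
      show "quot_map L (restrict \<Phi> (carr Lh')) u = \<phi> u"
        using extensional_arb[OF e, of u] by (cases "u \<in> L") (simp_all add: quot_map_def \<Phi>(2))
    qed
    ultimately show "\<phi> \<in> quot_map L ` carrier ?G" by (metis imageI)
  qed (auto intro: qin)
qed

abbreviation shift :: "'k \<Rightarrow> (real \<Rightarrow> 'a) \<times> 'k \<times> 'k \<Rightarrow> (real \<Rightarrow> 'a) \<times> 'k \<times> 'k" where
  "shift s \<equiv> \<lambda>(u, a, b). (u, a + s * b, b)"

lemma lie_iso_shift: "lie_iso Lh Lh (shift s)"
proof -
  have id: "lie_iso La La (\<lambda>u. u)" by (simp add: lie_iso_def bij_betw_def)
  interpret i: floop_iso br \<sigma> sc \<rho> br \<sigma> sc "\<lambda>u. u" by (rule self_iso[OF id])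
  have "i.std 1 (\<lambda>t. 0)" by (simp add: i.std_def L_zero f.brl.zero)
  from i.lie_iso_mk[OF this, of s] have "lie_iso Lh Lh (mk (\<lambda>u. u) 1 (\<lambda>t. 0) s)" .
  moreover have "mk (\<lambda>u. u) 1 (\<lambda>t. 0) s = shift s" by (auto simp: mk_def fun_eq_iff)
  ultimately show ?thesis by simp
qed

text \<open>\<open>mk\<close> multiplies the coefficients of \<open>c\<close> and \<open>d\<close>
  by the same \<open>e\<close>, so the shift can be made before or after. This makes the product in
  \<open>claim_iv\<close> direct.\<close>

lemma shift_commute:
  assumes g: "lie_iso Lh Lh g" and x: "x \<in> carr Lh"
  shows "shift s (g x) = g (shift s x)"
proof -
  obtain \<phi> e w \<nu> where "\<And>x. x \<in> carr Lh \<Longrightarrow> g x = mk \<phi> e w \<nu> x" by (rule affine_structure[OF g], rule that)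
  with x show ?thesis by (cases x) (simp add: mk_def algebra_simps)
qed

lemma shift_form:
  assumes f: "lie_iso Lh Lh f" and "f cc = cc" "f dd = (\<lambda>t. 0, \<nu>, 1)" "\<And>u. u \<in> L \<Longrightarrow> f (emb u) = emb u"
    and x: "x \<in> carr Lh"
  shows "f x = shift \<nu> x"
proof -
  obtain u a b where x: "x = (u, a, b)" "u \<in> L" using x by (cases x) auto
  have c: "f (\<lambda>t. 0, 1, 0) = (\<lambda>t. 0, 1, 0)" and d: "f (\<lambda>t. 0, 0, 1) = (\<lambda>t. 0, \<nu>, 1)" and e: "f (u, 0, 0) = (u, 0, 0)"
    using assms(2-4) x(2) by (simp_all add: cc_def dd_def emb_def)
  have "f (\<lambda>t. 0, a, 0) = (\<lambda>t. 0, a, 0)" "f (\<lambda>t. 0, 0, b) = (\<lambda>t. 0, b * \<nu>, b)"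
    using lie_isoD(4)[OF f, of "(\<lambda>t. 0, 1, 0)" a] lie_isoD(4)[OF f, of "(\<lambda>t. 0, 0, 1)" b] L_zero by (simp_all add: c d)
  then have "f (\<lambda>t. 0, a, b) = (\<lambda>t. 0, a + b * \<nu>, b)"
    using lie_isoD(3)[OF f, of "(\<lambda>t. 0, a, 0)" "(\<lambda>t. 0, 0, b)"] L_zero by simp
  then show ?thesis
    using lie_isoD(3)[OF f, of "(u, 0, 0)" "(\<lambda>t. 0, a, b)"] L_zero x by (simp add: e mult.commute)
qed

lemma shift_kernel:
  "restrict (shift \<nu>) (carr Lh) \<in> {\<Phi> \<in> carrier (AutG Lh). \<exists>\<nu>. \<Phi> cc = cc \<and> \<Phi> dd = (\<lambda>t. 0, \<nu>, 1) \<and> (\<forall>u\<in>L. \<Phi> (emb u) = emb u)}"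
  using AutG_restrict[OF closed_ops(2) lie_iso_shift] L_zero by (auto simp: cc_def dd_def emb_def)

lemma claim_iii: "claim_iii sc br \<sigma>"
  unfolding claim_iii_def Let_def loop_set_eq
proof (intro conjI)
  let ?G = "AutG Lh" and ?G' = "AutG Lh'" and ?r = "\<lambda>\<Phi>. restrict \<Phi> (carr Lh')"
  let ?K = "{\<Phi> \<in> carrier ?G. \<exists>\<nu>. \<Phi> cc = cc \<and> \<Phi> dd = (\<lambda>t. 0, \<nu>, 1) \<and> (\<forall>u\<in>L. \<Phi> (emb u) = emb u)}"
  have sub: "x \<in> carr Lh' \<Longrightarrow> x \<in> carr Lh" for x by auto
  have res: "lie_iso Lh' Lh' f" if "f \<in> carrier ?G" for f
    using that by (intro restricts_to_derived) (simp add: AutG_simps)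
  show "?r \<in> hom ?G ?G'"
  proof (rule homI)
    show "?r f \<in> carrier ?G'" if "f \<in> carrier ?G" for f by (rule AutG_restrict[OF closed_ops(3) res[OF that]])
    fix f g assume fg: "f \<in> carrier ?G" "g \<in> carrier ?G"
    then show "?r (f \<otimes>\<^bsub>?G\<^esub> g) = ?r f \<otimes>\<^bsub>?G'\<^esub> ?r g"
      using lie_isoD(2)[OF res[OF fg(2)]] sub by (auto simp: AutG_simps compose_def fun_eq_iff simp del: alg_simps)
  qed
  have shiftK: "\<exists>\<nu>. \<forall>x\<in>carr Lh. \<Phi> x = shift \<nu> x" if K: "\<Phi> \<in> ?K" for \<Phi>
  proof -
    from K obtain \<nu> where "lie_iso Lh Lh \<Phi>" "\<Phi> cc = cc" "\<Phi> dd = (\<lambda>t. 0, \<nu>, 1)" "\<And>u. u \<in> L \<Longrightarrow> \<Phi> (emb u) = emb u"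
      by (auto simp: AutG_simps)
    from shift_form[OF this] show ?thesis by blast
  qed
  show "kernel ?G ?G' ?r = ?K"
  proof (intro equalityI subsetI)
    fix \<Phi> assume "\<Phi> \<in> kernel ?G ?G' ?r"
    then have \<Phi>: "\<Phi> \<in> carrier ?G" "restrict \<Phi> (carr Lh') = restrict id (carr Lh')"
      by (simp_all add: kernel_def AutG_simps)
    have F: "lie_iso Lh Lh \<Phi>" using \<Phi> by (simp add: AutG_simps)
    have id: "\<Phi> (u, a, 0) = (u, a, 0)" if "u \<in> L" for u a
      using fun_cong[OF \<Phi>(2), of "(u, a, 0)"] that by simp
    obtain w \<nu> e where d: "\<Phi> (\<lambda>t. 0, 0, 1) = (w, \<nu>, e)" by (cases "\<Phi> (\<lambda>t. 0, 0, 1)")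
    \<comment> \<open>The bracket of \<open>d\<close> with \<open>v\<close> is the derivative of
      \<open>v\<close>, which \<open>\<Phi>\<close> fixes as a loop; comparison with the bracket of
      the images makes \<open>1 - e\<close> times differentiation inner.\<close>
    have eq: "sc (1 - e) (deriv_loop v t) = br (w t) (v t)" if v: "v \<in> L" for v t
    proof -
      have "deriv_loop v = (\<lambda>t. br (w t) (v t) + sc e (deriv_loop v t))"
        using lie_isoD(5)[OF F, of "(\<lambda>t. 0, 0, 1)" "(v, 0, 0)"] v L_zero by (simp add: d id L_deriv f.brl.zero)
      from fun_cong[OF this, of t] show ?thesis by (simp only: f.scale_left_diff_distrib f.scale_one diff_eq_eq)
    qed
    have "1 - e = 0" by (rule derivation_not_inner(1)[of "1 - e" w]) (rule eq)
    then have "e = 1" by simp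
    moreover have "w = (\<lambda>t. 0)" by (rule ext, rule derivation_not_inner(2)[of "1 - e" w]) (rule eq)
    ultimately show "\<Phi> \<in> ?K" using \<Phi>(1) d by (simp add: cc_def dd_def emb_def id L_zero)
  next
    fix \<Phi> assume K: "\<Phi> \<in> ?K"
    then obtain \<nu> where "\<And>x. x \<in> carr Lh \<Longrightarrow> \<Phi> x = shift \<nu> x" using shiftK by blast
    then have "restrict \<Phi> (carr Lh') = restrict id (carr Lh')" by (auto simp: fun_eq_iff)
    then show "\<Phi> \<in> kernel ?G ?G' ?r" using K by (simp add: kernel_def AutG_simps)
  qed
  let ?h = "\<lambda>\<Phi>::(real \<Rightarrow> 'a) \<times> 'k \<times> 'k \<Rightarrow> (real \<Rightarrow> 'a) \<times> 'k \<times> 'k. fst (snd (\<Phi> dd))"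
  have dd: "dd \<in> carr Lh" using L_zero by (simp add: dd_def)
  have hs: "?h \<Phi> = \<nu>" if "\<forall>x\<in>carr Lh. \<Phi> x = shift \<nu> x" for \<Phi> \<nu>
    using that dd by (simp add: dd_def)
  have "?h \<in> iso (?G\<lparr>carrier := ?K\<rparr>) addG"
  proof (rule isoI)
    show "?h \<in> hom (?G\<lparr>carrier := ?K\<rparr>) addG"
    proof (rule homI)
      fix f g assume "f \<in> carrier (?G\<lparr>carrier := ?K\<rparr>)" "g \<in> carrier (?G\<lparr>carrier := ?K\<rparr>)"
      then obtain \<nu> \<nu>' where s: "\<forall>x\<in>carr Lh. f x = shift \<nu> x" "\<forall>x\<in>carr Lh. g x = shift \<nu>' x"
        using shiftK[of f] shiftK[of g] by auto
      have "\<forall>x\<in>carr Lh. compose (carr Lh) f g x = shift (\<nu> + \<nu>') x"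
        using s by (auto simp: compose_def algebra_simps)
      then have "?h (compose (carr Lh) f g) = \<nu> + \<nu>'" by (rule hs)
      then show "?h (f \<otimes>\<^bsub>?G\<lparr>carrier := ?K\<rparr>\<^esub> g) = ?h f \<otimes>\<^bsub>addG\<^esub> ?h g"
        using hs[OF s(1)] hs[OF s(2)] by (simp add: AutG_simps addG_def)
    qed (simp add: addG_def)
    show "bij_betw ?h (carrier (?G\<lparr>carrier := ?K\<rparr>)) (carrier addG)"
      unfolding bij_betw_def
    proof (intro conjI inj_onI equalityI subsetI)
      fix f g assume "f \<in> carrier (?G\<lparr>carrier := ?K\<rparr>)" "g \<in> carrier (?G\<lparr>carrier := ?K\<rparr>)" and eq: "?h f = ?h g"
      then have fg: "f \<in> ?K" "g \<in> ?K" by simp_all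
      obtain \<nu> \<nu>' where s: "\<forall>x\<in>carr Lh. f x = shift \<nu> x" "\<forall>x\<in>carr Lh. g x = shift \<nu>' x"
        using shiftK[OF fg(1)] shiftK[OF fg(2)] by blast
      have "\<nu> = \<nu>'" using eq hs[OF s(1)] hs[OF s(2)] by simp
      then show "f = g" using fg s by (intro AutG_eqI[of f Lh g]) auto
    next
      fix \<nu> :: 'k
      have "?h (restrict (shift \<nu>) (carr Lh)) = \<nu>" by (rule hs) simp
      then show "\<nu> \<in> ?h ` carrier (?G\<lparr>carrier := ?K\<rparr>)" using shift_kernel[of \<nu>] by (intro image_eqI[of _ _ "restrict (shift \<nu>) (carr Lh)"]) simp_all
    qed (simp add: addG_def)
  qed
  then show "?G\<lparr>carrier := ?K\<rparr> \<cong> (addG :: 'k monoid)" by (rule is_isoI)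
qed

text \<open>The condition on \<open>\<nu>\<close> says that the image
  \<open>w + \<nu> c + e d\<close> of \<open>d\<close> is again isotropic. Elsewhere the term
  \<open>- e * pr w (\<phi> u)\<close> cancels the products with \<open>w\<close>.\<close>

lemma form_preserved:
  assumes "\<And>u. u \<in> L \<Longrightarrow> \<phi> u \<in> L" "e * e = 1" "w \<in> L" "\<And>u v. u \<in> L \<Longrightarrow> v \<in> L \<Longrightarrow> pr (\<phi> u) (\<phi> v) = pr u v"
    and \<nu>: "2 * e * \<nu> = - pr w w" and x: "x \<in> carr Lh" and y: "y \<in> carr Lh"
  shows "hat_form sc br (mk \<phi> e w \<nu> x) (mk \<phi> e w \<nu> y) = hat_form sc br x y"
proof -
  obtain u a b v a' b' where p: "x = (u, a, b)" "y = (v, a', b')" and uv: "u \<in> L" "v \<in> L" using x y by (cases x, cases y) auto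
  have ee': "e * (e * z) = z" for z by (simp add: assms(2) flip: mult.assoc)
  have 1: "pr (\<lambda>t. \<phi> u t + sc b (w t)) (\<lambda>t. \<phi> v t + sc b' (w t)) = pr u v + b' * pr w (\<phi> u) + b * pr w (\<phi> v) + b * (b' * pr w w)"
    by (simp add: pr_add_left pr_add_right pr_scale_left pr_scale_right L_add L_sc assms uv pr_commute[of "\<phi> u" w] algebra_simps)
  have 2: "(e * a + \<nu> * b - e * pr w (\<phi> u)) * (e * b') = a * b' + e * \<nu> * b * b' - b' * pr w (\<phi> u)" for a b b' u
  proof -
    have "(e * a + \<nu> * b - e * pr w (\<phi> u)) * (e * b') = e * (e * (a * b')) + e * \<nu> * b * b' - e * (e * (b' * pr w (\<phi> u)))"
      by (simp add: algebra_simps)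
    then show ?thesis by (simp only: ee')
  qed
  have "hat_form sc br (mk \<phi> e w \<nu> x) (mk \<phi> e w \<nu> y) = pr u v + a * b' + b * a' + (2 * e * \<nu> + pr w w) * (b * b')"
    unfolding p hat_form_def mk_def prod.case 1 mult.commute[of "e * b"] 2 by (simp add: algebra_simps)
  then show ?thesis unfolding \<nu> by (simp add: p hat_form_def)
qed

text \<open>A form-preserving automorphism is composed with a shift. The form takes the value
  \<open>2 * s\<close> on the image of \<open>d\<close> paired with itself, which recovers
  \<open>s\<close>.\<close>

lemma claim_iv: "claim_iv sc br \<sigma>"
  unfolding claim_iv_def
proof (rule is_iso_sym_closed)
  let ?F = "AutFormG Lh (hat_form sc br)" and ?G = "AutG Lh"
  let ?A = "?F \<times>\<times> (addG :: 'k monoid)"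
  let ?h = "\<lambda>(f, s). restrict (\<lambda>x. f (shift s x)) (carr Lh)"
  have F: "f \<in> carrier ?F \<longleftrightarrow> f \<in> carrier ?G \<and> (\<forall>x\<in>carr Lh. \<forall>y\<in>carr Lh. hat_form sc br (f x) (f y) = hat_form sc br x y)"
    and Fm: "f \<otimes>\<^bsub>?F\<^esub> g = compose (carr Lh) f g" for f g
    by (simp_all add: AutFormG_def AutG_def)
  have addm: "s \<otimes>\<^bsub>addG\<^esub> r = s + r" for s r :: 'k by (simp add: addG_def)
  have addc: "s \<in> carrier addG" for s :: 'k by (simp add: addG_def)
  have li: "lie_iso Lh Lh f" if "f \<in> carrier ?F" for f using that by (simp add: F AutG_simps)
  have shift_in: "shift s x \<in> carr Lh" if "x \<in> carr Lh" for s x using that by auto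
  have shift_shift: "shift s (shift r x) = shift (s + r) x" for s r x by (cases x) (simp add: algebra_simps)
  have hin: "restrict (\<lambda>x. f (shift s x)) (carr Lh) \<in> carrier ?G" if "f \<in> carrier ?F" for f s
    using AutG_restrict[OF closed_ops(2) lie_iso_comp[OF lie_iso_shift[of s] li[OF that]]] by (simp only: comp_def)
  show "x \<otimes>\<^bsub>?A\<^esub> y \<in> carrier ?A" if xy: "x \<in> carrier ?A" "y \<in> carrier ?A" for x y
  proof -
    obtain f s g r where p: "x = (f, s)" "y = (g, r)" by (cases x, cases y)
    have fg: "f \<in> carrier ?F" "g \<in> carrier ?F" using xy p by auto
    have "compose (carr Lh) f g \<in> carrier ?F"
      using fg AutG_closed[OF closed_ops(2), of f g] lie_isoD(2)[OF li[OF fg(2)]] by (simp add: F compose_def del: alg_simps)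
    then show ?thesis by (simp add: p Fm addc)
  qed
  show "?h \<in> iso ?A ?G"
  proof (rule isoI)
    show "?h \<in> hom ?A ?G"
    proof (rule homI)
      fix x y assume xy: "x \<in> carrier ?A" "y \<in> carrier ?A"
      obtain f s g r where p: "x = (f, s)" "y = (g, r)" by (cases x, cases y)
      have fg: "f \<in> carrier ?F" "g \<in> carrier ?F" using xy p by auto
      have "f (g (shift (s + r) z)) = f (shift s (g (shift r z)))" if "z \<in> carr Lh" for z
        unfolding shift_shift[symmetric] shift_commute[OF li[OF fg(2)] shift_in[OF that]] ..
      then show "?h (x \<otimes>\<^bsub>?A\<^esub> y) = ?h x \<otimes>\<^bsub>?G\<^esub> ?h y"
        using shift_in lie_isoD(2)[OF li[OF fg(2)]]
        by (simp add: p Fm addm AutG_simps compose_def restrict_def fun_eq_iff del: alg_simps split_paired_All)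
    qed (use hin in auto)
    show "bij_betw ?h (carrier ?A) (carrier ?G)"
      unfolding bij_betw_def
    proof (intro conjI inj_onI equalityI subsetI)
      fix x y assume xy: "x \<in> carrier ?A" "y \<in> carrier ?A" and eq: "?h x = ?h y"
      obtain f s g r where p: "x = (f, s)" "y = (g, r)" by (cases x, cases y)
      have fg: "f \<in> carrier ?F" "g \<in> carrier ?F" using xy p by auto
      have e: "f (shift s z) = g (shift r z)" if "z \<in> carr Lh" for z
        using fun_cong[OF eq, of z] that by (simp add: p del: alg_simps)
      have dd: "dd \<in> carr Lh" using L_zero by (simp add: dd_def)
      have form: "hat_form sc br (f (shift s dd)) (f (shift s dd)) = 2 * s" if "f \<in> carrier ?F" for f s
      proof -
        have "hat_form sc br (f (shift s dd)) (f (shift s dd)) = hat_form sc br (shift s dd) (shift s dd)"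
          using that shift_in[OF dd] unfolding F by blast
        then show ?thesis by (simp add: dd_def hat_form_def)
      qed
      have s: "s = r" using form[OF fg(1), of s] form[OF fg(2), of r] by (simp add: e[OF dd])
      have "f z = g z" if "z \<in> carr Lh" for z
        using e[OF shift_in[OF that, of "- s"]] unfolding shift_shift s by (simp add: case_prod_beta)
      then show "x = y" using fg unfolding p s F by (auto intro: AutG_eqI)
    next
      fix \<Phi> assume \<Phi>: "\<Phi> \<in> carrier ?G"
      then have L\<Phi>: "lie_iso Lh Lh \<Phi>" by (simp add: AutG_simps)
      obtain \<phi> e w \<nu> where m: "\<And>u. u \<in> L \<Longrightarrow> \<phi> u \<in> L" "e * e = 1" "w \<in> L" "\<And>u v. u \<in> L \<Longrightarrow> v \<in> L \<Longrightarrow> pr (\<phi> u) (\<phi> v) = pr u v"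
        "\<And>x. x \<in> carr Lh \<Longrightarrow> \<Phi> x = mk \<phi> e w \<nu> x" "\<And>\<nu>. lie_iso Lh Lh (mk \<phi> e w \<nu>)"
        by (rule affine_structure[OF L\<Phi>], rule that)
      \<comment> \<open>Half the value of the form on the image of \<open>d\<close> under
        \<open>\<Phi>\<close>, paired with itself. As \<open>mk\<close> turns a shift by
        \<open>s\<close> into \<open>e * s\<close> in its parameter, \<open>\<nu> - e * s\<close>
        remains for the isometry.\<close>
      define s where "s = (pr w w + 2 * \<nu> * e) / 2"
      let ?f = "restrict (mk \<phi> e w (\<nu> - e * s)) (carr Lh)"
      have "2 * e * (\<nu> - e * s) = 2 * e * \<nu> - (e * e) * (2 * s)" by (simp add: algebra_simps)
      also have "2 * s = pr w w + 2 * \<nu> * e" by (simp add: s_def)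
      also have "2 * e * \<nu> - e * e * (pr w w + 2 * \<nu> * e) = - pr w w" unfolding m(2) by (simp add: algebra_simps)
      finally have \<nu>: "2 * e * (\<nu> - e * s) = - pr w w" .
      have f: "?f \<in> carrier ?F"
        unfolding F using AutG_restrict[OF closed_ops(2) m(6)] form_preserved[OF m(1-4) \<nu>] by (simp del: alg_simps)
      have "\<Phi> = ?h (?f, s)"
      proof (rule AutG_eqI[OF \<Phi>])
        show "?h (?f, s) \<in> carrier ?G" using hin[OF f, of s] by simp
        fix x assume x: "x \<in> carr Lh"
        then have "?h (?f, s) x = mk \<phi> e w (\<nu> - e * s) (shift s x)" using shift_in[OF x, of s] by (simp del: alg_simps)
        also have "\<dots> = mk \<phi> e w \<nu> x" by (cases x) (simp add: mk_def algebra_simps)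
        finally show "\<Phi> x = ?h (?f, s) x" using m(5)[OF x] by simp
      qed
      moreover have "(?f, s) \<in> carrier ?A" using f by (simp add: addc)
      ultimately show "\<Phi> \<in> ?h ` carrier ?A" by (rule image_eqI)
    qed (use hin in auto)
  qed
qed

end

section \<open>The two base fields\<close>

lemma order_of:
  assumes "finite_order \<sigma>"
  shows "0 < order_of \<sigma>" "\<sigma> ^^ order_of \<sigma> = id"
proof -
  have "0 < order_of \<sigma> \<and> \<sigma> ^^ order_of \<sigma> = id"
    using assms unfolding finite_order_def order_of_def by (rule LeastI_ex)
  then show "0 < order_of \<sigma>" "\<sigma> ^^ order_of \<sigma> = id" by simp_all
qed

lemma floop_setting:
  fixes sc :: "'k::{real_normed_field, banach} \<Rightarrow> 'a::real_normed_vector \<Rightarrow> 'a"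
  assumes s: "setting sc br \<sigma>" and fd: "fin_dim (scaleR :: real \<Rightarrow> 'a \<Rightarrow> 'a)" and simple: "simple_lie (scaleR :: real \<Rightarrow> 'a \<Rightarrow> 'a) br"
    and \<rho>: "bounded_linear \<rho>" "\<And>z. (\<And>c. \<rho> (c * z) = 0) \<Longrightarrow> z = 0" "\<And>x y. killing scaleR br x y = \<rho> (killing sc br x y)"
  shows "floop br \<sigma> sc \<rho>"
proof -
  have sp: "F_vector_space sc" and lin: "Vector_Spaces.linear sc sc \<sigma>" and \<sigma>br: "\<And>x y. \<sigma> (br x y) = br (\<sigma> x) (\<sigma> y)"
    and f: "fin_dim sc" "lie_algebra sc br" "finite_order \<sigma>"
    using s by (auto simp: setting_def lie_aut_def simple_lie_def)
  have \<sigma>: "\<sigma> (x + y) = \<sigma> x + \<sigma> y" "\<sigma> (sc k x) = sc k (\<sigma> x)" for x y k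
    using lin by (simp_all add: Vector_Spaces.linear_iff)
  have "\<sigma> (r *\<^sub>R x) = r *\<^sub>R \<sigma> x" for r x
    using \<sigma>(2)[of "of_real r" x] sp by (simp add: F_vector_space_def)
  then have rl: "linear \<sigma>" by (simp add: linear_iff \<sigma>)
  have "fd_lie (scaleR :: real \<Rightarrow> 'a \<Rightarrow> 'a) br"
    unfolding fd_lie_def fd_space_def fd_space_axioms_def fd_lie_axioms_def
    using fd simple by (auto simp: simple_lie_def lie_algebra_def)
  then have "real_simple br"
    using simple by (simp add: real_simple_def real_lie_def simple_alg_def simple_alg_axioms_def)
  then have "loop_alg br \<sigma> (order_of \<sigma>)"
    using rl \<sigma>br order_of[OF f(3)] by (simp add: loop_alg_def loop_alg_axioms_def)
  then show ?thesis
    unfolding floop_def floop_axioms_def using sp f \<sigma>(2) \<rho> by blast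
qed

lemma floop_real:
  assumes "setting (scaleR :: real \<Rightarrow> 'a::real_normed_vector \<Rightarrow> 'a) br \<sigma>"
  shows "floop br \<sigma> (scaleR :: real \<Rightarrow> 'a \<Rightarrow> 'a) (\<lambda>x. x)"
proof (rule floop_setting[OF assms])
  show "z = 0" if "\<And>c. c * z = 0" for z :: real using that[of 1] by simp
qed (use assms in \<open>auto simp: setting_def bounded_linear_ident\<close>)

section \<open>Restriction of scalars from the complex to the real numbers\<close>

locale complex_space = fd_space sc for sc :: "complex \<Rightarrow> 'a::real_normed_vector \<Rightarrow> 'a" +
  assumes sc_of_real: "sc (of_real r) x = r *\<^sub>R x"
begin

lemma sc_Complex: "sc (Complex a b) x = a *\<^sub>R x + b *\<^sub>R sc \<i> x"
  by (simp add: Complex_eq scale_left_distrib sc_of_real scale_scale[symmetric] mult.commute[of \<i>] del: scale_scale)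

lemma sc_i_i: "sc \<i> (sc \<i> x) = - x"
  by simp

lemma sc_i_real: "sc \<i> (r *\<^sub>R x) = r *\<^sub>R sc \<i> x"
  by (simp add: mult.commute flip: sc_of_real)

abbreviation "C \<equiv> some_basis sc"

lemma inj_sc_i: "inj_on (sc \<i>) A"
  by (rule inj_onI) (metis minus_minus sc_i_i)

lemma basis_disjoint: "C \<inter> sc \<i> ` C = {}"
proof -
  have "b \<noteq> sc \<i> b'" if b: "b \<in> C" "b' \<in> C" for b b'
  proof
    assume e: "b = sc \<i> b'"
    have "representation C b b = 1" using representation_basis[OF some_basis(2) b(1)] by simp
    moreover have "representation C (sc \<i> b') b = \<i> * (if b = b' then 1 else 0)"
      using representation_scale[OF some_basis(2), of b' \<i>] representation_basis[OF some_basis(2) b(2)] some_basis(3) by simp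
    ultimately show False using e by (auto split: if_splits)
  qed
  then show ?thesis by blast
qed

lemma sum_real_basis: "(\<Sum>d\<in>C \<union> sc \<i> ` C. F d) = (\<Sum>b\<in>C. F b) + (\<Sum>b\<in>C. F (sc \<i> b))"
  using sum.union_disjoint[OF some_basis(1) finite_imageI[OF some_basis(1)] basis_disjoint, of F]
  by (simp add: sum.reindex[OF inj_sc_i])

lemma real_basis:
  "finite (C \<union> sc \<i> ` C)" "real_vector.independent (C \<union> sc \<i> ` C)" "real_vector.span (C \<union> sc \<i> ` C) = UNIV"
  "b \<in> C \<Longrightarrow> real_vector.representation (C \<union> sc \<i> ` C) x b = Re (representation C x b)"
  "b \<in> C \<Longrightarrow> real_vector.representation (C \<union> sc \<i> ` C) x (sc \<i> b) = Im (representation C x b)"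
proof -
  let ?D = "C \<union> sc \<i> ` C"
  show fin: "finite ?D" using some_basis(1) by simp
  show ind: "real_vector.independent ?D"
    unfolding dependent_raw_def[symmetric]
  proof (rule real_vector.independent_if_scalars_zero[OF fin])
    fix F d assume z: "(\<Sum>d\<in>?D. F d *\<^sub>R d) = 0" and d: "d \<in> ?D"
    have "(\<Sum>b\<in>C. sc (Complex (F b) (F (sc \<i> b))) b) = 0"
      using z unfolding sum_real_basis sc_Complex sum.distrib .
    then have "Complex (F b) (F (sc \<i> b)) = 0" if "b \<in> C" for b
      using independentD[OF some_basis(2) some_basis(1) subset_refl, of "\<lambda>b. Complex (F b) (F (sc \<i> b))" b] that by simp
    then show "F d = 0" using d by (auto simp: complex_eq_iff)
  qed
  define c where "c x d = (if d \<in> C then Re (representation C x d) else Im (representation C x (sc (- \<i>) d)))" for x d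
  have c1: "c x b = Re (representation C x b)" "c x (sc \<i> b) = Im (representation C x b)" if "b \<in> C" for x b
    using that basis_disjoint by (auto simp: c_def)
  have x: "x = (\<Sum>d\<in>?D. c x d *\<^sub>R d)" for x
  proof -
    have "x = (\<Sum>b\<in>C. sc (representation C x b) b)"
      using sum_representation_eq[OF some_basis(2), of x C] some_basis(1,3) by simp
    also have "\<dots> = (\<Sum>b\<in>C. c x b *\<^sub>R b + c x (sc \<i> b) *\<^sub>R sc \<i> b)"
      by (intro sum.cong refl) (simp add: c1 flip: sc_Complex)
    finally show ?thesis unfolding sum_real_basis sum.distrib .
  qed
  show "real_vector.span ?D = UNIV"
    unfolding span_raw_def[symmetric]
  proof (intro equalityI subsetI UNIV_I)
    fix y show "y \<in> Real_Vector_Spaces.span ?D"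
      by (subst x[of y]) (intro real_vector.span_sum real_vector.span_scale real_vector.span_base)
  qed
  have rep: "real_vector.representation ?D x d = c x d" if "d \<in> ?D" for d
    using real_vector.representation_lincomb[OF fin _ that, of "c x"] ind x[of x] by (simp add: dependent_raw_def representation_raw_def)
  show "b \<in> C \<Longrightarrow> real_vector.representation ?D x b = Re (representation C x b)"
    "b \<in> C \<Longrightarrow> real_vector.representation ?D x (sc \<i> b) = Im (representation C x b)"
    using rep c1 by auto
qed

lemma fin_dim_real: "fin_dim (scaleR :: real \<Rightarrow> 'a \<Rightarrow> 'a)"
  unfolding fin_dim_def using real_basis(1,3) by (metis (no_types) span_raw_def)

text \<open>In the real basis made of the vectors \<open>b\<close> and \<open>sc \<i> b\<close>,
  each complex diagonal entry \<open>z\<close> contributes \<open>Re z\<close> twice.\<close>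

lemma trace_real:
  assumes f: "Vector_Spaces.linear sc sc f"
  shows "trace_F (scaleR :: real \<Rightarrow> 'a \<Rightarrow> 'a) f = 2 * Re (trace_F sc f)"
proof -
  have fl: "f (x + y) = f x + f y" "f (sc k x) = sc k (f x)" for x y k
    using f by (simp_all add: Vector_Spaces.linear_iff)
  interpret R: fd_space "scaleR :: real \<Rightarrow> 'a \<Rightarrow> 'a"
    by (intro fd_space.intro real_vector.vector_space_axioms fd_space_axioms.intro fin_dim_real)
  have "f (r *\<^sub>R x) = r *\<^sub>R f x" for r x using fl(2)[of "of_real r" x] by (simp add: sc_of_real)
  then have rl: "Vector_Spaces.linear (scaleR :: real \<Rightarrow> 'a \<Rightarrow> 'a) scaleR f"
    by (simp add: Vector_Spaces.linear_iff fl real_vector.vector_space_axioms)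
  have "trace_F (scaleR :: real \<Rightarrow> 'a \<Rightarrow> 'a) f = btrace scaleR (C \<union> sc \<i> ` C) f"
    using R.trace_F_eq[OF _ _ _ rl] real_basis(1-3) by (simp add: dependent_raw_def span_raw_def)
  also have "\<dots> = (\<Sum>b\<in>C. Re (representation C (f b) b)) + (\<Sum>b\<in>C. Im (representation C (f (sc \<i> b)) b))"
    unfolding btrace_def sum_real_basis using real_basis(4,5) by (simp add: representation_raw_def)
  also have "(\<Sum>b\<in>C. Im (representation C (f (sc \<i> b)) b)) = (\<Sum>b\<in>C. Re (representation C (f b) b))"
    using representation_scale[OF some_basis(2), of _ \<i>] some_basis(3) by (simp add: fl(2))
  finally show ?thesis by (simp add: trace_F_def Re_sum)
qed

end

text \<open>For a real ideal \<open>I\<close> the intersection of \<open>I\<close> and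
  \<open>\<i> I\<close> is a complex ideal, and so is their sum. If the intersection is zero,
  brackets of elements of \<open>I\<close> vanish, as they lie in both; were the sum everything, the
  algebra would be abelian, so the sum and with it \<open>I\<close> are zero.\<close>

lemma simple_real:
  fixes sc :: "complex \<Rightarrow> 'a::real_normed_vector \<Rightarrow> 'a"
  assumes sp: "F_vector_space sc" and fin: "fin_dim sc" and s: "simple_lie sc br"
  shows "simple_lie (scaleR :: real \<Rightarrow> 'a \<Rightarrow> 'a) br"
proof -
  have lie: "lie_algebra sc br" using s by (simp add: simple_lie_def)
  interpret complex_space sc
    using sp fin by (simp add: complex_space_def complex_space_axioms_def fd_space_def fd_space_axioms_def F_vector_space_def)
  interpret fd_lie sc br by (intro fd_lie.intro fd_space_axioms fd_lie_axioms.intro lie)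
  have br_i: "br x (sc \<i> y) = sc \<i> (br x y)" "br (sc \<i> x) y = sc \<i> (br x y)" for x y
    by (simp_all add: br_scale_left br_scale_right)
  have br_real: "br (r *\<^sub>R x) y = r *\<^sub>R br x y" "br x (r *\<^sub>R y) = r *\<^sub>R br x y" for r x y
    by (simp_all add: br_scale_left br_scale_right flip: sc_of_real)
  have lieR: "lie_algebra (scaleR :: real \<Rightarrow> 'a \<Rightarrow> 'a) br"
    unfolding lie_algebra_def using real_vector.vector_space_axioms
    by (simp add: br_add_left br_add_right br_real jacobi)
  have complex_ideal: "K = {0} \<or> K = UNIV"
    if K: "0 \<in> K" "\<And>x y. x \<in> K \<Longrightarrow> y \<in> K \<Longrightarrow> x + y \<in> K" "\<And>r x. x \<in> K \<Longrightarrow> r *\<^sub>R x \<in> K" "\<And>x. x \<in> K \<Longrightarrow> sc \<i> x \<in> K"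
      "\<And>x y. x \<in> K \<Longrightarrow> br y x \<in> K" for K
  proof -
    have "sc k x \<in> K" if "x \<in> K" for k x
      using K(2)[OF K(3)[OF that, of "Re k"] K(3)[OF K(4)[OF that], of "Im k"]] by (simp flip: sc_Complex)
    then have "subspace K" using K by (auto intro: subspaceI)
    then show ?thesis using s K(5) by (auto simp: simple_lie_def)
  qed
  have "I = {0} \<or> I = UNIV" if I: "real_vector.subspace I" "\<forall>x\<in>I. \<forall>y. br y x \<in> I" for I
  proof -
    have I0: "0 \<in> I" and Ia: "\<And>x y. x \<in> I \<Longrightarrow> y \<in> I \<Longrightarrow> x + y \<in> I" and Is: "\<And>r x. x \<in> I \<Longrightarrow> r *\<^sub>R x \<in> I"
      using I(1) by (auto simp: real_vector.subspace_def)
    have In: "- x \<in> I" if "x \<in> I" for x using Is[OF that, of "-1"] by simp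
    have Il: "br x y \<in> I" if "x \<in> I" for x y using In[of "br y x"] I(2) that br_swap[of x y] by simp
    have "{x \<in> I. sc \<i> x \<in> I} = {0} \<or> {x \<in> I. sc \<i> x \<in> I} = UNIV"
      by (rule complex_ideal) (use I0 Ia Is In I(2) in \<open>auto simp: scale_right_distrib sc_i_real br_i sc_i_i simp flip: br_i(1)\<close>)
    then show ?thesis
    proof
      assume z: "{x \<in> I. sc \<i> x \<in> I} = {0}"
      let ?K = "{x + sc \<i> y | x y. x \<in> I \<and> y \<in> I}"
      have "?K = {0} \<or> ?K = UNIV"
      proof (rule complex_ideal)
        show "0 \<in> ?K" using I0 by (intro CollectI exI[of _ 0]) simp
      next
        fix p q assume "p \<in> ?K" "q \<in> ?K"
        then obtain x y x' y' where "p = x + sc \<i> y" "q = x' + sc \<i> y'" "x \<in> I" "y \<in> I" "x' \<in> I" "y' \<in> I" by blast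
        then show "p + q \<in> ?K"
          by (intro CollectI exI[of _ "x + x'"] exI[of _ "y + y'"]) (simp add: Ia scale_right_distrib)
      next
        fix r :: real and p assume "p \<in> ?K"
        then obtain x y where "p = x + sc \<i> y" "x \<in> I" "y \<in> I" by blast
        then show "r *\<^sub>R p \<in> ?K"
          by (intro CollectI exI[of _ "r *\<^sub>R x"] exI[of _ "r *\<^sub>R y"]) (simp add: Is scaleR_right_distrib sc_i_real)
      next
        fix p assume "p \<in> ?K"
        then obtain x y where "p = x + sc \<i> y" "x \<in> I" "y \<in> I" by blast
        then show "sc \<i> p \<in> ?K"
          by (intro CollectI exI[of _ "- y"] exI[of _ x]) (simp add: In scale_right_distrib)
      next
        fix p z assume "p \<in> ?K"
        then obtain x y where "p = x + sc \<i> y" "x \<in> I" "y \<in> I" by blast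
        then show "br z p \<in> ?K"
          using I(2) by (intro CollectI exI[of _ "br z x"] exI[of _ "br z y"]) (simp add: br_add_right br_i)
      qed
      then show ?thesis
      proof
        assume "?K = {0}"
        moreover have "x \<in> ?K" if "x \<in> I" for x using that I0 by (intro CollectI exI[of _ x] exI[of _ 0]) simp
        ultimately show ?thesis using I0 by blast
      next
        assume U: "?K = UNIV"
        have II: "br x y = 0" if "x \<in> I" "y \<in> I" for x y
        proof -
          have "br x y \<in> I" "sc \<i> (br x y) \<in> I" using Il[OF that(1), of y] Il[OF that(1), of "sc \<i> y"] by (simp_all add: br_i)
          then show ?thesis using z by blast
        qed
        have "br p q = 0" for p q
        proof -
          have "p \<in> ?K" "q \<in> ?K" using U by auto
          then obtain x y x' y' where "p = x + sc \<i> y" "q = x' + sc \<i> y'" "x \<in> I" "y \<in> I" "x' \<in> I" "y' \<in> I" by blast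
          then show ?thesis by (simp add: br_add_left br_add_right br_i II)
        qed
        then show ?thesis using s by (simp add: simple_lie_def)
      qed
    qed auto
  qed
  then show ?thesis
    using s lieR unfolding simple_lie_def by (simp add: subspace_raw_def)
qed

lemma floop_complex:
  fixes sc :: "complex \<Rightarrow> 'a::real_normed_vector \<Rightarrow> 'a"
  assumes s: "setting sc br \<sigma>"
  shows "floop br \<sigma> sc (\<lambda>z. 2 * Re z)"
proof -
  have sp: "F_vector_space sc" and fin: "fin_dim sc" and sl: "simple_lie sc br" using s by (auto simp: setting_def)
  interpret complex_space sc
    using sp fin by (simp add: complex_space_def complex_space_axioms_def fd_space_def fd_space_axioms_def F_vector_space_def)
  interpret fd_lie sc br
    using sl by (intro fd_lie.intro fd_space_axioms fd_lie_axioms.intro) (simp add: simple_lie_def)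
  show ?thesis
  proof (rule floop_setting[OF s fin_dim_real simple_real[OF sp fin sl]])
    show "bounded_linear (\<lambda>z. 2 * Re z)" by (intro bounded_linear_const_mult bounded_linear_Re)
    show "z = 0" if "\<And>c. 2 * Re (c * z) = 0" for z using that[of 1] that[of \<i>] by (simp add: complex_eq_iff)
    show "killing scaleR br x y = 2 * Re (killing sc br x y)" for x y
      unfolding killing_def by (rule trace_real[OF linear_brbr])
  qed
qed

theorem theorem8p8:
  shows
  "(\<forall>(br :: 'a::real_normed_vector \<Rightarrow> 'a \<Rightarrow> 'a) \<sigma> (br' :: 'b::real_normed_vector \<Rightarrow> 'b \<Rightarrow> 'b) \<sigma>'.
      setting (scaleR :: real \<Rightarrow> 'a \<Rightarrow> 'a) br \<sigma> \<and> setting (scaleR :: real \<Rightarrow> 'b \<Rightarrow> 'b) br' \<sigma>' \<longrightarrow>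
        claim_i scaleR br \<sigma> scaleR br' \<sigma>' \<and> claim_ii (scaleR :: real \<Rightarrow> 'a \<Rightarrow> 'a) br \<sigma>
        \<and> claim_iii (scaleR :: real \<Rightarrow> 'a \<Rightarrow> 'a) br \<sigma> \<and> claim_iv (scaleR :: real \<Rightarrow> 'a \<Rightarrow> 'a) br \<sigma>)
   \<and> (\<forall>(sc :: complex \<Rightarrow> 'c::real_normed_vector \<Rightarrow> 'c) br \<sigma>
        (sc' :: complex \<Rightarrow> 'd::real_normed_vector \<Rightarrow> 'd) br' \<sigma>'.
      setting sc br \<sigma> \<and> setting sc' br' \<sigma>' \<longrightarrow>
        claim_i sc br \<sigma> sc' br' \<sigma>' \<and> claim_ii sc br \<sigma> \<and> claim_iii sc br \<sigma> \<and> claim_iv sc br \<sigma>)"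
proof (intro conjI allI impI; (elim conjE)?)
  fix br \<sigma> br' \<sigma>'
  assume s: "setting (scaleR :: real \<Rightarrow> 'a \<Rightarrow> 'a) br \<sigma>" "setting (scaleR :: real \<Rightarrow> 'b \<Rightarrow> 'b) br' \<sigma>'"
  note A = floop_real[OF s(1)] and B = floop_real[OF s(2)]
  show "claim_i (scaleR :: real \<Rightarrow> 'a \<Rightarrow> 'a) br \<sigma> (scaleR :: real \<Rightarrow> 'b \<Rightarrow> 'b) br' \<sigma>'" by (rule claim_i[OF A B])
  show "claim_ii (scaleR :: real \<Rightarrow> 'a \<Rightarrow> 'a) br \<sigma>" by (rule floop.claim_ii[OF A])
  show "claim_iii (scaleR :: real \<Rightarrow> 'a \<Rightarrow> 'a) br \<sigma>" by (rule floop.claim_iii[OF A])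
  show "claim_iv (scaleR :: real \<Rightarrow> 'a \<Rightarrow> 'a) br \<sigma>" by (rule floop.claim_iv[OF A])
next
  fix sc :: "complex \<Rightarrow> 'c \<Rightarrow> 'c" and br \<sigma> and sc' :: "complex \<Rightarrow> 'd \<Rightarrow> 'd" and br' \<sigma>'
  assume s: "setting sc br \<sigma>" "setting sc' br' \<sigma>'"
  note A = floop_complex[OF s(1)] and B = floop_complex[OF s(2)]
  show "claim_i sc br \<sigma> sc' br' \<sigma>'" by (rule claim_i[OF A B])
  show "claim_ii sc br \<sigma>" by (rule floop.claim_ii[OF A])
  show "claim_iii sc br \<sigma>" by (rule floop.claim_iii[OF A])
  show "claim_iv sc br \<sigma>" by (rule floop.claim_iv[OF A])
qed

end
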